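(* Let $\mu_0,\mu_1$ be such that for every connected, undirected graph $G$ there exists a random variable $A$ such that almost surely $A_u=A$ for all $u\in V$. Then there exists a sequence $q(n)=q(n,\mu_0,\mu_1)$ such that $q(n)\to1$ as $n\to\infty$, and $\mathbb{P}[A=\{S\}]\ge q(n)$, for any choice of undirected, connected graph $G$ with $n$ agents.
   Context: Model. Let $\mu_0\neq\mu_1$ be mutually absolutely continuous probability measures on a measurable space $(\Omega,\mathcal{O})$. $V$ is a countable (finite or infinite) set of agents. The state of the world $S\in\{0,1\}$ and private signals $W_u\in\Omega$ ($u\in V$) have joint law $\frac12\delta_0\mu_0^V+\frac12\delta_1\mu_1^V$: $S$ is uniform on $\{0,1\}$ and, conditioned on $S$, the $W_u$ are i.i.d. with law $\mu_S$. The social network $G=(V,E)$ is a directed graph, assumed throughout to be simple (no loops or parallel edges) and strongly connected; it is undirected if $(u,v)\in E$ implies $(v,u)\in E$. $N(u)=\{v:(u,v)\in E\}$ is the set of neighbors of $u$. For $t=1,2,\dots$ the information $\mathcal{F}_u(t)$ and action $A_u(t)\in\{0,1\}$ of agent $u$ are defined jointly by $\mathcal{F}_u(t)=\sigma(W_u,\{A_v(t'):v\in N(u),t'<t\})$ and $A_u(t)=0$ if $\mathbb{P}[S=1|\mathcal{F}_u(t)]<1/2$, $A_u(t)=1$ if $\mathbb{P}[S=1|\mathcal{F}_u(t)]>1/2$, and $A_u(t)\in\{0,1\}$ if $\mathbb{P}[S=1|\mathcal{F}_u(t)]=1/2$. Equivalently, $A_u(t)$ is the MAP estimator of $S$ given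 $\mathcal{F}_u(t)$, i.e. an $\mathcal{F}_u(t)$-measurable estimator maximizing the probability of equaling $S$, with some tie-breaking rule. Nothing is assumed about how agents break ties. Let $\mathcal{F}_u$ be the $\sigma$-algebra generated by $\bigcup_t\mathcal{F}_u(t)$ and $X_u=\mathbb{P}[S=1|\mathcal{F}_u]$. The optimal action set $A_u$ of agent $u$ is $\{0\}$ if $X_u<1/2$, $\{1\}$ if $X_u>1/2$, and $\{0,1\}$ if $X_u=1/2$. *)

theory Defs
  imports "HOL-Probability.Probability" "Graph_Theory.Graph_Theory"
begin

text \<open>
  Agents are natural numbers: up to relabelling, the subsets of \<open>nat\<close> are all the finite and
  countably infinite agent sets.  The states and actions 0 and 1 are encoded as \<open>False\<close> and
  \<open>True\<close>.  The model lives on the canonical space: an outcome \<open>(s, w)\<close> consists of the state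
  \<open>s\<close> and the private signals \<open>w u\<close>.
\<close>

type_synonym 'w outcome = "bool \<times> (nat \<Rightarrow> 'w)"

type_synonym 'w action_process = "nat \<Rightarrow> nat \<Rightarrow> 'w outcome \<Rightarrow> bool"

text \<open>
  A simple (loopless, no parallel edges), undirected, connected graph, finite or infinite.
  The library's \<open>pair_graph\<close> would in addition require finiteness.
\<close>

definition connected_undirected_graph :: "nat pair_pre_digraph \<Rightarrow> bool" where
  "connected_undirected_graph G \<longleftrightarrow>
     pair_bidirected_digraph G \<and> strongly_connected (with_proj G)"

definition neighbors :: "nat pair_pre_digraph \<Rightarrow> nat \<Rightarrow> nat set" where
  "neighbors G u = {v. (u, v) \<in> parcs G}"

text \<open>The law \<open>1/2 \<delta>\<^sub>0 \<mu>\<^sub>0\<^sup>V + 1/2 \<delta>\<^sub>1 \<mu>\<^sub>1\<^sup>V\<close> of state and signals; see \<open>emeasure_world\<close> below.\<close>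

definition world :: "'w measure \<Rightarrow> 'w measure \<Rightarrow> nat set \<Rightarrow> 'w outcome measure" where
  "world \<mu>0 \<mu>1 V =
     measure_pmf (pmf_of_set (UNIV :: bool set)) \<bind>
       (\<lambda>s. return (count_space UNIV) s \<Otimes>\<^sub>M (\<Pi>\<^sub>M u\<in>V. if s then \<mu>1 else \<mu>0))"

lemma
  assumes p: "prob_space \<mu>0" "prob_space \<mu>1" and s: "sets \<mu>0 = sets \<mu>1"
  shows sets_world: "sets (world \<mu>0 \<mu>1 V) = sets (count_space UNIV \<Otimes>\<^sub>M (\<Pi>\<^sub>M u\<in>V. \<mu>0))"
    and prob_space_world: "prob_space (world \<mu>0 \<mu>1 V)"
    and emeasure_world: "\<And>B. B \<in> sets (world \<mu>0 \<mu>1 V) \<Longrightarrow> emeasure (world \<mu>0 \<mu>1 V) B =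
      1/2 * emeasure (\<Pi>\<^sub>M u\<in>V. \<mu>0) (Pair False -` B) + 1/2 * emeasure (\<Pi>\<^sub>M u\<in>V. \<mu>1) (Pair True -` B)"
proof -
  let ?K = "\<lambda>s. return (count_space UNIV) s \<Otimes>\<^sub>M (\<Pi>\<^sub>M u\<in>V. if s then \<mu>1 else \<mu>0)"
  let ?N = "count_space (UNIV :: bool set) \<Otimes>\<^sub>M (\<Pi>\<^sub>M u\<in>V. \<mu>0)"
  let ?U = "measure_pmf (pmf_of_set (UNIV :: bool set))"
  have pP: "prob_space (\<Pi>\<^sub>M u\<in>V. if s then \<mu>1 else \<mu>0)" for s
    using p by (auto intro!: prob_space_PiM)
  have sK: "sets (?K s) = sets ?N" for s
    using s by (auto intro!: sets_pair_measure_cong sets_PiM_cong)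
  have pK: "prob_space (?K s)" for s
    by (intro prob_space_pair pP prob_space_return) auto
  have K: "?K \<in> ?U \<rightarrow>\<^sub>M subprob_algebra ?N"
    by (auto simp: space_subprob_algebra sK intro!: prob_space_imp_subprob_space pK)
  have K': "?K \<in> ?U \<rightarrow>\<^sub>M prob_algebra ?N"
    by (auto simp: space_prob_algebra sK intro!: pK)
  show S: "sets (world \<mu>0 \<mu>1 V) = sets ?N"
    unfolding world_def by (rule sets_bind[OF sK]) auto
  show "prob_space (world \<mu>0 \<mu>1 V)"
    unfolding world_def
    by (rule prob_space_bind'[OF _ K']) (auto simp: space_prob_algebra intro: measure_pmf.prob_space_axioms)
  fix B assume B: "B \<in> sets (world \<mu>0 \<mu>1 V)"
  have "emeasure (world \<mu>0 \<mu>1 V) B = (\<integral>\<^sup>+ s. emeasure (?K s) B \<partial>?U)"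
    unfolding world_def using B S by (intro emeasure_bind[OF _ K]) auto
  also have "\<dots> = (\<integral>\<^sup>+ s. emeasure (\<Pi>\<^sub>M u\<in>V. if s then \<mu>1 else \<mu>0) (Pair s -` B) \<partial>?U)"
  proof (rule nn_integral_cong)
    fix s :: bool
    interpret P: prob_space "\<Pi>\<^sub>M u\<in>V. if s then \<mu>1 else \<mu>0" by (rule pP)
    have "B \<in> sets (?K s)" using B S sK by auto
    then show "emeasure (?K s) B = emeasure (\<Pi>\<^sub>M u\<in>V. if s then \<mu>1 else \<mu>0) (Pair s -` B)"
      by (subst P.emeasure_pair_measure_alt) (auto simp: nn_integral_return)
  qed
  also have "\<dots> = 1/2 * emeasure (\<Pi>\<^sub>M u\<in>V. \<mu>0) (Pair False -` B)
      + 1/2 * emeasure (\<Pi>\<^sub>M u\<in>V. \<mu>1) (Pair True -` B)"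
    by (simp add: nn_integral_measure_pmf nn_integral_count_space_finite UNIV_bool divide_ennreal_def)
  finally show "emeasure (world \<mu>0 \<mu>1 V) B = 1/2 * emeasure (\<Pi>\<^sub>M u\<in>V. \<mu>0) (Pair False -` B)
      + 1/2 * emeasure (\<Pi>\<^sub>M u\<in>V. \<mu>1) (Pair True -` B)" .
qed

text \<open>The \<open>\<sigma>\<close>-algebra \<open>\<F>\<^sub>u(t)\<close>; actions are taken at times \<open>1, 2, \<dots>\<close> only.\<close>

definition info ::
  "'w measure \<Rightarrow> 'w measure \<Rightarrow> nat pair_pre_digraph \<Rightarrow> 'w action_process \<Rightarrow> nat \<Rightarrow> nat \<Rightarrow> 'w outcome measure"
where
  "info \<mu>0 \<mu>1 G act u t =
     (let \<Omega> = space (world \<mu>0 \<mu>1 (pverts G)) in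
      sigma \<Omega> ({(\<lambda>(s, w). w u) -` B \<inter> \<Omega> | B. B \<in> sets \<mu>0} \<union>
               {act v t' -` B \<inter> \<Omega> | v t' B. v \<in> neighbors G u \<and> 1 \<le> t' \<and> t' < t}))"

definition info_limit ::
  "'w measure \<Rightarrow> 'w measure \<Rightarrow> nat pair_pre_digraph \<Rightarrow> 'w action_process \<Rightarrow> nat \<Rightarrow> 'w outcome measure"
where
  "info_limit \<mu>0 \<mu>1 G act u =
     sigma (space (world \<mu>0 \<mu>1 (pverts G))) (\<Union>t\<in>{1..}. sets (info \<mu>0 \<mu>1 G act u t))"

text \<open>The conditional probability that the state is 1 given a sub-\<open>\<sigma>\<close>-algebra.\<close>

definition belief ::
  "'w measure \<Rightarrow> 'w measure \<Rightarrow> nat pair_pre_digraph \<Rightarrow> 'w outcome measure \<Rightarrow> 'w outcome \<Rightarrow> real"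
where
  "belief \<mu>0 \<mu>1 G F = real_cond_exp (world \<mu>0 \<mu>1 (pverts G)) F (indicator {\<omega>. fst \<omega> = True})"

text \<open>
  Ties are broken arbitrarily, but the action has to be a function of the agent's information.
  The conditions are almost sure ones because conditional probabilities are only defined up to
  null sets.
\<close>

definition MAP_actions ::
  "'w measure \<Rightarrow> 'w measure \<Rightarrow> nat pair_pre_digraph \<Rightarrow> 'w action_process \<Rightarrow> bool"
where
  "MAP_actions \<mu>0 \<mu>1 G act \<longleftrightarrow>
     (\<forall>u\<in>pverts G. \<forall>t\<ge>1.
        act u t \<in> info \<mu>0 \<mu>1 G act u t \<rightarrow>\<^sub>M count_space UNIV \<and>
        (AE \<omega> in world \<mu>0 \<mu>1 (pverts G).
           (belief \<mu>0 \<mu>1 G (info \<mu>0 \<mu>1 G act u t) \<omega> < 1/2 \<longrightarrow> act u t \<omega> = False) \<and>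
           (belief \<mu>0 \<mu>1 G (info \<mu>0 \<mu>1 G act u t) \<omega> > 1/2 \<longrightarrow> act u t \<omega> = True)))"

definition optimal_action_set ::
  "'w measure \<Rightarrow> 'w measure \<Rightarrow> nat pair_pre_digraph \<Rightarrow> 'w action_process \<Rightarrow> nat \<Rightarrow> 'w outcome \<Rightarrow> bool set"
where
  "optimal_action_set \<mu>0 \<mu>1 G act u \<omega> =
     (let X = belief \<mu>0 \<mu>1 G (info_limit \<mu>0 \<mu>1 G act u) \<omega> in
      if X < 1/2 then {False} else if X > 1/2 then {True} else {False, True})"

text \<open>\<open>A\<close> is a random variable which almost surely equals the optimal action set of every agent.\<close>

definition common_optimal_action_set ::
  "'w measure \<Rightarrow> 'w measure \<Rightarrow> nat pair_pre_digraph \<Rightarrow> 'w action_process \<Rightarrow> ('w outcome \<Rightarrow> bool set) \<Rightarrow> bool"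
where
  "common_optimal_action_set \<mu>0 \<mu>1 G act A \<longleftrightarrow>
     A \<in> world \<mu>0 \<mu>1 (pverts G) \<rightarrow>\<^sub>M count_space UNIV \<and>
     (AE \<omega> in world \<mu>0 \<mu>1 (pverts G). \<forall>u\<in>pverts G. optimal_action_set \<mu>0 \<mu>1 G act u \<omega> = A \<omega>)"

end

theory Submission
  imports Defs
begin

text \<open>
  Call \<open>P(A = 1 | S = 1) - P(A = 1 | S = 0)\<close> the advantage of an action \<open>A\<close>.  Imitation makes the
  advantages of all agents of a network increase to a common limit, and if the agents agree, that limit
  bounds from below the probability that the common set is \<open>{S}\<close>.  An agent with many neighbors has
  a large advantage at time 2, as it sees many independent informative actions.

  For networks with degrees at most \<open>d\<close> the argument is by compactness: rooted networks together with
  their MAP actions have limits along subsequences, and the limit is infinite if the sizes are unbounded.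
  For this the actions are taken to be threshold rules in the likelihood ratio of the own signal; the
  behaviour on ties, where thresholds do not determine the action, converges because the laws of
  bit sequences on a given measure space form a closed set.  It remains to see that the limiting advantage is
  1 in every infinite network.  By compactness some infinite network attains the infimum \<open>g\<close>.  Moving its
  root to infinity gives a further network whose agents are nearly independent of what an agent of
  the first network learns, but agree with it, so that the latter acts as an additional independent
  signal which must not improve on \<open>g\<close>.  Hence the additional signal never overrules
  the agents, and since they agree with arbitrarily distant agents, whose signals are independent of
  their conclusion, that conclusion is certain, so \<open>g = 1\<close>.
\<close>

section \<open>Limits of events\<close>

text \<open>The agreement hypothesis applies to a limit only if this is again a network with the
  same \<open>\<mu>0\<close>, \<open>\<mu>1\<close> and with actions that are functions of the
  agents' information. Hence limit rules must be sets of signals, not randomised rules, although a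
  limit of tie-breaking rules looks like a law only. Bayesian optimality is recast as inequalities
  between the two conditional laws on information events, since these, unlike conditional
  expectations, survive limits. The infimum \<open>g\<close> is attained although each value is a
  supremum over time: at every fixed time the advantages converge, so those of the limit stay below
  \<open>g\<close>, and their supremum cannot be smaller than the infimum. Moving to infinity
  produces weights: let \<open>\<alpha> b\<close> and \<open>\<beta> b\<close> be the probabilities
  that an agent's limiting set is \<open>{b}\<close> if the state is \<open>b\<close> and if it is
  not. Independence multiplies the two laws of events near a distant agent by these numbers. Inside
  the region where the set is \<open>{b}\<close> events favour \<open>b\<close>, and acting on the
  region cannot lift the advantage above \<open>g\<close>; these two facts are the inequalities
  carried to the second limit.\<close>

lemma subseq_all_convergent:
  fixes X :: "nat \<Rightarrow> nat \<Rightarrow> real"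
  assumes "\<And>n k. \<bar>X n k\<bar> \<le> B"
  shows "\<exists>r. strict_mono r \<and> (\<forall>k. convergent (\<lambda>n. X (r n) k))"
proof -
  interpret subseqs "\<lambda>k s. convergent (\<lambda>n. X (s n) k)"
  proof
    fix k and s :: "nat \<Rightarrow> nat"
    have "bounded (range (\<lambda>n. X (s n) k))"
      using assms by (auto simp: bounded_iff)
    then obtain l r where "strict_mono r" "((\<lambda>n. X (s n) k) \<circ> r) \<longlonglongrightarrow> l"
      using bounded_imp_convergent_subsequence by blast
    then show "\<exists>r'. strict_mono r' \<and> convergent (\<lambda>n. X ((s \<circ> r') n) k)"
      by (auto simp: convergent_def o_def)
  qed
  have "convergent (\<lambda>n. X (diagseq n) k)" for k
  proof -
    have "convergent (\<lambda>n. X ((diagseq \<circ> (+) (Suc k)) n) k)"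
    proof (rule diagseq_holds)
      fix r s :: "nat \<Rightarrow> nat" and n
      assume "strict_mono r" "convergent (\<lambda>m. X (s m) n)"
      then show "convergent (\<lambda>m. X ((s \<circ> r) m) n)"
        using convergent_subseq_convergent[of "\<lambda>m. X (s m) n" r] by (simp add: o_def)
    qed
    then have "convergent (\<lambda>n. X (diagseq (n + Suc k)) k)"
      by (simp add: o_def add.commute)
    then show ?thesis
      using convergent_ignore_initial_segment[of "\<lambda>n. X (diagseq n) k" "Suc k"] by simp
  qed
  then show ?thesis using subseq_diagseq by blast
qed

lemma subseq_convergent_countable:
  fixes X :: "nat \<Rightarrow> 'k \<Rightarrow> real"
  assumes "countable K" and "\<And>n k. k \<in> K \<Longrightarrow> \<bar>X n k\<bar> \<le> B"
  shows "\<exists>r. strict_mono r \<and> (\<forall>k\<in>K. convergent (\<lambda>n. X (r n) k))"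
proof (cases "K = {}")
  case True
  then show ?thesis by (auto intro: exI[of _ id] simp: strict_mono_def)
next
  case False
  then have "from_nat_into K k \<in> K" for k by (simp add: from_nat_into)
  then obtain r where r: "strict_mono r" "\<And>k. convergent (\<lambda>n. X (r n) (from_nat_into K k))"
    using subseq_all_convergent[of "\<lambda>n k. X n (from_nat_into K k)" B] assms(2) by blast
  have "convergent (\<lambda>n. X (r n) k)" if "k \<in> K" for k
    using r(2)[of "to_nat_on K k"] that assms(1) by simp
  with r(1) show ?thesis by blast
qed

text \<open>A convergent sequence is Cauchy, and two of the values 0, 1 at distance below 1 are
  equal. This turns compactness of bounded real sequences into eventual constancy of vertex sets, of
  neighbourhoods and of bits at atoms.\<close>

lemma convergent_zero_one_eventually_const:
  assumes "convergent (\<lambda>n. of_bool (P n) :: real)"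
  shows "eventually P sequentially \<or> eventually (\<lambda>n. \<not> P n) sequentially"
proof -
  obtain l where "(\<lambda>n. of_bool (P n) :: real) \<longlonglongrightarrow> l" using assms by (auto simp: convergent_def)
  from LIMSEQ_imp_Cauchy[OF this] obtain N
    where N: "\<And>m n. m \<ge> N \<Longrightarrow> n \<ge> N \<Longrightarrow> \<bar>of_bool (P m) - of_bool (P n) :: real\<bar> < 1"
    by (auto simp: Cauchy_def dist_real_def) (metis zero_less_one)
  have "P n = P N" if "n \<ge> N" for n
    using N[of n N] that by (auto simp: of_bool_def split: if_splits)
  then show ?thesis
    by (cases "P N") (auto simp: eventually_sequentially)
qed

context finite_measure
begin

lemma tendsto_measure_eventually:
  assumes [measurable]: "\<And>n. Measurable.pred M (P n)" "Measurable.pred M Q"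
    and ev: "\<And>x. x \<in> space M \<Longrightarrow> eventually (\<lambda>n. P n x = Q x) sequentially"
  shows "(\<lambda>n. measure M {x\<in>space M. P n x}) \<longlonglongrightarrow> measure M {x\<in>space M. Q x}"
proof -
  have "(\<lambda>n. \<integral>x. indicator {x\<in>space M. P n x} x \<partial>M) \<longlonglongrightarrow> (\<integral>x. indicator {x\<in>space M. Q x} x \<partial>M :: real)"
  proof (rule integral_dominated_convergence[where w="\<lambda>_. 1"])
    show "AE x in M. (\<lambda>n. indicator {x\<in>space M. P n x} x :: real) \<longlonglongrightarrow> indicator {x\<in>space M. Q x} x"
    proof (rule AE_I2)
      fix x assume x: "x \<in> space M"
      show "(\<lambda>n. indicator {x\<in>space M. P n x} x :: real) \<longlonglongrightarrow> indicator {x\<in>space M. Q x} x"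
        by (rule tendsto_eventually, use ev[OF x] in eventually_elim) (auto simp: indicator_def)
    qed
  qed (auto simp: indicator_def)
  then show ?thesis by simp
qed

text \<open>Tannery's theorem: the measure of a cell bounds its terms for all \<open>n\<close>, and
  these bounds are summable, so cellwise convergence needs no uniformity. It is used with one cell
  for every tie value of the likelihood ratio and one cell for the remaining signals.\<close>

lemma tendsto_measure_countable_partition:
  assumes I: "countable I" and h: "\<And>x. x \<in> space M \<Longrightarrow> h x \<in> I"
    and mh: "\<And>i. i \<in> I \<Longrightarrow> {x\<in>space M. h x = i} \<in> sets M"
    and mP: "\<And>n. {x\<in>space M. P n x} \<in> sets M" and mQ: "{x\<in>space M. Q x} \<in> sets M"
    and lim: "\<And>i. i \<in> I \<Longrightarrow> (\<lambda>n. measure M {x\<in>space M. h x = i \<and> P n x})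
       \<longlonglongrightarrow> measure M {x\<in>space M. h x = i \<and> Q x}"
  shows "(\<lambda>n. measure M {x\<in>space M. P n x}) \<longlonglongrightarrow> measure M {x\<in>space M. Q x}"
proof -
  define C where "C k = {x\<in>space M. to_nat_on I (h x) = k}" for k
  have C_alt: "C k = (if k \<in> to_nat_on I ` I then {x\<in>space M. h x = the_inv_into I (to_nat_on I) k} else {})" for k
    using h inj_on_to_nat_on[OF I]
    by (auto simp: C_def the_inv_into_f_f inj_on_eq_iff)
  have mC: "C k \<in> sets M" for k
    unfolding C_alt using mh inj_on_to_nat_on[OF I] by (auto simp: the_inv_into_f_f)
  have sums: "(\<lambda>k. measure M (C k \<inter> {x\<in>space M. R x})) sums measure M {x\<in>space M. R x}"
    if "{x\<in>space M. R x} \<in> sets M" for R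
  proof -
    have "{x\<in>space M. R x} = (\<Union>k. C k \<inter> {x\<in>space M. R x})" by (auto simp: C_def)
    moreover have "disjoint_family (\<lambda>k. C k \<inter> {x\<in>space M. R x})"
      by (auto simp: disjoint_family_on_def C_def)
    ultimately show ?thesis
      using finite_measure_UNION[of "\<lambda>k. C k \<inter> {x\<in>space M. R x}"] mC that by auto
  qed
  have C_Int: "C k \<inter> {x\<in>space M. R x} = (if k \<in> to_nat_on I ` I
      then {x\<in>space M. h x = the_inv_into I (to_nat_on I) k \<and> R x} else {})" for k R
    unfolding C_alt by auto
  have "(\<lambda>n. \<Sum>k. measure M (C k \<inter> {x\<in>space M. P n x})) \<longlonglongrightarrow> (\<Sum>k. measure M (C k \<inter> {x\<in>space M. Q x}))"
  proof (rule tannerys_theorem[THEN conjunct2, THEN conjunct2])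
    show "(\<lambda>n. measure M (C k \<inter> {x\<in>space M. P n x})) \<longlonglongrightarrow> measure M (C k \<inter> {x\<in>space M. Q x})" for k
      unfolding C_Int using lim inj_on_to_nat_on[OF I] by (auto simp: the_inv_into_f_f)
    show "\<forall>\<^sub>F (k, n) in at_top \<times>\<^sub>F sequentially. norm (measure M (C k \<inter> {x\<in>space M. P n x})) \<le> measure M (C k)"
      using mC by (intro always_eventually) (auto intro!: finite_measure_mono)
    have "(\<lambda>k. measure M (C k \<inter> {x\<in>space M. True})) sums measure M {x\<in>space M. True}"
      by (rule sums) simp
    moreover have "C k \<inter> space M = C k" for k by (auto simp: C_def)
    ultimately show "summable (\<lambda>k. measure M (C k))" by (simp add: sums_iff)
  qed simp
  then show ?thesis
    using sums[OF mP] sums[OF mQ] by (simp add: sums_iff)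
qed

end

section \<open>Realising limit laws of bit sequences\<close>

definition ternary_code :: "(nat \<Rightarrow> bool) \<Rightarrow> real" where
  "ternary_code b = (\<Sum>j. of_bool (b j) * (1/3)^j)"

text \<open>Base 3 with digits 0 and 1 avoids the double expansions of base 2: beyond the first
  differing place \<open>j\<close> the tails contribute at most half of \<open>(1/3)^j\<close>. The
  code replaces countably many bits by one real statistic, whose level sets carry the atoms.\<close>

lemma ternary_code_inj:
  assumes eq: "ternary_code b = ternary_code b'"
  shows "b = b'"
proof (rule ccontr)
  assume "b \<noteq> b'"
  define j where "j = (LEAST i. b i \<noteq> b' i)"
  from \<open>b \<noteq> b'\<close> obtain i0 where "b i0 \<noteq> b' i0" by (auto simp: fun_eq_iff)
  then have j: "b j \<noteq> b' j" unfolding j_def by (rule LeastI)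
  have less: "b i = b' i" if "i < j" for i
    using not_less_Least that unfolding j_def by blast
  have geo: "summable (\<lambda>i. (1/3::real)^i)" by (simp add: summable_geometric)
  have sm: "summable (\<lambda>i. of_bool (c i) * (1/3::real)^i)" for c
    by (rule summable_comparison_test[OF _ geo]) (auto simp: of_bool_def)
  define d :: "nat \<Rightarrow> real" where "d i = of_bool (b i) * (1/3)^i - of_bool (b' i) * (1/3)^i" for i
  have "summable d" unfolding d_def by (intro summable_diff sm)
  have "suminf d = 0"
    using eq unfolding d_def ternary_code_def by (subst suminf_diff[symmetric]) (auto intro: sm)
  moreover have "suminf d = (\<Sum>i. d (i + Suc j)) + sum d {..<Suc j}"
    by (rule suminf_split_initial_segment[OF \<open>summable d\<close>])
  moreover have "sum d {..<j} = 0" using less by (intro sum.neutral) (auto simp: d_def)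
  ultimately have "\<bar>d j\<bar> = \<bar>\<Sum>i. d (i + Suc j)\<bar>" by simp
  also have "\<dots> \<le> (\<Sum>i. (1/3)^(Suc j) * (1/3)^i)"
  proof -
    have le: "norm (d (i + Suc j)) \<le> (1/3)^(Suc j) * (1/3)^i" for i
      by (auto simp: d_def of_bool_def power_add)
    have s: "summable (\<lambda>i. (1/3::real)^(Suc j) * (1/3)^i)" by (intro summable_mult geo)
    have "summable (\<lambda>i. norm (d (i + Suc j)))"
      by (rule summable_comparison_test[OF _ s]) (use le in auto)
    then have "norm (\<Sum>i. d (i + Suc j)) \<le> (\<Sum>i. norm (d (i + Suc j)))" by (rule summable_norm)
    also have "\<dots> \<le> (\<Sum>i. (1/3)^(Suc j) * (1/3)^i)"
      by (intro suminf_le le s) fact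
    finally show ?thesis by simp
  qed
  also have "\<dots> = (1/3)^(Suc j) * (\<Sum>i. (1/3)^i)" by (intro suminf_mult geo)
  also have "\<dots> = (1/3)^j / 2" by (subst suminf_geometric) auto
  also have "\<dots> < (1/3)^j" by simp
  also have "(1/3)^j = \<bar>d j\<bar>" using j by (auto simp: d_def of_bool_def)
  finally show False by simp
qed

text \<open>Sublevel sets of \<open>R\<close> are nested, and without atoms the cdf is continuous
  and takes all intermediate masses. The chain substitutes for a uniform random variable on the
  space.\<close>

lemma (in finite_measure) nonatomic_chain:
  fixes R :: "'a \<Rightarrow> real"
  assumes [measurable]: "R \<in> borel_measurable M"
    and nonatomic: "\<And>r. measure M {x\<in>space M. R x = r} = 0"
  obtains D where "\<And>c. D c \<in> sets M"
    and "\<And>c c'. c \<le> c' \<Longrightarrow> D c \<subseteq> D c'"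
    and "\<And>c. 0 \<le> c \<Longrightarrow> c \<le> measure M (space M) \<Longrightarrow> measure M (D c) = (c::real)"
proof -
  define m where "m = measure M (space M)"
  define N where "N = distr M borel R"
  interpret N: finite_borel_measure N
    by (auto simp: finite_borel_measure_def finite_borel_measure_axioms_def N_def intro!: finite_measure_distr)
  have cdf: "cdf N y = measure M {x\<in>space M. R x \<le> y}" for y
    unfolding cdf_def N_def by (subst measure_distr) (auto intro!: arg_cong[where f="measure M"])
  have cont: "isCont (cdf N) y" for y
    using nonatomic[of y]
    by (subst N.isCont_cdf) (simp add: N_def measure_distr vimage_def Int_def conj_commute)
  have mN: "measure N (space N) = m"
    unfolding N_def m_def by (subst measure_distr) auto
  have ex: "\<exists>y. cdf N y = c" if "0 < c" "c < m" for c
  proof -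
    have "eventually (\<lambda>y. cdf N y > c) at_top"
      using order_tendstoD(1)[OF N.cdf_lim_at_top, of c] that mN by simp
    then obtain u where u: "cdf N u > c" by (auto simp: eventually_at_top_linorder)
    have "eventually (\<lambda>y. cdf N y < c) at_bot"
      using order_tendstoD(2)[OF N.cdf_lim_at_bot, of c] that by simp
    then obtain l where l: "cdf N l < c" by (auto simp: eventually_at_bot_linorder)
    have "l \<le> u" using u l N.cdf_nondecreasing[of u l] by linarith
    then show ?thesis using IVT'[of "cdf N" l c u] u l cont
      by (auto intro!: continuous_at_imp_continuous_on)
  qed
  define y where "y c = (SOME y. cdf N y = c)" for c
  have y: "cdf N (y c) = c" if "0 < c" "c < m" for c
    unfolding y_def using someI_ex[OF ex[OF that]] .
  \<comment> \<open>The masses 0 and \<open>m\<close> need not be values of the cdf, so the two ends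
    are set by hand.\<close>
  define D where "D c = (if c \<le> 0 then {} else if c \<ge> m then space M else {x\<in>space M. R x \<le> y c})" for c
  show ?thesis
  proof (rule that[of D])
    show "D c \<in> sets M" for c unfolding D_def by auto
    show "D c \<subseteq> D c'" if "c \<le> c'" for c c'
    proof (cases "0 < c \<and> c' < m \<and> c < c'")
      case True
      then have "y c \<le> y c'" using N.cdf_nondecreasing[of "y c'" "y c"] y[of c] y[of c'] by force
      with True show ?thesis by (auto simp: D_def)
    next
      case False
      then show ?thesis using that by (cases "c = c'") (auto simp: D_def)
    qed
    show "measure M (D c) = c" if "0 \<le> c" "c \<le> measure M (space M)" for c
      using that y[of c] by (auto simp: D_def m_def cdf)
  qed
qed

text \<open>The newest bit is at the head, so refining a prefix by one bit is a \<open>Cons\<close>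
  and the tree of prefixes is handled by structural recursion on lists.\<close>

primrec rprefix :: "(nat \<Rightarrow> bool) \<Rightarrow> nat \<Rightarrow> bool list" where
  "rprefix b 0 = []"
| "rprefix b (Suc k) = b k # rprefix b k"

lemma length_rprefix [simp]: "length (rprefix b k) = k"
  by (induction k) auto

text \<open>The child \<open>False\<close> takes the left part of its parent's interval and the
  child \<open>True\<close> the right part, hence the shift by \<open>l (False # s)\<close>.\<close>

primrec left_end :: "(bool list \<Rightarrow> real) \<Rightarrow> bool list \<Rightarrow> real" where
  "left_end l [] = 0"
| "left_end l (b # s) = left_end l s + (if b then l (False # s) else 0)"

text \<open>Arithmetic coding: the interval of length \<open>l []\<close> is cut successively into intervals of
  lengths \<open>l s\<close>, and the bits of a point record which intervals contain it.\<close>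

primrec interval_code :: "(real \<Rightarrow> 'a set) \<Rightarrow> (bool list \<Rightarrow> real) \<Rightarrow> 'a \<Rightarrow> nat \<Rightarrow> bool list" where
  "interval_code D l x 0 = []"
| "interval_code D l x (Suc k) =
     (x \<notin> D (left_end l (interval_code D l x k) + l (False # interval_code D l x k))) # interval_code D l x k"

lemma rprefix_interval_code: "rprefix (\<lambda>k. hd (interval_code D l x (Suc k))) k = interval_code D l x k"
  by (induction k) auto

lemma length_interval_code [simp]: "length (interval_code D l x k) = k"
  by (induction k) auto

text \<open>\<open>max 0 (min (c - a) r)\<close> is the length of the part left of \<open>c\<close>
  in an interval of length \<open>r\<close> starting at \<open>a\<close>. Cutting an interval into
  pieces of lengths \<open>p\<close> and \<open>q\<close> gives the two identities, one for each
  child.\<close>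

lemma clamp_split:
  fixes p q a c :: real
  assumes "p \<ge> 0" "q \<ge> 0"
  shows "max 0 (min (min c (a + p) - a) (p + q)) = max 0 (min (c - a) p)"
    and "max 0 (min (c - a) (p + q)) - max 0 (min (min c (a + p) - a) (p + q)) = max 0 (min (c - (a + p)) q)"
  using assms by (simp_all add: max_def min_def)

text \<open>The sets \<open>D c\<close> of the chain play the role of the intervals
  \<open>[0, c]\<close>; the interval code reads off the cell of a point, and the consistency
  condition on \<open>l\<close> says that the two children fill their parent.\<close>

lemma (in finite_measure) nonatomic_tree:
  fixes R :: "'a \<Rightarrow> real"
  assumes R: "R \<in> borel_measurable M"
    and nonatomic: "\<And>r. measure M {x\<in>space M. R x = r} = 0"
    and l: "\<And>s. l s \<ge> 0" "\<And>s. l s = l (False # s) + l (True # s)" "l [] = measure M (space M)"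
  shows "\<exists>g. (\<forall>k. Measurable.pred M (g k)) \<and>
    (\<forall>s. measure M {x\<in>space M. rprefix (\<lambda>k. g k x) (length s) = s} = l s)"
proof -
  define m where "m = measure M (space M)"
  obtain D where mD [measurable]: "\<And>c. D c \<in> sets M" and mono: "\<And>c c'. c \<le> c' \<Longrightarrow> D c \<subseteq> D c'"
    and D: "\<And>c. 0 \<le> c \<Longrightarrow> c \<le> m \<Longrightarrow> measure M (D c) = c"
    using nonatomic_chain[OF R nonatomic] unfolding m_def by metis
  have bounds: "0 \<le> left_end l s \<and> left_end l s + l s \<le> m" for s
  proof (induction s)
    case Nil then show ?case using l(3) by (simp add: m_def)
  next
    case (Cons b s)
    then show ?case using l(2)[of s] l(1)[of "True # s"] l(1)[of "False # s"] by auto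
  qed
  define A where "A s = {x\<in>space M. interval_code D l x (length s) = s}" for s
  have A_Cons: "A (b # s) = (if b then A s - D (left_end l s + l (False # s))
      else A s \<inter> D (left_end l s + l (False # s)))" for b s
    by (auto simp: A_def)
  have mA: "A s \<in> sets M" for s
  proof (induction s)
    case Nil then show ?case by (simp add: A_def)
  next
    case (Cons b s) then show ?case by (simp add: A_Cons)
  qed
  \<comment> \<open>The induction needs the mass of a cell below every level \<open>c\<close>, not
    only its total mass, since the next cut is made at a level inside the cell.\<close>
  have inv: "\<forall>c\<in>{0..m}. measure M (A s \<inter> D c) = max 0 (min (c - left_end l s) (l s))" for s
  proof (induction s)
    case Nil
    have "A [] \<inter> D c = D c" for c using mD[THEN sets.sets_into_space] by (auto simp: A_def)
    then show ?case using D l(3) by (auto simp: m_def)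
  next
    case (Cons b s)
    define c0 where "c0 = left_end l s + l (False # s)"
    have c0: "c0 \<in> {0..m}" using bounds[of s] l(1)[of "False # s"] l(1)[of "True # s"] l(2)[of s]
      by (auto simp: c0_def)
    show ?case
    proof
      fix c assume c: "c \<in> {0..m}"
      have 1: "A s \<inter> D c0 \<inter> D c = A s \<inter> D (min c c0)"
        using mono[of c c0] mono[of c0 c] by (cases "c \<le> c0") (auto simp: min_def)
      have 2: "measure M (A s \<inter> D (min c c0)) = max 0 (min (min c c0 - left_end l s) (l s))"
        using Cons.IH c c0 by (auto simp: min_def)
      have 3: "(A s - D c0) \<inter> D c = (A s \<inter> D c) - (A s \<inter> D (min c c0))"
        using 1 by blast
      have 4: "measure M ((A s - D c0) \<inter> D c) = measure M (A s \<inter> D c) - measure M (A s \<inter> D (min c c0))"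
        unfolding 3 using mono[of "min c c0" c] mA by (intro finite_measure_Diff) auto
      have 5: "measure M (A s \<inter> D c) = max 0 (min (c - left_end l s) (l s))"
        using Cons.IH c by auto
      show "measure M (A (b # s) \<inter> D c) = max 0 (min (c - left_end l (b # s)) (l (b # s)))"
        using clamp_split[OF l(1)[of "False # s"] l(1)[of "True # s"], of c "left_end l s"]
        by (cases b) (simp_all only: A_Cons if_True if_False left_end.simps 1 2 4 5
            c0_def[symmetric] l(2)[of s] add_0_right)
    qed
  qed
  have full: "measure M (A s) = l s" for s
  proof -
    \<comment> \<open>Of \<open>D m\<close> only the measure is known, so its complement is
      discarded as a null set.\<close>
    have "measure M (space M - D m) = 0"
      using D[of m] finite_measure_compl[of "D m"] by (simp add: m_def)
    then have "measure M (A s - D m) = 0"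
      using finite_measure_mono[of "A s - D m" "space M - D m"] sets.sets_into_space[OF mA[of s]]
      by (auto intro: antisym simp: measure_le_0_iff)
    moreover have "measure M (A s) = measure M (A s \<inter> D m) + measure M (A s - D m)"
      using mA[of s] by (subst finite_measure_Union[symmetric]) (auto intro!: arg_cong[where f="measure M"])
    moreover have "measure M (A s \<inter> D m) = l s"
      using inv[of s] bounds[of s] l(1)[of s] by (auto simp: m_def)
    ultimately show ?thesis by simp
  qed
  define g where "g k x = hd (interval_code D l x (Suc k))" for k x
  have "Measurable.pred M (g k)" for k
  proof -
    have "{x\<in>space M. g k x} = (\<Union>s\<in>{s. length s = k}. A (True # s))"
      by (auto simp: g_def A_def)
    also have "\<dots> \<in> sets M" by (intro sets.countable_UN'' mA) auto
    finally show ?thesis by (simp add: pred_def)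
  qed
  moreover have "measure M {x\<in>space M. rprefix (\<lambda>k. g k x) (length s) = s} = l s" for s
    using full[of s] unfolding A_def g_def rprefix_interval_code .
  ultimately show ?thesis by blast
qed

lemma measurable_rprefix:
  assumes [measurable]: "\<And>k. Measurable.pred M (g k)"
  shows "{x\<in>space M. rprefix (\<lambda>k. g k x) K = s} \<in> sets M"
proof (induction K arbitrary: s)
  case 0 then show ?case by simp
next
  case (Suc K)
  show ?case
  proof (cases s)
    case (Cons b t)
    have "{x\<in>space M. rprefix (\<lambda>k. g k x) (Suc K) = s} =
       {x\<in>space M. g K x = b} \<inter> {x\<in>space M. rprefix (\<lambda>k. g k x) K = t}"
      by (auto simp: Cons)
    then show ?thesis using Suc by simp
  qed simp
qed

lemma rprefix_cong: "(\<And>k. k < K \<Longrightarrow> b k = b' k) \<Longrightarrow> rprefix b K = rprefix b' K"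
  by (induction K) auto

lemma rprefix_eventually:
  assumes "\<And>k. eventually (\<lambda>n. b n k = b' k) sequentially"
  shows "eventually (\<lambda>n. rprefix (b n) K = rprefix b' K) sequentially"
proof (induction K)
  case (Suc K)
  from Suc assms[of K] show ?case by eventually_elim auto
qed simp

text \<open>On an atom of the joint code of all bits every bit is constant; on the nonatomic
  part every law is realised by arithmetic coding.\<close>

lemma (in finite_measure) exists_limit_bits:
  assumes [measurable]: "\<And>n k. Measurable.pred M (f n k)"
    and conv: "\<And>s. convergent (\<lambda>n. measure M {x\<in>space M. rprefix (\<lambda>k. f n k x) (length s) = s})"
  shows "\<exists>g. (\<forall>k. Measurable.pred M (g k)) \<and>
    (\<forall>s. (\<lambda>n. measure M {x\<in>space M. rprefix (\<lambda>k. f n k x) (length s) = s})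
       \<longlonglongrightarrow> measure M {x\<in>space M. rprefix (\<lambda>k. g k x) (length s) = s})"
proof -
  \<comment> \<open>One code for the whole array of bits over \<open>n\<close> and \<open>k\<close>,
    so that all functions \<open>f n k\<close> are constant on its level sets.\<close>
  define R where "R x = ternary_code (\<lambda>j. f (fst (prod_decode j)) (snd (prod_decode j)) x)" for x
  have [measurable]: "R \<in> borel_measurable M"
    unfolding R_def ternary_code_def of_bool_def by measurable
  have R_inj: "f n k x = f n k y" if "R x = R y" for n k x y
    using fun_cong[OF ternary_code_inj[OF that[unfolded R_def]], of "prod_encode (n, k)"] by simp
  define At where "At = {r. measure (distr M borel R) {r} \<noteq> 0}"
  interpret dR: finite_measure "distr M borel R" by (rule finite_measure_distr) simp
  have At: "countable At" unfolding At_def by (rule dR.countable_support)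
  have dR: "measure (distr M borel R) {r} = measure M {x\<in>space M. R x = r}" for r
    by (subst measure_distr) (auto intro!: arg_cong[where f="measure M"])
  define C where "C = {x\<in>space M. R x \<notin> At}"
  have mC [measurable]: "C \<in> sets M"
  proof -
    have "{x\<in>space M. R x \<in> At} = (\<Union>r\<in>At. {x\<in>space M. R x = r})" by auto
    also have "\<dots> \<in> sets M" using At by (intro sets.countable_UN'') auto
    finally have "space M - {x\<in>space M. R x \<in> At} \<in> sets M" by auto
    also have "space M - {x\<in>space M. R x \<in> At} = C" by (auto simp: C_def)
    finally show ?thesis .
  qed
  \<comment> \<open>A representative of the level set; by injectivity of the code it has the bits of
    all points of the level.\<close>
  define pt where "pt r = (SOME x. x \<in> space M \<and> R x = r)" for r
  have pt: "f n k (pt (R x)) = f n k x" if "x \<in> space M" for n k x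
    using someI[of "\<lambda>y. y \<in> space M \<and> R y = R x" x] that unfolding pt_def by (auto intro!: R_inj)
  \<comment> \<open>A subsequence is taken along which the bits at the countably many atoms
    converge, together with all cylinder masses on the nonatomic part \<open>C\<close>.\<close>
  define X where "X n i = (case i of Inl (r, k) \<Rightarrow> of_bool (f n k (pt r))
    | Inr s \<Rightarrow> measure M (C \<inter> {x\<in>space M. rprefix (\<lambda>k. f n k x) (length s) = s}))" for n i
  have "\<exists>r. strict_mono r \<and> (\<forall>i\<in>(At \<times> UNIV) <+> UNIV. convergent (\<lambda>n. X (r n) i))"
  proof (rule subseq_convergent_countable)
    show "countable ((At \<times> (UNIV::nat set)) <+> (UNIV :: bool list set))"
      using At by (intro countable_Plus countable_SIGMA) auto
    show "\<bar>X n i\<bar> \<le> max 1 (measure M (space M))" for n i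
      by (auto simp: X_def split: sum.splits intro: bounded_measure le_max_iff_disj[THEN iffD2])
  qed
  then obtain r where r: "strict_mono r" and
    conv_r: "\<And>i. i \<in> (At \<times> UNIV) <+> UNIV \<Longrightarrow> convergent (\<lambda>n. X (r n) i)" by blast
  have atom: "eventually (\<lambda>n. f (r n) k x = (\<exists>N. \<forall>n\<ge>N. f (r n) k x)) sequentially"
    if "x \<in> space M" "R x \<in> At" for x k
  proof -
    have "convergent (\<lambda>n. of_bool (f (r n) k x) :: real)"
      using conv_r[of "Inl (R x, k)"] that by (auto simp: X_def pt)
    from convergent_zero_one_eventually_const[OF this] show ?thesis
    proof
      assume *: "eventually (\<lambda>n. f (r n) k x) sequentially"
      then have "\<exists>N. \<forall>n\<ge>N. f (r n) k x" by (auto simp: eventually_sequentially)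
      with * show ?thesis by (auto elim: eventually_mono)
    next
      assume *: "eventually (\<lambda>n. \<not> f (r n) k x) sequentially"
      then have no: "(\<exists>N. \<forall>n\<ge>N. f (r n) k x) = False"
        unfolding eventually_sequentially by (metis nat_le_linear)
      from * show ?thesis unfolding no by simp
    qed
  qed
  define l where "l s = lim (\<lambda>n. X (r n) (Inr s))" for s
  have l: "(\<lambda>n. X (r n) (Inr s)) \<longlonglongrightarrow> l s" for s
    using conv_r[of "Inr s"] by (auto simp: l_def convergent_LIMSEQ_iff)
  define MC where "MC = restrict_space M C"
  have sMC: "space MC = C" unfolding MC_def by (auto simp: space_restrict_space C_def)
  have meas_MC: "measure MC A = measure M A" if "A \<subseteq> C" for A
    unfolding MC_def using that by (intro measure_restrict_space) auto
  interpret MC: finite_measure MC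
    unfolding MC_def by (intro finite_measure_restrict_space finite_measure_axioms) auto
  have "\<exists>g. (\<forall>k. Measurable.pred MC (g k)) \<and>
    (\<forall>s. measure MC {x\<in>space MC. rprefix (\<lambda>k. g k x) (length s) = s} = l s)"
  proof (rule MC.nonatomic_tree)
    show "R \<in> borel_measurable MC" unfolding MC_def by (intro measurable_restrict_space1) simp
    show "measure MC {x\<in>space MC. R x = r} = 0" for r
    proof (cases "r \<in> At")
      case True
      then have "{x\<in>space MC. R x = r} = {}" by (auto simp: sMC C_def)
      then show ?thesis by (simp only: measure_empty)
    next
      case False
      have "measure MC {x\<in>space MC. R x = r} = measure M (C \<inter> {x\<in>space M. R x = r})"
        by (subst meas_MC) (auto simp: sMC C_def intro!: arg_cong[where f="measure M"])
      also have "\<dots> \<le> measure M {x\<in>space M. R x = r}" by (intro finite_measure_mono) auto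
      also have "\<dots> = 0" using False by (simp add: At_def dR)
      finally show ?thesis by (simp add: measure_le_0_iff)
    qed
    show "l s \<ge> 0" for s
      by (rule LIMSEQ_le_const[OF l]) (auto simp: X_def)
    show "l s = l (False # s) + l (True # s)" for s
    proof (rule LIMSEQ_unique[OF l])
      have "X n (Inr s) = X n (Inr (False # s)) + X n (Inr (True # s))" for n
        unfolding X_def sum.case using measurable_rprefix[of "f n"]
        by (subst finite_measure_Union[symmetric]) (auto intro!: arg_cong[where f="measure M"])
      then show "(\<lambda>n. X (r n) (Inr s)) \<longlonglongrightarrow> l (False # s) + l (True # s)"
        using tendsto_add[OF l l, of "False # s" "True # s"] by simp
    qed
    show "l [] = measure MC (space MC)"
    proof (rule LIMSEQ_unique[OF l])
      have "C \<inter> space M = C" by (auto simp: C_def)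
      then show "(\<lambda>n. X (r n) (Inr [])) \<longlonglongrightarrow> measure MC (space MC)"
        by (simp add: X_def sMC meas_MC)
    qed
  qed
  then obtain gC where gC: "\<And>k. Measurable.pred MC (gC k)"
    and gC_l: "\<And>s. measure MC {x\<in>space MC. rprefix (\<lambda>k. gC k x) (length s) = s} = l s" by blast
  \<comment> \<open>On atoms the bits are eventually constant along \<open>r\<close>, so their limit
    is a function of the point. On \<open>C\<close> only the law converges, and coded bits with the
    limit law are substituted.\<close>
  define g where "g k x = (if x \<in> C then gC k x else (\<exists>N. \<forall>n\<ge>N. f (r n) k x))" for k x
  have mg [measurable]: "Measurable.pred M (g k)" for k
  proof -
    have "{x\<in>space MC. gC k x} \<in> sets MC" using gC by (simp add: pred_def)
    then have *: "{x\<in>C. gC k x} \<in> sets M"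
      unfolding sMC by (auto simp: MC_def sets_restrict_space_iff)
    have "{x\<in>space M. g k x} = {x\<in>C. gC k x} \<union> ({x\<in>space M. \<exists>N. \<forall>n\<ge>N. f (r n) k x} - C)"
      by (auto simp: g_def C_def)
    also have "\<dots> \<in> sets M" using * by (intro sets.Un sets.Diff) auto
    finally show ?thesis by (simp add: pred_def)
  qed
  have "(\<lambda>n. measure M {x\<in>space M. rprefix (\<lambda>k. f n k x) (length s) = s})
       \<longlonglongrightarrow> measure M {x\<in>space M. rprefix (\<lambda>k. g k x) (length s) = s}" for s
  proof -
    define P where "P n x = (rprefix (\<lambda>k. f n k x) (length s) = s)" for n x
    define Q where "Q x = (rprefix (\<lambda>k. g k x) (length s) = s)" for x
    have mP: "{x\<in>space M. P n x} \<in> sets M" for n unfolding P_def by (rule measurable_rprefix) simp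
    have mQ: "{x\<in>space M. Q x} \<in> sets M" unfolding Q_def by (rule measurable_rprefix) simp
    have split: "measure M {x\<in>space M. T x} = measure M (C \<inter> {x\<in>space M. T x}) + measure M {x\<in>space M. x \<notin> C \<and> T x}"
      if "{x\<in>space M. T x} \<in> sets M" for T
    proof -
      have *: "{x\<in>space M. x \<notin> C \<and> T x} = {x\<in>space M. T x} - C" by auto
      show ?thesis unfolding * using that
        by (subst finite_measure_Union[symmetric]) (auto intro!: arg_cong[where f="measure M"])
    qed
    have 1: "(\<lambda>n. measure M (C \<inter> {x\<in>space M. P (r n) x})) \<longlonglongrightarrow> measure M (C \<inter> {x\<in>space M. Q x})"
    proof -
      have "C \<inter> {x\<in>space M. Q x} = {x\<in>space MC. rprefix (\<lambda>k. gC k x) (length s) = s}"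
        by (auto simp: sMC Q_def g_def C_def cong: rprefix_cong)
      then have "measure M (C \<inter> {x\<in>space M. Q x}) = l s"
        using gC_l[of s] by (simp add: meas_MC sMC subset_eq)
      then show ?thesis using l[of s] by (simp add: X_def P_def)
    qed
    have 2: "(\<lambda>n. measure M {x\<in>space M. x \<notin> C \<and> P (r n) x}) \<longlonglongrightarrow> measure M {x\<in>space M. x \<notin> C \<and> Q x}"
    proof (rule tendsto_measure_eventually)
      show "Measurable.pred M (\<lambda>x. x \<notin> C \<and> P (r n) x)" for n using mP by (auto simp: pred_def)
      show "Measurable.pred M (\<lambda>x. x \<notin> C \<and> Q x)" using mQ by (auto simp: pred_def)
      fix x assume x: "x \<in> space M"
      show "\<forall>\<^sub>F n in sequentially. (x \<notin> C \<and> P (r n) x) = (x \<notin> C \<and> Q x)"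
      proof (cases "x \<in> C")
        case False
        then have "R x \<in> At" using x by (auto simp: C_def)
        then have "eventually (\<lambda>n. rprefix (\<lambda>k. f (r n) k x) (length s) =
            rprefix (\<lambda>k. \<exists>N. \<forall>n\<ge>N. f (r n) k x) (length s)) sequentially"
          by (intro rprefix_eventually atom[OF x])
        then show ?thesis
          using False by (auto simp: P_def Q_def g_def elim: eventually_mono)
      qed simp
    qed
    have "(\<lambda>n. measure M {x\<in>space M. P (r n) x}) \<longlonglongrightarrow> measure M {x\<in>space M. Q x}"
      unfolding split[OF mP] split[OF mQ] by (rule tendsto_add[OF 1 2])
    \<comment> \<open>So far only the subsequence is controlled; the assumed convergence of the
      cylinder masses along the full sequence identifies its limit.\<close>
    moreover from conv[of s] obtain L where L: "(\<lambda>n. measure M {x\<in>space M. P n x}) \<longlonglongrightarrow> L"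
      by (auto simp: P_def convergent_def)
    ultimately have "L = measure M {x\<in>space M. Q x}"
      using LIMSEQ_subseq_LIMSEQ[OF L r] by (auto simp: o_def intro: LIMSEQ_unique)
    with L show ?thesis by (simp add: P_def Q_def)
  qed
  with mg show ?thesis by blast
qed

section \<open>The likelihood ratio of a signal\<close>

lemma finite_bits_eq_UN_rprefix:
  assumes dep: "\<And>b b'. (\<And>k. k < L \<Longrightarrow> b k = b' k) \<Longrightarrow> \<Phi> b = \<Phi> b'"
  shows "{x\<in>A. \<Phi> (\<lambda>k. g k x)} = (\<Union>s\<in>(\<lambda>b. rprefix b L) ` Collect \<Phi>. {x\<in>A. rprefix (\<lambda>k. g k x) L = s})"
proof -
  have "b k = b' k" if "rprefix b L = rprefix b' L" "k < L" for b b' k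
    using that by (induction L) (auto simp: less_Suc_eq)
  then have same: "\<Phi> b' = \<Phi> b" if "rprefix b' L = rprefix b L" for b b' using dep that by blast
  have mem: "rprefix b L \<in> (\<lambda>b. rprefix b L) ` Collect \<Phi> \<longleftrightarrow> \<Phi> b" for b
  proof
    assume "rprefix b L \<in> (\<lambda>b. rprefix b L) ` Collect \<Phi>"
    then show "\<Phi> b"
    proof (rule imageE)
      fix b' assume "rprefix b L = rprefix b' L" "b' \<in> Collect \<Phi>"
      then show "\<Phi> b" using same[of b b'] by simp
    qed
  qed (intro imageI CollectI)
  have UN: "(\<Union>s\<in>R. {x\<in>A. h x = s}) = {x\<in>A. h x \<in> R}" for R and h :: "'a \<Rightarrow> bool list" by auto
  show ?thesis unfolding UN mem ..
qed

lemma finite_rprefixes: "finite ((\<lambda>b. rprefix b L) ` Collect \<Phi>)"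
proof (rule finite_subset)
  show "(\<lambda>b. rprefix b L) ` Collect \<Phi> \<subseteq> {s. set s \<subseteq> UNIV \<and> length s = L}" by auto
qed (rule finite_lists_length_eq, simp)

lemma (in finite_measure) measure_finite_bits:
  assumes g: "\<And>k. Measurable.pred M (g k)" and A: "A \<in> sets M"
    and dep: "\<And>b b'. (\<And>k. k < L \<Longrightarrow> b k = b' k) \<Longrightarrow> \<Phi> b = \<Phi> b'"
  shows "measure M {x\<in>A. \<Phi> (\<lambda>k. g k x)} =
     (\<Sum>s\<in>(\<lambda>b. rprefix b L) ` Collect \<Phi>. measure M {x\<in>A. rprefix (\<lambda>k. g k x) L = s})"
    and "{x\<in>A. \<Phi> (\<lambda>k. g k x)} \<in> sets M"
proof -
  have m: "{x\<in>A. rprefix (\<lambda>k. g k x) L = s} \<in> sets M" for s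
  proof -
    have "{x\<in>A. rprefix (\<lambda>k. g k x) L = s} = A \<inter> {x\<in>space M. rprefix (\<lambda>k. g k x) L = s}"
      using sets.sets_into_space[OF A] by auto
    then show ?thesis using measurable_rprefix[where g=g and K=L and s=s] A g by auto
  qed
  have eq: "{x\<in>A. \<Phi> (\<lambda>k. g k x)} =
      (\<Union>s\<in>(\<lambda>b. rprefix b L) ` Collect \<Phi>. {x\<in>A. rprefix (\<lambda>k. g k x) L = s})"
    by (rule finite_bits_eq_UN_rprefix) (rule dep)
  show "measure M {x\<in>A. \<Phi> (\<lambda>k. g k x)} =
     (\<Sum>s\<in>(\<lambda>b. rprefix b L) ` Collect \<Phi>. measure M {x\<in>A. rprefix (\<lambda>k. g k x) L = s})"
    unfolding eq
    by (rule finite_measure_finite_Union)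
      (auto simp: finite_rprefixes disjoint_family_on_def m)
  show "{x\<in>A. \<Phi> (\<lambda>k. g k x)} \<in> sets M"
    unfolding eq
    by (intro sets.finite_UN finite_rprefixes m)
qed

locale signal_pair =
  fixes \<mu>0 \<mu>1 :: "'w measure"
  assumes prob0: "prob_space \<mu>0" and prob1: "prob_space \<mu>1" and sets_eq: "sets \<mu>0 = sets \<mu>1"
    and ac01: "absolutely_continuous \<mu>0 \<mu>1" and ac10: "absolutely_continuous \<mu>1 \<mu>0"
    and neq: "\<mu>0 \<noteq> \<mu>1"
begin

sublocale M0: prob_space \<mu>0 by (rule prob0)
sublocale M1: prob_space \<mu>1 by (rule prob1)

definition sig :: "bool \<Rightarrow> 'w measure" where "sig s = (if s then \<mu>1 else \<mu>0)"

sublocale sig: prob_space "sig s" for s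
  unfolding sig_def using prob0 prob1 by auto

lemma space_eq: "space \<mu>1 = space \<mu>0"
  using sets_eq_imp_space_eq[OF sets_eq] by simp

lemma sets_sig [simp, measurable_cong]: "sets (sig s) = sets \<mu>0"
  by (simp add: sig_def sets_eq)

lemma space_sig [simp]: "space (sig s) = space \<mu>0"
  by (simp add: sig_def space_eq)

lemma sig_simps [simp]: "sig True = \<mu>1" "sig False = \<mu>0"
  by (auto simp: sig_def)

lemma null_iff:
  assumes "A \<in> sets \<mu>0"
  shows "measure \<mu>1 A = 0 \<longleftrightarrow> measure \<mu>0 A = 0"
proof -
  have "A \<in> null_sets \<mu>0 \<longleftrightarrow> A \<in> null_sets \<mu>1"
    using ac01 ac10 by (auto simp: absolutely_continuous_def)
  then show ?thesis
    using assms sets_eq by (auto simp: null_sets_def M0.emeasure_eq_measure M1.emeasure_eq_measure)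
qed

text \<open>The Radon-Nikodym derivative of a finite measure is finite almost everywhere, so a
  version with real nonnegative values can be chosen.\<close>

lemma exists_lr:
  "\<exists>D. D \<in> borel_measurable \<mu>0 \<and> (\<forall>x. 0 \<le> D x) \<and> integrable \<mu>0 D \<and>
    (\<forall>A\<in>sets \<mu>0. measure \<mu>1 A = (\<integral>x. D x * indicator A x \<partial>\<mu>0))"
proof -
  obtain D where D [measurable]: "D \<in> borel_measurable \<mu>0"
    and AE: "AE x in \<mu>0. RN_deriv \<mu>0 \<mu>1 x = ennreal (D x)" and nn: "\<And>x. 0 \<le> D x"
    using M0.real_RN_deriv[OF M1.finite_measure_axioms ac01 sets_eq[symmetric]] by metis
  have nni: "emeasure \<mu>1 A = (\<integral>\<^sup>+x. ennreal (D x * indicator A x) \<partial>\<mu>0)" if A: "A \<in> sets \<mu>0" for A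
  proof -
    have "emeasure \<mu>1 A = emeasure (density \<mu>0 (RN_deriv \<mu>0 \<mu>1)) A"
      using M0.density_RN_deriv[OF ac01 sets_eq[symmetric]] by simp
    also have "\<dots> = (\<integral>\<^sup>+x. RN_deriv \<mu>0 \<mu>1 x * indicator A x \<partial>\<mu>0)"
      using A by (intro emeasure_density) auto
    also have "\<dots> = (\<integral>\<^sup>+x. ennreal (D x * indicator A x) \<partial>\<mu>0)"
      using AE by (intro nn_integral_cong_AE) (auto simp: indicator_def)
    finally show ?thesis .
  qed
  have "(\<integral>\<^sup>+x. ennreal (D x) \<partial>\<mu>0) = emeasure \<mu>1 (space \<mu>0)"
    by (subst nni) (auto intro!: nn_integral_cong simp: indicator_def)
  then have int: "integrable \<mu>0 D"
    using nn by (intro integrableI_nonneg) (auto simp: M1.emeasure_eq_measure)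
  have "measure \<mu>1 A = (\<integral>x. D x * indicator A x \<partial>\<mu>0)" if A: "A \<in> sets \<mu>0" for A
    using nni[OF A] A nn unfolding measure_def
    by (subst integral_eq_nn_integral) auto
  with D nn int show ?thesis by blast
qed

definition lr :: "'w \<Rightarrow> real" where
  "lr = (SOME D. D \<in> borel_measurable \<mu>0 \<and> (\<forall>x. 0 \<le> D x) \<and> integrable \<mu>0 D \<and>
    (\<forall>A\<in>sets \<mu>0. measure \<mu>1 A = (\<integral>x. D x * indicator A x \<partial>\<mu>0)))"

lemma lr_measurable [measurable]: "lr \<in> borel_measurable \<mu>0"
  and lr_nonneg: "lr x \<ge> 0"
  and lr_integrable: "integrable \<mu>0 lr"
  and measure1_lr: "A \<in> sets \<mu>0 \<Longrightarrow> measure \<mu>1 A = (\<integral>x. lr x * indicator A x \<partial>\<mu>0)"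
  using someI_ex[OF exists_lr] unfolding lr_def[symmetric] by auto

lemma integral_lr_linear:
  assumes A: "A \<in> sets \<mu>0"
  shows "integrable \<mu>0 (\<lambda>x. (a * lr x - b) * indicator A x)"
    and "(\<integral>x. (a * lr x - b) * indicator A x \<partial>\<mu>0) = a * measure \<mu>1 A - b * measure \<mu>0 A"
proof -
  have 1: "integrable \<mu>0 (\<lambda>x. lr x * indicator A x)"
    using A lr_integrable by (intro integrable_real_mult_indicator) auto
  have 2: "integrable \<mu>0 (\<lambda>x. indicator A x :: real)"
    using A by (simp add: M0.emeasure_eq_measure)
  have eq: "(\<lambda>x. (a * lr x - b) * indicator A x) = (\<lambda>x. a * (lr x * indicator A x) - b * indicator A x)"
    by (auto simp: algebra_simps)
  show "integrable \<mu>0 (\<lambda>x. (a * lr x - b) * indicator A x)"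
    unfolding eq by (intro Bochner_Integration.integrable_diff integrable_mult_right 1 2)
  show "(\<integral>x. (a * lr x - b) * indicator A x \<partial>\<mu>0) = a * measure \<mu>1 A - b * measure \<mu>0 A"
    unfolding eq using 1 2 A sets.sets_into_space[OF A]
    by (subst Bochner_Integration.integral_diff) (auto simp: measure1_lr Int_absorb2)
qed

text \<open>The integrand \<open>lr x - c\<close> vanishes on \<open>A\<close>. On a level set of
  the likelihood ratio the two laws are thus proportional, and a limit or an inequality under
  \<open>\<mu>0\<close> carries over to \<open>\<mu>1\<close>.\<close>

lemma lr_const:
  assumes "A \<in> sets \<mu>0" "\<And>x. x \<in> A \<Longrightarrow> lr x = c"
  shows "measure \<mu>1 A = c * measure \<mu>0 A"
proof -
  have "(\<integral>x. (1 * lr x - c) * indicator A x \<partial>\<mu>0) = (\<integral>x. 0 \<partial>\<mu>0)"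
    using assms(2) by (intro Bochner_Integration.integral_cong) (auto simp: indicator_def)
  then show ?thesis using integral_lr_linear(2)[OF assms(1), of 1 c] by simp
qed

text \<open>A strictly positive integrand with nonpositive integral lives on a null set. It is used
  to show that a Bayesian rule violates its own threshold on a null set only.\<close>

lemma lr_strict_null:
  assumes A: "A \<in> sets \<mu>0" and strict: "\<And>x. x \<in> A \<Longrightarrow> b < a * lr x"
    and le: "a * measure \<mu>1 A \<le> b * measure \<mu>0 A"
  shows "measure \<mu>0 A = 0"
proof -
  have nn: "AE x in \<mu>0. 0 \<le> (a * lr x - b) * indicator A x"
    using strict by (auto simp: indicator_def less_imp_le)
  have "(\<integral>x. (a * lr x - b) * indicator A x \<partial>\<mu>0) \<le> 0"
    using integral_lr_linear(2)[OF A, of a b] le by simp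
  moreover have "(\<integral>x. (a * lr x - b) * indicator A x \<partial>\<mu>0) \<ge> 0"
    using nn by (rule integral_nonneg_AE)
  ultimately have "(\<integral>x. (a * lr x - b) * indicator A x \<partial>\<mu>0) = 0" by simp
  then have "AE x in \<mu>0. (a * lr x - b) * indicator A x = 0"
    using integral_nonneg_eq_0_iff_AE[OF integral_lr_linear(1)[OF A] nn] by simp
  then have "AE x in \<mu>0. x \<notin> A"
    by eventually_elim (use strict in \<open>force simp: indicator_def\<close>)
  then show ?thesis using M0.prob_eq_0[OF A] by simp
qed

text \<open>Away from ties the limit inequality is strict, hence holds for the thresholds of large
  \<open>n\<close> as well, and the bits converge pointwise. On a level \<open>lr x = c\<close> with
  \<open>c \<in> T\<close> the thresholds may say nothing; there \<open>exists_limit_bits\<close> is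
  applied to the measure restricted to the level.\<close>

lemma exists_limit_rule_bits:
  assumes mf [measurable]: "\<And>n k. Measurable.pred \<mu>0 (f n k)"
    and thr_True: "\<And>n k x. x \<in> space \<mu>0 \<Longrightarrow> q n k < (1 - q n k) * lr x \<Longrightarrow> f n k x"
    and thr_False: "\<And>n k x. x \<in> space \<mu>0 \<Longrightarrow> (1 - q n k) * lr x < q n k \<Longrightarrow> \<not> f n k x"
    and q: "\<And>k. (\<lambda>n. q n k) \<longlonglongrightarrow> ql k"
    and T: "countable T" and ties: "\<And>k x. x \<in> space \<mu>0 \<Longrightarrow> (1 - ql k) * lr x = ql k \<Longrightarrow> lr x \<in> T"
    and conv: "\<And>c s. c \<in> T \<Longrightarrow>
      convergent (\<lambda>n. measure \<mu>0 {x\<in>space \<mu>0. lr x = c \<and> rprefix (\<lambda>k. f n k x) (length s) = s})"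
  shows "\<exists>g. (\<forall>k. Measurable.pred \<mu>0 (g k)) \<and>
    (\<forall>x\<in>space \<mu>0. lr x \<notin> T \<longrightarrow> (\<forall>k. eventually (\<lambda>n. f n k x = g k x) sequentially)) \<and>
    (\<forall>c\<in>T. \<forall>s. (\<lambda>n. measure \<mu>0 {x\<in>space \<mu>0. lr x = c \<and> rprefix (\<lambda>k. f n k x) (length s) = s})
       \<longlonglongrightarrow> measure \<mu>0 {x\<in>space \<mu>0. lr x = c \<and> rprefix (\<lambda>k. g k x) (length s) = s})"
proof -
  define E where "E c = {x\<in>space \<mu>0. lr x = c}" for c
  have mE [measurable]: "E c \<in> sets \<mu>0" for c unfolding E_def by simp
  define Mc where "Mc c = restrict_space \<mu>0 (E c)" for c
  have sMc: "space (Mc c) = E c" for c by (auto simp: Mc_def space_restrict_space E_def)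
  have meas: "measure (Mc c) A = measure \<mu>0 A" if "A \<subseteq> E c" for A c
    unfolding Mc_def using that by (intro measure_restrict_space) auto
  have "\<exists>g. (\<forall>k. Measurable.pred (Mc c) (g k)) \<and>
    (\<forall>s. (\<lambda>n. measure (Mc c) {x\<in>space (Mc c). rprefix (\<lambda>k. f n k x) (length s) = s})
       \<longlonglongrightarrow> measure (Mc c) {x\<in>space (Mc c). rprefix (\<lambda>k. g k x) (length s) = s})" if c: "c \<in> T" for c
  proof -
    interpret Mc: finite_measure "Mc c"
      unfolding Mc_def by (intro finite_measure_restrict_space M0.finite_measure_axioms) auto
    show ?thesis
    proof (rule Mc.exists_limit_bits)
      show "Measurable.pred (Mc c) (f n k)" for n k
        unfolding Mc_def by (intro measurable_restrict_space1) simp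
      show "convergent (\<lambda>n. measure (Mc c) {x\<in>space (Mc c). rprefix (\<lambda>k. f n k x) (length s) = s})" for s
        using conv[OF c, of s] by (subst meas) (auto simp: sMc E_def conj_assoc)
    qed
  qed
  then obtain g where g': "\<forall>c\<in>T. (\<forall>k. Measurable.pred (Mc c) (g c k)) \<and>
    (\<forall>s. (\<lambda>n. measure (Mc c) {x\<in>space (Mc c). rprefix (\<lambda>k. f n k x) (length s) = s})
       \<longlonglongrightarrow> measure (Mc c) {x\<in>space (Mc c). rprefix (\<lambda>k. g c k x) (length s) = s})"
    using bchoice[of T "\<lambda>c g. (\<forall>k. Measurable.pred (Mc c) (g k)) \<and>
      (\<forall>s. (\<lambda>n. measure (Mc c) {x\<in>space (Mc c). rprefix (\<lambda>k. f n k x) (length s) = s})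
        \<longlonglongrightarrow> measure (Mc c) {x\<in>space (Mc c). rprefix (\<lambda>k. g k x) (length s) = s})"] by blast
  then have mg: "\<And>c k. c \<in> T \<Longrightarrow> Measurable.pred (Mc c) (g c k)" and
    g: "\<And>c s. c \<in> T \<Longrightarrow> (\<lambda>n. measure (Mc c) {x\<in>space (Mc c). rprefix (\<lambda>k. f n k x) (length s) = s})
       \<longlonglongrightarrow> measure (Mc c) {x\<in>space (Mc c). rprefix (\<lambda>k. g c k x) (length s) = s}" by simp_all
  define h where "h k x = (if lr x \<in> T then g (lr x) k x else ql k < (1 - ql k) * lr x)" for k x
  have "Measurable.pred \<mu>0 (h k)" for k
  proof -
    have "{x\<in>E c. g c k x} \<in> sets \<mu>0" if "c \<in> T" for c
    proof -
      have "{x\<in>space (Mc c). g c k x} \<in> sets (Mc c)" using mg[OF that, of k] by (simp add: pred_def)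
      then show ?thesis unfolding sMc by (auto simp: Mc_def sets_restrict_space_iff)
    qed
    then have 1: "(\<Union>c\<in>T. {x\<in>E c. g c k x}) \<in> sets \<mu>0"
      using T by (intro sets.countable_UN'') auto
    have "(\<Union>c\<in>T. E c) \<in> sets \<mu>0" using T by (intro sets.countable_UN'') auto
    then have 2: "{x\<in>space \<mu>0. ql k < (1 - ql k) * lr x} - (\<Union>c\<in>T. E c) \<in> sets \<mu>0" by auto
    have "{x\<in>space \<mu>0. h k x} = (\<Union>c\<in>T. {x\<in>E c. g c k x}) \<union> ({x\<in>space \<mu>0. ql k < (1 - ql k) * lr x} - (\<Union>c\<in>T. E c))"
      by (auto simp: h_def E_def)
    with 1 2 show ?thesis by (simp add: pred_def)
  qed
  moreover have "eventually (\<lambda>n. f n k x = h k x) sequentially" if x: "x \<in> space \<mu>0" "lr x \<notin> T" for x k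
  proof -
    have lim: "(\<lambda>n. (1 - q n k) * lr x - q n k) \<longlonglongrightarrow> (1 - ql k) * lr x - ql k"
      by (intro tendsto_intros q)
    consider "ql k < (1 - ql k) * lr x" | "(1 - ql k) * lr x < ql k" using ties[of x k] x by fastforce
    then show ?thesis
    proof cases
      case 1
      then have "eventually (\<lambda>n. (1 - q n k) * lr x - q n k > 0) sequentially"
        using order_tendstoD(1)[OF lim, of 0] by simp
      then show ?thesis by eventually_elim (use thr_True x 1 in \<open>auto simp: h_def\<close>)
    next
      case 2
      then have "eventually (\<lambda>n. (1 - q n k) * lr x - q n k < 0) sequentially"
        using order_tendstoD(2)[OF lim, of 0] by simp
      then show ?thesis by eventually_elim (use thr_False x 2 in \<open>auto simp: h_def\<close>)
    qed
  qed
  moreover have "(\<lambda>n. measure \<mu>0 {x\<in>space \<mu>0. lr x = c \<and> rprefix (\<lambda>k. f n k x) (length s) = s})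
       \<longlonglongrightarrow> measure \<mu>0 {x\<in>space \<mu>0. lr x = c \<and> rprefix (\<lambda>k. h k x) (length s) = s}" if c: "c \<in> T" for c s
  proof -
    have "rprefix (\<lambda>k. h k x) K = rprefix (\<lambda>k. g c k x) K" if "lr x = c" for x K
      using c that by (simp add: h_def)
    then have "{x\<in>space (Mc c). rprefix (\<lambda>k. g c k x) (length s) = s} =
        {x\<in>space \<mu>0. lr x = c \<and> rprefix (\<lambda>k. h k x) (length s) = s}"
      by (auto simp: sMc E_def)
    moreover have "{x\<in>space (Mc c). rprefix (\<lambda>k. f n k x) (length s) = s} =
        {x\<in>space \<mu>0. lr x = c \<and> rprefix (\<lambda>k. f n k x) (length s) = s}" for n
      by (auto simp: sMc E_def)
    ultimately show ?thesis using g[OF c, of s] by (simp add: meas E_def subset_eq)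
  qed
  ultimately show ?thesis by blast
qed

definition bits_converge :: "real set \<Rightarrow> (nat \<Rightarrow> 'k \<Rightarrow> 'w \<Rightarrow> bool) \<Rightarrow> ('k \<Rightarrow> 'w \<Rightarrow> bool) \<Rightarrow> bool" where
  "bits_converge T f g \<longleftrightarrow> countable T \<and> (\<forall>\<Phi> K. finite K \<longrightarrow>
     (\<forall>b b'. (\<forall>k\<in>K. b k = b' k) \<longrightarrow> \<Phi> b = \<Phi> b') \<longrightarrow>
       {x\<in>space \<mu>0. \<Phi> (\<lambda>k. g k x)} \<in> sets \<mu>0 \<and>
       (\<forall>s. (\<lambda>n. measure (sig s) {x\<in>space \<mu>0. \<Phi> (\<lambda>k. f n k x)}) \<longlonglongrightarrow> measure (sig s) {x\<in>space \<mu>0. \<Phi> (\<lambda>k. g k x)}) \<and>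
       (\<forall>s D. D \<in> sets \<mu>0 \<longrightarrow> (\<forall>x\<in>D. lr x \<notin> T) \<longrightarrow>
         (\<lambda>n. measure (sig s) {x\<in>D. \<Phi> (\<lambda>k. f n k x)}) \<longlonglongrightarrow> measure (sig s) {x\<in>D. \<Phi> (\<lambda>k. g k x)}) \<and>
       (\<forall>s c. c \<in> T \<longrightarrow>
         (\<lambda>n. measure (sig s) {x\<in>space \<mu>0. lr x = c \<and> \<Phi> (\<lambda>k. f n k x)})
            \<longlonglongrightarrow> measure (sig s) {x\<in>space \<mu>0. lr x = c \<and> \<Phi> (\<lambda>k. g k x)}))"

lemma bits_convergeI:
  fixes f :: "nat \<Rightarrow> nat \<Rightarrow> 'w \<Rightarrow> bool"
  assumes mf [measurable]: "\<And>n k. Measurable.pred \<mu>0 (f n k)"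
    and mg [measurable]: "\<And>k. Measurable.pred \<mu>0 (g k)"
    and T: "countable T"
    and off: "\<And>x k. x \<in> space \<mu>0 \<Longrightarrow> lr x \<notin> T \<Longrightarrow> eventually (\<lambda>n. f n k x = g k x) sequentially"
    and on: "\<And>c s. c \<in> T \<Longrightarrow> (\<lambda>n. measure \<mu>0 {x\<in>space \<mu>0. lr x = c \<and> rprefix (\<lambda>k. f n k x) (length s) = s})
       \<longlonglongrightarrow> measure \<mu>0 {x\<in>space \<mu>0. lr x = c \<and> rprefix (\<lambda>k. g k x) (length s) = s}"
  shows "bits_converge T f g"
  unfolding bits_converge_def
proof (intro conjI T allI impI)
  fix \<Phi> :: "(nat \<Rightarrow> bool) \<Rightarrow> bool" and K :: "nat set"
  assume K: "finite K" and "\<forall>b b'. (\<forall>k\<in>K. b k = b' k) \<longrightarrow> \<Phi> b = \<Phi> b'"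
  moreover obtain L where L: "\<And>k. k \<in> K \<Longrightarrow> k < L" using finite_nat_set_iff_bounded[of K] K by blast
  ultimately have dep: "\<And>b b'. (\<And>k. k < L \<Longrightarrow> b k = b' k) \<Longrightarrow> \<Phi> b = \<Phi> b'" by blast
  have mf': "{x\<in>A. \<Phi> (\<lambda>k. f n k x)} \<in> sets \<mu>0" if "A \<in> sets \<mu>0" for A n
    by (rule M0.measure_finite_bits(2)[OF _ that dep]) simp_all
  have mg': "{x\<in>A. \<Phi> (\<lambda>k. g k x)} \<in> sets \<mu>0" if "A \<in> sets \<mu>0" for A
    by (rule M0.measure_finite_bits(2)[OF _ that dep]) simp_all
  show "{x\<in>space \<mu>0. \<Phi> (\<lambda>k. g k x)} \<in> sets \<mu>0" by (rule mg') simp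
  show 1: "(\<lambda>n. measure (sig s) {x\<in>D. \<Phi> (\<lambda>k. f n k x)}) \<longlonglongrightarrow> measure (sig s) {x\<in>D. \<Phi> (\<lambda>k. g k x)}"
    if D: "D \<in> sets \<mu>0" "\<forall>x\<in>D. lr x \<notin> T" for s D
  proof -
    have eq: "{x\<in>D. R x} = {x\<in>space (sig s). x \<in> D \<and> R x}" for R
      using sets.sets_into_space[OF D(1)] by auto
    have eq': "{x\<in>space (sig s). x \<in> D \<and> R x} = {x\<in>D. R x}" for R
      using eq by simp
    show ?thesis unfolding eq
    proof (rule sig.tendsto_measure_eventually)
      show "Measurable.pred (sig s) (\<lambda>x. x \<in> D \<and> \<Phi> (\<lambda>k. f n k x))" for n
        using mf'[OF D(1)] unfolding pred_def eq' sets_sig .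
      show "Measurable.pred (sig s) (\<lambda>x. x \<in> D \<and> \<Phi> (\<lambda>k. g k x))"
        using mg'[OF D(1)] unfolding pred_def eq' sets_sig .
      fix x assume "x \<in> space (sig s)"
      then have x: "x \<in> space \<mu>0" by simp
      show "\<forall>\<^sub>F n in sequentially. (x \<in> D \<and> \<Phi> (\<lambda>k. f n k x)) = (x \<in> D \<and> \<Phi> (\<lambda>k. g k x))"
      proof (cases "x \<in> D")
        case True
        have "eventually (\<lambda>n. \<forall>k\<in>{..<L}. f n k x = g k x) sequentially"
          using off[OF x] D(2) True by (intro eventually_ball_finite) auto
        then show ?thesis
        proof eventually_elim
          case (elim n)
          then have "\<Phi> (\<lambda>k. f n k x) = \<Phi> (\<lambda>k. g k x)" by (intro dep) auto
          then show ?case by simp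
        qed
      qed simp
    qed
  qed
  show 2: "(\<lambda>n. measure (sig s) {x\<in>space \<mu>0. lr x = c \<and> \<Phi> (\<lambda>k. f n k x)})
            \<longlonglongrightarrow> measure (sig s) {x\<in>space \<mu>0. lr x = c \<and> \<Phi> (\<lambda>k. g k x)}" if c: "c \<in> T" for s c
  proof -
    define E where "E = {x\<in>space \<mu>0. lr x = c}"
    have mE: "E \<in> sets \<mu>0" by (simp add: E_def)
    have eq: "{x\<in>space \<mu>0. lr x = c \<and> R x} = {x\<in>E. R x}" for R by (auto simp: E_def)
    have "(\<lambda>n. measure \<mu>0 {x\<in>E. \<Phi> (\<lambda>k. f n k x)}) \<longlonglongrightarrow> measure \<mu>0 {x\<in>E. \<Phi> (\<lambda>k. g k x)}"
    proof -
      have f_sum: "measure \<mu>0 {x\<in>E. \<Phi> (\<lambda>k. f n k x)} =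
        (\<Sum>s\<in>(\<lambda>b. rprefix b L) ` Collect \<Phi>. measure \<mu>0 {x\<in>E. rprefix (\<lambda>k. f n k x) L = s})" for n
        by (rule M0.measure_finite_bits(1)[OF _ mE dep]) simp_all
      have g_sum: "measure \<mu>0 {x\<in>E. \<Phi> (\<lambda>k. g k x)} =
        (\<Sum>s\<in>(\<lambda>b. rprefix b L) ` Collect \<Phi>. measure \<mu>0 {x\<in>E. rprefix (\<lambda>k. g k x) L = s})"
        by (rule M0.measure_finite_bits(1)[OF _ mE dep]) simp_all
      show ?thesis unfolding f_sum g_sum
      proof (rule tendsto_sum)
        fix s assume "s \<in> (\<lambda>b. rprefix b L) ` Collect \<Phi>"
        then have "length s = L" by auto
        then show "(\<lambda>n. measure \<mu>0 {x\<in>E. rprefix (\<lambda>k. f n k x) L = s}) \<longlonglongrightarrow> measure \<mu>0 {x\<in>E. rprefix (\<lambda>k. g k x) L = s}"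
          using on[OF c, of s] by (simp add: eq)
      qed
    qed
    \<comment> \<open>On a tie level convergence under \<open>\<mu>0\<close> gives convergence under
      both laws by proportionality.\<close>
    moreover have "measure (sig s) {x\<in>E. R x} = (if s then c else 1) * measure \<mu>0 {x\<in>E. R x}"
      if "{x\<in>E. R x} \<in> sets \<mu>0" for R
      using lr_const[OF that, of c] by (auto simp: E_def)
    ultimately show ?thesis unfolding eq using mf'[OF mE] mg'[OF mE] by (auto intro!: tendsto_mult_left)
  qed
  show "(\<lambda>n. measure (sig s) {x\<in>space \<mu>0. \<Phi> (\<lambda>k. f n k x)}) \<longlonglongrightarrow> measure (sig s) {x\<in>space \<mu>0. \<Phi> (\<lambda>k. g k x)}" for s
  proof -
    \<comment> \<open>\<open>None\<close> collects the points off \<open>T\<close>, and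
      \<open>Some c\<close> is the level of the tie value \<open>c\<close>.\<close>
    define h where "h x = (if lr x \<in> T then Some (lr x) else None)" for x
    define N where "N = {x\<in>space \<mu>0. lr x \<notin> T}"
    have mN: "N \<in> sets \<mu>0"
    proof -
      have "(\<Union>c\<in>T. {x\<in>space \<mu>0. lr x = c}) \<in> sets \<mu>0" using T by (intro sets.countable_UN'') auto
      moreover have "N = space \<mu>0 - (\<Union>c\<in>T. {x\<in>space \<mu>0. lr x = c})" by (auto simp: N_def)
      ultimately show ?thesis by auto
    qed
    have hN: "{x\<in>space \<mu>0. h x = None \<and> R x} = {x\<in>N. R x}" for R
      by (auto simp: h_def N_def)
    have hT: "{x\<in>space \<mu>0. h x = Some c \<and> R x} = {x\<in>space \<mu>0. lr x = c \<and> R x}" if "c \<in> T" for R c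
      using that by (auto simp: h_def)
    have "(\<lambda>n. measure (sig s) {x\<in>space (sig s). \<Phi> (\<lambda>k. f n k x)}) \<longlonglongrightarrow> measure (sig s) {x\<in>space (sig s). \<Phi> (\<lambda>k. g k x)}"
    proof (rule sig.tendsto_measure_countable_partition[where I="insert None (Some ` T)" and h=h])
      show "countable (insert None (Some ` T))" using T by auto
      show "h x \<in> insert None (Some ` T)" for x by (auto simp: h_def)
      show "{x\<in>space (sig s). h x = i} \<in> sets (sig s)" if "i \<in> insert None (Some ` T)" for i
        using that hN[of "\<lambda>_. True"] hT[of _ "\<lambda>_. True"] mN by auto
      show "{x\<in>space (sig s). \<Phi> (\<lambda>k. f n k x)} \<in> sets (sig s)" for n using mf' by simp
      show "{x\<in>space (sig s). \<Phi> (\<lambda>k. g k x)} \<in> sets (sig s)" using mg' by simp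
      fix i assume "i \<in> insert None (Some ` T)"
      then show "(\<lambda>n. measure (sig s) {x\<in>space (sig s). h x = i \<and> \<Phi> (\<lambda>k. f n k x)})
         \<longlonglongrightarrow> measure (sig s) {x\<in>space (sig s). h x = i \<and> \<Phi> (\<lambda>k. g k x)}"
        using 1[OF mN, of s] 2[of _ s] by (auto simp: hN hT) (auto simp: N_def)
    qed
    then show ?thesis by simp
  qed
qed

end

section \<open>Runs of reaction rules\<close>

type_synonym history = "(nat \<times> nat) set"
type_synonym table = "nat \<Rightarrow> nat \<Rightarrow> history \<Rightarrow> bool"

text \<open>The pair \<open>(u, t)\<close> in a history records that agent \<open>u\<close> takes action 1 at time \<open>t + 1\<close>.
  An agent reacts to its local history, which consists of its own and its neighbours' actions.\<close>

definition local_history :: "(nat \<Rightarrow> nat set) \<Rightarrow> nat \<Rightarrow> history \<Rightarrow> history" where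
  "local_history N u X = {p\<in>X. fst p \<in> insert u (N u)}"

primrec run :: "(nat \<Rightarrow> nat set) \<Rightarrow> nat set \<Rightarrow> table \<Rightarrow> nat \<Rightarrow> history" where
  "run N V b 0 = {}"
| "run N V b (Suc t) = run N V b t \<union> {(u, t) | u. u \<in> V \<and> b u t (local_history N u (run N V b t))}"

text \<open>Agent \<open>u\<close> replays the actions recorded in \<open>h\<close> whatever its
  signal is, so a run with this table does not depend on the responses of \<open>u\<close>.\<close>

definition forced :: "table \<Rightarrow> nat \<Rightarrow> history \<Rightarrow> table" where
  "forced b u h = (\<lambda>v t h'. if v = u then (u, t) \<in> h else b v t h')"

text \<open>The part of \<open>h\<close> before \<open>t'\<close> is the history to which
  \<open>u\<close> reacts at \<open>t'\<close>; the condition therefore involves the responses of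
  \<open>u\<close> only.\<close>

definition consistent :: "table \<Rightarrow> nat \<Rightarrow> history \<Rightarrow> nat \<Rightarrow> bool" where
  "consistent b u h t \<longleftrightarrow> (\<forall>t'<t. b u t' {p\<in>h. snd p < t'} \<longleftrightarrow> (u, t') \<in> h)"

lemma run_bounds: "p \<in> run N V b t \<Longrightarrow> fst p \<in> V \<and> snd p < t"
  by (induction t) (auto simp: less_Suc_eq)

lemma run_cut: "t \<le> t' \<Longrightarrow> {p\<in>run N V b t'. snd p < t} = run N V b t"
proof (induction t')
  case 0 then show ?case by simp
next
  case (Suc t')
  show ?case
  proof (cases "t = Suc t'")
    case True
    then show ?thesis using run_bounds[of _ N V b "Suc t'"] by blast
  next
    case False
    then have "t \<le> t'" using Suc.prems by simp
    then have "{p\<in>run N V b (Suc t'). snd p < t} = {p\<in>run N V b t'. snd p < t}" by auto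
    then show ?thesis using Suc.IH \<open>t \<le> t'\<close> by simp
  qed
qed

lemma mem_run_iff: "t < t' \<Longrightarrow> (u, t) \<in> run N V b t' \<longleftrightarrow> u \<in> V \<and> b u t (local_history N u (run N V b t))"
proof -
  assume "t < t'"
  then have "(u, t) \<in> run N V b t' \<longleftrightarrow> (u, t) \<in> run N V b (Suc t)"
    using run_cut[of "Suc t" t' N V b] by auto
  then show ?thesis using run_bounds[of "(u, t)" N V b t] by auto
qed

lemma local_history_cut:
  "t \<le> t' \<Longrightarrow> {p\<in>local_history N u (run N V b t'). snd p < t} = local_history N u (run N V b t)"
  using run_cut[of t t' N V b] by (auto simp: local_history_def)

text \<open>The event of seeing \<open>h\<close> splits into a condition on the responses of
  \<open>u\<close> and one that ignores them, from which independence of the own signal is derived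
  later. Both directions compare the two runs step by step: as long as the history agrees with
  \<open>h\<close>, forcing changes nothing.\<close>

lemma local_history_run_eq_iff:
  assumes u: "u \<in> V"
  shows "local_history N u (run N V b t) = h \<longleftrightarrow>
    consistent b u h t \<and> local_history N u (run N V (forced b u h) t) = h"
proof (intro iffI conjI)
  assume h: "local_history N u (run N V b t) = h"
  have "run N V (forced b u h) t' = run N V b t'" if "t' \<le> t" for t'
    using that
  proof (induction t')
    case (Suc t')
    have "(u, t') \<in> h \<longleftrightarrow> b u t' (local_history N u (run N V b t'))"
      using mem_run_iff[of t' t u N V b] Suc.prems u h by (auto simp: local_history_def)
    then show ?case using Suc by (auto simp: forced_def)
  qed simp
  from this[of t] show "local_history N u (run N V (forced b u h) t) = h" using h by simp
  show "consistent b u h t"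
    unfolding consistent_def
  proof (intro allI impI)
    fix t' assume t': "t' < t"
    have "{p\<in>h. snd p < t'} = local_history N u (run N V b t')"
      unfolding h[symmetric] using t' by (intro local_history_cut) simp
    moreover have "(u, t') \<in> h \<longleftrightarrow> (u, t') \<in> run N V b t"
      unfolding h[symmetric] by (auto simp: local_history_def)
    ultimately show "b u t' {p\<in>h. snd p < t'} \<longleftrightarrow> (u, t') \<in> h"
      using mem_run_iff[OF t', of u N V b] u by simp
  qed
next
  assume *: "consistent b u h t \<and> local_history N u (run N V (forced b u h) t) = h"
  have "run N V (forced b u h) t' = run N V b t'" if "t' \<le> t" for t'
    using that
  proof (induction t')
    case (Suc t')
    have "{p\<in>h. snd p < t'} = local_history N u (run N V (forced b u h) t')"
      using * local_history_cut[of t' t N u V "forced b u h"] Suc.prems by simp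
    also have "\<dots> = local_history N u (run N V b t')" using Suc by simp
    finally have eqh: "{p\<in>h. snd p < t'} = local_history N u (run N V b t')" .
    have "b u t' {p\<in>h. snd p < t'} \<longleftrightarrow> (u, t') \<in> h"
      using * Suc.prems by (simp add: consistent_def)
    then have "(u, t') \<in> h \<longleftrightarrow> b u t' (local_history N u (run N V b t'))"
      unfolding eqh by blast
    then show ?case using Suc by (auto simp: forced_def)
  qed simp
  from this[of t] * show "local_history N u (run N V b t) = h" by simp
qed

text \<open>\<open>K\<close> lists table entries, that is, triples of an agent, a time and a
  history. For finite \<open>K\<close> an event of the table becomes a finite combination of
  conditions on single signals.\<close>

definition determined_by :: "(nat \<times> nat \<times> history) set \<Rightarrow> (table \<Rightarrow> 'a) \<Rightarrow> bool" where
  "determined_by K \<Phi> \<longleftrightarrow> (\<forall>b b'. (\<forall>(v, t, h)\<in>K. b v t h = b' v t h) \<longrightarrow> \<Phi> b = \<Phi> b')"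

lemma determined_byD:
  assumes "determined_by K \<Phi>" "\<And>v t h. (v, t, h) \<in> K \<Longrightarrow> b v t h = b' v t h"
  shows "\<Phi> b = \<Phi> b'"
proof -
  have "\<forall>(v, t, h)\<in>K. b v t h = b' v t h" using assms(2) by auto
  then show ?thesis using assms(1) unfolding determined_by_def by simp
qed

lemma determined_byI:
  assumes "\<And>b b'. (\<And>v t h. (v, t, h) \<in> K \<Longrightarrow> b v t h = b' v t h) \<Longrightarrow> \<Phi> b = \<Phi> b'"
  shows "determined_by K \<Phi>"
  unfolding determined_by_def
proof (intro allI impI)
  fix b b' :: table assume "\<forall>(v, t, h)\<in>K. b v t h = b' v t h"
  then show "\<Phi> b = \<Phi> b'" by (intro assms) auto
qed

definition locally_finite :: "nat set \<Rightarrow> (nat \<Rightarrow> nat set) \<Rightarrow> bool" where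
  "locally_finite V N \<longleftrightarrow> (\<forall>v\<in>V. N v \<subseteq> V \<and> finite (N v))"

text \<open>Induction on time: the next actions of \<open>U\<close> need the run on \<open>U\<close>
  and its neighbours, where only finitely many histories can occur. Keeping the histories in
  \<open>K\<close> finite matters since the finite ones form a countable set, to which diagonal
  arguments apply.\<close>

lemma run_determined:
  assumes "locally_finite V N" "finite U" "U \<subseteq> V"
  shows "\<exists>K. finite K \<and> K \<subseteq> {(v, t', h). v \<in> V \<and> finite h} \<and>
    determined_by K (\<lambda>b. {p\<in>run N V b t. fst p \<in> U})"
  using assms(2,3)
proof (induction t arbitrary: U)
  case 0
  then show ?case by (intro exI[of _ "{}"]) (auto simp: determined_by_def)
next
  case (Suc t)
  define U' where "U' = (\<Union>u\<in>U. insert u (N u))"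
  have U': "finite U'" "U' \<subseteq> V" "U \<subseteq> U'"
    using Suc.prems assms(1) by (auto simp: U'_def locally_finite_def)
  from Suc.IH[OF U'(1,2)] obtain K where K: "finite K" "K \<subseteq> {(v, t', h). v \<in> V \<and> finite h}"
    "determined_by K (\<lambda>b. {p\<in>run N V b t. fst p \<in> U'})" by blast
  define K' where "K' = K \<union> U \<times> {t} \<times> Pow (U' \<times> {..<t})"
  have "determined_by K' (\<lambda>b. {p\<in>run N V b (Suc t). fst p \<in> U})"
  proof (rule determined_byI)
    fix b b' :: table assume agree: "\<And>v t h. (v, t, h) \<in> K' \<Longrightarrow> b v t h = b' v t h"
    have eq: "{p\<in>run N V b t. fst p \<in> U'} = {p\<in>run N V b' t. fst p \<in> U'}"
      by (rule determined_byD[OF K(3)]) (use agree in \<open>auto simp: K'_def\<close>)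
    have lh: "local_history N u (run N V b t) = local_history N u (run N V b' t)" if "u \<in> U" for u
    proof -
      have "local_history N u X = {p\<in>{p\<in>X. fst p \<in> U'}. fst p \<in> insert u (N u)}" for X
        using that by (auto simp: local_history_def U'_def)
      then show ?thesis by (simp only: eq)
    qed
    have "local_history N u (run N V b' t) \<in> Pow (U' \<times> {..<t})" if "u \<in> U" for u
      using run_bounds[of _ N V b' t] that by (force simp: local_history_def U'_def)
    then have "b u t (local_history N u (run N V b t)) = b' u t (local_history N u (run N V b' t))" if "u \<in> U" for u
      using agree lh that by (auto simp: K'_def)
    moreover have "{p\<in>run N V b t. fst p \<in> U} = {p\<in>run N V b' t. fst p \<in> U}"
      using eq U'(3) by blast
    ultimately show "{p\<in>run N V b (Suc t). fst p \<in> U} = {p\<in>run N V b' (Suc t). fst p \<in> U}"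
      by auto
  qed
  moreover have "finite K'" using K U' Suc.prems by (simp add: K'_def)
  moreover have "K' \<subseteq> {(v, t', h). v \<in> V \<and> finite h}"
  proof -
    have "finite h" if "h \<subseteq> U' \<times> {..<t}" for h
      by (rule finite_subset[OF that]) (use U' in simp)
    then show ?thesis using K(2) Suc.prems by (auto simp: K'_def)
  qed
  ultimately show ?case by blast
qed

lemma local_history_determined:
  assumes "locally_finite V N" "u \<in> V"
  shows "\<exists>K. finite K \<and> K \<subseteq> {(v, t', h). v \<in> V \<and> finite h} \<and>
    determined_by K (\<lambda>b. local_history N u (run N V b t))"
  using run_determined[of V N "insert u (N u)" t] assms by (simp add: locally_finite_def local_history_def)

text \<open>Forcing overwrites the entries of \<open>u\<close>, so they can be deleted from
  \<open>K\<close>.\<close>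

lemma forced_determined:
  assumes "locally_finite V N" "u \<in> V"
  shows "\<exists>K. finite K \<and> K \<subseteq> {(v, t', h). v \<in> V \<and> v \<noteq> u \<and> finite h} \<and>
    determined_by K (\<lambda>b. local_history N u (run N V (forced b u h) t))"
proof -
  obtain K where K: "finite K" "K \<subseteq> {(v, t', h). v \<in> V \<and> finite h}"
    "determined_by K (\<lambda>b. local_history N u (run N V b t))"
    using local_history_determined[OF assms] by blast
  define K' where "K' = {k\<in>K. fst k \<noteq> u}"
  have "determined_by K' (\<lambda>b. local_history N u (run N V (forced b u h) t))"
  proof (rule determined_byI)
    fix b b' :: table assume "\<And>v t h. (v, t, h) \<in> K' \<Longrightarrow> b v t h = b' v t h"
    then show "local_history N u (run N V (forced b u h) t) = local_history N u (run N V (forced b' u h) t)"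
      by (intro determined_byD[OF K(3)]) (auto simp: forced_def K'_def)
  qed
  moreover have "finite K'" "K' \<subseteq> {(v, t', h). v \<in> V \<and> v \<noteq> u \<and> finite h}"
    using K by (auto simp: K'_def)
  ultimately show ?thesis by blast
qed

lemma determined_by_comp:
  assumes "determined_by K f"
  shows "determined_by K (\<lambda>b. g (f b))"
proof (rule determined_byI)
  fix b b' :: table assume "\<And>v t h. (v, t, h) \<in> K \<Longrightarrow> b v t h = b' v t h"
  then have "f b = f b'" by (rule determined_byD[OF assms])
  then show "g (f b) = g (f b')" by (rule arg_cong)
qed

text \<open>By time \<open>t\<close> influence has travelled a bounded distance, so local
  convergence of the graphs suffices. The statement is uniform in the table because the tables vary
  with \<open>n\<close> as well.\<close>

lemma run_eventually_local:
  assumes fin: "locally_finite V N"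
    and N: "\<And>v. v \<in> V \<Longrightarrow> eventually (\<lambda>n. Nn n v = N v) sequentially"
    and V: "\<And>v. v \<in> V \<Longrightarrow> eventually (\<lambda>n. v \<in> Vn n) sequentially"
  shows "finite U \<Longrightarrow> U \<subseteq> V \<Longrightarrow>
    eventually (\<lambda>n. \<forall>b. {p\<in>run (Nn n) (Vn n) b t. fst p \<in> U} = {p\<in>run N V b t. fst p \<in> U}) sequentially"
proof (induction t arbitrary: U)
  case 0
  then show ?case by simp
next
  case (Suc t)
  define U' where "U' = (\<Union>u\<in>U. insert u (N u))"
  have U': "finite U'" "U' \<subseteq> V" "U \<subseteq> U'"
    using Suc.prems fin by (auto simp: U'_def locally_finite_def)
  have "eventually (\<lambda>n. \<forall>u\<in>U. Nn n u = N u) sequentially"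
    using Suc.prems N by (intro eventually_ball_finite) auto
  moreover have "eventually (\<lambda>n. \<forall>u\<in>U. u \<in> Vn n) sequentially"
    using Suc.prems V by (intro eventually_ball_finite) auto
  ultimately show ?case using Suc.IH[OF U'(1,2)]
  proof eventually_elim
    case (elim n)
    show ?case
    proof
      fix b
      have eq: "{p\<in>run (Nn n) (Vn n) b t. fst p \<in> U'} = {p\<in>run N V b t. fst p \<in> U'}" using elim by blast
      have lh: "local_history (Nn n) u (run (Nn n) (Vn n) b t) = local_history N u (run N V b t)" if "u \<in> U" for u
      proof -
        have "local_history N u X = {p\<in>{p\<in>X. fst p \<in> U'}. fst p \<in> insert u (N u)}" for X
          using that by (auto simp: local_history_def U'_def)
        moreover have "local_history (Nn n) u = local_history N u"
          using elim(1) that by (auto simp: local_history_def fun_eq_iff)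
        ultimately show ?thesis by (simp only: eq)
      qed
      have "{p\<in>run (Nn n) (Vn n) b t. fst p \<in> U} = {p\<in>run N V b t. fst p \<in> U}"
        using eq U'(3) by blast
      then show "{p\<in>run (Nn n) (Vn n) b (Suc t). fst p \<in> U} = {p\<in>run N V b (Suc t). fst p \<in> U}"
        using lh elim(2) Suc.prems(2) by auto
    qed
  qed
qed

section \<open>Independence of signals and histories\<close>

context signal_pair
begin

definition signals :: "nat set \<Rightarrow> bool \<Rightarrow> (nat \<Rightarrow> 'w) measure" where
  "signals V s = PiM V (\<lambda>_. sig s)"

sublocale signals: prob_space "signals V s" for V s
  unfolding signals_def by (intro prob_space_PiM sig.prob_space_axioms)

lemma space_signals: "space (signals V s) = (\<Pi>\<^sub>E u\<in>V. space \<mu>0)"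
  by (simp add: signals_def space_PiM)

lemma sets_signals: "sets (signals V s) = sets (PiM V (\<lambda>_. \<mu>0))"
  unfolding signals_def by (intro sets_PiM_cong) auto

lemma signal_in_space: "w \<in> space (signals V s) \<Longrightarrow> u \<in> V \<Longrightarrow> w u \<in> space \<mu>0"
  by (auto simp: space_signals)

lemma measure_signals_rectangle:
  assumes "finite J" "J \<subseteq> V" "\<And>v. v \<in> J \<Longrightarrow> A v \<in> sets \<mu>0"
  shows "measure (signals V s) {w\<in>space (signals V s). \<forall>v\<in>J. w v \<in> A v} = (\<Prod>v\<in>J. measure (sig s) (A v))"
    and "{w\<in>space (signals V s). \<forall>v\<in>J. w v \<in> A v} \<in> sets (signals V s)"
proof -
  interpret P: product_prob_space "\<lambda>_. sig s" V
    by (auto simp: product_prob_space_def product_prob_space_axioms_def product_sigma_finite_def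
        intro: sig.prob_space_axioms sig.sigma_finite_measure_axioms)
  have "emeasure (signals V s) {w\<in>space (signals V s). \<forall>v\<in>J. w v \<in> A v} = (\<Prod>v\<in>J. emeasure (sig s) (A v))"
    unfolding signals_def using assms by (intro P.emeasure_PiM_Collect) auto
  then show "measure (signals V s) {w\<in>space (signals V s). \<forall>v\<in>J. w v \<in> A v} = (\<Prod>v\<in>J. measure (sig s) (A v))"
    by (simp add: signals.emeasure_eq_measure sig.emeasure_eq_measure prod_ennreal prod_nonneg)
  have "{w\<in>space (signals V s). \<forall>v\<in>J. w v \<in> A v} = (\<Inter>v\<in>J. {w\<in>space (signals V s). w v \<in> A v}) \<inter> space (signals V s)"
    by auto
  also have "\<dots> \<in> sets (signals V s)"
  proof (cases "J = {}")
    case False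
    have "{w\<in>space (signals V s). w v \<in> A v} \<in> sets (signals V s)" if "v \<in> J" for v
      unfolding signals_def using that assms by (intro sets_Collect_single) auto
    then show ?thesis using False assms(1) by (intro sets.Int sets.finite_INT) auto
  qed simp
  finally show "{w\<in>space (signals V s). \<forall>v\<in>J. w v \<in> A v} \<in> sets (signals V s)" .
qed

definition responses :: "(nat \<Rightarrow> nat \<Rightarrow> history \<Rightarrow> 'w \<Rightarrow> bool) \<Rightarrow> (nat \<Rightarrow> 'w) \<Rightarrow> table" where
  "responses F w = (\<lambda>v t h. F v t h (w v))"

definition pattern_set ::
  "(nat \<Rightarrow> nat \<Rightarrow> history \<Rightarrow> 'w \<Rightarrow> bool) \<Rightarrow> (nat \<times> nat \<times> history) set \<Rightarrow> (nat \<times> nat \<times> history) set \<Rightarrow> nat \<Rightarrow> 'w set"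
where
  "pattern_set F K S v = {x\<in>space \<mu>0. \<forall>t h. (v, t, h) \<in> K \<longrightarrow> (F v t h x \<longleftrightarrow> (v, t, h) \<in> S)}"

lemma pattern_set_measurable:
  assumes "finite K" "\<And>t h. (v, t, h) \<in> K \<Longrightarrow> Measurable.pred \<mu>0 (F v t h)"
  shows "pattern_set F K S v \<in> sets \<mu>0"
proof -
  let ?K = "{k\<in>K. fst k = v}"
  have "pattern_set F K S v = {x\<in>space \<mu>0. \<forall>k\<in>?K. F v (fst (snd k)) (snd (snd k)) x \<longleftrightarrow> k \<in> S}"
    by (auto simp: pattern_set_def)
  also have "\<dots> \<in> sets \<mu>0"
  proof (rule sets.sets_Collect_finite_All)
    fix k assume "k \<in> ?K"
    then have "Measurable.pred \<mu>0 (F v (fst (snd k)) (snd (snd k)))" using assms(2) by (cases k) auto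
    then show "{x\<in>space \<mu>0. F v (fst (snd k)) (snd (snd k)) x \<longleftrightarrow> k \<in> S} \<in> sets \<mu>0" by simp
  qed (use assms(1) in auto)
  finally show ?thesis .
qed

text \<open>Outcomes are sorted by the set \<open>S\<close> of entries of \<open>K\<close> with
  response 1. Each such pattern constrains every agent's signal separately, hence is a rectangle.
  The condition \<open>R\<close> is carried along for a constraint on one further signal.\<close>

lemma determined_event_decomposition:
  assumes "finite K" "K \<subseteq> {(v, t, h). v \<in> V}" "determined_by K \<Phi>"
  shows "{w\<in>space (signals V s). R w \<and> \<Phi> (responses F w)} =
    (\<Union>S\<in>{S\<in>Pow K. \<Phi> (\<lambda>v t h. (v, t, h) \<in> S)}.
      {w\<in>space (signals V s). R w \<and> (\<forall>v\<in>fst ` K. w v \<in> pattern_set F K S v)})"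
proof -
  have eq: "\<Phi> (responses F w) = \<Phi> (\<lambda>v t h. (v, t, h) \<in> S)"
    if w: "\<forall>v\<in>fst ` K. w v \<in> pattern_set F K S v" for w S
  proof -
    have "responses F w v t h = ((v, t, h) \<in> S)" if "(v, t, h) \<in> K" for v t h
    proof -
      have "v \<in> fst ` K" using that by (force simp: image_iff)
      with w have "w v \<in> pattern_set F K S v" by (rule bspec)
      then show ?thesis using that by (simp add: responses_def pattern_set_def)
    qed
    then show ?thesis by (rule determined_byD[OF assms(3)])
  qed
  have ex: "\<forall>v\<in>fst ` K. w v \<in> pattern_set F K {(v, t, h)\<in>K. F v t h (w v)} v" if "w \<in> space (signals V s)" for w
    using assms(2) signal_in_space[OF that] by (auto simp: pattern_set_def)
  show ?thesis
  proof (intro set_eqI iffI)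
    fix w assume w: "w \<in> {w\<in>space (signals V s). R w \<and> \<Phi> (responses F w)}"
    let ?S = "{(v, t, h)\<in>K. F v t h (w v)}"
    show "w \<in> (\<Union>S\<in>{S\<in>Pow K. \<Phi> (\<lambda>v t h. (v, t, h) \<in> S)}.
      {w\<in>space (signals V s). R w \<and> (\<forall>v\<in>fst ` K. w v \<in> pattern_set F K S v)})"
      using w ex[of w] eq[of w ?S] by (intro UN_I[of ?S]) auto
  next
    fix w assume "w \<in> (\<Union>S\<in>{S\<in>Pow K. \<Phi> (\<lambda>v t h. (v, t, h) \<in> S)}.
      {w\<in>space (signals V s). R w \<and> (\<forall>v\<in>fst ` K. w v \<in> pattern_set F K S v)})"
    then obtain S where S: "\<Phi> (\<lambda>v t h. (v, t, h) \<in> S)" "w \<in> space (signals V s)" "R w"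
      "\<forall>v\<in>fst ` K. w v \<in> pattern_set F K S v" by blast
    then show "w \<in> {w\<in>space (signals V s). R w \<and> \<Phi> (responses F w)}" using eq[OF S(4)] by simp
  qed
qed

lemma pattern_sets_disjoint:
  assumes "K \<subseteq> {(v, t, h). v \<in> V}"
  shows "disjoint_family_on (\<lambda>S. {w\<in>space (signals V s). R w \<and> (\<forall>v\<in>fst ` K. w v \<in> pattern_set F K S v)})
     {S\<in>Pow K. P S}"
  unfolding disjoint_family_on_def
proof (intro ballI impI, rule ccontr)
  fix S S' assume S: "S \<in> {S\<in>Pow K. P S}" "S' \<in> {S\<in>Pow K. P S}" "S \<noteq> S'"
  assume "{w\<in>space (signals V s). R w \<and> (\<forall>v\<in>fst ` K. w v \<in> pattern_set F K S v)} \<inter>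
    {w\<in>space (signals V s). R w \<and> (\<forall>v\<in>fst ` K. w v \<in> pattern_set F K S' v)} \<noteq> {}"
  then obtain w where w: "\<forall>v\<in>fst ` K. w v \<in> pattern_set F K S v" "\<forall>v\<in>fst ` K. w v \<in> pattern_set F K S' v" by blast
  have "k \<in> S \<longleftrightarrow> k \<in> S'" if "k \<in> K" for k
  proof -
    obtain v t h where k: "k = (v, t, h)" by (cases k)
    have "w v \<in> pattern_set F K S v" "w v \<in> pattern_set F K S' v" using w that k by force+
    then show ?thesis using that k by (auto simp: pattern_set_def)
  qed
  then show False using S by blast
qed

text \<open>The probability is a polynomial in probabilities of single-signal events, and the
  formula does not mention \<open>V\<close>. This is what allows it to be passed to the limit
  although the sets of agents vary.\<close>

lemma prob_determined:
  assumes K: "finite K" "K \<subseteq> {(v, t, h). v \<in> V}" and det: "determined_by K \<Phi>"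
    and mF: "\<And>v t h. (v, t, h) \<in> K \<Longrightarrow> Measurable.pred \<mu>0 (F v t h)"
  shows "measure (signals V s) {w\<in>space (signals V s). \<Phi> (responses F w)} =
      (\<Sum>S\<in>{S\<in>Pow K. \<Phi> (\<lambda>v t h. (v, t, h) \<in> S)}. \<Prod>v\<in>fst ` K. measure (sig s) (pattern_set F K S v))"
    and "{w\<in>space (signals V s). \<Phi> (responses F w)} \<in> sets (signals V s)"
proof -
  have J: "finite (fst ` K)" "fst ` K \<subseteq> V" using K by auto
  have fin: "finite {S\<in>Pow K. \<Phi> (\<lambda>v t h. (v, t, h) \<in> S)}" using K(1) by simp
  have mp: "pattern_set F K S v \<in> sets \<mu>0" for S v by (rule pattern_set_measurable[OF K(1) mF])
  have rect1: "measure (signals V s) {w\<in>space (signals V s). \<forall>v\<in>fst ` K. w v \<in> pattern_set F K S v} =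
      (\<Prod>v\<in>fst ` K. measure (sig s) (pattern_set F K S v))" for S
    by (rule measure_signals_rectangle(1)[OF J mp])
  have rect2: "{w\<in>space (signals V s). \<forall>v\<in>fst ` K. w v \<in> pattern_set F K S v} \<in> sets (signals V s)" for S
    by (rule measure_signals_rectangle(2)[OF J mp])
  have dec: "{w\<in>space (signals V s). \<Phi> (responses F w)} =
    (\<Union>S\<in>{S\<in>Pow K. \<Phi> (\<lambda>v t h. (v, t, h) \<in> S)}.
      {w\<in>space (signals V s). \<forall>v\<in>fst ` K. w v \<in> pattern_set F K S v})"
    using determined_event_decomposition[OF K det, of s "\<lambda>_. True" F] by simp
  show "{w\<in>space (signals V s). \<Phi> (responses F w)} \<in> sets (signals V s)"
    unfolding dec by (intro sets.finite_UN fin rect2)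
  have disj: "disjoint_family_on (\<lambda>S. {w\<in>space (signals V s). \<forall>v\<in>fst ` K. w v \<in> pattern_set F K S v})
     {S\<in>Pow K. \<Phi> (\<lambda>v t h. (v, t, h) \<in> S)}"
    using pattern_sets_disjoint[OF K(2), of s "\<lambda>_. True" F] by simp
  show "measure (signals V s) {w\<in>space (signals V s). \<Phi> (responses F w)} =
      (\<Sum>S\<in>{S\<in>Pow K. \<Phi> (\<lambda>v t h. (v, t, h) \<in> S)}. \<Prod>v\<in>fst ` K. measure (sig s) (pattern_set F K S v))"
    unfolding dec rect1[symmetric]
    by (rule signals.finite_measure_finite_Union[OF fin _ disj]) (intro image_subsetI rect2)
qed

text \<open>No entry of \<open>K\<close> belongs to \<open>u\<close>, so its signal adds one side to
  each rectangle and factors out of the sum.\<close>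

lemma prob_determined_independent:
  assumes K: "finite K" "K \<subseteq> {(v, t, h). v \<in> V \<and> v \<noteq> u}" and u: "u \<in> V" and det: "determined_by K \<Phi>"
    and mF: "\<And>v t h. (v, t, h) \<in> K \<Longrightarrow> Measurable.pred \<mu>0 (F v t h)" and D: "D \<in> sets \<mu>0"
  shows "measure (signals V s) {w\<in>space (signals V s). w u \<in> D \<and> \<Phi> (responses F w)} =
      measure (sig s) D * measure (signals V s) {w\<in>space (signals V s). \<Phi> (responses F w)}"
proof -
  have K': "K \<subseteq> {(v, t, h). v \<in> V}" using K by auto
  have J: "finite (insert u (fst ` K))" "insert u (fst ` K) \<subseteq> V" "u \<notin> fst ` K" using K u by auto
  have fin: "finite {S\<in>Pow K. \<Phi> (\<lambda>v t h. (v, t, h) \<in> S)}" using K(1) by simp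
  define A where "A S v = (if v = u then D else pattern_set F K S v)" for S v
  have mA: "A S v \<in> sets \<mu>0" for S v
    unfolding A_def using D pattern_set_measurable[OF K(1) mF] by auto
  have rect1: "measure (signals V s) {w\<in>space (signals V s). \<forall>v\<in>insert u (fst ` K). w v \<in> A S v} =
      (\<Prod>v\<in>insert u (fst ` K). measure (sig s) (A S v))" for S
    by (rule measure_signals_rectangle(1)[OF J(1,2) mA])
  have rect2: "{w\<in>space (signals V s). \<forall>v\<in>insert u (fst ` K). w v \<in> A S v} \<in> sets (signals V s)" for S
    by (rule measure_signals_rectangle(2)[OF J(1,2) mA])
  have eq: "{w\<in>space (signals V s). w u \<in> D \<and> (\<forall>v\<in>fst ` K. w v \<in> pattern_set F K S v)} =
    {w\<in>space (signals V s). \<forall>v\<in>insert u (fst ` K). w v \<in> A S v}" for S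
    using J(3) by (auto simp: A_def)
  have disj: "disjoint_family_on (\<lambda>S. {w\<in>space (signals V s). \<forall>v\<in>insert u (fst ` K). w v \<in> A S v})
      {S\<in>Pow K. \<Phi> (\<lambda>v t h. (v, t, h) \<in> S)}"
    using pattern_sets_disjoint[OF K', of s "\<lambda>w. w u \<in> D" F] unfolding eq by simp
  have "measure (signals V s) {w\<in>space (signals V s). w u \<in> D \<and> \<Phi> (responses F w)} =
     (\<Sum>S\<in>{S\<in>Pow K. \<Phi> (\<lambda>v t h. (v, t, h) \<in> S)}. \<Prod>v\<in>insert u (fst ` K). measure (sig s) (A S v))"
    unfolding determined_event_decomposition[OF K(1) K' det, of s "\<lambda>w. w u \<in> D" F] eq rect1[symmetric]
    by (rule signals.finite_measure_finite_Union[OF fin _ disj]) (intro image_subsetI rect2)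
  also have "\<dots> = measure (sig s) D * (\<Sum>S\<in>{S\<in>Pow K. \<Phi> (\<lambda>v t h. (v, t, h) \<in> S)}. \<Prod>v\<in>fst ` K. measure (sig s) (pattern_set F K S v))"
  proof -
    have "(\<Prod>v\<in>fst ` K. measure (sig s) (A S v)) = (\<Prod>v\<in>fst ` K. measure (sig s) (pattern_set F K S v))" for S
      using J(3) by (intro prod.cong) (auto simp: A_def)
    then show ?thesis using J by (simp add: sum_distrib_left) (simp add: A_def)
  qed
  finally show ?thesis using prob_determined(1)[OF K(1) K' det mF] by simp
qed

definition consistent_signals :: "(nat \<Rightarrow> nat \<Rightarrow> history \<Rightarrow> 'w \<Rightarrow> bool) \<Rightarrow> nat \<Rightarrow> nat \<Rightarrow> history \<Rightarrow> 'w set" where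
  "consistent_signals F u t h = {x\<in>space \<mu>0. \<forall>t'<t. F u t' {p\<in>h. snd p < t'} x \<longleftrightarrow> (u, t') \<in> h}"

text \<open>Conditionally on its own actions, an agent's signal is independent of what it observes:
  \<open>forced_prob\<close> is the probability of the observations when the agent is forced to play as in \<open>h\<close>.\<close>

definition forced_prob ::
  "(nat \<Rightarrow> nat set) \<Rightarrow> nat set \<Rightarrow> (nat \<Rightarrow> nat \<Rightarrow> history \<Rightarrow> 'w \<Rightarrow> bool) \<Rightarrow> bool \<Rightarrow> nat \<Rightarrow> nat \<Rightarrow> history \<Rightarrow> real"
where
  "forced_prob N V F s u t h = measure (signals V s)
     {w\<in>space (signals V s). local_history N u (run N V (forced (responses F w) u h) t) = h}"

definition history_prob ::
  "(nat \<Rightarrow> nat set) \<Rightarrow> nat set \<Rightarrow> (nat \<Rightarrow> nat \<Rightarrow> history \<Rightarrow> 'w \<Rightarrow> bool) \<Rightarrow> bool \<Rightarrow> nat \<Rightarrow> nat \<Rightarrow> history \<Rightarrow> 'w set \<Rightarrow> real"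
where
  "history_prob N V F s u t h D = measure (signals V s)
     {w\<in>space (signals V s). local_history N u (run N V (responses F w) t) = h \<and> w u \<in> D}"

lemma consistent_signals_measurable:
  assumes "\<And>t h. Measurable.pred \<mu>0 (F u t h)"
  shows "consistent_signals F u t h \<in> sets \<mu>0"
proof -
  note assms[measurable]
  have "consistent_signals F u t h = {x\<in>space \<mu>0. \<forall>t'\<in>{..<t}. F u t' {p\<in>h. snd p < t'} x \<longleftrightarrow> (u, t') \<in> h}"
    by (auto simp: consistent_signals_def)
  also have "\<dots> \<in> sets \<mu>0" by measurable
  finally show ?thesis .
qed

text \<open>\<open>local_history_run_eq_iff\<close> splits the event, and the forced part involves
  no entry of \<open>u\<close>, so the two probabilities multiply.\<close>

lemma history_prob_factor:
  assumes fin: "locally_finite V N" and u: "u \<in> V"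
    and mF: "\<And>v t h. v \<in> V \<Longrightarrow> Measurable.pred \<mu>0 (F v t h)" and D: "D \<in> sets \<mu>0"
  shows "history_prob N V F s u t h D =
    measure (sig s) (consistent_signals F u t h \<inter> D) * forced_prob N V F s u t h"
proof -
  obtain K where K: "finite K" "K \<subseteq> {(v, t', h). v \<in> V \<and> v \<noteq> u \<and> finite h}"
    "determined_by K (\<lambda>b. local_history N u (run N V (forced b u h) t))"
    using forced_determined[OF fin u, where h=h and t=t] by blast
  have K2: "K \<subseteq> {(v, t, h). v \<in> V \<and> v \<noteq> u}" using K(2) by auto
  have D': "consistent_signals F u t h \<inter> D \<in> sets \<mu>0"
    using consistent_signals_measurable[of F u] mF[OF u] D by auto
  have "history_prob N V F s u t h D = measure (signals V s)
     {w\<in>space (signals V s). w u \<in> consistent_signals F u t h \<inter> D \<and>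
       local_history N u (run N V (forced (responses F w) u h) t) = h}"
    unfolding history_prob_def
  proof (rule arg_cong[where f="measure (signals V s)"], rule Collect_cong, rule conj_cong[OF refl])
    fix w assume w: "w \<in> space (signals V s)"
    have "consistent (responses F w) u h t \<longleftrightarrow> w u \<in> consistent_signals F u t h"
      using signal_in_space[OF w u] by (auto simp: consistent_def consistent_signals_def responses_def)
    then show "(local_history N u (run N V (responses F w) t) = h \<and> w u \<in> D) =
      (w u \<in> consistent_signals F u t h \<inter> D \<and> local_history N u (run N V (forced (responses F w) u h) t) = h)"
      unfolding local_history_run_eq_iff[OF u, of N "responses F w" t h] by auto
  qed
  also have "\<dots> = measure (sig s) (consistent_signals F u t h \<inter> D) * forced_prob N V F s u t h"
    unfolding forced_prob_def
  proof (rule prob_determined_independent[where \<Phi>="\<lambda>b. local_history N u (run N V (forced b u h) t) = h",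
        OF K(1) K2 u _ _ D'])
    show "determined_by K (\<lambda>b. local_history N u (run N V (forced b u h) t) = h)"
      by (rule determined_by_comp[OF K(3), of "\<lambda>X. X = h"])
    show "Measurable.pred \<mu>0 (F v t' h')" if "(v, t', h') \<in> K" for v t' h'
      using mF K2 that by auto
  qed
  finally show ?thesis .
qed

end

section \<open>Laws conditional on the state\<close>

text \<open>The defining property of conditional expectation on \<open>E\<close>, centred at 1/2. It
  ties the sign of the belief minus 1/2 to the comparison of the two states on information
  events.\<close>

lemma (in prob_space) integral_cond_exp_half:
  assumes sub: "subalgebra M F" and B: "B \<in> events" and E: "E \<in> sets F"
  defines "X \<equiv> real_cond_exp M F (indicator B)"
  shows "integrable M (\<lambda>x. (X x - 1/2) * indicator E x)"
    and "(\<integral>x. (X x - 1/2) * indicator E x \<partial>M) = (prob (E \<inter> B) - prob (E - B)) / 2"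
proof -
  interpret F: finite_measure_subalgebra M F by unfold_locales (rule sub)
  have EM: "E \<in> events" using sub E by (auto simp: subalgebra_def)
  have intB: "integrable M (indicator B :: _ \<Rightarrow> real)" using B by (simp add: emeasure_eq_measure)
  have intX: "integrable M X" unfolding X_def by (rule F.real_cond_exp_int(1)[OF intB])
  have 1: "integrable M (\<lambda>x. X x * indicator E x)"
    by (rule integrable_real_mult_indicator[OF EM intX])
  have 2: "integrable M (\<lambda>x. 1/2 * (indicator E x :: real))" using EM by (simp add: emeasure_eq_measure)
  have eq: "(\<lambda>x. (X x - 1/2) * indicator E x) = (\<lambda>x. X x * indicator E x - 1/2 * indicator E x)"
    by (auto simp: algebra_simps)
  show "integrable M (\<lambda>x. (X x - 1/2) * indicator E x)"
    unfolding eq by (intro Bochner_Integration.integrable_diff 1 2)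
  have "(\<integral>x. X x * indicator E x \<partial>M) = (\<integral>x. indicator B x * indicator E x \<partial>M)"
    using F.real_cond_exp_intA[OF intB E] by (simp add: set_lebesgue_integral_def X_def mult.commute)
  also have "\<dots> = prob (E \<inter> B)"
  proof -
    have "(\<lambda>x. indicator B x * indicator E x :: real) = indicator (E \<inter> B)" by (auto simp: indicator_def)
    then show ?thesis using EM B sets.sets_into_space[OF EM] by (simp add: Int_absorb2 le_infI1)
  qed
  finally have "(\<integral>x. (X x - 1/2) * indicator E x \<partial>M) = prob (E \<inter> B) - 1/2 * prob E"
    unfolding eq using 1 2 EM sets.sets_into_space[OF EM]
    by (subst Bochner_Integration.integral_diff) (auto simp: Int_absorb2)
  also have "prob E = prob (E \<inter> B) + prob (E - B)"
    using EM B by (subst finite_measure_Union[symmetric]) (auto intro!: arg_cong[where f=prob])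
  also have "prob (E \<inter> B) - 1/2 * (prob (E \<inter> B) + prob (E - B)) = (prob (E \<inter> B) - prob (E - B)) / 2"
    by (simp add: field_simps)
  finally show "(\<integral>x. (X x - 1/2) * indicator E x \<partial>M) = (prob (E \<inter> B) - prob (E - B)) / 2" .
qed

lemma (in finite_measure) integral_pos_null:
  fixes f :: "'a \<Rightarrow> real"
  assumes int: "integrable M (\<lambda>x. f x * indicator E x)" and E: "E \<in> sets M"
    and pos: "\<And>x. x \<in> E \<Longrightarrow> f x > 0" and le: "(\<integral>x. f x * indicator E x \<partial>M) \<le> 0"
  shows "measure M E = 0"
proof -
  have nn: "AE x in M. 0 \<le> f x * indicator E x"
    using pos by (auto simp: indicator_def less_imp_le)
  then have "(\<integral>x. f x * indicator E x \<partial>M) = 0" using le by (intro antisym integral_nonneg_AE)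
  then have "AE x in M. f x * indicator E x = 0"
    using integral_nonneg_eq_0_iff_AE[OF int nn] by simp
  then have "AE x in M. x \<notin> E"
    by eventually_elim (use pos in \<open>force simp: indicator_def\<close>)
  then have "emeasure M E = 0" using AE_iff_null_sets[OF E] by (auto simp: null_sets_def)
  then show ?thesis by (simp add: measure_def)
qed

context signal_pair
begin

abbreviation "World V \<equiv> world \<mu>0 \<mu>1 V"

lemmas World_simps = prob0 prob1 sets_eq

sublocale World: prob_space "World V" for V
  by (rule prob_space_world[OF World_simps])

lemma sets_World [measurable_cong]: "sets (World V) = sets (count_space UNIV \<Otimes>\<^sub>M (PiM V (\<lambda>_. \<mu>0)))"
  by (rule sets_world[OF World_simps])

lemma space_World: "space (World V) = UNIV \<times> (\<Pi>\<^sub>E u\<in>V. space \<mu>0)"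
  using sets_eq_imp_space_eq[OF sets_World] by (simp add: space_pair_measure space_PiM)

lemma mem_space_World: "(s, w) \<in> space (World V) \<longleftrightarrow> w \<in> space (signals V s')"
  by (simp add: space_World space_signals)

text \<open>The law conditional on the state is pushed to the space of \<open>World\<close>, so that
  the two conditional laws and their mixture share one sigma-algebra.\<close>

definition given :: "nat set \<Rightarrow> bool \<Rightarrow> 'w outcome measure" where
  "given V s = distr (signals V s) (World V) (Pair s)"

lemma measurable_Pair_World [measurable]: "Pair s \<in> signals V s \<rightarrow>\<^sub>M World V"
proof -
  have "Pair s \<in> PiM V (\<lambda>_. \<mu>0) \<rightarrow>\<^sub>M (count_space UNIV \<Otimes>\<^sub>M PiM V (\<lambda>_. \<mu>0))" by measurable
  then show ?thesis
    using measurable_cong_sets[OF sets_signals sets_World, of V s V] by simp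
qed

sublocale given: prob_space "given V s" for V s
  unfolding given_def by (rule signals.prob_space_distr) simp

lemma sets_given [simp, measurable_cong]: "sets (given V s) = sets (World V)"
  and space_given [simp]: "space (given V s) = space (World V)"
  by (auto simp: given_def)

lemma measure_given:
  assumes "E \<in> sets (World V)"
  shows "measure (given V s) E = measure (signals V s) {w\<in>space (signals V s). (s, w) \<in> E}"
  unfolding given_def using assms
  by (subst measure_distr) (auto intro!: arg_cong[where f="measure (signals V s)"])

lemma measure_World:
  assumes B: "B \<in> sets (World V)"
  shows "measure (World V) B = (measure (given V False) B + measure (given V True) B) / 2"
proof -
  have sub: "Pair s -` B = {w\<in>space (signals V s). (s, w) \<in> B}" for s
    using sets.sets_into_space[OF B] mem_space_World[of s _ V s] by auto
  have "emeasure (World V) B = 1/2 * emeasure (signals V False) (Pair False -` B) + 1/2 * emeasure (signals V True) (Pair True -` B)"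
    using emeasure_world[OF World_simps B] by (simp add: signals_def)
  also have "\<dots> = ennreal ((measure (given V False) B + measure (given V True) B) / 2)"
  proof -
    have half: "(1/2::ennreal) = ennreal (1/2)"
      by (simp add: divide_ennreal[symmetric]) (simp add: divide_ennreal_def)
    have "1/2 * ennreal a + 1/2 * ennreal b = ennreal ((a + b) / 2)" if "a \<ge> 0" "b \<ge> 0" for a b
    proof -
      have "1/2 * ennreal a + 1/2 * ennreal b = ennreal (1/2 * a) + ennreal (1/2 * b)"
        unfolding half using that by (intro arg_cong2[where f="(+)"] ennreal_mult[symmetric]) auto
      also have "\<dots> = ennreal (1/2 * a + 1/2 * b)"
        using that by (intro ennreal_plus[symmetric]) auto
      also have "1/2 * a + 1/2 * b = (a + b) / 2" by simp
      finally show ?thesis .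
    qed
    then show ?thesis
      unfolding measure_given[OF B] sub signals.emeasure_eq_measure by simp
  qed
  finally show ?thesis by (simp add: World.emeasure_eq_measure)
qed

definition state_one :: "nat set \<Rightarrow> 'w outcome set" where
  "state_one V = {\<omega>\<in>space (World V). fst \<omega>}"

lemma state_one_measurable [measurable]: "state_one V \<in> sets (World V)"
proof -
  have "Measurable.pred (count_space UNIV \<Otimes>\<^sub>M PiM V (\<lambda>_. \<mu>0)) (\<lambda>\<omega>. fst \<omega>)" by measurable
  then show ?thesis
    unfolding state_one_def pred_def sets_World
    using sets_eq_imp_space_eq[OF sets_World, of V] by simp
qed

lemma measure_state_one:
  assumes E: "E \<in> sets (World V)"
  shows "measure (World V) (E \<inter> state_one V) = measure (given V True) E / 2"
    and "measure (World V) (E - state_one V) = measure (given V False) E / 2"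
proof -
  have sub: "E \<subseteq> space (World V)" by (rule sets.sets_into_space[OF E])
  have 1: "{w\<in>space (signals V s). (s, w) \<in> E \<inter> state_one V} = (if s then {w\<in>space (signals V s). (s, w) \<in> E} else {})"
    and 2: "{w\<in>space (signals V s). (s, w) \<in> E - state_one V} = (if s then {} else {w\<in>space (signals V s). (s, w) \<in> E})" for s
    using sub by (auto simp: state_one_def)
  have "measure (given V True) (E \<inter> state_one V) = measure (given V True) E"
    "measure (given V False) (E \<inter> state_one V) = 0"
    "measure (given V True) (E - state_one V) = 0"
    "measure (given V False) (E - state_one V) = measure (given V False) E"
    using E by (simp_all only: measure_given sets.Int sets.Diff state_one_measurable 1 2 if_True if_False measure_empty)
  then show "measure (World V) (E \<inter> state_one V) = measure (given V True) E / 2"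
    and "measure (World V) (E - state_one V) = measure (given V False) E / 2"
    using E by (simp_all add: measure_World)
qed

lemma belief_measurable: "subalgebra (World (pverts G)) F \<Longrightarrow> belief \<mu>0 \<mu>1 G F \<in> borel_measurable F"
  unfolding belief_def by simp

text \<open>One factor 1/2 comes from \<open>integral_cond_exp_half\<close> and the other one from
  the uniform prior.\<close>

lemma integral_belief:
  assumes sub: "subalgebra (World (pverts G)) F" and E: "E \<in> sets F"
  shows "integrable (World (pverts G)) (\<lambda>x. (belief \<mu>0 \<mu>1 G F x - 1/2) * indicator E x)"
    and "(\<integral>x. (belief \<mu>0 \<mu>1 G F x - 1/2) * indicator E x \<partial>World (pverts G)) =
      (measure (given (pverts G) True) E - measure (given (pverts G) False) E) / 4"
proof -
  let ?V = "pverts G" and ?X = "real_cond_exp (World (pverts G)) F (indicator (state_one (pverts G)))"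
  interpret F: finite_measure_subalgebra "World ?V" F by unfold_locales (rule sub)
  have EM: "E \<in> sets (World ?V)" using sub E by (auto simp: subalgebra_def)
  \<comment> \<open>The event in \<open>belief\<close> ranges over all outcomes, also those outside
    the space; on the space its indicator agrees with that of \<open>state_one\<close>.\<close>
  have fstm: "indicator {\<omega>::'w outcome. fst \<omega> = True} \<in> borel_measurable (World ?V)"
  proof -
    have "indicator (state_one ?V) \<in> borel_measurable (World ?V)" by measurable
    then show ?thesis
      by (subst measurable_cong[where g="indicator (state_one ?V)"]) (auto simp: state_one_def indicator_def)
  qed
  have "AE x in World ?V. belief \<mu>0 \<mu>1 G F x = ?X x"
    unfolding belief_def
  proof (rule F.real_cond_exp_cong[OF AE_I2])
    show "indicator {\<omega>. fst \<omega> = True} x = indicator (state_one ?V) x" if "x \<in> space (World ?V)" for x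
      using that by (simp add: state_one_def indicator_def)
  qed (use fstm in measurable)
  then have AE: "AE x in World ?V. (?X x - 1/2) * indicator E x = (belief \<mu>0 \<mu>1 G F x - 1/2) * indicator E x"
    by eventually_elim simp
  note half = World.integral_cond_exp_half[OF sub state_one_measurable E]
  have mb: "belief \<mu>0 \<mu>1 G F \<in> borel_measurable (World ?V)"
    using belief_measurable[OF sub] by (rule measurable_from_subalg[OF sub])
  have mX: "?X \<in> borel_measurable (World ?V)"
    by (rule measurable_from_subalg[OF sub]) simp
  show "integrable (World ?V) (\<lambda>x. (belief \<mu>0 \<mu>1 G F x - 1/2) * indicator E x)"
    using half(1) AE EM mb mX by (subst integrable_cong_AE[where g="\<lambda>x. (?X x - 1/2) * indicator E x"]) auto
  have "(\<integral>x. (belief \<mu>0 \<mu>1 G F x - 1/2) * indicator E x \<partial>World ?V) = (\<integral>x. (?X x - 1/2) * indicator E x \<partial>World ?V)"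
    using AE EM mb mX by (intro integral_cong_AE) auto
  then show "(\<integral>x. (belief \<mu>0 \<mu>1 G F x - 1/2) * indicator E x \<partial>World ?V) =
      (measure (given ?V True) E - measure (given ?V False) E) / 4"
    using half(2) measure_state_one[OF EM] by simp
qed

lemma belief_ge_half:
  assumes sub: "subalgebra (World (pverts G)) F" and E: "E \<in> sets F"
    and ge: "AE x in World (pverts G). x \<in> E \<longrightarrow> belief \<mu>0 \<mu>1 G F x \<ge> 1/2"
  shows "measure (given (pverts G) False) E \<le> measure (given (pverts G) True) E"
proof -
  have "(\<integral>x. (belief \<mu>0 \<mu>1 G F x - 1/2) * indicator E x \<partial>World (pverts G)) \<ge> 0"
    by (rule integral_nonneg_AE) (use ge in eventually_elim, auto simp: indicator_def)
  then show ?thesis using integral_belief(2)[OF sub E] by simp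
qed

lemma belief_le_half:
  assumes sub: "subalgebra (World (pverts G)) F" and E: "E \<in> sets F"
    and le: "AE x in World (pverts G). x \<in> E \<longrightarrow> belief \<mu>0 \<mu>1 G F x \<le> 1/2"
  shows "measure (given (pverts G) True) E \<le> measure (given (pverts G) False) E"
proof -
  have "(\<integral>x. - ((belief \<mu>0 \<mu>1 G F x - 1/2) * indicator E x) \<partial>World (pverts G)) \<ge> 0"
    by (rule integral_nonneg_AE) (use le in eventually_elim, auto simp: indicator_def)
  then show ?thesis using integral_belief(2)[OF sub E] by simp
qed

lemma belief_gt_half_null:
  assumes sub: "subalgebra (World (pverts G)) F" and E: "E \<in> sets F"
    and gt: "\<And>x. x \<in> E \<Longrightarrow> belief \<mu>0 \<mu>1 G F x > 1/2"
    and le: "measure (given (pverts G) True) E \<le> measure (given (pverts G) False) E"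
  shows "measure (World (pverts G)) E = 0"
  using integral_belief[OF sub E] le gt sub E
  by (intro World.integral_pos_null[where f="\<lambda>x. belief \<mu>0 \<mu>1 G F x - 1/2"]) (auto simp: subalgebra_def)

lemma belief_lt_half_null:
  assumes sub: "subalgebra (World (pverts G)) F" and E: "E \<in> sets F"
    and lt: "\<And>x. x \<in> E \<Longrightarrow> belief \<mu>0 \<mu>1 G F x < 1/2"
    and le: "measure (given (pverts G) False) E \<le> measure (given (pverts G) True) E"
  shows "measure (World (pverts G)) E = 0"
proof -
  have eq: "(\<lambda>x. (1/2 - belief \<mu>0 \<mu>1 G F x) * indicator E x) = (\<lambda>x. - ((belief \<mu>0 \<mu>1 G F x - 1/2) * indicator E x))"
    by (auto simp: algebra_simps)
  show ?thesis
  proof (rule World.integral_pos_null[where f="\<lambda>x. 1/2 - belief \<mu>0 \<mu>1 G F x"])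
    show "integrable (World (pverts G)) (\<lambda>x. (1/2 - belief \<mu>0 \<mu>1 G F x) * indicator E x)"
      unfolding eq by (rule Bochner_Integration.integrable_minus[OF integral_belief(1)[OF sub E]])
    show "(\<integral>x. (1/2 - belief \<mu>0 \<mu>1 G F x) * indicator E x \<partial>World (pverts G)) \<le> 0"
      unfolding eq using integral_belief[OF sub E] le by (simp only: Bochner_Integration.integral_minus) simp
  qed (use lt sub E in \<open>auto simp: subalgebra_def\<close>)
qed

lemma measure_World_null:
  assumes E: "E \<in> sets (World V)"
  shows "measure (World V) E = 0 \<longleftrightarrow> (\<forall>s. measure (given V s) E = 0)"
  using measure_World[OF E] measure_nonneg[of "given V True" E] measure_nonneg[of "given V False" E]
  by (auto simp: all_bool_eq add_nonneg_eq_0_iff)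

text \<open>Bayesian optimality without conditional expectations: integrating the belief over an
  information event on which one action is taken compares the two states. For the converse it
  suffices to test the two events on which belief and action conflict; the assumed inequality makes
  them null.\<close>

lemma MAP_iff_likelihood:
  assumes sub: "subalgebra (World (pverts G)) F" and a: "{\<omega>\<in>space (World (pverts G)). a \<omega>} \<in> sets F"
  shows "(AE \<omega> in World (pverts G). (belief \<mu>0 \<mu>1 G F \<omega> < 1/2 \<longrightarrow> a \<omega> = False) \<and> (belief \<mu>0 \<mu>1 G F \<omega> > 1/2 \<longrightarrow> a \<omega> = True))
    \<longleftrightarrow> (\<forall>E\<in>sets F. ((\<forall>\<omega>\<in>E. a \<omega>) \<longrightarrow> measure (given (pverts G) False) E \<le> measure (given (pverts G) True) E) \<and>
           ((\<forall>\<omega>\<in>E. \<not> a \<omega>) \<longrightarrow> measure (given (pverts G) True) E \<le> measure (given (pverts G) False) E))"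
proof (intro iffI ballI conjI impI)
  fix E assume AE: "AE \<omega> in World (pverts G). (belief \<mu>0 \<mu>1 G F \<omega> < 1/2 \<longrightarrow> a \<omega> = False) \<and> (belief \<mu>0 \<mu>1 G F \<omega> > 1/2 \<longrightarrow> a \<omega> = True)"
    and E: "E \<in> sets F"
  show "measure (given (pverts G) False) E \<le> measure (given (pverts G) True) E" if "\<forall>\<omega>\<in>E. a \<omega>"
    by (rule belief_ge_half[OF sub E]) (use AE in eventually_elim, use that in force)
  show "measure (given (pverts G) True) E \<le> measure (given (pverts G) False) E" if "\<forall>\<omega>\<in>E. \<not> a \<omega>"
    by (rule belief_le_half[OF sub E]) (use AE in eventually_elim, use that in force)
next
  assume *: "\<forall>E\<in>sets F. ((\<forall>\<omega>\<in>E. a \<omega>) \<longrightarrow> measure (given (pverts G) False) E \<le> measure (given (pverts G) True) E) \<and>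
           ((\<forall>\<omega>\<in>E. \<not> a \<omega>) \<longrightarrow> measure (given (pverts G) True) E \<le> measure (given (pverts G) False) E)"
  have subalgebra_sets: "sets F \<subseteq> sets (World (pverts G))" using sub by (simp add: subalgebra_def)
  have sp: "space F = space (World (pverts G))" using sub by (simp add: subalgebra_def)
  have [measurable]: "belief \<mu>0 \<mu>1 G F \<in> borel_measurable F" by (rule belief_measurable[OF sub])
  have [measurable]: "Measurable.pred F a" using a by (simp add: pred_def sp)
  let ?E1 = "{\<omega>\<in>space F. belief \<mu>0 \<mu>1 G F \<omega> < 1/2 \<and> a \<omega>}"
  let ?E2 = "{\<omega>\<in>space F. belief \<mu>0 \<mu>1 G F \<omega> > 1/2 \<and> \<not> a \<omega>}"
  have E: "?E1 \<in> sets F" "?E2 \<in> sets F" by measurable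
  have "measure (World (pverts G)) ?E1 = 0" by (rule belief_lt_half_null[OF sub E(1)]) (use * E(1) in auto)
  moreover have "measure (World (pverts G)) ?E2 = 0" by (rule belief_gt_half_null[OF sub E(2)]) (use * E(2) in auto)
  moreover have EW: "?E1 \<in> sets (World (pverts G))" "?E2 \<in> sets (World (pverts G))"
    using subsetD[OF subalgebra_sets E(1)] subsetD[OF subalgebra_sets E(2)] .
  ultimately have "AE \<omega> in World (pverts G). \<omega> \<notin> ?E1" "AE \<omega> in World (pverts G). \<omega> \<notin> ?E2"
    using World.prob_eq_0[OF EW(1)] World.prob_eq_0[OF EW(2)] by (simp_all only:)
  with AE_space show "AE \<omega> in World (pverts G). (belief \<mu>0 \<mu>1 G F \<omega> < 1/2 \<longrightarrow> a \<omega> = False) \<and> (belief \<mu>0 \<mu>1 G F \<omega> > 1/2 \<longrightarrow> a \<omega> = True)"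
    by eventually_elim (auto simp: sp)
qed

end

section \<open>Information and locality\<close>

primrec nball :: "(nat \<Rightarrow> nat set) \<Rightarrow> nat \<Rightarrow> nat \<Rightarrow> nat set" where
  "nball N 0 u = {u}"
| "nball N (Suc k) u = (\<Union>v\<in>nball N k u. insert v (N v))"

lemma nball_self [simp]: "u \<in> nball N k u"
  by (induction k) auto

lemma nball_Suc_subset: "nball N k u \<subseteq> nball N (Suc k) u"
  by auto

lemma nball_mono: "k \<le> l \<Longrightarrow> nball N k u \<subseteq> nball N l u"
  by (rule lift_Suc_mono_le[of "\<lambda>k. nball N k u"]) (simp_all only: nball_Suc_subset)

lemma nball_trans: "v \<in> nball N k u \<Longrightarrow> w \<in> nball N l v \<Longrightarrow> w \<in> nball N (k + l) u"
proof (induction l arbitrary: w)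
  case (Suc l)
  then obtain x where "x \<in> nball N l v" "w \<in> insert x (N x)" by auto
  with Suc show ?case by auto
qed simp

lemma neighbor_nball: "v \<in> N u \<Longrightarrow> nball N k v \<subseteq> nball N (Suc k) u"
  using nball_trans[of v N 1 u _ k] by auto

lemma nball_sym:
  assumes "\<And>u v. v \<in> N u \<Longrightarrow> u \<in> N v"
  shows "v \<in> nball N k u \<Longrightarrow> u \<in> nball N k v"
proof (induction k arbitrary: v)
  case (Suc k)
  then obtain x where x: "x \<in> nball N k u" "v \<in> insert x (N x)" by auto
  then have "x \<in> nball N 1 v" using assms by auto
  with nball_trans[of x N 1 v u k] Suc.IH[OF x(1)] show ?case by simp
qed simp

lemma nball_subset:
  assumes "\<And>v. v \<in> V \<Longrightarrow> N v \<subseteq> V" "u \<in> V"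
  shows "nball N k u \<subseteq> V"
  using assms by (induction k) auto

lemma nball_finite_card:
  assumes "\<And>v. v \<in> V \<Longrightarrow> N v \<subseteq> V \<and> finite (N v) \<and> card (N v) \<le> d" "u \<in> V"
  shows "finite (nball N k u) \<and> card (nball N k u) \<le> (d + 1)^k"
proof (induction k)
  case (Suc k)
  have sub: "nball N k u \<subseteq> V" using assms by (intro nball_subset) auto
  have "card (nball N (Suc k) u) \<le> (\<Sum>v\<in>nball N k u. card (insert v (N v)))"
    using Suc by (simp add: card_UN_le)
  also have "\<dots> \<le> (\<Sum>v\<in>nball N k u. d + 1)"
  proof (rule sum_mono)
    fix v assume "v \<in> nball N k u"
    then have "finite (N v)" "card (N v) \<le> d" using assms sub by auto
    then show "card (insert v (N v)) \<le> d + 1" by (simp add: card_insert_if)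
  qed
  also have "\<dots> = card (nball N k u) * (d + 1)" by simp
  also have "\<dots> \<le> (d + 1)^k * (d + 1)" using Suc by (intro mult_le_mono1) simp
  also have "\<dots> = (d + 1)^Suc k" by simp
  finally show ?case using Suc assms sub by auto
qed simp

text \<open>The degree bound keeps the balls finite, with sizes bounded in terms of \<open>d\<close>
  and the radius only. This is the compactness behind all limits of graphs.\<close>

definition network :: "nat \<Rightarrow> nat pair_pre_digraph \<Rightarrow> bool" where
  "network d G \<longleftrightarrow> connected_undirected_graph G \<and>
     (\<forall>u\<in>pverts G. finite (neighbors G u) \<and> card (neighbors G u) \<le> d)"

lemma connected_undirected_graphD:
  assumes "connected_undirected_graph G"
  shows "pverts G \<noteq> {}"
    and "v \<in> neighbors G u \<Longrightarrow> u \<in> pverts G \<and> v \<in> pverts G \<and> v \<noteq> u \<and> u \<in> neighbors G v"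
    and "u \<in> pverts G \<Longrightarrow> v \<in> pverts G \<Longrightarrow> \<exists>k. v \<in> nball (neighbors G) k u"
proof -
  interpret pair_bidirected_digraph G using assms by (simp add: connected_undirected_graph_def)
  have sc: "strongly_connected (with_proj G)" using assms by (simp add: connected_undirected_graph_def)
  then show "pverts G \<noteq> {}" by (simp add: strongly_connected_def)
  show "u \<in> pverts G \<and> v \<in> pverts G \<and> v \<noteq> u \<and> u \<in> neighbors G v" if "v \<in> neighbors G u"
  proof -
    have uv: "(u, v) \<in> parcs G" using that by (simp add: neighbors_def)
    have "(v, u) \<in> parcs G"
      using pair_sym_arcs uv unfolding symmetric_def by (simp add: symD)
    then show ?thesis using in_arcsD1[OF uv] in_arcsD2[OF uv] pair_no_loops[OF uv] by (simp add: neighbors_def eq_commute)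
  qed
  assume "u \<in> pverts G" "v \<in> pverts G"
  then have "u \<rightarrow>\<^sup>*\<^bsub>with_proj G\<^esub> v" using sc by (simp add: strongly_connected_def)
  then have "(u, v) \<in> rtrancl_on (pverts G) (parcs G)" by (simp add: reachable_def)
  then show "\<exists>k. v \<in> nball (neighbors G) k u"
  proof (induction rule: rtrancl_on.induct)
    case (rtrancl_on_refl a)
    then show ?case by (intro exI[of _ 0]) simp
  next
    case (rtrancl_on_into_rtrancl_on a b c)
    then obtain k where "b \<in> nball (neighbors G) k a" by blast
    moreover have "c \<in> neighbors G b"
      using rtrancl_on_into_rtrancl_on by (simp add: neighbors_def)
    ultimately show ?case by (intro exI[of _ "Suc k"]) auto
  qed
qed

lemma connected_undirected_graphI:
  assumes ne: "V \<noteq> {}" and N: "\<And>u v. v \<in> N u \<Longrightarrow> u \<in> V \<and> v \<in> V \<and> v \<noteq> u \<and> u \<in> N v"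
    and r: "r \<in> V" and conn: "\<And>v. v \<in> V \<Longrightarrow> \<exists>k. v \<in> nball N k r"
  defines "G \<equiv> \<lparr>pverts = V, parcs = {(u, v). v \<in> N u}\<rparr>"
  shows "connected_undirected_graph G" "neighbors G = N" "pverts G = V"
proof -
  show "neighbors G = N" "pverts G = V" by (auto simp: neighbors_def G_def fun_eq_iff)
  have bi: "pair_bidirected_digraph G"
    by unfold_locales (use N in \<open>auto simp: G_def symmetric_def sym_def\<close>)
  then interpret pair_bidirected_digraph G .
  have reach: "r \<rightarrow>\<^sup>*\<^bsub>with_proj G\<^esub> v" if "v \<in> nball N k r" for k v
    using that
  proof (induction k arbitrary: v)
    case 0
    then have "v = r" "r \<in> pverts G" using r by (simp_all add: G_def)
    then show ?case by simp
  next
    case (Suc k)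
    then obtain x where x: "x \<in> nball N k r" "v \<in> insert x (N x)" by auto
    then have "v = x \<or> (x, v) \<in> parcs G" by (auto simp: G_def)
    then show ?case using Suc.IH[OF x(1)] by (auto intro: reachable_adj_trans)
  qed
  have "strongly_connected (with_proj G)"
  proof (rule strongly_connectedI)
    show "verts (with_proj G) \<noteq> {}" using ne by (simp add: G_def)
    fix u v assume "u \<in> verts (with_proj G)" "v \<in> verts (with_proj G)"
    then have "r \<rightarrow>\<^sup>*\<^bsub>with_proj G\<^esub> u" "r \<rightarrow>\<^sup>*\<^bsub>with_proj G\<^esub> v" using conn reach by (auto simp: G_def)
    then show "u \<rightarrow>\<^sup>*\<^bsub>with_proj G\<^esub> v" using symmetric_reachable' reachable_trans by blast
  qed
  with bi show "connected_undirected_graph G" by (simp add: connected_undirected_graph_def)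
qed

text \<open>Own past actions are included although they are not generators of the information:
  adapted actions are functions of it, and with them the history is the \<open>local_history\<close>
  of a run. An entry with time \<open>t'\<close> stands for the action at time
  \<open>t' + 1\<close>.\<close>

definition observed_history ::
  "nat pair_pre_digraph \<Rightarrow> 'w action_process \<Rightarrow> nat \<Rightarrow> nat \<Rightarrow> 'w outcome \<Rightarrow> history" where
  "observed_history G act u t \<omega> = {(v, t'). v \<in> insert u (neighbors G u) \<and> t' < t \<and> act v (Suc t') \<omega>}"

section \<open>Information as a function of nearby signals\<close>

context signal_pair
begin

abbreviation "Info \<equiv> info \<mu>0 \<mu>1"

definition info_generator :: "nat pair_pre_digraph \<Rightarrow> 'w action_process \<Rightarrow> nat \<Rightarrow> nat \<Rightarrow> 'w outcome set set" where
  "info_generator G act u t = {{\<omega>\<in>space (World (pverts G)). snd \<omega> u \<in> B} | B. B \<in> sets \<mu>0} \<union>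
     {{\<omega>\<in>space (World (pverts G)). act v t' \<omega> \<in> B} | v t' B. v \<in> neighbors G u \<and> 1 \<le> t' \<and> t' < t}"

lemma info_eq: "Info G act u t = sigma (space (World (pverts G))) (info_generator G act u t)"
proof -
  have "{(\<lambda>(s, w). w u) -` B \<inter> space (World (pverts G)) |B. B \<in> sets \<mu>0} =
      {{\<omega>\<in>space (World (pverts G)). snd \<omega> u \<in> B} | B. B \<in> sets \<mu>0}"
    by (intro Collect_cong ex_cong1 conj_cong refl arg_cong[where f="(=) _"]) (auto simp: split_beta)
  moreover have "{act v t' -` B \<inter> space (World (pverts G)) |v t' B. v \<in> neighbors G u \<and> 1 \<le> t' \<and> t' < t} =
      {{\<omega>\<in>space (World (pverts G)). act v t' \<omega> \<in> B} | v t' B. v \<in> neighbors G u \<and> 1 \<le> t' \<and> t' < t}"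
    by (intro Collect_cong ex_cong1 conj_cong refl arg_cong[where f="(=) _"]) auto
  ultimately show ?thesis unfolding info_def Let_def info_generator_def by simp
qed

lemma info_generator_subset: "info_generator G act u t \<subseteq> Pow (space (World (pverts G)))"
  by (auto simp: info_generator_def)

lemma space_info [simp]: "space (Info G act u t) = space (World (pverts G))"
  by (simp add: info_eq info_generator_subset)

lemma sets_info: "sets (Info G act u t) = sigma_sets (space (World (pverts G))) (info_generator G act u t)"
  by (simp add: info_eq info_generator_subset)

lemma info_signal: "B \<in> sets \<mu>0 \<Longrightarrow> {\<omega>\<in>space (World (pverts G)). snd \<omega> u \<in> B} \<in> sets (Info G act u t)"
  unfolding sets_info by (rule sigma_sets.Basic) (auto simp: info_generator_def)

lemma info_neighbor_action:
  "v \<in> neighbors G u \<Longrightarrow> 1 \<le> t' \<Longrightarrow> t' < t \<Longrightarrow> {\<omega>\<in>space (World (pverts G)). act v t' \<omega>} \<in> sets (Info G act u t)"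
  unfolding sets_info
  by (rule sigma_sets.Basic, unfold info_generator_def, rule UnI2, rule CollectI,
      intro exI[of _ v] exI[of _ t'] exI[of _ "{True}"]) auto

lemma info_mono: "t \<le> t' \<Longrightarrow> sets (Info G act u t) \<subseteq> sets (Info G act u t')"
  unfolding sets_info by (rule sigma_sets_mono', unfold info_generator_def) fastforce

definition adapted :: "nat pair_pre_digraph \<Rightarrow> 'w action_process \<Rightarrow> bool" where
  "adapted G act \<longleftrightarrow> (\<forall>u\<in>pverts G. \<forall>t\<ge>1. {\<omega>\<in>space (World (pverts G)). act u t \<omega>} \<in> sets (Info G act u t))"

lemma adapted_iff_measurable:
  "act u t \<in> Info G act u t \<rightarrow>\<^sub>M count_space UNIV \<longleftrightarrow> {\<omega>\<in>space (World (pverts G)). act u t \<omega>} \<in> sets (Info G act u t)"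
  using pred_def[where M="Info G act u t" and P="act u t"] by simp

lemma own_action_info:
  "adapted G act \<Longrightarrow> u \<in> pverts G \<Longrightarrow> 1 \<le> t' \<Longrightarrow> t' \<le> t \<Longrightarrow>
    {\<omega>\<in>space (World (pverts G)). act u t' \<omega>} \<in> sets (Info G act u t)"
  using info_mono[of t' t G act u] unfolding adapted_def by blast

text \<open>The events that depend on the signals indexed by \<open>J\<close> alone. The state does
  not enter, so independence given the state applies to them.\<close>

definition signal_events :: "nat set \<Rightarrow> nat set \<Rightarrow> 'w outcome set set" where
  "signal_events V J = {{\<omega>\<in>space (World V). restrict (snd \<omega>) J \<in> A} | A. A \<in> sets (PiM J (\<lambda>_. \<mu>0))}"

lemma restrict_signal: "\<omega> \<in> space (World V) \<Longrightarrow> J \<subseteq> V \<Longrightarrow> restrict (snd \<omega>) J \<in> space (PiM J (\<lambda>_. \<mu>0))"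
  by (auto simp: space_World space_PiM)

lemma signal_events_sigma:
  assumes "J \<subseteq> V" "C \<subseteq> signal_events V J" "E \<in> sigma_sets (space (World V)) C"
  shows "E \<in> signal_events V J"
  using assms(3)
proof induction
  case (Basic a)
  then show ?case using assms(2) by auto
next
  case Empty
  have "{} = {\<omega>\<in>space (World V). restrict (snd \<omega>) J \<in> {}}" by simp
  then show ?case unfolding signal_events_def by blast
next
  case (Compl a)
  then obtain A where A: "A \<in> sets (PiM J (\<lambda>_. \<mu>0))" "a = {\<omega>\<in>space (World V). restrict (snd \<omega>) J \<in> A}"
    unfolding signal_events_def by blast
  have "space (World V) - a = {\<omega>\<in>space (World V). restrict (snd \<omega>) J \<in> space (PiM J (\<lambda>_. \<mu>0)) - A}"
    using restrict_signal[OF _ assms(1)] by (auto simp: A(2))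
  moreover have "space (PiM J (\<lambda>_. \<mu>0)) - A \<in> sets (PiM J (\<lambda>_. \<mu>0))" using A(1) by auto
  ultimately show ?case unfolding signal_events_def by blast
next
  case (Union a)
  then have "\<forall>i. \<exists>A. A \<in> sets (PiM J (\<lambda>_. \<mu>0)) \<and> a i = {\<omega>\<in>space (World V). restrict (snd \<omega>) J \<in> A}"
    unfolding signal_events_def by blast
  from choice[OF this] obtain A where
    A': "\<forall>i. A i \<in> sets (PiM J (\<lambda>_. \<mu>0)) \<and> a i = {\<omega>\<in>space (World V). restrict (snd \<omega>) J \<in> A i}" ..
  then have A: "\<And>i. A i \<in> sets (PiM J (\<lambda>_. \<mu>0))"
    "\<And>i. a i = {\<omega>\<in>space (World V). restrict (snd \<omega>) J \<in> A i}" by simp_all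
  have "(\<Union>i. a i) = {\<omega>\<in>space (World V). restrict (snd \<omega>) J \<in> (\<Union>i. A i)}" by (auto simp: A(2))
  moreover have "(\<Union>i. A i) \<in> sets (PiM J (\<lambda>_. \<mu>0))" using A(1) by auto
  ultimately show ?case unfolding signal_events_def by blast
qed

lemma signal_events_mono:
  assumes "J \<subseteq> J'" "J' \<subseteq> V"
  shows "signal_events V J \<subseteq> signal_events V J'"
proof
  fix E assume "E \<in> signal_events V J"
  then obtain A where A: "A \<in> sets (PiM J (\<lambda>_. \<mu>0))" "E = {\<omega>\<in>space (World V). restrict (snd \<omega>) J \<in> A}"
    unfolding signal_events_def by blast
  let ?A = "(\<lambda>w. restrict w J) -` A \<inter> space (PiM J' (\<lambda>_. \<mu>0))"
  have "?A \<in> sets (PiM J' (\<lambda>_. \<mu>0))"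
    using A(1) assms(1) by (intro measurable_sets[OF measurable_restrict_subset])
  moreover have "E = {\<omega>\<in>space (World V). restrict (snd \<omega>) J' \<in> ?A}"
    using restrict_signal[OF _ assms(2)] assms(1) by (auto simp: A(2) restrict_restrict Int_absorb1)
  ultimately show "E \<in> signal_events V J'" unfolding signal_events_def by blast
qed

lemma signal_events_World:
  assumes "J \<subseteq> V" "E \<in> signal_events V J"
  shows "E \<in> sets (World V)"
proof -
  obtain A where A: "A \<in> sets (PiM J (\<lambda>_. \<mu>0))" "E = {\<omega>\<in>space (World V). restrict (snd \<omega>) J \<in> A}"
    using assms(2) unfolding signal_events_def by blast
  have "(\<lambda>\<omega>. restrict (snd \<omega>) J) \<in> (count_space UNIV \<Otimes>\<^sub>M PiM V (\<lambda>_. \<mu>0)) \<rightarrow>\<^sub>M PiM J (\<lambda>_. \<mu>0)"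
    by (rule measurable_compose[OF measurable_snd measurable_restrict_subset[OF assms(1)]])
  then have "(\<lambda>\<omega>. restrict (snd \<omega>) J) \<in> World V \<rightarrow>\<^sub>M PiM J (\<lambda>_. \<mu>0)"
    using measurable_cong_sets[OF sets_World refl] by blast
  then have "(\<lambda>\<omega>. restrict (snd \<omega>) J) -` A \<inter> space (World V) \<in> sets (World V)" using A(1) by (rule measurable_sets)
  also have "(\<lambda>\<omega>. restrict (snd \<omega>) J) -` A \<inter> space (World V) = E" by (auto simp: A(2))
  finally show ?thesis .
qed

lemma signal_event_singleton:
  assumes "B \<in> sets \<mu>0" "u \<in> V"
  shows "{\<omega>\<in>space (World V). snd \<omega> u \<in> B} \<in> signal_events V {u}"
proof -
  let ?A = "{w\<in>space (PiM {u} (\<lambda>_. \<mu>0)). w u \<in> B}"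
  have "?A \<in> sets (PiM {u} (\<lambda>_. \<mu>0))" using assms(1) by (intro sets_Collect_single) auto
  moreover have "{\<omega>\<in>space (World V). snd \<omega> u \<in> B} = {\<omega>\<in>space (World V). restrict (snd \<omega>) {u} \<in> ?A}"
    using restrict_signal[of _ V "{u}"] assms(2) by auto
  ultimately show ?thesis unfolding signal_events_def by blast
qed

text \<open>A neighbour's action at time \<open>t'\<close> depends on signals within distance
  \<open>t'\<close> of that neighbour, and \<open>t' < t\<close> leaves room for the extra edge;
  hence strong induction on time.\<close>

lemma info_signal_events:
  assumes G: "connected_undirected_graph G" and ad: "adapted G act"
  shows "u \<in> pverts G \<Longrightarrow> sets (Info G act u t) \<subseteq> signal_events (pverts G) (nball (neighbors G) t u)"
proof (induction t arbitrary: u rule: less_induct)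
  case (less t)
  let ?V = "pverts G" and ?N = "neighbors G"
  have ball: "nball ?N t v \<subseteq> ?V" if "v \<in> ?V" for v t
    using that connected_undirected_graphD(2)[OF G] by (intro nball_subset) auto
  have "info_generator G act u t \<subseteq> signal_events ?V (nball ?N t u)"
  proof
    fix E assume "E \<in> info_generator G act u t"
    then consider B where "B \<in> sets \<mu>0" "E = {\<omega>\<in>space (World ?V). snd \<omega> u \<in> B}"
      | v t' B where "v \<in> ?N u" "1 \<le> t'" "t' < t" "E = {\<omega>\<in>space (World ?V). act v t' \<omega> \<in> B}"
      unfolding info_generator_def by blast
    then show "E \<in> signal_events ?V (nball ?N t u)"
    proof cases
      case 1
      then show ?thesis
        using signal_event_singleton[of B u ?V] signal_events_mono[of "{u}" "nball ?N t u" ?V] ball[OF less.prems] less.prems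
        by (auto simp del: nball.simps)
    next
      case 2
      have v: "v \<in> ?V" using 2(1) connected_undirected_graphD(2)[OF G] by blast
      have "act v t' \<in> Info G act v t' \<rightarrow>\<^sub>M count_space UNIV"
        using ad v 2(2) by (simp add: adapted_iff_measurable adapted_def)
      then have "act v t' -` B \<inter> space (Info G act v t') \<in> sets (Info G act v t')"
        by (rule measurable_sets) simp
      also have "act v t' -` B \<inter> space (Info G act v t') = E" using 2(4) by auto
      finally have "E \<in> signal_events ?V (nball ?N t' v)" using less.IH[OF 2(3) v] by blast
      moreover have "nball ?N t' v \<subseteq> nball ?N t u"
        using neighbor_nball[of v ?N u t', OF 2(1)] nball_mono[of "Suc t'" t ?N u] 2(3) by (auto simp del: nball.simps)
      ultimately show ?thesis using signal_events_mono ball[OF less.prems] by blast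
    qed
  qed
  then show ?case unfolding sets_info using signal_events_sigma[OF ball[OF less.prems]] by blast
qed

lemma info_subalgebra:
  assumes G: "connected_undirected_graph G" and ad: "adapted G act" and u: "u \<in> pverts G"
  shows "subalgebra (World (pverts G)) (Info G act u t)"
proof -
  have "nball (neighbors G) t u \<subseteq> pverts G"
    using u connected_undirected_graphD(2)[OF G] by (intro nball_subset) auto
  then show ?thesis
    using info_signal_events[OF G ad u, of t] signal_events_World by (auto simp: subalgebra_def)
qed

lemma indep_vars_signals: "V \<noteq> {} \<Longrightarrow> signals.indep_vars V s (\<lambda>_. \<mu>0) (\<lambda>u w. w u) V"
proof (subst signals.indep_vars_iff_distr_eq_PiM')
  have eq: "sets (PiM V (\<lambda>_. \<mu>0)) = sets (signals V s)" by (simp add: sets_signals)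
  show "(\<lambda>w. w u) \<in> signals V s \<rightarrow>\<^sub>M \<mu>0" if "u \<in> V" for u
    using measurable_component_singleton[OF that, of "\<lambda>_. \<mu>0"] measurable_cong_sets[OF eq refl] by blast
  interpret P: product_prob_space "\<lambda>_. sig s" V
    by (auto simp: product_prob_space_def product_prob_space_axioms_def product_sigma_finite_def
        intro: sig.prob_space_axioms sig.sigma_finite_measure_axioms)
  have "distr (signals V s) \<mu>0 (\<lambda>w. w u) = sig s" if "u \<in> V" for u
  proof -
    have "distr (signals V s) \<mu>0 (\<lambda>w. w u) = distr (signals V s) (sig s) (\<lambda>w. w u)"
      by (rule distr_cong) auto
    then show ?thesis using P.PiM_component[OF that] by (simp add: signals_def)
  qed
  then have "PiM V (\<lambda>u. distr (signals V s) \<mu>0 (\<lambda>w. w u)) = signals V s"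
    unfolding signals_def by (intro PiM_cong) auto
  moreover have "distr (signals V s) (PiM V (\<lambda>_. \<mu>0)) (\<lambda>w. \<lambda>u\<in>V. w u) = distr (signals V s) (signals V s) (\<lambda>w. w)"
    by (rule distr_cong) (auto simp: sets_signals space_signals)
  ultimately show "distr (signals V s) (PiM V (\<lambda>_. \<mu>0)) (\<lambda>w. \<lambda>u\<in>V. w u) = PiM V (\<lambda>u. distr (signals V s) \<mu>0 (\<lambda>w. w u))"
    by (simp add: distr_id2)
qed auto

lemma signal_events_indep:
  assumes J: "J1 \<subseteq> V" "J2 \<subseteq> V" "J1 \<inter> J2 = {}" and V: "V \<noteq> {}"
    and E: "E1 \<in> signal_events V J1" "E2 \<in> signal_events V J2"
  shows "measure (given V s) (E1 \<inter> E2) = measure (given V s) E1 * measure (given V s) E2"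
proof -
  obtain A1 where A1: "A1 \<in> sets (PiM J1 (\<lambda>_. \<mu>0))" "E1 = {\<omega>\<in>space (World V). restrict (snd \<omega>) J1 \<in> A1}"
    using E(1) unfolding signal_events_def by blast
  obtain A2 where A2: "A2 \<in> sets (PiM J2 (\<lambda>_. \<mu>0))" "E2 = {\<omega>\<in>space (World V). restrict (snd \<omega>) J2 \<in> A2}"
    using E(2) unfolding signal_events_def by blast
  have EW: "E1 \<in> sets (World V)" "E2 \<in> sets (World V)"
    using signal_events_World J E by blast+
  have "signals.indep_var V s (PiM J1 (\<lambda>_. \<mu>0)) (\<lambda>w. restrict (\<lambda>i. w i) J1) (PiM J2 (\<lambda>_. \<mu>0)) (\<lambda>w. restrict (\<lambda>i. w i) J2)"
    by (rule signals.indep_var_restrict[OF indep_vars_signals[OF V] J(3,1,2)])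
  from signals.indep_varD[OF this A1(1) A2(1)]
  have "measure (signals V s) ((\<lambda>w. (restrict w J1, restrict w J2)) -` (A1 \<times> A2) \<inter> space (signals V s)) =
    measure (signals V s) ((\<lambda>w. restrict w J1) -` A1 \<inter> space (signals V s)) *
    measure (signals V s) ((\<lambda>w. restrict w J2) -` A2 \<inter> space (signals V s))" by simp
  moreover have "(\<lambda>w. (restrict w J1, restrict w J2)) -` (A1 \<times> A2) \<inter> space (signals V s) = {w\<in>space (signals V s). (s, w) \<in> E1 \<inter> E2}"
    "(\<lambda>w. restrict w J1) -` A1 \<inter> space (signals V s) = {w\<in>space (signals V s). (s, w) \<in> E1}"
    "(\<lambda>w. restrict w J2) -` A2 \<inter> space (signals V s) = {w\<in>space (signals V s). (s, w) \<in> E2}"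
    using mem_space_World[of s _ V s] by (auto simp: A1(2) A2(2))
  ultimately show ?thesis
    using EW by (simp add: measure_given)
qed

text \<open>Information at time \<open>t + 1\<close> consists of the signal and of actions at times
  up to \<open>t\<close>, so an event is a set of signals chosen in dependence on the history. Sets
  of this form are closed under complements and countable unions, which are taken for every history
  separately.\<close>

lemma info_representation:
  assumes "E \<in> sets (Info G act u (Suc t))" "u \<in> pverts G"
  shows "\<exists>D. (\<forall>h. D h \<in> sets \<mu>0) \<and>
    E = {\<omega>\<in>space (World (pverts G)). snd \<omega> u \<in> D (observed_history G act u t \<omega>)}"
  using assms(1) unfolding sets_info
proof induction
  have in_space: "snd \<omega> u \<in> space \<mu>0" if "\<omega> \<in> space (World (pverts G))" for \<omega>
    using that assms(2) by (auto simp: space_World)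
  {
    case (Basic E)
    then consider B where "B \<in> sets \<mu>0" "E = {\<omega>\<in>space (World (pverts G)). snd \<omega> u \<in> B}"
      | v t' B where "v \<in> neighbors G u" "1 \<le> t'" "t' < Suc t" "E = {\<omega>\<in>space (World (pverts G)). act v t' \<omega> \<in> B}"
      unfolding info_generator_def by blast
    then show ?case
    proof cases
      case 1
      then show ?thesis by (intro exI[of _ "\<lambda>_. B"]) auto
    next
      case 2
      \<comment> \<open>Action times start at 1, so the subtraction is not truncated.\<close>
      have "act v t' \<omega> \<longleftrightarrow> (v, t' - 1) \<in> observed_history G act u t \<omega>" for \<omega>
        using 2(1-3) by (auto simp: observed_history_def)
      then show ?thesis using 2(4) in_space
        by (intro exI[of _ "\<lambda>h. if ((v, t' - 1) \<in> h) \<in> B then space \<mu>0 else {}"]) auto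
    qed
  next
    case Empty
    show ?case by (intro exI[of _ "\<lambda>_. {}"]) auto
  next
    case (Compl E)
    then obtain D where D: "\<forall>h. D h \<in> sets \<mu>0"
      "E = {\<omega>\<in>space (World (pverts G)). snd \<omega> u \<in> D (observed_history G act u t \<omega>)}" by blast
    then show ?case using in_space by (intro exI[of _ "\<lambda>h. space \<mu>0 - D h"]) auto
  next
    case (Union E)
    then have "\<forall>i. \<exists>D. (\<forall>h. D h \<in> sets \<mu>0) \<and>
      E i = {\<omega>\<in>space (World (pverts G)). snd \<omega> u \<in> D (observed_history G act u t \<omega>)}" by blast
    from choice[OF this] obtain D where D': "\<forall>i. (\<forall>h. D i h \<in> sets \<mu>0) \<and>
      E i = {\<omega>\<in>space (World (pverts G)). snd \<omega> u \<in> D i (observed_history G act u t \<omega>)}" ..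
    then have D: "\<And>i h. D i h \<in> sets \<mu>0"
      "\<And>i. E i = {\<omega>\<in>space (World (pverts G)). snd \<omega> u \<in> D i (observed_history G act u t \<omega>)}" by simp_all
    then show ?case by (intro exI[of _ "\<lambda>h. \<Union>i. D i h"]) auto
  }
qed

lemma history_event_info:
  assumes own: "\<And>t'. t' < t \<Longrightarrow> {\<omega>\<in>space (World (pverts G)). act u (Suc t') \<omega>} \<in> sets (Info G act u (Suc t'))"
    and fin: "finite (neighbors G u)"
  shows "{\<omega>\<in>space (World (pverts G)). observed_history G act u t \<omega> = h} \<in> sets (Info G act u (Suc t))"
proof -
  let ?P = "insert u (neighbors G u) \<times> {..<t}"
  have P: "{\<omega>\<in>space (World (pverts G)). act v (Suc t') \<omega>} \<in> sets (Info G act u (Suc t))" if vt: "(v, t') \<in> ?P" for v t'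
  proof (cases "v = u")
    case True
    then show ?thesis using own[of t'] vt info_mono[of "Suc t'" "Suc t" G act u] by auto
  next
    case False
    then show ?thesis using vt by (intro info_neighbor_action) auto
  qed
  show ?thesis
  proof (cases "h \<subseteq> ?P")
    case True
    have "{\<omega>\<in>space (World (pverts G)). observed_history G act u t \<omega> = h} =
      {\<omega>\<in>space (Info G act u (Suc t)). \<forall>p\<in>?P. act (fst p) (Suc (snd p)) \<omega> \<longleftrightarrow> p \<in> h}"
      using True by (auto simp: observed_history_def)
    also have "\<dots> \<in> sets (Info G act u (Suc t))"
    proof (rule sets.sets_Collect_finite_All)
      fix p assume "p \<in> ?P"
      then have "{\<omega>\<in>space (Info G act u (Suc t)). act (fst p) (Suc (snd p)) \<omega>} \<in> sets (Info G act u (Suc t))"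
        using P[of "fst p" "snd p"] by simp
      then show "{\<omega>\<in>space (Info G act u (Suc t)). act (fst p) (Suc (snd p)) \<omega> \<longleftrightarrow> p \<in> h} \<in> sets (Info G act u (Suc t))"
        by (cases "p \<in> h") (auto intro: sets.sets_Collect_neg simp del: space_info)
    qed (use fin in auto)
    finally show ?thesis .
  next
    case False
    then have "{\<omega>\<in>space (World (pverts G)). observed_history G act u t \<omega> = h} = {}"
      by (auto simp: observed_history_def)
    then show ?thesis by (simp only: sets.empty_sets)
  qed
qed

end

lemma connected_undirected_graph_nbhd:
  assumes "connected_undirected_graph G" "u \<in> pverts G"
  shows "insert u (neighbors G u) \<subseteq> pverts G"
  using assms connected_undirected_graphD(2) by blast

lemma network_locally_finite: "network d G \<Longrightarrow> locally_finite (pverts G) (neighbors G)"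
  using connected_undirected_graph_nbhd by (fastforce simp: network_def locally_finite_def)

context signal_pair
begin

lemma history_event_measurable:
  assumes fin: "locally_finite V N" and u: "u \<in> V"
    and mF: "\<And>v t h. v \<in> V \<Longrightarrow> Measurable.pred \<mu>0 (F v t h)" and D: "D \<in> sets \<mu>0"
  shows "{w\<in>space (signals V s). local_history N u (run N V (responses F w) t) = h \<and> w u \<in> D} \<in> sets (signals V s)"
proof -
  obtain K where K: "finite K" "K \<subseteq> {(v, t', h). v \<in> V \<and> finite h}"
    "determined_by K (\<lambda>b. local_history N u (run N V b t))"
    using local_history_determined[OF fin u, where t=t] by blast
  have "determined_by K (\<lambda>b. local_history N u (run N V b t) = h)"
    by (rule determined_by_comp[OF K(3), of "\<lambda>X. X = h"])
  then have 1: "{w\<in>space (signals V s). local_history N u (run N V (responses F w) t) = h} \<in> sets (signals V s)"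
    using K(1,2) mF by (intro prob_determined(2)[where K=K and \<Phi>="\<lambda>b. local_history N u (run N V b t) = h"]) auto
  have 2: "{w\<in>space (signals V s). w u \<in> D} \<in> sets (signals V s)"
    unfolding signals_def using D u by (intro sets_Collect_single) auto
  have "{w\<in>space (signals V s). local_history N u (run N V (responses F w) t) = h \<and> w u \<in> D} =
    {w\<in>space (signals V s). local_history N u (run N V (responses F w) t) = h} \<inter> {w\<in>space (signals V s). w u \<in> D}"
    by auto
  with 1 2 show ?thesis by simp
qed

lemma local_history_bounds:
  "local_history N u (run N V b t) \<subseteq> insert u (N u) \<times> {..<t}"
  using run_bounds[of _ N V b t] by (force simp: local_history_def)

definition follows :: "nat pair_pre_digraph \<Rightarrow> 'w action_process \<Rightarrow> (nat \<Rightarrow> nat \<Rightarrow> history \<Rightarrow> 'w \<Rightarrow> bool) \<Rightarrow> bool" where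
  "follows G act F \<longleftrightarrow> (\<forall>u\<in>pverts G. \<forall>t. \<forall>\<omega>\<in>space (World (pverts G)).
     act u (Suc t) \<omega> \<longleftrightarrow> (u, t) \<in> run (neighbors G) (pverts G) (responses F (snd \<omega>)) (Suc t))"

lemma observed_history_eq:
  assumes G: "connected_undirected_graph G" and u: "u \<in> pverts G"
    and eq: "\<And>v t'. v \<in> pverts G \<Longrightarrow> t' < t \<Longrightarrow> act v (Suc t') \<omega> \<longleftrightarrow> (v, t') \<in> run (neighbors G) (pverts G) b (Suc t')"
  shows "observed_history G act u t \<omega> = local_history (neighbors G) u (run (neighbors G) (pverts G) b t)"
proof -
  have "(v, t') \<in> run (neighbors G) (pverts G) b t \<longleftrightarrow> t' < t \<and> act v (Suc t') \<omega>" if "v \<in> insert u (neighbors G u)" for v t'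
  proof (cases "t' < t")
    case True
    have "v \<in> pverts G" using that connected_undirected_graph_nbhd[OF G u] by blast
    then show ?thesis using eq[of v t'] True mem_run_iff[OF True, of v "neighbors G" "pverts G" b]
      mem_run_iff[of t' "Suc t'" v "neighbors G" "pverts G" b] by simp
  next
    case False
    then show ?thesis using run_bounds[of "(v, t')" "neighbors G" "pverts G" b t] by auto
  qed
  then show ?thesis by (auto simp: observed_history_def local_history_def)
qed

lemma follows_observed_history:
  assumes "connected_undirected_graph G" "follows G act F" "u \<in> pverts G" "\<omega> \<in> space (World (pverts G))"
  shows "observed_history G act u t \<omega> = local_history (neighbors G) u (run (neighbors G) (pverts G) (responses F (snd \<omega>)) t)"
  using assms by (intro observed_history_eq) (auto simp: follows_def)

lemma follows_action:
  assumes G: "connected_undirected_graph G" and f: "follows G act F" and u: "u \<in> pverts G" and \<omega>: "\<omega> \<in> space (World (pverts G))"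
  shows "act u (Suc t) \<omega> \<longleftrightarrow> F u t (observed_history G act u t \<omega>) (snd \<omega> u)"
  using f u \<omega> mem_run_iff[of t "Suc t" u "neighbors G" "pverts G" "responses F (snd \<omega>)"]
    follows_observed_history[OF G f u \<omega>, of t]
  by (simp add: follows_def responses_def del: run.simps)

lemma given_Collect:
  assumes "{\<omega>\<in>space (World V). P \<omega>} \<in> sets (World V)"
  shows "measure (given V s) {\<omega>\<in>space (World V). P \<omega>} = measure (signals V s) {w\<in>space (signals V s). P (s, w)}"
  using measure_given[OF assms, of s] mem_space_World[of s _ V s]
  by (auto intro!: arg_cong[where f="measure (signals V s)"])

lemma MAP_actions_adapted:
  assumes "MAP_actions \<mu>0 \<mu>1 G act"
  shows "adapted G act"
  using assms by (auto simp: MAP_actions_def adapted_def adapted_iff_measurable)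

lemma MAP_actions_iff:
  assumes G: "connected_undirected_graph G"
  shows "MAP_actions \<mu>0 \<mu>1 G act \<longleftrightarrow> adapted G act \<and> (\<forall>u\<in>pverts G. \<forall>t\<ge>1. \<forall>E\<in>sets (Info G act u t).
     ((\<forall>\<omega>\<in>E. act u t \<omega>) \<longrightarrow> measure (given (pverts G) False) E \<le> measure (given (pverts G) True) E) \<and>
     ((\<forall>\<omega>\<in>E. \<not> act u t \<omega>) \<longrightarrow> measure (given (pverts G) True) E \<le> measure (given (pverts G) False) E))"
proof (cases "adapted G act")
  case True
  have "(AE \<omega> in World (pverts G).
           (belief \<mu>0 \<mu>1 G (Info G act u t) \<omega> < 1/2 \<longrightarrow> act u t \<omega> = False) \<and>
           (belief \<mu>0 \<mu>1 G (Info G act u t) \<omega> > 1/2 \<longrightarrow> act u t \<omega> = True)) \<longleftrightarrow>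
      (\<forall>E\<in>sets (Info G act u t).
     ((\<forall>\<omega>\<in>E. act u t \<omega>) \<longrightarrow> measure (given (pverts G) False) E \<le> measure (given (pverts G) True) E) \<and>
     ((\<forall>\<omega>\<in>E. \<not> act u t \<omega>) \<longrightarrow> measure (given (pverts G) True) E \<le> measure (given (pverts G) False) E))"
    if "u \<in> pverts G" "t \<ge> 1" for u t
    using that True by (intro MAP_iff_likelihood[OF info_subalgebra[OF G True that(1)]]) (simp add: adapted_def)
  then show ?thesis using True unfolding MAP_actions_def adapted_iff_measurable
    by (auto simp: adapted_def)
next
  case False
  then show ?thesis using MAP_actions_adapted by blast
qed

lemma info_event_World:
  assumes "connected_undirected_graph G" "adapted G act" "u \<in> pverts G" "E \<in> sets (Info G act u t)"
  shows "E \<in> sets (World (pverts G))"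
  using info_subalgebra[OF assms(1-3), of t] assms(4) by (auto simp: subalgebra_def)

lemma observed_event_info:
  assumes net: "network d G" and ad: "adapted G act" and u: "u \<in> pverts G" and D: "D \<in> sets \<mu>0"
  shows "{\<omega>\<in>space (World (pverts G)). observed_history G act u t \<omega> = h \<and> snd \<omega> u \<in> D} \<in> sets (Info G act u (Suc t))"
proof -
  have "{\<omega>\<in>space (World (pverts G)). observed_history G act u t \<omega> = h \<and> snd \<omega> u \<in> D} =
    {\<omega>\<in>space (World (pverts G)). observed_history G act u t \<omega> = h} \<inter> {\<omega>\<in>space (World (pverts G)). snd \<omega> u \<in> D}"
    by auto
  also have "\<dots> \<in> sets (Info G act u (Suc t))"
    using ad net u info_signal[OF D] by (intro sets.Int history_event_info) (auto simp: network_def adapted_def)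
  finally show ?thesis .
qed

lemma given_history_prob:
  assumes net: "network d G" and ad: "adapted G act" and f: "follows G act F" and u: "u \<in> pverts G" and D: "D \<in> sets \<mu>0"
  shows "measure (given (pverts G) s) {\<omega>\<in>space (World (pverts G)). observed_history G act u t \<omega> = h \<and> snd \<omega> u \<in> D} =
    history_prob (neighbors G) (pverts G) F s u t h D"
proof -
  have G: "connected_undirected_graph G" using net by (simp add: network_def)
  have "{\<omega>\<in>space (World (pverts G)). observed_history G act u t \<omega> = h \<and> snd \<omega> u \<in> D} \<in> sets (World (pverts G))"
    by (rule info_event_World[OF G ad u observed_event_info[OF net ad u D]])
  then have "measure (given (pverts G) s) {\<omega>\<in>space (World (pverts G)). observed_history G act u t \<omega> = h \<and> snd \<omega> u \<in> D} =
    measure (signals (pverts G) s) {w\<in>space (signals (pverts G) s). observed_history G act u t (s, w) = h \<and> snd (s, w) u \<in> D}"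
    by (rule given_Collect)
  also have "\<dots> = history_prob (neighbors G) (pverts G) F s u t h D"
    unfolding history_prob_def
  proof (rule arg_cong[where f="measure (signals (pverts G) s)"], rule Collect_cong, rule conj_cong[OF refl])
    fix w assume "w \<in> space (signals (pverts G) s)"
    then have "(s, w) \<in> space (World (pverts G))" using mem_space_World by blast
    from follows_observed_history[OF G f u this, of t]
    show "(observed_history G act u t (s, w) = h \<and> snd (s, w) u \<in> D) =
      (local_history (neighbors G) u (run (neighbors G) (pverts G) (responses F w) t) = h \<and> w u \<in> D)" by simp
  qed
  finally show ?thesis .
qed

text \<open>Optimality tested on sets of signals for each single history. It speaks about the rule
  through \<open>history_prob\<close> only, which factors and has controllable limits.\<close>

definition rule_MAP :: "(nat \<Rightarrow> nat set) \<Rightarrow> nat set \<Rightarrow> (nat \<Rightarrow> nat \<Rightarrow> history \<Rightarrow> 'w \<Rightarrow> bool) \<Rightarrow> bool" where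
  "rule_MAP N V F \<longleftrightarrow> (\<forall>u\<in>V. \<forall>t h. \<forall>D\<in>sets \<mu>0.
     ((\<forall>x\<in>D. F u t h x) \<longrightarrow> history_prob N V F False u t h D \<le> history_prob N V F True u t h D) \<and>
     ((\<forall>x\<in>D. \<not> F u t h x) \<longrightarrow> history_prob N V F True u t h D \<le> history_prob N V F False u t h D))"

text \<open>The threshold \<open>q / (1 - q)\<close> for the likelihood ratio is written without
  division, so that \<open>q\<close> ranges over the compact interval from 0 to 1 and an infinite
  threshold is \<open>q = 1\<close>. On equality the rule is free.\<close>

definition threshold_rule :: "(nat \<Rightarrow> nat \<Rightarrow> history \<Rightarrow> 'w \<Rightarrow> bool) \<Rightarrow> (nat \<Rightarrow> nat \<Rightarrow> history \<Rightarrow> real) \<Rightarrow> bool" where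
  "threshold_rule F q \<longleftrightarrow> (\<forall>u t h. 0 \<le> q u t h \<and> q u t h \<le> 1 \<and>
     (\<forall>x\<in>space \<mu>0. (q u t h < (1 - q u t h) * lr x \<longrightarrow> F u t h x) \<and> ((1 - q u t h) * lr x < q u t h \<longrightarrow> \<not> F u t h x)))"

text \<open>\<open>info_representation\<close> yields a set of signals for every agent, time and
  history. Read as a rule it reproduces the actions, by induction on time.\<close>

lemma exists_following_rule:
  assumes G: "connected_undirected_graph G" and ad: "adapted G act"
  shows "\<exists>F. (\<forall>u t h. Measurable.pred \<mu>0 (F u t h)) \<and> follows G act F"
proof -
  let ?V = "pverts G" and ?N = "neighbors G"
  have "\<exists>D. (\<forall>h. D h \<in> sets \<mu>0) \<and> (u \<in> ?V \<longrightarrow>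
     {\<omega>\<in>space (World ?V). act u (Suc t) \<omega>} = {\<omega>\<in>space (World ?V). snd \<omega> u \<in> D (observed_history G act u t \<omega>)})" for u t
  proof (cases "u \<in> ?V")
    case True
    then have "{\<omega>\<in>space (World ?V). act u (Suc t) \<omega>} \<in> sets (Info G act u (Suc t))"
      using ad by (simp add: adapted_def)
    from info_representation[OF this True] show ?thesis by blast
  qed (auto intro: exI[of _ "\<lambda>_. {}"])
  then have "\<forall>p. \<exists>D. (\<forall>h. D h \<in> sets \<mu>0) \<and> (fst p \<in> ?V \<longrightarrow> {\<omega>\<in>space (World ?V). act (fst p) (Suc (snd p)) \<omega>} =
      {\<omega>\<in>space (World ?V). snd \<omega> (fst p) \<in> D (observed_history G act (fst p) (snd p) \<omega>)})" by blast
  from choice[OF this] obtain D1 where D1: "\<forall>p. (\<forall>h. D1 p h \<in> sets \<mu>0) \<and>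
     (fst p \<in> ?V \<longrightarrow> {\<omega>\<in>space (World ?V). act (fst p) (Suc (snd p)) \<omega>} =
      {\<omega>\<in>space (World ?V). snd \<omega> (fst p) \<in> D1 p (observed_history G act (fst p) (snd p) \<omega>)})" ..
  define D0 where "D0 u t = D1 (u, t)" for u t
  have mD: "D0 u t h \<in> sets \<mu>0" for u t h using D1[rule_format, of "(u, t)"] by (simp add: D0_def)
  have D0: "{\<omega>\<in>space (World ?V). act u (Suc t) \<omega>} = {\<omega>\<in>space (World ?V). snd \<omega> u \<in> D0 u t (observed_history G act u t \<omega>)}"
    if "u \<in> ?V" for u t
    using D1[rule_format, of "(u, t)"] that by (simp add: D0_def)
  define F where "F u t h x = (x \<in> D0 u t h)" for u t h x
  have "Measurable.pred \<mu>0 (F u t h)" for u t h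
    unfolding F_def pred_def using mD[of u t h] sets.sets_into_space[OF mD[of u t h]] by (simp add: Int_def[symmetric] Int_absorb1)
  moreover have "act u (Suc t) \<omega> \<longleftrightarrow> (u, t) \<in> run ?N ?V (responses F (snd \<omega>)) (Suc t)"
    if "u \<in> ?V" "\<omega> \<in> space (World ?V)" for u t \<omega>
    using that(1)
  proof (induction t arbitrary: u rule: less_induct)
    case (less t)
    have "observed_history G act u t \<omega> = local_history ?N u (run ?N ?V (responses F (snd \<omega>)) t)"
      using less by (intro observed_history_eq[OF G]) auto
    moreover have "act u (Suc t) \<omega> \<longleftrightarrow> snd \<omega> u \<in> D0 u t (observed_history G act u t \<omega>)"
      using D0[OF less.prems, of t] that(2) by blast
    ultimately show ?case
      using mem_run_iff[of t "Suc t" u ?N ?V "responses F (snd \<omega>)"] less.prems by (simp add: F_def responses_def del: run.simps)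
  qed
  ultimately show ?thesis unfolding follows_def by blast
qed

end

section \<open>Threshold rules\<close>

context signal_pair
begin

lemma run_event_measurable:
  assumes fin: "locally_finite V N" and u: "u \<in> V"
    and mF: "\<And>v t h. v \<in> V \<Longrightarrow> Measurable.pred \<mu>0 (F v t h)"
  shows "{w\<in>space (signals V s). (u, t) \<in> run N V (responses F w) t'} \<in> sets (signals V s)"
proof -
  obtain K where K: "finite K" "K \<subseteq> {(v, t', h). v \<in> V \<and> finite h}"
    "determined_by K (\<lambda>b. {p\<in>run N V b t'. fst p \<in> {u}})"
    using run_determined[OF fin, of "{u}" t'] u by blast
  have eq: "(u, t) \<in> run N V b t' \<longleftrightarrow> (u, t) \<in> {p\<in>run N V b t'. fst p \<in> {u}}" for b by simp
  have "determined_by K (\<lambda>b. (u, t) \<in> {p\<in>run N V b t'. fst p \<in> {u}})"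
    by (rule determined_by_comp[OF K(3), of "\<lambda>X. (u, t) \<in> X"])
  then have "determined_by K (\<lambda>b. (u, t) \<in> run N V b t')" unfolding eq[symmetric] .
  then show ?thesis
    using K(1,2) mF by (intro prob_determined(2)[where K=K and \<Phi>="\<lambda>b. (u, t) \<in> run N V b t'"]) auto
qed

lemma run_cong_responses:
  assumes "\<And>u t. u \<in> V \<Longrightarrow> b u t (local_history N u (run N V b t)) = b' u t (local_history N u (run N V b t))"
  shows "run N V b' t = run N V b t"
proof (induction t)
  case (Suc t)
  then show ?case using assms by auto
qed simp

text \<open>Modifying the rule of a Bayesian agent where its posterior dictates the action,
  or where the observations have probability 0, changes the actions on a null set only.\<close>

lemma exists_threshold_rule:
  assumes net: "network d G" and MAP: "MAP_actions \<mu>0 \<mu>1 G act"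
  shows "\<exists>F q. (\<forall>u t h. Measurable.pred \<mu>0 (F u t h)) \<and> threshold_rule F q \<and> rule_MAP (neighbors G) (pverts G) F \<and>
    (\<forall>s t h. \<forall>u\<in>pverts G. \<forall>D\<in>sets \<mu>0. history_prob (neighbors G) (pverts G) F s u t h D =
       measure (given (pverts G) s) {\<omega>\<in>space (World (pverts G)). observed_history G act u t \<omega> = h \<and> snd \<omega> u \<in> D}) \<and>
    (\<forall>s t. \<forall>u\<in>pverts G. measure (signals (pverts G) s)
         {w\<in>space (signals (pverts G) s). (u, t) \<in> run (neighbors G) (pverts G) (responses F w) (Suc t)} =
       measure (given (pverts G) s) {\<omega>\<in>space (World (pverts G)). act u (Suc t) \<omega>})"
proof -
  let ?V = "pverts G" and ?N = "neighbors G"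
  have G: "connected_undirected_graph G" using net by (simp add: network_def)
  have lf: "locally_finite ?V ?N" by (rule network_locally_finite[OF net])
  have ad: "adapted G act" by (rule MAP_actions_adapted[OF MAP])
  obtain F0 where mF0 [measurable]: "\<And>u t h. Measurable.pred \<mu>0 (F0 u t h)" and f0: "follows G act F0"
    using exists_following_rule[OF G ad] by blast
  define q0 where "q0 = forced_prob ?N ?V F0 False"
  define q1 where "q1 = forced_prob ?N ?V F0 True"
  have qnn: "q0 u t h \<ge> 0" "q1 u t h \<ge> 0" for u t h by (auto simp: q0_def q1_def forced_prob_def)
  \<comment> \<open>If the forced probabilities vanish in both states, \<open>q\<close> becomes 0
    through division by zero and the threshold condition demands action 1 as soon as
    \<open>lr x > 0\<close>; hence the first alternative. On ties the original rule is kept.\<close>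
  define F where "F u t h x \<longleftrightarrow> q0 u t h + q1 u t h = 0 \<or> q0 u t h < q1 u t h * lr x \<or>
     (q0 u t h = q1 u t h * lr x \<and> F0 u t h x)" for u t h x
  define q where "q u t h = q0 u t h / (q0 u t h + q1 u t h)" for u t h
  have mF [measurable]: "Measurable.pred \<mu>0 (F u t h)" for u t h unfolding F_def by measurable
  have thr: "threshold_rule F q"
    unfolding threshold_rule_def
  proof (intro allI conjI ballI impI)
    fix u t h
    show "0 \<le> q u t h" "q u t h \<le> 1" using qnn[of u t h] by (auto simp: q_def divide_le_eq_1)
    have eq: "(1 - q u t h) * y = q1 u t h * y / (q0 u t h + q1 u t h)" if "q0 u t h + q1 u t h \<noteq> 0" for y
      using that by (simp add: q_def field_simps)
    have pos: "q0 u t h + q1 u t h > 0" if "q0 u t h + q1 u t h \<noteq> 0" using qnn[of u t h] that by linarith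
    show "F u t h x" if "q u t h < (1 - q u t h) * lr x" for x
    proof (cases "q0 u t h + q1 u t h = 0")
      case False
      then have "q0 u t h < q1 u t h * lr x"
        using that pos unfolding eq[OF False] by (simp add: q_def divide_less_cancel)
      then show ?thesis by (simp add: F_def)
    qed (simp add: F_def)
    show "\<not> F u t h x" if "(1 - q u t h) * lr x < q u t h" for x
    proof (cases "q0 u t h + q1 u t h = 0")
      case True
      then show ?thesis using that lr_nonneg[of x] by (simp add: q_def)
    next
      case False
      then have "q1 u t h * lr x < q0 u t h"
        using that pos unfolding eq[OF False] by (simp add: q_def divide_less_cancel)
      then show ?thesis using False by (simp add: F_def)
    qed
  qed
  define B where "B u t h = {x\<in>space \<mu>0. F u t h x \<noteq> F0 u t h x}" for u t h
  have mB: "B u t h \<in> sets \<mu>0" for u t h unfolding B_def by measurable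
  note MAP' = MAP[unfolded MAP_actions_iff[OF G], THEN conjunct2, rule_format]
  have hist_MAP: "history_prob ?N ?V F0 False u t h D \<le> history_prob ?N ?V F0 True u t h D"
    if u: "u \<in> ?V" and D: "D \<in> sets \<mu>0" and tr: "\<forall>x\<in>D. F0 u t h x" for u t h D
  proof -
    let ?E = "{\<omega>\<in>space (World ?V). observed_history G act u t \<omega> = h \<and> snd \<omega> u \<in> D}"
    have "\<forall>\<omega>\<in>?E. act u (Suc t) \<omega>" using tr follows_action[OF G f0 u, of _ t] by auto
    then have "measure (given ?V False) ?E \<le> measure (given ?V True) ?E"
      using MAP'[OF u, of "Suc t" ?E] observed_event_info[OF net ad u D] by simp
    then show ?thesis unfolding given_history_prob[OF net ad f0 u D] .
  qed
  have hist_MAP': "history_prob ?N ?V F0 True u t h D \<le> history_prob ?N ?V F0 False u t h D"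
    if u: "u \<in> ?V" and D: "D \<in> sets \<mu>0" and tr: "\<forall>x\<in>D. \<not> F0 u t h x" for u t h D
  proof -
    let ?E = "{\<omega>\<in>space (World ?V). observed_history G act u t \<omega> = h \<and> snd \<omega> u \<in> D}"
    have "\<forall>\<omega>\<in>?E. \<not> act u (Suc t) \<omega>" using tr follows_action[OF G f0 u, of _ t] by auto
    then have "measure (given ?V True) ?E \<le> measure (given ?V False) ?E"
      using MAP'[OF u, of "Suc t" ?E] observed_event_info[OF net ad u D] by simp
    then show ?thesis unfolding given_history_prob[OF net ad f0 u D] .
  qed
  have factor: "history_prob ?N ?V F0 s u t h D = measure (sig s) (consistent_signals F0 u t h \<inter> D) * (if s then q1 u t h else q0 u t h)"
    if "u \<in> ?V" "D \<in> sets \<mu>0" for s u t h D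
    using history_prob_factor[where F=F0 and s=s and t=t and h=h, OF lf that(1) mF0 that(2)] by (cases s) (simp_all add: q0_def q1_def)
  have mR: "consistent_signals F0 u t h \<in> sets \<mu>0" for u t h by (rule consistent_signals_measurable) simp
  have null: "history_prob ?N ?V F0 s u t h (B u t h) = 0" if u: "u \<in> ?V" for s u t h
  proof (cases "q0 u t h + q1 u t h = 0")
    case True
    then have "q0 u t h = 0" "q1 u t h = 0" using qnn[of u t h] by auto
    then show ?thesis unfolding factor[OF u mB] by simp
  next
    case False
    let ?R = "consistent_signals F0 u t h"
    \<comment> \<open>\<open>A1\<close> and \<open>A2\<close> are the signals at which the original
      rule acts against its posterior. Its MAP inequalities make them null among the signals
      consistent with \<open>h\<close>.\<close>
    define A1 where "A1 = {x\<in>space \<mu>0. F0 u t h x \<and> q1 u t h * lr x < q0 u t h}"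
    define A2 where "A2 = {x\<in>space \<mu>0. \<not> F0 u t h x \<and> q0 u t h < q1 u t h * lr x}"
    have mA: "A1 \<in> sets \<mu>0" "A2 \<in> sets \<mu>0" unfolding A1_def A2_def by measurable
    have B_sub: "B u t h \<subseteq> A1 \<union> A2" using False by (auto simp: B_def A1_def A2_def F_def)
    have "measure \<mu>0 (?R \<inter> A1) = 0"
    proof (rule lr_strict_null)
      \<comment> \<open>The signs are reversed because on \<open>A1\<close> the likelihood ratio
        lies below the threshold, while \<open>lr_strict_null\<close> asks for a strict inequality
        in the other direction.\<close>
      show "- q0 u t h < - q1 u t h * lr x" if "x \<in> ?R \<inter> A1" for x using that by (simp add: A1_def)
      show "- q1 u t h * measure \<mu>1 (?R \<inter> A1) \<le> - q0 u t h * measure \<mu>0 (?R \<inter> A1)"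
        using hist_MAP[OF u mA(1), of t h] factor[OF u mA(1), of _ t h] by (simp add: A1_def mult.commute)
    qed (use mR mA in auto)
    moreover have "measure \<mu>0 (?R \<inter> A2) = 0"
    proof (rule lr_strict_null)
      show "q0 u t h < q1 u t h * lr x" if "x \<in> ?R \<inter> A2" for x using that by (simp add: A2_def)
      show "q1 u t h * measure \<mu>1 (?R \<inter> A2) \<le> q0 u t h * measure \<mu>0 (?R \<inter> A2)"
        using hist_MAP'[OF u mA(2), of t h] factor[OF u mA(2), of _ t h] by (simp add: A2_def mult.commute)
    qed (use mR mA in auto)
    ultimately have "measure \<mu>0 (?R \<inter> (A1 \<union> A2)) \<le> 0"
      using measure_Un_le[of "?R \<inter> A1" \<mu>0 "?R \<inter> A2"] mR mA by (simp add: Int_Un_distrib)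
    then have "measure \<mu>0 (?R \<inter> B u t h) = 0"
      using M0.finite_measure_mono[of "?R \<inter> B u t h" "?R \<inter> (A1 \<union> A2)"] B_sub mR mA
      by (intro antisym) (auto intro: order_trans)
    moreover have "?R \<inter> B u t h \<in> sets \<mu>0" using mR mB by auto
    ultimately have "measure (sig s) (?R \<inter> B u t h) = 0" using null_iff by (cases s) auto
    then show ?thesis unfolding factor[OF u mB] by simp
  qed
  \<comment> \<open>An agent has finitely many possible histories at a given time, and agents and
    times are countable, so the null events can be collected into one.\<close>
  have AE: "AE w in signals ?V s. \<forall>u\<in>?V. \<forall>t. w u \<notin> B u t (local_history ?N u (run ?N ?V (responses F0 w) t))" for s
  proof -
    have "AE w in signals ?V s. w u \<notin> B u t (local_history ?N u (run ?N ?V (responses F0 w) t))" if u: "u \<in> ?V" for u t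
    proof -
      let ?P = "insert u (?N u) \<times> {..<t}"
      have fin: "finite (Pow ?P)" using lf u by (simp add: locally_finite_def)
      have "AE w in signals ?V s. w \<notin> {w\<in>space (signals ?V s). local_history ?N u (run ?N ?V (responses F0 w) t) = h \<and> w u \<in> B u t h}" for h
        using null[OF u, of s t h] signals.prob_eq_0[OF history_event_measurable[where F=F0 and s=s and t=t and h=h, OF lf u mF0 mB[of u t h]]]
        by (simp add: history_prob_def)
      then have "AE w in signals ?V s. \<forall>h\<in>Pow ?P. w \<notin> {w\<in>space (signals ?V s). local_history ?N u (run ?N ?V (responses F0 w) t) = h \<and> w u \<in> B u t h}"
        using fin by (intro AE_finite_allI) auto
      with AE_space show ?thesis
      proof eventually_elim
        case (elim w)
        then show ?case using local_history_bounds[of ?N u ?V "responses F0 w" t] by blast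
      qed
    qed
    then show ?thesis
      by (subst AE_ball_countable) (auto simp: AE_all_countable)
  qed
  have AE_run: "AE w in signals ?V s. (\<forall>t. run ?N ?V (responses F w) t = run ?N ?V (responses F0 w) t) \<and>
      (\<forall>u\<in>?V. \<forall>t. F u t (local_history ?N u (run ?N ?V (responses F w) t)) (w u) =
        F0 u t (local_history ?N u (run ?N ?V (responses F0 w) t)) (w u))" for s
    using AE[of s] AE_space
  proof eventually_elim
    case (elim w)
    have eq: "F u t (local_history ?N u (run ?N ?V (responses F0 w) t)) (w u) =
        F0 u t (local_history ?N u (run ?N ?V (responses F0 w) t)) (w u)" if "u \<in> ?V" for u t
      using elim(1) that signal_in_space[OF elim(2) that] unfolding B_def by blast
    then have "run ?N ?V (responses F w) t = run ?N ?V (responses F0 w) t" for t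
      by (intro run_cong_responses) (simp add: responses_def)
    with eq show ?case by simp
  qed
  have hist_eq: "history_prob ?N ?V F s u t h D = history_prob ?N ?V F0 s u t h D" if u: "u \<in> ?V" and D: "D \<in> sets \<mu>0" for s u t h D
    unfolding history_prob_def
  proof (rule signals.finite_measure_eq_AE)
    show "AE w in signals ?V s. (w \<in> {w\<in>space (signals ?V s). local_history ?N u (run ?N ?V (responses F w) t) = h \<and> w u \<in> D}) =
       (w \<in> {w\<in>space (signals ?V s). local_history ?N u (run ?N ?V (responses F0 w) t) = h \<and> w u \<in> D})"
      using AE_run[of s] by eventually_elim simp
  qed (rule history_event_measurable[OF lf u _ D], simp)+
  have act_eq: "measure (signals ?V s) {w\<in>space (signals ?V s). (u, t) \<in> run ?N ?V (responses F w) (Suc t)} =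
     measure (given ?V s) {\<omega>\<in>space (World ?V). act u (Suc t) \<omega>}" if u: "u \<in> ?V" for s u t
  proof -
    have "{\<omega>\<in>space (World ?V). act u (Suc t) \<omega>} \<in> sets (World ?V)"
      by (rule info_event_World[OF G ad u, of _ "Suc t"]) (use ad u in \<open>simp add: adapted_def\<close>)
    then have "measure (given ?V s) {\<omega>\<in>space (World ?V). act u (Suc t) \<omega>} = measure (signals ?V s) {w\<in>space (signals ?V s). act u (Suc t) (s, w)}"
      by (rule given_Collect)
    also have "{w\<in>space (signals ?V s). act u (Suc t) (s, w)} = {w\<in>space (signals ?V s). (u, t) \<in> run ?N ?V (responses F0 w) (Suc t)}"
      using f0 u mem_space_World[of s _ ?V s] unfolding follows_def by auto
    also have "measure (signals ?V s) \<dots> = measure (signals ?V s) {w\<in>space (signals ?V s). (u, t) \<in> run ?N ?V (responses F w) (Suc t)}"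
    proof (rule signals.finite_measure_eq_AE)
      show "AE w in signals ?V s. (w \<in> {w\<in>space (signals ?V s). (u, t) \<in> run ?N ?V (responses F0 w) (Suc t)}) =
        (w \<in> {w\<in>space (signals ?V s). (u, t) \<in> run ?N ?V (responses F w) (Suc t)})"
        using AE_run[of s] by eventually_elim (simp del: run.simps)
    qed (rule run_event_measurable[OF lf u], simp)+
    finally show ?thesis by simp
  qed
  have "rule_MAP ?N ?V F"
    unfolding rule_MAP_def
  proof (intro ballI allI conjI impI)
    fix u t h D assume u: "u \<in> ?V" and D: "D \<in> sets \<mu>0"
    have D': "{x\<in>D. F0 u t h x} \<in> sets \<mu>0" "{x\<in>D. \<not> F0 u t h x} \<in> sets \<mu>0"
    proof -
      have "{x\<in>D. F0 u t h x} = D \<inter> {x\<in>space \<mu>0. F0 u t h x}" "{x\<in>D. \<not> F0 u t h x} = D \<inter> {x\<in>space \<mu>0. \<not> F0 u t h x}"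
        using sets.sets_into_space[OF D] by auto
      then show "{x\<in>D. F0 u t h x} \<in> sets \<mu>0" "{x\<in>D. \<not> F0 u t h x} \<in> sets \<mu>0"
        using D by simp_all
    qed
    \<comment> \<open>Off a null set \<open>F\<close> and \<open>F0\<close> respond alike to the
      realised history. If \<open>F\<close> chooses action 1 on \<open>D\<close>, then so does
      \<open>F0\<close> on the relevant outcomes, and the inequality known for \<open>F0\<close> can
      be applied to the smaller set.\<close>
    have restr: "history_prob ?N ?V F s u t h D = history_prob ?N ?V F0 s u t h {x\<in>D. F0 u t h x}" if "\<forall>x\<in>D. F u t h x" for s
      unfolding history_prob_def
    proof (rule signals.finite_measure_eq_AE)
      show "AE w in signals ?V s. (w \<in> {w\<in>space (signals ?V s). local_history ?N u (run ?N ?V (responses F w) t) = h \<and> w u \<in> D}) =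
         (w \<in> {w\<in>space (signals ?V s). local_history ?N u (run ?N ?V (responses F0 w) t) = h \<and> w u \<in> {x\<in>D. F0 u t h x}})"
        using AE_run[of s] by eventually_elim (use that u in auto)
      show "{w\<in>space (signals ?V s). local_history ?N u (run ?N ?V (responses F w) t) = h \<and> w u \<in> D} \<in> sets (signals ?V s)"
        by (rule history_event_measurable[OF lf u _ D]) simp
      show "{w\<in>space (signals ?V s). local_history ?N u (run ?N ?V (responses F0 w) t) = h \<and> w u \<in> {x\<in>D. F0 u t h x}} \<in> sets (signals ?V s)"
        by (rule history_event_measurable[OF lf u _ D'(1)]) simp
    qed
    have restr': "history_prob ?N ?V F s u t h D = history_prob ?N ?V F0 s u t h {x\<in>D. \<not> F0 u t h x}" if "\<forall>x\<in>D. \<not> F u t h x" for s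
      unfolding history_prob_def
    proof (rule signals.finite_measure_eq_AE)
      show "AE w in signals ?V s. (w \<in> {w\<in>space (signals ?V s). local_history ?N u (run ?N ?V (responses F w) t) = h \<and> w u \<in> D}) =
         (w \<in> {w\<in>space (signals ?V s). local_history ?N u (run ?N ?V (responses F0 w) t) = h \<and> w u \<in> {x\<in>D. \<not> F0 u t h x}})"
        using AE_run[of s] by eventually_elim (use that u in auto)
      show "{w\<in>space (signals ?V s). local_history ?N u (run ?N ?V (responses F w) t) = h \<and> w u \<in> D} \<in> sets (signals ?V s)"
        by (rule history_event_measurable[OF lf u _ D]) simp
      show "{w\<in>space (signals ?V s). local_history ?N u (run ?N ?V (responses F0 w) t) = h \<and> w u \<in> {x\<in>D. \<not> F0 u t h x}} \<in> sets (signals ?V s)"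
        by (rule history_event_measurable[OF lf u _ D'(2)]) simp
    qed
    show "history_prob ?N ?V F False u t h D \<le> history_prob ?N ?V F True u t h D" if "\<forall>x\<in>D. F u t h x"
      unfolding restr[OF that] by (rule hist_MAP[OF u D'(1)]) simp
    show "history_prob ?N ?V F True u t h D \<le> history_prob ?N ?V F False u t h D" if "\<forall>x\<in>D. \<not> F u t h x"
      unfolding restr'[OF that] by (rule hist_MAP'[OF u D'(2)]) simp
  qed
  moreover have "history_prob ?N ?V F s u t h D =
       measure (given ?V s) {\<omega>\<in>space (World ?V). observed_history G act u t \<omega> = h \<and> snd \<omega> u \<in> D}"
    if "u \<in> ?V" "D \<in> sets \<mu>0" for s u t h D
    unfolding hist_eq[OF that] given_history_prob[OF net ad f0 that] ..
  ultimately show ?thesis using mF thr act_eq by blast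
qed

text \<open>Histories take finitely many values, so an information event is a finite disjoint union
  of history events. \<open>Q\<close> is a property of signals inherited by the pieces, such as the
  action taken.\<close>

lemma given_info_sum:
  assumes net: "network d G" and ad: "adapted G act" and f: "follows G act F" and u: "u \<in> pverts G"
    and E: "E \<in> sets (Info G act u (Suc t))"
    and mQ: "\<And>h. Measurable.pred \<mu>0 (Q h)" and Q: "\<And>\<omega>. \<omega> \<in> E \<Longrightarrow> Q (observed_history G act u t \<omega>) (snd \<omega> u)"
  shows "\<exists>D. (\<forall>h. D h \<in> sets \<mu>0 \<and> (\<forall>x\<in>D h. Q h x)) \<and> (\<forall>s. measure (given (pverts G) s) E =
    (\<Sum>h\<in>Pow (insert u (neighbors G u) \<times> {..<t}). history_prob (neighbors G) (pverts G) F s u t h (D h)))"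
proof -
  let ?V = "pverts G" and ?N = "neighbors G" and ?P = "Pow (insert u (neighbors G u) \<times> {..<t})"
  have G: "connected_undirected_graph G" using net by (simp add: network_def)
  obtain D0 where D0: "\<And>h. D0 h \<in> sets \<mu>0"
    "E = {\<omega>\<in>space (World ?V). snd \<omega> u \<in> D0 (observed_history G act u t \<omega>)}"
    using info_representation[OF E u] by blast
  define D where "D h = D0 h \<inter> {x\<in>space \<mu>0. Q h x}" for h
  have mD: "D h \<in> sets \<mu>0" for h using D0(1) mQ by (auto simp: D_def pred_def)
  define EE where "EE h = {\<omega>\<in>space (World ?V). observed_history G act u t \<omega> = h \<and> snd \<omega> u \<in> D h}" for h
  have mEE: "EE h \<in> sets (World ?V)" for h
    unfolding EE_def by (rule info_event_World[OF G ad u observed_event_info[OF net ad u mD]])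
  have fin: "finite ?P" using net u by (simp add: network_def)
  have "E = (\<Union>h\<in>?P. EE h)"
  proof (intro set_eqI iffI)
    fix \<omega> assume \<omega>: "\<omega> \<in> E"
    then have sp: "\<omega> \<in> space (World ?V)" by (simp add: D0(2))
    then have "snd \<omega> u \<in> space \<mu>0" using u by (auto simp: space_World)
    moreover have "observed_history G act u t \<omega> \<in> ?P" by (auto simp: observed_history_def)
    ultimately show "\<omega> \<in> (\<Union>h\<in>?P. EE h)" using \<omega> Q[OF \<omega>] sp by (auto simp: EE_def D_def D0(2))
  next
    fix \<omega> assume "\<omega> \<in> (\<Union>h\<in>?P. EE h)"
    then show "\<omega> \<in> E" by (auto simp: EE_def D_def D0(2))
  qed
  moreover have "disjoint_family_on EE ?P" by (auto simp: disjoint_family_on_def EE_def)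
  ultimately have "measure (given ?V s) E = (\<Sum>h\<in>?P. measure (given ?V s) (EE h))" for s
    using fin mEE by (subst given.finite_measure_finite_Union[symmetric]) auto
  then have "measure (given ?V s) E = (\<Sum>h\<in>?P. history_prob ?N ?V F s u t h (D h))" for s
    unfolding EE_def given_history_prob[OF net ad f u mD] .
  moreover have "D h \<in> sets \<mu>0 \<and> (\<forall>x\<in>D h. Q h x)" for h using mD by (auto simp: D_def)
  ultimately show ?thesis by blast
qed

lemma given_info_inequality:
  assumes "network d G" "adapted G act" "follows G act F" "u \<in> pverts G" "E \<in> sets (Info G act u (Suc t))"
    and "\<And>h. Measurable.pred \<mu>0 (Q h)" "\<And>\<omega>. \<omega> \<in> E \<Longrightarrow> Q (observed_history G act u t \<omega>) (snd \<omega> u)"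
    and ineq: "\<And>h D. D \<in> sets \<mu>0 \<Longrightarrow> \<forall>x\<in>D. Q h x \<Longrightarrow>
      a * history_prob (neighbors G) (pverts G) F s u t h D \<le> b * history_prob (neighbors G) (pverts G) F s' u t h D"
  shows "a * measure (given (pverts G) s) E \<le> b * measure (given (pverts G) s') E"
proof -
  obtain D where D: "\<forall>h. D h \<in> sets \<mu>0 \<and> (\<forall>x\<in>D h. Q h x)"
    "\<forall>s. measure (given (pverts G) s) E =
    (\<Sum>h\<in>Pow (insert u (neighbors G u) \<times> {..<t}). history_prob (neighbors G) (pverts G) F s u t h (D h))"
    using given_info_sum[where Q=Q, OF assms(1-7)] by blast
  show ?thesis
    unfolding D(2)[rule_format] sum_distrib_left
    by (intro sum_mono ineq) (use D(1) in auto)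
qed

text \<open>Actions start at time 1; the value at time 0 is a dummy.\<close>

definition run_action :: "nat pair_pre_digraph \<Rightarrow> (nat \<Rightarrow> nat \<Rightarrow> history \<Rightarrow> 'w \<Rightarrow> bool) \<Rightarrow> 'w action_process" where
  "run_action G F u t \<omega> \<longleftrightarrow>
     (case t of 0 \<Rightarrow> False | Suc t' \<Rightarrow> (u, t') \<in> run (neighbors G) (pverts G) (responses F (snd \<omega>)) (Suc t'))"

lemma run_action_follows: "follows G (run_action G F) F"
  by (simp add: follows_def run_action_def del: run.simps)

lemma run_action_adapted:
  assumes net: "network d G" and mF: "\<And>u t h. Measurable.pred \<mu>0 (F u t h)"
  shows "adapted G (run_action G F)"
proof -
  let ?V = "pverts G" and ?act = "run_action G F"
  have G: "connected_undirected_graph G" using net by (simp add: network_def)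
  have "{\<omega>\<in>space (World ?V). ?act u (Suc t) \<omega>} \<in> sets (Info G ?act u (Suc t))" if u: "u \<in> ?V" for u t
  proof (induction t rule: less_induct)
    case (less t)
    let ?P = "Pow (insert u (neighbors G u) \<times> {..<t})"
    have fin: "finite ?P" "finite (neighbors G u)" using net u by (simp_all add: network_def)
    have m: "{\<omega>\<in>space (World ?V). observed_history G ?act u t \<omega> = h} \<inter>
       {\<omega>\<in>space (World ?V). snd \<omega> u \<in> {x\<in>space \<mu>0. F u t h x}} \<in> sets (Info G ?act u (Suc t))" for h
      by (intro sets.Int history_event_info info_signal less fin predE mF)
    have "{\<omega>\<in>space (World ?V). ?act u (Suc t) \<omega>} = (\<Union>h\<in>?P. {\<omega>\<in>space (World ?V). observed_history G ?act u t \<omega> = h} \<inter>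
       {\<omega>\<in>space (World ?V). snd \<omega> u \<in> {x\<in>space \<mu>0. F u t h x}})" (is "_ = ?R")
    proof (intro set_eqI iffI)
      fix \<omega> assume "\<omega> \<in> {\<omega>\<in>space (World ?V). ?act u (Suc t) \<omega>}"
      moreover have "observed_history G ?act u t \<omega> \<in> ?P" by (auto simp: observed_history_def)
      ultimately show "\<omega> \<in> ?R" using follows_action[OF G run_action_follows u, of \<omega> F t] u by (auto simp: space_World)
    next
      fix \<omega> assume "\<omega> \<in> ?R"
      then show "\<omega> \<in> {\<omega>\<in>space (World ?V). ?act u (Suc t) \<omega>}"
        using follows_action[OF G run_action_follows u, of \<omega> F t] by auto
    qed
    also have "\<dots> \<in> sets (Info G ?act u (Suc t))" by (intro sets.finite_UN fin m)
    finally show ?case .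
  qed
  note Suc = this
  show ?thesis
    unfolding adapted_def
  proof (intro ballI allI impI)
    fix u t :: nat assume "u \<in> ?V" "1 \<le> t"
    then show "{\<omega>\<in>space (World ?V). ?act u t \<omega>} \<in> sets (Info G ?act u t)"
      using Suc[of u "t - 1"] by simp
  qed
qed

text \<open>The way back from rules to networks: optimality on the history events adds up to
  optimality on all information events.\<close>

lemma run_action_MAP:
  assumes net: "network d G" and mF: "\<And>u t h. Measurable.pred \<mu>0 (F u t h)"
    and MAP: "rule_MAP (neighbors G) (pverts G) F"
  shows "MAP_actions \<mu>0 \<mu>1 G (run_action G F)"
proof -
  let ?V = "pverts G" and ?act = "run_action G F"
  have G: "connected_undirected_graph G" using net by (simp add: network_def)
  have ad: "adapted G ?act" by (rule run_action_adapted[OF net mF])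
  have "((\<forall>\<omega>\<in>E. ?act u (Suc t) \<omega>) \<longrightarrow> measure (given ?V False) E \<le> measure (given ?V True) E) \<and>
     ((\<forall>\<omega>\<in>E. \<not> ?act u (Suc t) \<omega>) \<longrightarrow> measure (given ?V True) E \<le> measure (given ?V False) E)"
    if u: "u \<in> ?V" and E: "E \<in> sets (Info G ?act u (Suc t))" for u t E
  proof (intro conjI impI)
    have act: "?act u (Suc t) \<omega> \<longleftrightarrow> F u t (observed_history G ?act u t \<omega>) (snd \<omega> u)" if "\<omega> \<in> E" for \<omega>
      using follows_action[OF G run_action_follows u, of \<omega> F t] sets.sets_into_space[OF E] that by auto
    show "measure (given ?V False) E \<le> measure (given ?V True) E" if "\<forall>\<omega>\<in>E. ?act u (Suc t) \<omega>"
      using given_info_inequality[OF net ad run_action_follows u E, where Q="F u t" and a=1 and b=1 and s=False and s'=True]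
        mF act that MAP u by (auto simp: rule_MAP_def)
    show "measure (given ?V True) E \<le> measure (given ?V False) E" if "\<forall>\<omega>\<in>E. \<not> ?act u (Suc t) \<omega>"
      using given_info_inequality[OF net ad run_action_follows u E, where Q="\<lambda>h x. \<not> F u t h x" and a=1 and b=1 and s=True and s'=False]
        mF act that MAP u by (auto simp: rule_MAP_def)
  qed
  note Suc = this
  show ?thesis
    unfolding MAP_actions_iff[OF G]
  proof (rule conjI[OF ad], intro ballI allI impI)
    fix u t :: nat and E assume "u \<in> ?V" "1 \<le> t" "E \<in> sets (Info G ?act u t)"
    then show "((\<forall>\<omega>\<in>E. ?act u t \<omega>) \<longrightarrow> measure (given ?V False) E \<le> measure (given ?V True) E) \<and>
       ((\<forall>\<omega>\<in>E. \<not> ?act u t \<omega>) \<longrightarrow> measure (given ?V True) E \<le> measure (given ?V False) E)"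
      using Suc[of u E "t - 1"] by simp
  qed
qed

end

section \<open>Limits of threshold rules\<close>

context signal_pair
begin

text \<open>Off \<open>T\<close> the inequality passes to the limit on every piece. On a tie level
  only the whole level converges, but there the two laws are proportional: the inequality on the
  whole level says that the event is null or that \<open>y0 \<le> y1 * c\<close>, and either of
  these gives it on every subset of the level. The countably many pieces of \<open>D\<close> are
  then summed.\<close>

lemma limit_inequality:
  assumes conv: "bits_converge T f g" and K: "finite K"
    and dep: "\<And>b b'. (\<And>k. k \<in> K \<Longrightarrow> b k = b' k) \<Longrightarrow> \<Phi> b = \<Phi> b'"
    and x: "x0 \<longlonglongrightarrow> y0" "x1 \<longlonglongrightarrow> y1"
    and ineq: "\<And>e. e > 0 \<Longrightarrow> eventually (\<lambda>n. \<forall>D\<in>sets \<mu>0.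
      x0 n * measure \<mu>0 {x\<in>D. \<Phi> (\<lambda>k. f n k x)} \<le> x1 n * measure \<mu>1 {x\<in>D. \<Phi> (\<lambda>k. f n k x)} + e) sequentially"
    and D: "D \<in> sets \<mu>0"
  shows "y0 * measure \<mu>0 {x\<in>D. \<Phi> (\<lambda>k. g k x)} \<le> y1 * measure \<mu>1 {x\<in>D. \<Phi> (\<lambda>k. g k x)}"
proof -
  have T: "countable T" using conv by (simp add: bits_converge_def)
  note conv' = conv[unfolded bits_converge_def, THEN conjunct2, rule_format, OF K, of \<Phi>]
  have dep': "\<And>b b'. \<forall>k\<in>K. b k = b' k \<Longrightarrow> \<Phi> b = \<Phi> b'" using dep by blast
  have mg: "{x\<in>space \<mu>0. \<Phi> (\<lambda>k. g k x)} \<in> sets \<mu>0" using conv'[OF dep'] by blast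
  have off: "(\<lambda>n. measure (sig s) {x\<in>D. \<Phi> (\<lambda>k. f n k x)}) \<longlonglongrightarrow> measure (sig s) {x\<in>D. \<Phi> (\<lambda>k. g k x)}"
    if "D \<in> sets \<mu>0" "\<forall>x\<in>D. lr x \<notin> T" for s D
    using conv'[OF dep'] that by blast
  have on: "(\<lambda>n. measure (sig s) {x\<in>space \<mu>0. lr x = c \<and> \<Phi> (\<lambda>k. f n k x)})
            \<longlonglongrightarrow> measure (sig s) {x\<in>space \<mu>0. lr x = c \<and> \<Phi> (\<lambda>k. g k x)}" if "c \<in> T" for s c
    using conv'[OF dep'] that by blast
  have lim: "y0 * m0 \<le> y1 * m1" if D: "D \<in> sets \<mu>0"
    and m: "(\<lambda>n. measure \<mu>0 {x\<in>D. \<Phi> (\<lambda>k. f n k x)}) \<longlonglongrightarrow> m0" "(\<lambda>n. measure \<mu>1 {x\<in>D. \<Phi> (\<lambda>k. f n k x)}) \<longlonglongrightarrow> m1" for D m0 m1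
  proof (rule field_le_epsilon)
    fix e :: real assume "e > 0"
    show "y0 * m0 \<le> y1 * m1 + e"
    proof (rule tendsto_le[OF sequentially_bot])
      show "(\<lambda>n. x0 n * measure \<mu>0 {x\<in>D. \<Phi> (\<lambda>k. f n k x)}) \<longlonglongrightarrow> y0 * m0" by (intro tendsto_mult x m)
      show "(\<lambda>n. x1 n * measure \<mu>1 {x\<in>D. \<Phi> (\<lambda>k. f n k x)} + e) \<longlonglongrightarrow> y1 * m1 + e"
        by (intro tendsto_add tendsto_mult x m tendsto_const)
      show "\<forall>\<^sub>F n in sequentially. x0 n * measure \<mu>0 {x\<in>D. \<Phi> (\<lambda>k. f n k x)} \<le> x1 n * measure \<mu>1 {x\<in>D. \<Phi> (\<lambda>k. f n k x)} + e"
        using ineq[OF \<open>e > 0\<close>] by eventually_elim (use D in blast)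
    qed
  qed
  have mD: "{x\<in>D'. \<Phi> (\<lambda>k. g k x)} \<in> sets \<mu>0" if "D' \<in> sets \<mu>0" for D'
  proof -
    have "{x\<in>D'. \<Phi> (\<lambda>k. g k x)} = D' \<inter> {x\<in>space \<mu>0. \<Phi> (\<lambda>k. g k x)}" using sets.sets_into_space[OF that] by auto
    then show ?thesis using mg that by auto
  qed
  have le_off: "y0 * measure \<mu>0 {x\<in>D'. \<Phi> (\<lambda>k. g k x)} \<le> y1 * measure \<mu>1 {x\<in>D'. \<Phi> (\<lambda>k. g k x)}"
    if "D' \<in> sets \<mu>0" "\<forall>x\<in>D'. lr x \<notin> T" for D'
    using lim[OF that(1)] off[OF that, of False] off[OF that, of True] by simp
  have le_on: "y0 * measure \<mu>0 {x\<in>D'. \<Phi> (\<lambda>k. g k x)} \<le> y1 * measure \<mu>1 {x\<in>D'. \<Phi> (\<lambda>k. g k x)}"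
    if D': "D' \<in> sets \<mu>0" "\<forall>x\<in>D'. lr x = c" and c: "c \<in> T" for D' c
  proof -
    let ?E = "{x\<in>space \<mu>0. lr x = c}"
    have eq: "{x\<in>space \<mu>0. lr x = c \<and> R x} = {x\<in>?E. R x}" for R by auto
    have "y0 * measure \<mu>0 {x\<in>?E. \<Phi> (\<lambda>k. g k x)} \<le> y1 * measure \<mu>1 {x\<in>?E. \<Phi> (\<lambda>k. g k x)}"
      using lim[of ?E] on[OF c, of False] on[OF c, of True] unfolding eq by simp
    also have "measure \<mu>1 {x\<in>?E. \<Phi> (\<lambda>k. g k x)} = c * measure \<mu>0 {x\<in>?E. \<Phi> (\<lambda>k. g k x)}"
      by (rule lr_const[OF mD]) auto
    finally have "measure \<mu>0 {x\<in>?E. \<Phi> (\<lambda>k. g k x)} = 0 \<or> y0 \<le> y1 * c"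
      using measure_nonneg[of \<mu>0 "{x\<in>?E. \<Phi> (\<lambda>k. g k x)}"]
        mult_le_cancel_right_pos[of "measure \<mu>0 {x\<in>?E. \<Phi> (\<lambda>k. g k x)}" y0 "y1 * c"]
      by (cases "measure \<mu>0 {x\<in>?E. \<Phi> (\<lambda>k. g k x)} = 0") (simp_all add: mult.assoc order_less_le)
    moreover have "measure \<mu>0 {x\<in>D'. \<Phi> (\<lambda>k. g k x)} \<le> measure \<mu>0 {x\<in>?E. \<Phi> (\<lambda>k. g k x)}"
      using D' sets.sets_into_space[OF D'(1)] by (intro M0.finite_measure_mono mD) auto
    ultimately have "y0 * measure \<mu>0 {x\<in>D'. \<Phi> (\<lambda>k. g k x)} \<le> (y1 * c) * measure \<mu>0 {x\<in>D'. \<Phi> (\<lambda>k. g k x)}"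
      using measure_nonneg[of \<mu>0 "{x\<in>D'. \<Phi> (\<lambda>k. g k x)}"] by (auto intro: mult_right_mono simp: measure_le_0_iff)
    moreover have "measure \<mu>1 {x\<in>D'. \<Phi> (\<lambda>k. g k x)} = c * measure \<mu>0 {x\<in>D'. \<Phi> (\<lambda>k. g k x)}"
      by (rule lr_const[OF mD[OF D'(1)]]) (use D' in auto)
    ultimately show ?thesis by (simp add: mult.assoc)
  qed
  \<comment> \<open>Piece 0 lies off \<open>T\<close>, and piece \<open>j + 1\<close> is the part of
    \<open>D\<close> on the level of the tie value with number \<open>j\<close>.\<close>
  define C where "C k = (case k of 0 \<Rightarrow> {x\<in>D. lr x \<notin> T} | Suc j \<Rightarrow> {x\<in>D. lr x \<in> T \<and> to_nat_on T (lr x) = j})" for k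
  have C_Suc: "C (Suc j) = (if j \<in> to_nat_on T ` T then {x\<in>D. lr x = the_inv_into T (to_nat_on T) j} else {})" for j
    using inj_on_to_nat_on[OF T] by (auto simp: C_def the_inv_into_f_f inj_on_eq_iff)
  have m_lr: "{x\<in>D. lr x = c} \<in> sets \<mu>0" for c
  proof -
    have "{x\<in>D. lr x = c} = D \<inter> {x\<in>space \<mu>0. lr x = c}" using sets.sets_into_space[OF D] by auto
    then show ?thesis using D by simp
  qed
  have mC: "C k \<in> sets \<mu>0" for k
  proof (cases k)
    case 0
    have "(\<Union>c\<in>T. {x\<in>D. lr x = c}) \<in> sets \<mu>0" using T m_lr by (intro sets.countable_UN'') auto
    moreover have "C 0 = D - (\<Union>c\<in>T. {x\<in>D. lr x = c})" by (auto simp: C_def)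
    ultimately show ?thesis using 0 D by auto
  next
    case (Suc j)
    then show ?thesis using C_Suc[of j] m_lr by simp
  qed
  have D_eq: "(\<Union>k. {x\<in>C k. \<Phi> (\<lambda>k. g k x)}) = {x\<in>D. \<Phi> (\<lambda>k. g k x)}"
  proof -
    have "\<exists>k. x \<in> C k" if "x \<in> D" for x
      using that by (cases "lr x \<in> T") (auto simp: C_def intro: exI[of _ 0] exI[of _ "Suc (to_nat_on T (lr x))"])
    moreover have "C k \<subseteq> D" for k by (auto simp: C_def split: nat.splits)
    ultimately show ?thesis by blast
  qed
  have disj: "disjoint_family (\<lambda>k. {x\<in>C k. \<Phi> (\<lambda>k. g k x)})"
    by (auto simp: disjoint_family_on_def C_def split: nat.splits)
  have sums: "(\<lambda>k. measure (sig s) {x\<in>C k. \<Phi> (\<lambda>k. g k x)}) sums measure (sig s) {x\<in>D. \<Phi> (\<lambda>k. g k x)}" for s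
    unfolding D_eq[symmetric] using mD[OF mC] disj by (intro sig.finite_measure_UNION) auto
  have "y0 * measure \<mu>0 {x\<in>C k. \<Phi> (\<lambda>k. g k x)} \<le> y1 * measure \<mu>1 {x\<in>C k. \<Phi> (\<lambda>k. g k x)}" for k
  proof (cases k)
    case 0
    then show ?thesis using le_off[OF mC[of 0]] by (auto simp: C_def)
  next
    case (Suc j)
    show ?thesis
    proof (cases "j \<in> to_nat_on T ` T")
      case True
      then have "the_inv_into T (to_nat_on T) j \<in> T"
        using inj_on_to_nat_on[OF T] by (auto simp: the_inv_into_f_f)
      then show ?thesis using le_on[OF mC[of k]] Suc C_Suc[of j] True by auto
    next
      case False
      then show ?thesis using C_Suc[of j] Suc by simp
    qed
  qed
  then show ?thesis
    using sums_le[OF _ sums_mult[OF sums[of False], of y0] sums_mult[OF sums[of True], of y1]] by simp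
qed

text \<open>Bits at infinite histories are masked by \<open>finite (snd p)\<close>: such histories
  have probability 0 in locally finite networks and would make the set of indices uncountable. One
  set \<open>T\<close> serves all agents.\<close>

definition rules_converge ::
  "real set \<Rightarrow> (nat \<Rightarrow> nat \<Rightarrow> nat \<Rightarrow> history \<Rightarrow> 'w \<Rightarrow> bool) \<Rightarrow> (nat \<Rightarrow> nat \<Rightarrow> history \<Rightarrow> 'w \<Rightarrow> bool) \<Rightarrow> bool" where
  "rules_converge T F F' \<longleftrightarrow> (\<forall>v t h. Measurable.pred \<mu>0 (F' v t h)) \<and> (\<forall>v.
     bits_converge T (\<lambda>n (p :: nat \<times> history) x. finite (snd p) \<and> F n v (fst p) (snd p) x)
       (\<lambda>p x. finite (snd p) \<and> F' v (fst p) (snd p) x))"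

text \<open>Limits of bits were constructed for bits numbered by natural numbers. This carries them
  over to bits indexed by times and histories, with a mask \<open>R\<close>.\<close>

lemma bits_converge_reindex:
  fixes f :: "nat \<Rightarrow> nat \<Rightarrow> 'w \<Rightarrow> bool" and e :: "'k \<Rightarrow> nat"
  assumes "bits_converge T f g"
  shows "bits_converge T (\<lambda>n p x. R p \<and> f n (e p) x) (\<lambda>p x. R p \<and> g (e p) x)"
  unfolding bits_converge_def
proof (intro conjI[OF _ allI] allI impI)
  show "countable T" using assms by (simp add: bits_converge_def)
  fix \<Phi> :: "('k \<Rightarrow> bool) \<Rightarrow> bool" and K :: "'k set"
  assume K: "finite K" and dep: "\<forall>b b'. (\<forall>k\<in>K. b k = b' k) \<longrightarrow> \<Phi> b = \<Phi> b'"
  have "\<forall>b b'. (\<forall>k\<in>e ` K. b k = b' k) \<longrightarrow> \<Phi> (\<lambda>p. R p \<and> b (e p)) = \<Phi> (\<lambda>p. R p \<and> b' (e p))"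
  proof (intro allI impI)
    fix b b' :: "nat \<Rightarrow> bool" assume "\<forall>k\<in>e ` K. b k = b' k"
    then have "\<forall>k\<in>K. (\<lambda>p. R p \<and> b (e p)) k = (\<lambda>p. R p \<and> b' (e p)) k" by simp
    then show "\<Phi> (\<lambda>p. R p \<and> b (e p)) = \<Phi> (\<lambda>p. R p \<and> b' (e p))"
      by (rule dep[THEN spec[of _ "\<lambda>p. R p \<and> b (e p)"], THEN spec[of _ "\<lambda>p. R p \<and> b' (e p)"], THEN mp])
  qed
  from assms[unfolded bits_converge_def, THEN conjunct2, THEN spec[of _ "\<lambda>b. \<Phi> (\<lambda>p. R p \<and> b (e p))"],
      THEN spec[of _ "e ` K"], THEN mp, OF finite_imageI[OF K], THEN mp, OF this]
  show "{x\<in>space \<mu>0. \<Phi> (\<lambda>k. R k \<and> g (e k) x)} \<in> sets \<mu>0 \<and>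
       (\<forall>s. (\<lambda>n. measure (sig s) {x\<in>space \<mu>0. \<Phi> (\<lambda>k. R k \<and> f n (e k) x)}) \<longlonglongrightarrow> measure (sig s) {x\<in>space \<mu>0. \<Phi> (\<lambda>k. R k \<and> g (e k) x)}) \<and>
       (\<forall>s D. D \<in> sets \<mu>0 \<longrightarrow> (\<forall>x\<in>D. lr x \<notin> T) \<longrightarrow>
         (\<lambda>n. measure (sig s) {x\<in>D. \<Phi> (\<lambda>k. R k \<and> f n (e k) x)}) \<longlonglongrightarrow> measure (sig s) {x\<in>D. \<Phi> (\<lambda>k. R k \<and> g (e k) x)}) \<and>
       (\<forall>s c. c \<in> T \<longrightarrow>
         (\<lambda>n. measure (sig s) {x\<in>space \<mu>0. lr x = c \<and> \<Phi> (\<lambda>k. R k \<and> f n (e k) x)})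
            \<longlonglongrightarrow> measure (sig s) {x\<in>space \<mu>0. lr x = c \<and> \<Phi> (\<lambda>k. R k \<and> g (e k) x)})"
    .
qed

lemma pattern_set_converge:
  assumes conv: "rules_converge T F F'" and K: "finite K" "K \<subseteq> {(v, t, h). finite h}"
  shows "(\<lambda>n. measure (sig s) (pattern_set (F n) K S v)) \<longlonglongrightarrow> measure (sig s) (pattern_set F' K S v)"
proof -
  let ?K = "{p. (v, p) \<in> K}"
  define \<Phi> where "\<Phi> b \<longleftrightarrow> (\<forall>p\<in>?K. b p \<longleftrightarrow> (v, p) \<in> S)" for b :: "nat \<times> history \<Rightarrow> bool"
  have fK: "finite ?K" by (rule finite_subset[of _ "snd ` K"]) (use K in \<open>force+\<close>)
  have dep: "\<forall>b b'. (\<forall>k\<in>?K. b k = b' k) \<longrightarrow> \<Phi> b = \<Phi> b'" by (auto simp: \<Phi>_def)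
  have eq: "pattern_set F0 K S v = {x\<in>space \<mu>0. \<Phi> (\<lambda>p. finite (snd p) \<and> F0 v (fst p) (snd p) x)}" for F0
  proof -
    have fin: "finite h" if "(v, t, h) \<in> K" for t h using that K(2) by auto
    show ?thesis unfolding pattern_set_def \<Phi>_def by (rule Collect_cong) (auto simp: fin)
  qed
  have "bits_converge T (\<lambda>n (p :: nat \<times> history) x. finite (snd p) \<and> F n v (fst p) (snd p) x)
       (\<lambda>p x. finite (snd p) \<and> F' v (fst p) (snd p) x)" using conv by (simp add: rules_converge_def)
  from this[unfolded bits_converge_def, THEN conjunct2, rule_format, OF fK, of \<Phi>] dep
  show ?thesis unfolding eq by blast
qed

text \<open>By \<open>prob_determined\<close> the probabilities are eventually one fixed finite sum
  of finite products of single-signal probabilities, and each factor converges.\<close>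

lemma prob_determined_converge:
  assumes conv: "rules_converge T F F'" and mF: "\<And>n v t h. Measurable.pred \<mu>0 (F n v t h)"
    and K: "finite K" "K \<subseteq> {(v, t, h). v \<in> V' \<and> finite h}" and det: "determined_by K \<Phi>"
    and V: "\<And>v. v \<in> V' \<Longrightarrow> eventually (\<lambda>n. v \<in> V n) sequentially"
    and \<Phi>: "eventually (\<lambda>n. \<forall>b. \<Phi>n n b = \<Phi> b) sequentially"
  shows "(\<lambda>n. measure (signals (V n) s) {w\<in>space (signals (V n) s). \<Phi>n n (responses (F n) w)})
    \<longlonglongrightarrow> measure (signals V' s) {w\<in>space (signals V' s). \<Phi> (responses F' w)}"
proof -
  let ?f = "\<lambda>F. \<Sum>S\<in>{S\<in>Pow K. \<Phi> (\<lambda>v t h. (v, t, h) \<in> S)}. \<Prod>v\<in>fst ` K. measure (sig s) (pattern_set F K S v)"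
  have mF': "Measurable.pred \<mu>0 (F' v t h)" for v t h using conv by (simp add: rules_converge_def)
  have "eventually (\<lambda>n. \<forall>v\<in>fst ` K. v \<in> V n) sequentially"
    using K V by (intro eventually_ball_finite) auto
  with \<Phi> have "eventually (\<lambda>n. measure (signals (V n) s) {w\<in>space (signals (V n) s). \<Phi>n n (responses (F n) w)} = ?f (F n)) sequentially"
  proof eventually_elim
    case (elim n)
    have "K \<subseteq> {(v, t, h). v \<in> V n}" using elim(2) by force
    from prob_determined(1)[where F="F n" and s=s, OF K(1) this det mF] elim(1) show ?case by simp
  qed
  moreover have "(\<lambda>n. ?f (F n)) \<longlonglongrightarrow> ?f F'"
    using K by (intro tendsto_sum tendsto_prod pattern_set_converge[OF conv]) auto
  moreover have "measure (signals V' s) {w\<in>space (signals V' s). \<Phi> (responses F' w)} = ?f F'"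
    using K by (intro prob_determined(1)[OF _ _ det mF']) auto
  ultimately show ?thesis by (simp add: tendsto_cong)
qed

text \<open>The limits of the thresholds determine the countable set \<open>T\<close> of possible
  ties. A subsequence then makes the laws of all bit prefixes converge on every tie level, for all
  agents at once.\<close>

lemma exists_limit_rule:
  assumes mF: "\<And>n v t h. Measurable.pred \<mu>0 (F n v t h)" and thr: "\<And>n. threshold_rule (F n) (q n)"
    and q: "\<And>v t h. finite h \<Longrightarrow> convergent (\<lambda>n. q n v t h)"
  shows "\<exists>r T F'. strict_mono r \<and> rules_converge T (\<lambda>n. F (r n)) F'"
proof -
  define ql where "ql v t h = lim (\<lambda>n. q n v t h)" for v t h
  have ql: "(\<lambda>n. q n v t h) \<longlonglongrightarrow> ql v t h" if "finite h" for v t h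
    using q[OF that] by (simp add: ql_def convergent_LIMSEQ_iff)
  define S where "S = (UNIV :: nat set) \<times> Collect (finite :: history \<Rightarrow> bool)"
  have S: "countable S" unfolding S_def by (intro countable_SIGMA countable_Collect_finite) auto
  have S0: "(0, {}) \<in> S" by (simp add: S_def)
  then have S_ne: "S \<noteq> {}" by blast
  define de where "de = from_nat_into S"
  define en where "en = to_nat_on S"
  have de_S: "de k \<in> S" for k using S_ne by (simp add: de_def from_nat_into)
  have de_en: "de (en p) = p" if "p \<in> S" for p using S that by (simp add: de_def en_def)
  have de_fin: "finite (snd (de k))" for k using de_S[of k] by (auto simp: S_def)
  \<comment> \<open>For a limit 1 the quotient is 0 by division by zero; but then no tie can occur,
    as it would read \<open>0 = 1\<close>.\<close>
  define T where "T = (\<lambda>(v, p). ql v (fst p) (snd p) / (1 - ql v (fst p) (snd p))) ` (UNIV \<times> S)"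
  have T: "countable T" unfolding T_def using S by (intro countable_image countable_SIGMA) auto
  define f where "f n v k x = F n v (fst (de k)) (snd (de k)) x" for n v k x
  have mf [measurable]: "Measurable.pred \<mu>0 (f n v k)" for n v k unfolding f_def by (rule mF)
  let ?X = "\<lambda>n (v, c, s). measure \<mu>0 {x\<in>space \<mu>0. lr x = c \<and> rprefix (\<lambda>k. f n v k x) (length s) = s}"
  have "\<exists>r. strict_mono r \<and> (\<forall>i\<in>UNIV \<times> T \<times> UNIV. convergent (\<lambda>n. ?X (r n) i))"
    using T by (intro subseq_convergent_countable[where B=1] countable_SIGMA) auto
  then obtain r where r: "strict_mono r" and conv: "\<And>v c s. c \<in> T \<Longrightarrow>
      convergent (\<lambda>n. measure \<mu>0 {x\<in>space \<mu>0. lr x = c \<and> rprefix (\<lambda>k. f (r n) v k x) (length s) = s})" by fastforce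
  have "\<exists>g. (\<forall>k. Measurable.pred \<mu>0 (g k)) \<and> bits_converge T (\<lambda>n. f (r n) v) g" for v
  proof -
    let ?q = "\<lambda>n k. q n v (fst (de k)) (snd (de k))"
    have "\<exists>g. (\<forall>k. Measurable.pred \<mu>0 (g k)) \<and>
      (\<forall>x\<in>space \<mu>0. lr x \<notin> T \<longrightarrow> (\<forall>k. eventually (\<lambda>n. f (r n) v k x = g k x) sequentially)) \<and>
      (\<forall>c\<in>T. \<forall>s. (\<lambda>n. measure \<mu>0 {x\<in>space \<mu>0. lr x = c \<and> rprefix (\<lambda>k. f (r n) v k x) (length s) = s})
       \<longlonglongrightarrow> measure \<mu>0 {x\<in>space \<mu>0. lr x = c \<and> rprefix (\<lambda>k. g k x) (length s) = s})"
    proof (rule exists_limit_rule_bits[where q="\<lambda>n. ?q (r n)" and ql="\<lambda>k. ql v (fst (de k)) (snd (de k))"])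
      show "f (r n) v k x" if "x \<in> space \<mu>0" "?q (r n) k < (1 - ?q (r n) k) * lr x" for n k x
        using thr[of "r n"] that by (simp add: threshold_rule_def f_def)
      show "\<not> f (r n) v k x" if "x \<in> space \<mu>0" "(1 - ?q (r n) k) * lr x < ?q (r n) k" for n k x
        using thr[of "r n"] that by (simp add: threshold_rule_def f_def)
      show "(\<lambda>n. ?q (r n) k) \<longlonglongrightarrow> ql v (fst (de k)) (snd (de k))" for k
        using LIMSEQ_subseq_LIMSEQ[OF ql[OF de_fin] r] by (simp add: o_def)
      show "lr x \<in> T" if "(1 - ql v (fst (de k)) (snd (de k))) * lr x = ql v (fst (de k)) (snd (de k))" for k x
      proof -
        have "1 - ql v (fst (de k)) (snd (de k)) \<noteq> 0" using that by auto
        then have "lr x = (\<lambda>(v, p). ql v (fst p) (snd p) / (1 - ql v (fst p) (snd p))) (v, de k)"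
          using that by (simp add: field_simps)
        then show ?thesis unfolding T_def using de_S[of k] by (intro image_eqI) auto
      qed
    qed (use T conv in simp_all)
    then obtain g where mg: "\<And>k. Measurable.pred \<mu>0 (g k)"
      and g1: "\<And>x k. x \<in> space \<mu>0 \<Longrightarrow> lr x \<notin> T \<Longrightarrow> eventually (\<lambda>n. f (r n) v k x = g k x) sequentially"
      and g2: "\<And>c s. c \<in> T \<Longrightarrow> (\<lambda>n. measure \<mu>0 {x\<in>space \<mu>0. lr x = c \<and> rprefix (\<lambda>k. f (r n) v k x) (length s) = s})
       \<longlonglongrightarrow> measure \<mu>0 {x\<in>space \<mu>0. lr x = c \<and> rprefix (\<lambda>k. g k x) (length s) = s}" by blast
    have "bits_converge T (\<lambda>n. f (r n) v) g"
      by (rule bits_convergeI[OF mf mg T g1 g2])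
    with mg show ?thesis by blast
  qed
  then have "\<forall>v. \<exists>g. (\<forall>k. Measurable.pred \<mu>0 (g k)) \<and> bits_converge T (\<lambda>n. f (r n) v) g" by blast
  from choice[OF this] obtain g where g: "\<forall>v. (\<forall>k. Measurable.pred \<mu>0 (g v k)) \<and> bits_converge T (\<lambda>n. f (r n) v) (g v)" ..
  define F' where "F' v t h x = g v (en (t, h)) x" for v t h x
  have "rules_converge T (\<lambda>n. F (r n)) F'"
    unfolding rules_converge_def
  proof (intro conjI allI)
    have "F' v t h = g v (en (t, h))" for v t h by (rule ext) (simp add: F'_def)
    then show "Measurable.pred \<mu>0 (F' v t h)" for v t h using g by simp
    fix v
    have "bits_converge T (\<lambda>n p x. finite (snd p) \<and> f (r n) v (en p) x) (\<lambda>p x. finite (snd p) \<and> g v (en p) x)"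
      by (rule bits_converge_reindex) (use g in blast)
    moreover have "(\<lambda>n p x. finite (snd p) \<and> f (r n) v (en p) x) = (\<lambda>n p x. finite (snd p) \<and> F (r n) v (fst p) (snd p) x)"
      by (intro ext conj_cong refl) (simp add: f_def de_en S_def mem_Times_iff)
    ultimately show "bits_converge T (\<lambda>n p x. finite (snd p) \<and> F (r n) v (fst p) (snd p) x)
       (\<lambda>p x. finite (snd p) \<and> F' v (fst p) (snd p) x)" by (simp add: F'_def)
  qed
  with r show ?thesis by blast
qed

end

section \<open>Limits of rooted graphs\<close>

text \<open>As the balls are labelled from finite sets \<open>L k\<close> that do not depend on the graph, they converge
  along a subsequence of any sequence of labelled graphs.\<close>

definition labelled_graph :: "nat \<Rightarrow> (nat \<Rightarrow> nat set) \<Rightarrow> nat \<Rightarrow> nat set \<Rightarrow> (nat \<Rightarrow> nat set) \<Rightarrow> bool" where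
  "labelled_graph d L r V N \<longleftrightarrow> r \<in> V \<and> (\<forall>u v. v \<in> N u \<longrightarrow> u \<in> V \<and> v \<in> V \<and> v \<noteq> u \<and> u \<in> N v) \<and>
     (\<forall>v\<in>V. finite (N v) \<and> card (N v) \<le> d) \<and> (\<forall>k. nball N k r = V \<inter> L k) \<and> V \<subseteq> (\<Union>k. L k)"

lemma labelled_graph_locally_finite: "labelled_graph d L r V N \<Longrightarrow> locally_finite V N"
  by (auto simp: labelled_graph_def locally_finite_def)

lemma eventually_const_on_finite:
  assumes "\<And>v. eventually (\<lambda>n. v \<in> A n) sequentially \<or> eventually (\<lambda>n. v \<notin> A n) sequentially" and "finite B"
  shows "eventually (\<lambda>n. A n \<inter> B = {v. eventually (\<lambda>n. v \<in> A n) sequentially} \<inter> B) sequentially"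
proof -
  have "eventually (\<lambda>n. v \<in> A n \<longleftrightarrow> eventually (\<lambda>n. v \<in> A n) sequentially) sequentially" for v
  proof (cases "eventually (\<lambda>n. v \<in> A n) sequentially")
    case True
    then show ?thesis by eventually_elim (simp add: True)
  next
    case False
    then have "eventually (\<lambda>n. v \<notin> A n) sequentially" using assms(1) by blast
    then show ?thesis by eventually_elim (simp add: False)
  qed
  then have "eventually (\<lambda>n. \<forall>v\<in>B. v \<in> A n \<longleftrightarrow> eventually (\<lambda>n. v \<in> A n) sequentially) sequentially"
    using assms(2) by (intro eventually_ball_finite) auto
  then show ?thesis by eventually_elim auto
qed

text \<open>Neighbours of a vertex in \<open>L k\<close> lie in the finite set
  \<open>L (Suc k)\<close>, so eventual constancy of the single edges makes whole neighbourhoods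
  stabilise. The limit is infinite: inside some \<open>L K\<close> its balls would have stopped
  growing at radius \<open>K\<close>, and then so would those of the approximating graphs, against
  \<open>far\<close>.\<close>

lemma limit_graph:
  assumes lab: "\<And>n. labelled_graph d L r (V n) (N n)" and L: "\<And>k. finite (L k)" "mono L"
    and convV: "\<And>v. eventually (\<lambda>n. v \<in> V n) sequentially \<or> eventually (\<lambda>n. v \<notin> V n) sequentially"
    and convN: "\<And>v w. eventually (\<lambda>n. w \<in> N n v) sequentially \<or> eventually (\<lambda>n. w \<notin> N n v) sequentially"
    and far: "\<And>k. eventually (\<lambda>n. \<not> V n \<subseteq> L k) sequentially"
  defines "V' \<equiv> {v. eventually (\<lambda>n. v \<in> V n) sequentially}"
    and "N' \<equiv> \<lambda>v. {w. eventually (\<lambda>n. w \<in> N n v) sequentially}"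
  shows "labelled_graph d L r V' N'" "infinite V'" "v \<in> V' \<Longrightarrow> eventually (\<lambda>n. N n v = N' v) sequentially"
proof -
  have Nn: "w \<in> N n v \<Longrightarrow> v \<in> V n \<and> w \<in> V n \<and> w \<noteq> v \<and> v \<in> N n w" for n v w
    using lab[of n] unfolding labelled_graph_def by blast
  have ball: "nball (N n) k r = V n \<inter> L k" for n k
    using lab[of n] unfolding labelled_graph_def by blast
  have cover: "V n \<subseteq> (\<Union>k. L k)" for n using lab[of n] unfolding labelled_graph_def by blast
  have evV: "eventually (\<lambda>n. V n \<inter> L k = V' \<inter> L k) sequentially" for k
    unfolding V'_def by (rule eventually_const_on_finite[OF convV L(1)])
  have V'_cover: "v \<in> V' \<Longrightarrow> \<exists>k. v \<in> L k" for v
    using eventually_happens'[OF sequentially_bot, of "\<lambda>n. v \<in> V n"] cover unfolding V'_def by blast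
  show evN: "eventually (\<lambda>n. N n v = N' v) sequentially" if v: "v \<in> V'" for v
  proof -
    obtain k where k: "v \<in> L k" using V'_cover[OF v] by blast
    have sub: "N n v \<subseteq> L (Suc k)" for n
    proof
      fix w assume w: "w \<in> N n v"
      then have "v \<in> nball (N n) k r" using ball k Nn by blast
      with w have "w \<in> nball (N n) (Suc k) r" by auto
      then show "w \<in> L (Suc k)" unfolding ball by blast
    qed
    have "N' v \<subseteq> L (Suc k)"
      using eventually_happens'[OF sequentially_bot, of "\<lambda>n. _ \<in> N n v"] sub unfolding N'_def by blast
    moreover have "eventually (\<lambda>n. N n v \<inter> L (Suc k) = N' v \<inter> L (Suc k)) sequentially"
      unfolding N'_def by (rule eventually_const_on_finite[OF convN L(1)])
    ultimately show ?thesis using sub by (auto elim!: eventually_mono simp: Int_absorb2)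
  qed
  have N': "v \<in> V' \<and> w \<in> V' \<and> w \<noteq> v \<and> v \<in> N' w" if "w \<in> N' v" for v w
  proof -
    have ev: "eventually (\<lambda>n. w \<in> N n v) sequentially" using that by (simp add: N'_def)
    then have "w \<noteq> v" using eventually_happens'[OF sequentially_bot ev] Nn by blast
    moreover have "v \<in> V'" unfolding V'_def mem_Collect_eq using ev by (rule eventually_mono) (use Nn in blast)
    moreover have "w \<in> V'" unfolding V'_def mem_Collect_eq using ev by (rule eventually_mono) (use Nn in blast)
    moreover have "v \<in> N' w" unfolding N'_def mem_Collect_eq using ev by (rule eventually_mono) (use Nn in blast)
    ultimately show ?thesis by blast
  qed
  have r: "r \<in> V'" using lab by (simp add: V'_def labelled_graph_def)
  have sub': "nball N' k r \<subseteq> V'" for k using N' r by (intro nball_subset) auto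
  have evball: "eventually (\<lambda>n. nball (N n) k r = nball N' k r) sequentially \<and> finite (nball N' k r)" for k
  proof (induction k)
    case (Suc k)
    have "eventually (\<lambda>n. \<forall>v\<in>nball N' k r. N n v = N' v) sequentially"
      using Suc evN sub' by (intro eventually_ball_finite) blast+
    with Suc[THEN conjunct1] have ev: "eventually (\<lambda>n. nball (N n) (Suc k) r = nball N' (Suc k) r) sequentially"
      by eventually_elim simp
    from eventually_happens'[OF sequentially_bot this] obtain n where "nball (N n) (Suc k) r = nball N' (Suc k) r" by blast
    then have "finite (nball N' (Suc k) r)" using ball[of n "Suc k"] L(1)[of "Suc k"] by simp
    with ev show ?case by blast
  qed simp
  have ball': "nball N' k r = V' \<inter> L k" for k
  proof -
    from evball[of k] have "eventually (\<lambda>n. nball (N n) k r = nball N' k r) sequentially" by blast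
    with evV[of k] have "eventually (\<lambda>n. nball N' k r = V' \<inter> L k) sequentially"
      by eventually_elim (use ball in auto)
    then show ?thesis by simp
  qed
  have "finite (N' v) \<and> card (N' v) \<le> d" if "v \<in> V'" for v
  proof -
    have "eventually (\<lambda>n. v \<in> V n) sequentially" using that by (simp add: V'_def)
    with evN[OF that] have "eventually (\<lambda>n. N n v = N' v \<and> v \<in> V n) sequentially" by (rule eventually_conj)
    from eventually_happens'[OF sequentially_bot this] obtain n where "N n v = N' v" "v \<in> V n" by blast
    have "\<forall>v\<in>V n. finite (N n v) \<and> card (N n v) \<le> d" using lab[of n] by (simp add: labelled_graph_def)
    from bspec[OF this \<open>v \<in> V n\<close>] \<open>N n v = N' v\<close> show ?thesis by simp
  qed
  note deg = this
  show "labelled_graph d L r V' N'"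
    unfolding labelled_graph_def
  proof (intro conjI allI ballI impI subsetI r ball')
    show "finite (N' v)" "card (N' v) \<le> d" if "v \<in> V'" for v using deg[OF that] by simp_all
    show "v \<in> (\<Union>k. L k)" if "v \<in> V'" for v using V'_cover[OF that] by simp
  qed (use N' in blast)+
  show "infinite V'"
  proof
    assume fin: "finite V'"
    have "\<exists>K. V' \<subseteq> L K"
      using fin V'_cover
    proof (induction V')
      case (insert x A)
      then obtain K k where "A \<subseteq> L K" "x \<in> L k" by blast
      then have "insert x A \<subseteq> L (max K k)" using monoD[OF L(2), of K "max K k"] monoD[OF L(2), of k "max K k"] by auto
      then show ?case by blast
    qed simp
    then obtain K where K: "V' \<subseteq> L K" by blast
    then have eq: "nball N' (Suc K) r = nball N' K r" unfolding ball' using monoD[OF L(2), of K "Suc K"] by auto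
    have "eventually (\<lambda>n. nball (N n) (Suc K) r = nball N' (Suc K) r) sequentially"
      "eventually (\<lambda>n. nball (N n) K r = nball N' K r) sequentially" using evball by blast+
    with far[of K] have "eventually (\<lambda>n. False) sequentially"
    proof eventually_elim
      case (elim n)
      then have closed: "nball (N n) (Suc K) r = nball (N n) K r" using eq by simp
      \<comment> \<open>A ball that does not grow in one step never grows again, hence by
        connectedness contains all vertices.\<close>
      have "nball (N n) (K + j) r = nball (N n) K r" for j
      proof (induction j)
        case (Suc j)
        have "nball (N n) (K + Suc j) r = (\<Union>v\<in>nball (N n) (K + j) r. insert v (N n v))" by simp
        also have "\<dots> = nball (N n) (Suc K) r" using Suc by simp
        finally show ?case using closed by simp
      qed simp
      then have "nball (N n) k r \<subseteq> nball (N n) K r" for k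
        using nball_mono[of k "K + k" "N n" r] by auto
      then have sub: "V n \<inter> L k \<subseteq> V n \<inter> L K" for k unfolding ball .
      have "V n \<subseteq> L K"
      proof
        fix x assume x: "x \<in> V n"
        then obtain k where "x \<in> L k" using cover[of n] by blast
        then show "x \<in> L K" using x sub[of k] by blast
      qed
      then show False using elim by blast
    qed
    then show False by simp
  qed
qed

section \<open>Limits of MAP inequalities\<close>

context signal_pair
begin

definition response_bits :: "(nat \<Rightarrow> nat \<Rightarrow> history \<Rightarrow> 'w \<Rightarrow> bool) \<Rightarrow> nat \<Rightarrow> 'w \<Rightarrow> nat \<times> history \<Rightarrow> bool" where
  "response_bits F v x = (\<lambda>p. finite (snd p) \<and> F v (fst p) (snd p) x)"

text \<open>Consistency of the responses with \<open>h\<close>, as an event of finitely many bits.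
  Suitable \<open>\<Psi>\<close> ask for action 1 in response to \<open>h\<close>, for action 0, or
  for nothing.\<close>

definition response_event :: "nat \<Rightarrow> nat \<Rightarrow> history \<Rightarrow> (bool \<Rightarrow> bool) \<Rightarrow> (nat \<times> history \<Rightarrow> bool) \<Rightarrow> bool" where
  "response_event v t h \<Psi> b \<longleftrightarrow> (\<forall>t'<t. b (t', {p\<in>h. snd p < t'}) \<longleftrightarrow> (v, t') \<in> h) \<and> \<Psi> (b (t, h))"

lemma history_prob_response_event:
  assumes fin: "locally_finite V N" and v: "v \<in> V" and h: "finite h"
    and mF: "\<And>v t h. Measurable.pred \<mu>0 (F v t h)" and D: "D \<in> sets \<mu>0"
  shows "history_prob N V F s v t h {x\<in>D. \<Psi> (F v t h x)} =
    measure (sig s) {x\<in>D. response_event v t h \<Psi> (response_bits F v x)} * forced_prob N V F s v t h"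
proof -
  have "{x\<in>D. \<Psi> (F v t h x)} = D \<inter> {x\<in>space \<mu>0. \<Psi> (F v t h x)}"
    using sets.sets_into_space[OF D] by auto
  moreover have "{x\<in>space \<mu>0. \<Psi> (F v t h x)} \<in> sets \<mu>0"
    using mF by measurable
  ultimately have m: "{x\<in>D. \<Psi> (F v t h x)} \<in> sets \<mu>0" using D by simp
  have "consistent_signals F v t h \<inter> {x\<in>D. \<Psi> (F v t h x)} = {x\<in>D. response_event v t h \<Psi> (response_bits F v x)}"
    using sets.sets_into_space[OF D] h by (auto simp: consistent_signals_def response_event_def response_bits_def)
  then show ?thesis using history_prob_factor[where F=F, OF fin v mF m] by simp
qed

lemma history_prob_infinite:
  assumes "locally_finite V N" "v \<in> V" "infinite h"
  shows "history_prob N V F s v t h D = 0"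
proof -
  have "local_history N v (run N V b t) \<noteq> h" for b
    using local_history_bounds[of N v V b t] assms finite_subset[of h "insert v (N v) \<times> {..<t}"]
    by (auto simp: locally_finite_def)
  then show ?thesis by (simp add: history_prob_def)
qed

text \<open>\<open>history_prob_factor\<close> separates the law of the signal of \<open>v\<close>,
  to which \<open>limit_inequality\<close> applies, from the two forced probabilities, which
  converge and serve as its coefficients.\<close>

lemma history_limit_inequality:
  assumes conv: "rules_converge T F F'" and mF: "\<And>n v t h. Measurable.pred \<mu>0 (F n v t h)"
    and fin: "\<And>n. locally_finite (V n) (N n)" "locally_finite V' N'"
    and V: "\<And>v. v \<in> V' \<Longrightarrow> eventually (\<lambda>n. v \<in> V n) sequentially"
    and N: "\<And>v. v \<in> V' \<Longrightarrow> eventually (\<lambda>n. N n v = N' v) sequentially"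
    and v: "v \<in> V'" and h: "finite h"
    and ineq: "\<And>e. e > 0 \<Longrightarrow> eventually (\<lambda>n. \<forall>D\<in>sets \<mu>0.
      a * history_prob (N n) (V n) (F n) False v t h {x\<in>D. \<Psi> (F n v t h x)} \<le>
      c * history_prob (N n) (V n) (F n) True v t h {x\<in>D. \<Psi> (F n v t h x)} + e) sequentially"
    and D: "D \<in> sets \<mu>0"
  shows "a * history_prob N' V' F' False v t h {x\<in>D. \<Psi> (F' v t h x)} \<le>
      c * history_prob N' V' F' True v t h {x\<in>D. \<Psi> (F' v t h x)}"
proof -
  have mF': "Measurable.pred \<mu>0 (F' v t h)" for v t h using conv by (simp add: rules_converge_def)
  have Q: "(\<lambda>n. forced_prob (N n) (V n) (F n) s v t h) \<longlonglongrightarrow> forced_prob N' V' F' s v t h" for s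
  proof -
    obtain K where K: "finite K" "K \<subseteq> {(v', t', h). v' \<in> V' \<and> v' \<noteq> v \<and> finite h}"
      "determined_by K (\<lambda>b. local_history N' v (run N' V' (forced b v h) t))"
      using forced_determined[OF fin(2) v, where h=h and t=t] by blast
    have K2: "K \<subseteq> {(v, t', h). v \<in> V' \<and> finite h}" using K(2) by auto
    have det: "determined_by K (\<lambda>b. local_history N' v (run N' V' (forced b v h) t) = h)"
      by (rule determined_by_comp[OF K(3), of "\<lambda>X. X = h"])
    have U: "finite (insert v (N' v))" "insert v (N' v) \<subseteq> V'" using fin(2) v by (auto simp: locally_finite_def)
    have "eventually (\<lambda>n. \<forall>b. {p\<in>run (N n) (V n) b t. fst p \<in> insert v (N' v)} = {p\<in>run N' V' b t. fst p \<in> insert v (N' v)}) sequentially"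
      by (rule run_eventually_local[OF fin(2) N V U])
    with N[OF v] have "eventually (\<lambda>n. \<forall>b. (local_history (N n) v (run (N n) (V n) (forced b v h) t) = h) =
        (local_history N' v (run N' V' (forced b v h) t) = h)) sequentially"
      by eventually_elim (simp add: local_history_def)
    from prob_determined_converge[where \<Phi>n="\<lambda>n b. local_history (N n) v (run (N n) (V n) (forced b v h) t) = h" and V=V and s=s,
        OF conv mF K(1) K2 det V this]
    show ?thesis by (simp add: forced_prob_def)
  qed
  let ?\<Phi> = "response_event v t h \<Psi>"
  define K where "K = insert (t, h) ((\<lambda>t'. (t', {p\<in>h. snd p < t'})) ` {..<t})"
  have fK: "finite K" by (simp add: K_def)
  have dep: "?\<Phi> b = ?\<Phi> b'" if "\<And>k. k \<in> K \<Longrightarrow> b k = b' k" for b b'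
  proof -
    have "b (t', {p\<in>h. snd p < t'}) = b' (t', {p\<in>h. snd p < t'})" if "t' < t" for t'
      by (rule \<open>\<And>k. k \<in> K \<Longrightarrow> b k = b' k\<close>) (use that in \<open>simp add: K_def\<close>)
    moreover have "b (t, h) = b' (t, h)" by (rule that) (simp add: K_def)
    ultimately show ?thesis by (simp add: response_event_def)
  qed
  have bc: "bits_converge T (\<lambda>n p x. response_bits (F n) v x p) (\<lambda>p x. response_bits F' v x p)"
    using conv by (simp add: rules_converge_def response_bits_def)
  have "(a * forced_prob N' V' F' False v t h) * measure \<mu>0 {x\<in>D. ?\<Phi> (\<lambda>p. response_bits F' v x p)} \<le>
    (c * forced_prob N' V' F' True v t h) * measure \<mu>1 {x\<in>D. ?\<Phi> (\<lambda>p. response_bits F' v x p)}"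
  proof (rule limit_inequality[OF bc fK dep _ _ _ D])
    show "(\<lambda>n. a * forced_prob (N n) (V n) (F n) False v t h) \<longlonglongrightarrow> a * forced_prob N' V' F' False v t h"
      by (intro tendsto_mult_left Q)
    show "(\<lambda>n. c * forced_prob (N n) (V n) (F n) True v t h) \<longlonglongrightarrow> c * forced_prob N' V' F' True v t h"
      by (intro tendsto_mult_left Q)
    fix e :: real assume "e > 0"
    from ineq[OF this] V[OF v]
    show "eventually (\<lambda>n. \<forall>D\<in>sets \<mu>0.
      a * forced_prob (N n) (V n) (F n) False v t h * measure \<mu>0 {x\<in>D. ?\<Phi> (\<lambda>p. response_bits (F n) v x p)} \<le>
      c * forced_prob (N n) (V n) (F n) True v t h * measure \<mu>1 {x\<in>D. ?\<Phi> (\<lambda>p. response_bits (F n) v x p)} + e) sequentially"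
    proof eventually_elim
      case (elim n)
      show ?case
      proof
        fix D assume D: "D \<in> sets \<mu>0"
        show "a * forced_prob (N n) (V n) (F n) False v t h * measure \<mu>0 {x\<in>D. ?\<Phi> (\<lambda>p. response_bits (F n) v x p)} \<le>
            c * forced_prob (N n) (V n) (F n) True v t h * measure \<mu>1 {x\<in>D. ?\<Phi> (\<lambda>p. response_bits (F n) v x p)} + e"
          using elim(1)[rule_format, OF D]
          unfolding history_prob_response_event[where F="F n", OF fin(1) elim(2) h mF D] by (simp add: mult_ac)
      qed
    qed
  qed
  then show ?thesis
    unfolding history_prob_response_event[where F=F', OF fin(2) v h mF' D] by (simp add: mult_ac)
qed

text \<open>Vertices, edges and thresholds converge along \<open>r1\<close>, the laws on ties along
  a further subsequence \<open>r2\<close>. The inequalities are carried with weights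
  \<open>a\<close>, \<open>c\<close> of any sign and an error \<open>e\<close>: both directions of
  MAP are needed, and later also inequalities that hold asymptotically only.\<close>

lemma limit_system:
  assumes lab: "\<And>n. labelled_graph d L r (V n) (N n)" and L: "\<And>k. finite (L k)" "mono L"
    and far: "\<And>k. eventually (\<lambda>n. \<not> V n \<subseteq> L k) sequentially"
    and mF: "\<And>n v t h. Measurable.pred \<mu>0 (F n v t h)" and thr: "\<And>n. threshold_rule (F n) (q n)"
    and MAP: "\<And>n. rule_MAP (N n) (V n) (F n)"
  shows "\<exists>\<sigma> V' N' F'. strict_mono \<sigma> \<and> labelled_graph d L r V' N' \<and> infinite V' \<and>
    (\<forall>v t h. Measurable.pred \<mu>0 (F' v t h)) \<and> rule_MAP N' V' F' \<and>
    (\<forall>v\<in>V'. eventually (\<lambda>n. v \<in> V (\<sigma> n)) sequentially) \<and>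
    (\<forall>s t. \<forall>v\<in>V'. (\<lambda>n. measure (signals (V (\<sigma> n)) s)
        {w\<in>space (signals (V (\<sigma> n)) s). (v, t) \<in> run (N (\<sigma> n)) (V (\<sigma> n)) (responses (F (\<sigma> n)) w) (Suc t)})
      \<longlonglongrightarrow> measure (signals V' s) {w\<in>space (signals V' s). (v, t) \<in> run N' V' (responses F' w) (Suc t)}) \<and>
    (\<forall>a c t h. \<forall>v\<in>V'. (\<forall>e>0. eventually (\<lambda>n. \<forall>D\<in>sets \<mu>0.
        a * history_prob (N (\<sigma> n)) (V (\<sigma> n)) (F (\<sigma> n)) False v t h D \<le>
        c * history_prob (N (\<sigma> n)) (V (\<sigma> n)) (F (\<sigma> n)) True v t h D + e) sequentially) \<longrightarrow>
      (\<forall>D\<in>sets \<mu>0. a * history_prob N' V' F' False v t h D \<le> c * history_prob N' V' F' True v t h D))"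
proof -
  define X :: "nat \<Rightarrow> nat + nat \<times> nat + nat \<times> nat \<times> history \<Rightarrow> real" where
    "X n i = (case i of Inl v \<Rightarrow> of_bool (v \<in> V n) | Inr (Inl (v, w)) \<Rightarrow> of_bool (w \<in> N n v)
       | Inr (Inr (v, t, h)) \<Rightarrow> q n v t h)" for n i
  let ?I = "(UNIV :: nat set) <+> ((UNIV :: (nat \<times> nat) set) <+> ((UNIV :: nat set) \<times> (UNIV :: nat set) \<times> Collect (finite :: history \<Rightarrow> bool)))"
  have "\<exists>r. strict_mono r \<and> (\<forall>i\<in>?I. convergent (\<lambda>n. X (r n) i))"
  proof (rule subseq_convergent_countable[where B=1])
    show "countable ?I" by (intro countable_Plus countable_SIGMA countable_Collect_finite) auto
    have q01: "0 \<le> q n v t h \<and> q n v t h \<le> 1" for n v t h using thr[of n] by (simp add: threshold_rule_def)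
    show "\<bar>X n i\<bar> \<le> 1" for n i using q01 by (auto simp: X_def split: sum.splits)
  qed
  then obtain r1 where r1: "strict_mono r1" and conv1: "\<And>i. i \<in> ?I \<Longrightarrow> convergent (\<lambda>n. X (r1 n) i)" by blast
  have "\<exists>r T F'. strict_mono r \<and> rules_converge T (\<lambda>n. F (r1 (r n))) F'"
  proof (rule exists_limit_rule[where q="\<lambda>n. q (r1 n)"])
    show "convergent (\<lambda>n. q (r1 n) v t h)" if "finite h" for v t h
      using conv1[of "Inr (Inr (v, t, h))"] that by (auto simp: X_def)
  qed (use mF thr in auto)
  then obtain r2 T F' where r2: "strict_mono r2" and conv: "rules_converge T (\<lambda>n. F (r1 (r2 n))) F'" by blast
  define \<sigma> where "\<sigma> n = r1 (r2 n)" for n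
  have \<sigma>: "strict_mono \<sigma>" using strict_mono_o[OF r1 r2] by (simp add: strict_mono_def \<sigma>_def)
  have conv\<sigma>: "rules_converge T (\<lambda>n. F (\<sigma> n)) F'" using conv by (simp add: \<sigma>_def)
  have cX: "convergent (\<lambda>n. X (\<sigma> n) i)" if "i \<in> ?I" for i
    using convergent_subseq_convergent[OF conv1[OF that] r2] by (simp add: o_def \<sigma>_def)
  have convV: "eventually (\<lambda>n. v \<in> V (\<sigma> n)) sequentially \<or> eventually (\<lambda>n. v \<notin> V (\<sigma> n)) sequentially" for v
    using convergent_zero_one_eventually_const[of "\<lambda>n. v \<in> V (\<sigma> n)"] cX[of "Inl v", OF InlI] by (simp add: X_def)
  have convN: "eventually (\<lambda>n. w \<in> N (\<sigma> n) v) sequentially \<or> eventually (\<lambda>n. w \<notin> N (\<sigma> n) v) sequentially" for v w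
    using convergent_zero_one_eventually_const[of "\<lambda>n. w \<in> N (\<sigma> n) v"] cX[of "Inr (Inl (v, w))", OF InrI[OF InlI]] by (simp add: X_def)
  have far\<sigma>: "eventually (\<lambda>n. \<not> V (\<sigma> n) \<subseteq> L k) sequentially" for k
    by (rule eventually_subseq[OF \<sigma> far])
  define V' where "V' = {v. eventually (\<lambda>n. v \<in> V (\<sigma> n)) sequentially}"
  define N' where "N' = (\<lambda>v. {w. eventually (\<lambda>n. w \<in> N (\<sigma> n) v) sequentially})"
  have lg: "labelled_graph d L r V' N'" "infinite V'" "v \<in> V' \<Longrightarrow> eventually (\<lambda>n. N (\<sigma> n) v = N' v) sequentially" for v
    unfolding V'_def N'_def
    by (rule limit_graph[where V="\<lambda>n. V (\<sigma> n)" and N="\<lambda>n. N (\<sigma> n)" and L=L and d=d and r=r];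
        (intro lab L convV convN far\<sigma>)?; assumption?)+
  have fin: "locally_finite (V (\<sigma> n)) (N (\<sigma> n))" for n by (rule labelled_graph_locally_finite[OF lab])
  have fin': "locally_finite V' N'" by (rule labelled_graph_locally_finite[OF lg(1)])
  have evV: "eventually (\<lambda>n. v \<in> V (\<sigma> n)) sequentially" if "v \<in> V'" for v using that by (simp add: V'_def)
  have mF': "Measurable.pred \<mu>0 (F' v t h)" for v t h using conv by (simp add: rules_converge_def)
  have ineq: "a * history_prob N' V' F' False v t h {x\<in>D. P (F' v t h x)} \<le>
      c * history_prob N' V' F' True v t h {x\<in>D. P (F' v t h x)}"
    if v: "v \<in> V'" and D: "D \<in> sets \<mu>0" and le: "\<And>e. e > 0 \<Longrightarrow> eventually (\<lambda>n. \<forall>D\<in>sets \<mu>0.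
      a * history_prob (N (\<sigma> n)) (V (\<sigma> n)) (F (\<sigma> n)) False v t h {x\<in>D. P (F (\<sigma> n) v t h x)} \<le>
      c * history_prob (N (\<sigma> n)) (V (\<sigma> n)) (F (\<sigma> n)) True v t h {x\<in>D. P (F (\<sigma> n) v t h x)} + e) sequentially"
    for a c t h v D P
  proof (cases "finite h")
    case True
    then show ?thesis
      using history_limit_inequality[where F="\<lambda>n. F (\<sigma> n)" and V="\<lambda>n. V (\<sigma> n)" and N="\<lambda>n. N (\<sigma> n)",
          OF conv\<sigma> mF fin fin' evV lg(3) v True le D] by blast
  next
    case False
    then show ?thesis using history_prob_infinite[OF fin' v False] by simp
  qed
  have mset: "{x\<in>D. P (F n v t h x)} \<in> sets \<mu>0" if D: "D \<in> sets \<mu>0" for D P n v t h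
  proof -
    have "{x\<in>D. P (F n v t h x)} = D \<inter> {x\<in>space \<mu>0. P (F n v t h x)}" using sets.sets_into_space[OF D] by auto
    moreover have "{x\<in>space \<mu>0. P (F n v t h x)} \<in> sets \<mu>0" using mF by measurable
    ultimately show ?thesis using D by simp
  qed
  have "rule_MAP N' V' F'"
    unfolding rule_MAP_def
  proof (intro ballI allI conjI impI)
    fix v t h D assume v: "v \<in> V'" and D: "D \<in> sets \<mu>0"
    show "history_prob N' V' F' False v t h D \<le> history_prob N' V' F' True v t h D" if "\<forall>x\<in>D. F' v t h x"
    proof -
      have "{x\<in>D. F' v t h x} = D" using that by blast
      moreover have "1 * history_prob N' V' F' False v t h {x\<in>D. F' v t h x} \<le>
        1 * history_prob N' V' F' True v t h {x\<in>D. F' v t h x}"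
      proof (rule ineq[of v D 1 t h "\<lambda>b. b" 1, OF v D])
        fix e :: real assume "e > 0"
        show "eventually (\<lambda>n. \<forall>D\<in>sets \<mu>0.
          1 * history_prob (N (\<sigma> n)) (V (\<sigma> n)) (F (\<sigma> n)) False v t h {x\<in>D. F (\<sigma> n) v t h x} \<le>
          1 * history_prob (N (\<sigma> n)) (V (\<sigma> n)) (F (\<sigma> n)) True v t h {x\<in>D. F (\<sigma> n) v t h x} + e) sequentially"
          using evV[OF v]
        proof eventually_elim
          case (elim n)
          show ?case
          proof
            fix D assume "D \<in> sets \<mu>0"
            have "history_prob (N (\<sigma> n)) (V (\<sigma> n)) (F (\<sigma> n)) False v t h {x\<in>D. F (\<sigma> n) v t h x} \<le>
                history_prob (N (\<sigma> n)) (V (\<sigma> n)) (F (\<sigma> n)) True v t h {x\<in>D. F (\<sigma> n) v t h x}"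
              using MAP[of "\<sigma> n"] elim mset[of D "\<lambda>b. b" "\<sigma> n" v t h, OF \<open>D \<in> sets \<mu>0\<close>]
              unfolding rule_MAP_def by simp
            with \<open>e > 0\<close>
            show "1 * history_prob (N (\<sigma> n)) (V (\<sigma> n)) (F (\<sigma> n)) False v t h {x\<in>D. F (\<sigma> n) v t h x} \<le>
              1 * history_prob (N (\<sigma> n)) (V (\<sigma> n)) (F (\<sigma> n)) True v t h {x\<in>D. F (\<sigma> n) v t h x} + e"
              by simp
          qed
        qed
      qed
      ultimately show ?thesis by simp
    qed
    show "history_prob N' V' F' True v t h D \<le> history_prob N' V' F' False v t h D" if "\<forall>x\<in>D. \<not> F' v t h x"
    proof -
      have "{x\<in>D. \<not> F' v t h x} = D" using that by blast
      \<comment> \<open>The weights -1 reverse the inequality, so that the same limit argument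
        covers action 0.\<close>
      moreover have "(-1) * history_prob N' V' F' False v t h {x\<in>D. \<not> F' v t h x} \<le>
        (-1) * history_prob N' V' F' True v t h {x\<in>D. \<not> F' v t h x}"
      proof (rule ineq[of v D "-1" t h "\<lambda>b. \<not> b" "-1", OF v D])
        fix e :: real assume "e > 0"
        show "eventually (\<lambda>n. \<forall>D\<in>sets \<mu>0.
          (-1) * history_prob (N (\<sigma> n)) (V (\<sigma> n)) (F (\<sigma> n)) False v t h {x\<in>D. \<not> F (\<sigma> n) v t h x} \<le>
          (-1) * history_prob (N (\<sigma> n)) (V (\<sigma> n)) (F (\<sigma> n)) True v t h {x\<in>D. \<not> F (\<sigma> n) v t h x} + e) sequentially"
          using evV[OF v]
        proof eventually_elim
          case (elim n)
          show ?case
          proof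
            fix D assume "D \<in> sets \<mu>0"
            have "history_prob (N (\<sigma> n)) (V (\<sigma> n)) (F (\<sigma> n)) True v t h {x\<in>D. \<not> F (\<sigma> n) v t h x} \<le>
                history_prob (N (\<sigma> n)) (V (\<sigma> n)) (F (\<sigma> n)) False v t h {x\<in>D. \<not> F (\<sigma> n) v t h x}"
              using MAP[of "\<sigma> n"] elim mset[of D "\<lambda>b. \<not> b" "\<sigma> n" v t h, OF \<open>D \<in> sets \<mu>0\<close>]
              unfolding rule_MAP_def by simp
            with \<open>e > 0\<close>
            show "(-1) * history_prob (N (\<sigma> n)) (V (\<sigma> n)) (F (\<sigma> n)) False v t h {x\<in>D. \<not> F (\<sigma> n) v t h x} \<le>
              (-1) * history_prob (N (\<sigma> n)) (V (\<sigma> n)) (F (\<sigma> n)) True v t h {x\<in>D. \<not> F (\<sigma> n) v t h x} + e"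
              by simp
          qed
        qed
      qed
      ultimately show ?thesis by simp
    qed
  qed
  moreover have "(\<lambda>n. measure (signals (V (\<sigma> n)) s)
        {w\<in>space (signals (V (\<sigma> n)) s). (v, t) \<in> run (N (\<sigma> n)) (V (\<sigma> n)) (responses (F (\<sigma> n)) w) (Suc t)})
      \<longlonglongrightarrow> measure (signals V' s) {w\<in>space (signals V' s). (v, t) \<in> run N' V' (responses F' w) (Suc t)}"
    if v: "v \<in> V'" for s t v
  proof -
    obtain K where K: "finite K" "K \<subseteq> {(v, t', h). v \<in> V' \<and> finite h}"
      "determined_by K (\<lambda>b. {p\<in>run N' V' b (Suc t). fst p \<in> {v}})"
      using run_determined[OF fin', of "{v}" "Suc t"] v by blast
    have det: "determined_by K (\<lambda>b. (v, t) \<in> {p\<in>run N' V' b (Suc t). fst p \<in> {v}})"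
      by (rule determined_by_comp[OF K(3), of "\<lambda>X. (v, t) \<in> X"])
    have "eventually (\<lambda>n. \<forall>b. {p\<in>run (N (\<sigma> n)) (V (\<sigma> n)) b (Suc t). fst p \<in> {v}} = {p\<in>run N' V' b (Suc t). fst p \<in> {v}}) sequentially"
      using v by (intro run_eventually_local[OF fin' lg(3) evV]) auto
    then have "eventually (\<lambda>n. \<forall>b. ((v, t) \<in> {p\<in>run (N (\<sigma> n)) (V (\<sigma> n)) b (Suc t). fst p \<in> {v}}) =
        ((v, t) \<in> {p\<in>run N' V' b (Suc t). fst p \<in> {v}})) sequentially"
      by eventually_elim (simp only: simp_thms)
    from prob_determined_converge[where \<Phi>n="\<lambda>n b. (v, t) \<in> {p\<in>run (N (\<sigma> n)) (V (\<sigma> n)) b (Suc t). fst p \<in> {v}}" and V="\<lambda>n. V (\<sigma> n)" and s=s,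
        OF conv\<sigma> mF K(1,2) det evV this]
    show ?thesis by (simp del: run.simps)
  qed
  moreover have "\<forall>D\<in>sets \<mu>0. a * history_prob N' V' F' False v t h D \<le> c * history_prob N' V' F' True v t h D"
    if "v \<in> V'" "\<forall>e>0. eventually (\<lambda>n. \<forall>D\<in>sets \<mu>0.
        a * history_prob (N (\<sigma> n)) (V (\<sigma> n)) (F (\<sigma> n)) False v t h D \<le>
        c * history_prob (N (\<sigma> n)) (V (\<sigma> n)) (F (\<sigma> n)) True v t h D + e) sequentially" for a c t h v
    using ineq[of v _ a t h "\<lambda>_. True" c, OF that(1)] that(2) by simp
  ultimately show ?thesis
    using \<sigma> lg(1,2) mF' evV by (intro exI[of _ \<sigma>] exI[of _ V'] exI[of _ N'] exI[of _ F']) simp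
qed

end

section \<open>Limits of networks\<close>

definition relabel_nbrs :: "(nat \<Rightarrow> nat) \<Rightarrow> nat set \<Rightarrow> (nat \<Rightarrow> nat set) \<Rightarrow> nat \<Rightarrow> nat set" where
  "relabel_nbrs \<phi> V N v = (if v \<in> \<phi> ` V then \<phi> ` N (inv_into V \<phi> v) else {})"

text \<open>Agent and history are translated back before the old table is consulted. The result type
  is left open so that it serves tables, rules and thresholds.\<close>

definition relabel_table :: "(nat \<Rightarrow> nat) \<Rightarrow> nat set \<Rightarrow> (nat \<Rightarrow> nat \<Rightarrow> history \<Rightarrow> 'b) \<Rightarrow> nat \<Rightarrow> nat \<Rightarrow> history \<Rightarrow> 'b" where
  "relabel_table \<phi> V b v t h = b (inv_into V \<phi> v) t (map_prod (inv_into V \<phi>) id ` h)"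

lemma relabel_nbrs_image:
  assumes "inj_on \<phi> V" "v \<in> V"
  shows "relabel_nbrs \<phi> V N (\<phi> v) = \<phi> ` N v"
  using assms by (simp add: relabel_nbrs_def)

lemma nball_relabel:
  assumes inj: "inj_on \<phi> V" and N: "\<forall>v\<in>V. N v \<subseteq> V" and u: "u \<in> V"
  shows "nball (relabel_nbrs \<phi> V N) k (\<phi> u) = \<phi> ` nball N k u"
proof (induction k)
  case (Suc k)
  have sub: "nball N k u \<subseteq> V" using N by (intro nball_subset[OF _ u]) auto
  have "nball (relabel_nbrs \<phi> V N) (Suc k) (\<phi> u) = (\<Union>v\<in>nball N k u. insert (\<phi> v) (relabel_nbrs \<phi> V N (\<phi> v)))"
    using Suc by simp
  also have "\<dots> = (\<Union>v\<in>nball N k u. insert (\<phi> v) (\<phi> ` N v))"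
    using sub relabel_nbrs_image[OF inj] by (intro SUP_cong) auto
  also have "\<dots> = \<phi> ` nball N (Suc k) u" by auto
  finally show ?case .
qed simp

lemma map_prod_inv_image:
  assumes "inj_on \<phi> V" "fst ` Y \<subseteq> V"
  shows "map_prod (inv_into V \<phi>) id ` map_prod \<phi> id ` Y = Y"
proof -
  have "map_prod (inv_into V \<phi>) id ` map_prod \<phi> id ` Y = (\<lambda>p. p) ` Y"
    unfolding image_image using assms by (intro image_cong) (auto simp: map_prod_def split_beta)
  then show ?thesis by simp
qed

lemma local_history_relabel:
  assumes inj: "inj_on \<phi> V" and N: "\<forall>v\<in>V. N v \<subseteq> V" and u: "u \<in> V" and X: "fst ` X \<subseteq> V"
  shows "local_history (relabel_nbrs \<phi> V N) (\<phi> u) (map_prod \<phi> id ` X) = map_prod \<phi> id ` local_history N u X"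
proof -
  have "\<phi> v \<in> insert (\<phi> u) (\<phi> ` N u) \<longleftrightarrow> v \<in> insert u (N u)" if "v \<in> V" for v
    using inj_on_image_mem_iff[OF inj that, of "insert u (N u)"] bspec[OF N u] u by simp
  note mem = this
  have "local_history (relabel_nbrs \<phi> V N) (\<phi> u) (map_prod \<phi> id ` X) =
    map_prod \<phi> id ` {p\<in>X. \<phi> (fst p) \<in> insert (\<phi> u) (\<phi> ` N u)}"
    unfolding local_history_def relabel_nbrs_image[OF inj u] by auto
  also have "{p\<in>X. \<phi> (fst p) \<in> insert (\<phi> u) (\<phi> ` N u)} = local_history N u X"
    unfolding local_history_def
  proof (rule Collect_cong, rule conj_cong[OF refl])
    fix p assume "p \<in> X"
    then have "fst p \<in> V" using X by blast
    then show "\<phi> (fst p) \<in> insert (\<phi> u) (\<phi> ` N u) \<longleftrightarrow> fst p \<in> insert u (N u)" by (rule mem)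
  qed
  finally show ?thesis .
qed

lemma run_relabel:
  assumes inj: "inj_on \<phi> V" and N: "\<forall>v\<in>V. N v \<subseteq> V"
  shows "run (relabel_nbrs \<phi> V N) (\<phi> ` V) (relabel_table \<phi> V b) t = map_prod \<phi> id ` run N V b t"
proof (induction t)
  case (Suc t)
  have X: "fst ` run N V b t \<subseteq> V" using run_bounds[of _ N V b t] by auto
  have "relabel_table \<phi> V b (\<phi> u) t (local_history (relabel_nbrs \<phi> V N) (\<phi> u) (map_prod \<phi> id ` run N V b t)) =
      b u t (local_history N u (run N V b t))" if u: "u \<in> V" for u
  proof -
    have "fst ` local_history N u (run N V b t) \<subseteq> V" using X by (auto simp: local_history_def)
    then show ?thesis
      unfolding relabel_table_def local_history_relabel[OF inj N u X] map_prod_inv_image[OF inj \<open>fst ` local_history N u (run N V b t) \<subseteq> V\<close>]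
      using inj u by simp
  qed
  note eq = this
  define Q where "Q u = b u t (local_history N u (run N V b t))" for u
  define Q' where "Q' u = relabel_table \<phi> V b u t (local_history (relabel_nbrs \<phi> V N) u (map_prod \<phi> id ` run N V b t))" for u
  have "{(u, t) | u. u \<in> \<phi> ` V \<and> Q' u} = (\<lambda>u. (\<phi> u, t)) ` {u\<in>V. Q' (\<phi> u)}" by auto
  also have "{u\<in>V. Q' (\<phi> u)} = {u\<in>V. Q u}" using eq by (auto simp: Q_def Q'_def)
  also have "(\<lambda>u. (\<phi> u, t)) ` {u\<in>V. Q u} = map_prod \<phi> id ` (\<lambda>u. (u, t)) ` {u\<in>V. Q u}" by (simp add: image_image)
  also have "(\<lambda>u. (u, t)) ` {u\<in>V. Q u} = {(u, t) | u. u \<in> V \<and> Q u}" by auto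
  finally show ?case unfolding run.simps Suc Q_def Q'_def image_Un by (simp add: id_def)
qed simp

context signal_pair
begin

lemma measure_signals_reindex:
  assumes inj: "inj_on \<phi> V" and P: "{w\<in>space (signals V s). P w} \<in> sets (signals V s)"
  shows "measure (signals (\<phi> ` V) s) {w\<in>space (signals (\<phi> ` V) s). P (\<lambda>v\<in>V. w (\<phi> v))} =
    measure (signals V s) {w\<in>space (signals V s). P w}"
proof -
  have d: "distr (signals (\<phi> ` V) s) (signals V s) (\<lambda>w. \<lambda>v\<in>V. w (\<phi> v)) = signals V s"
    unfolding signals_def
    by (rule distr_PiM_reindex[of "\<phi> ` V" "\<lambda>_. sig s" \<phi> V]) (auto intro: sig.prob_space_axioms inj)
  have m: "(\<lambda>w. \<lambda>v\<in>V. w (\<phi> v)) \<in> signals (\<phi> ` V) s \<rightarrow>\<^sub>M signals V s"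
    unfolding signals_def by (intro measurable_restrict measurable_component_singleton) auto
  have "measure (signals V s) {w\<in>space (signals V s). P w} =
    measure (distr (signals (\<phi> ` V) s) (signals V s) (\<lambda>w. \<lambda>v\<in>V. w (\<phi> v))) {w\<in>space (signals V s). P w}"
    unfolding d ..
  also have "\<dots> = measure (signals (\<phi> ` V) s) {w\<in>space (signals (\<phi> ` V) s). P (\<lambda>v\<in>V. w (\<phi> v))}"
    using measurable_space[OF m]
    by (subst measure_distr[OF m P]) (auto intro!: arg_cong[where f="measure (signals (\<phi> ` V) s)"])
  finally show ?thesis by simp
qed

lemma run_relabel_responses:
  assumes inj: "inj_on \<phi> V" and N: "\<forall>v\<in>V. N v \<subseteq> V"
  shows "run (relabel_nbrs \<phi> V N) (\<phi> ` V) (responses (relabel_table \<phi> V F) w) t =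
    map_prod \<phi> id ` run N V (responses F (\<lambda>v\<in>V. w (\<phi> v))) t"
proof -
  have "run (relabel_nbrs \<phi> V N) (\<phi> ` V) (responses (relabel_table \<phi> V F) w) t =
    run (relabel_nbrs \<phi> V N) (\<phi> ` V) (relabel_table \<phi> V (responses F (\<lambda>v\<in>V. w (\<phi> v)))) t"
    using inj by (intro run_cong_responses) (auto simp: responses_def relabel_table_def)
  then show ?thesis using run_relabel[OF inj N] by simp
qed

text \<open>A history that names labels outside the image of \<open>\<phi>\<close> cannot occur,
  while its back translation is arbitrary; hence the case distinction.\<close>

lemma history_prob_relabel:
  assumes inj: "inj_on \<phi> V" and fin: "locally_finite V N" and v: "v \<in> V"
    and mF: "\<And>v t h. Measurable.pred \<mu>0 (F v t h)" and D: "D \<in> sets \<mu>0"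
  shows "history_prob (relabel_nbrs \<phi> V N) (\<phi> ` V) (relabel_table \<phi> V F) s (\<phi> v) t h D =
    (if fst ` h \<subseteq> \<phi> ` V then history_prob N V F s v t (map_prod (inv_into V \<phi>) id ` h) D else 0)"
proof -
  have N: "\<forall>v\<in>V. N v \<subseteq> V" using fin by (simp add: locally_finite_def)
  let ?\<psi> = "map_prod (inv_into V \<phi>) id"
  have lh: "local_history (relabel_nbrs \<phi> V N) (\<phi> v) (run (relabel_nbrs \<phi> V N) (\<phi> ` V) (responses (relabel_table \<phi> V F) w) t) =
    map_prod \<phi> id ` local_history N v (run N V (responses F (\<lambda>v\<in>V. w (\<phi> v))) t)" for w
  proof -
    have "fst ` run N V b t \<subseteq> V" for b using run_bounds[of _ N V b t] by auto
    then show ?thesis unfolding run_relabel_responses[OF inj N] by (rule local_history_relabel[OF inj N v])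
  qed
  have sub: "fst ` local_history N v (run N V b t) \<subseteq> V" for b
    using run_bounds[of _ N V b t] by (auto simp: local_history_def)
  show ?thesis
  proof (cases "fst ` h \<subseteq> \<phi> ` V")
    case True
    have h: "map_prod \<phi> id ` ?\<psi> ` h = h"
    proof -
      have "map_prod \<phi> id ` ?\<psi> ` h = (\<lambda>p. p) ` h"
        unfolding image_image
      proof (rule image_cong[OF refl])
        fix p assume "p \<in> h"
        then have "fst p \<in> \<phi> ` V" using True by blast
        then show "map_prod \<phi> id (?\<psi> p) = p" by (cases p) (simp add: f_inv_into_f)
      qed
      then show ?thesis by simp
    qed
    have "map_prod \<phi> id ` X = h \<longleftrightarrow> X = ?\<psi> ` h" if "fst ` X \<subseteq> V" for X
      using h map_prod_inv_image[OF inj that] by auto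
    note eq = this[OF sub]
    let ?P = "\<lambda>w. local_history N v (run N V (responses F w) t) = ?\<psi> ` h \<and> w v \<in> D"
    have "history_prob (relabel_nbrs \<phi> V N) (\<phi> ` V) (relabel_table \<phi> V F) s (\<phi> v) t h D =
      measure (signals (\<phi> ` V) s) {w\<in>space (signals (\<phi> ` V) s). ?P (\<lambda>v\<in>V. w (\<phi> v))}"
      unfolding history_prob_def lh eq using v by simp
    also have "\<dots> = measure (signals V s) {w\<in>space (signals V s). ?P w}"
      by (rule measure_signals_reindex[OF inj], rule history_event_measurable[where F=F, OF fin v mF D])
    finally show ?thesis using True by (simp add: history_prob_def)
  next
    case False
    have "map_prod \<phi> id ` local_history N v (run N V b t) \<noteq> h" for b
    proof
      assume "map_prod \<phi> id ` local_history N v (run N V b t) = h"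
      moreover have "fst ` map_prod \<phi> id ` Y = \<phi> ` fst ` Y" for Y :: history by (simp add: image_image)
      ultimately have "fst ` h = \<phi> ` fst ` local_history N v (run N V b t)" by metis
      then show False using False sub[of b] by blast
    qed
    then show ?thesis using False unfolding history_prob_def lh by simp
  qed
qed

lemma run_prob_relabel:
  assumes inj: "inj_on \<phi> V" and fin: "locally_finite V N" and v: "v \<in> V"
    and mF: "\<And>v t h. Measurable.pred \<mu>0 (F v t h)"
  shows "measure (signals (\<phi> ` V) s) {w\<in>space (signals (\<phi> ` V) s).
      (\<phi> v, t) \<in> run (relabel_nbrs \<phi> V N) (\<phi> ` V) (responses (relabel_table \<phi> V F) w) t'} =
    measure (signals V s) {w\<in>space (signals V s). (v, t) \<in> run N V (responses F w) t'}"
proof -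
  have N: "\<forall>v\<in>V. N v \<subseteq> V" using fin by (simp add: locally_finite_def)
  have "(\<phi> v, t) \<in> map_prod \<phi> id ` run N V b t' \<longleftrightarrow> (v, t) \<in> run N V b t'" for b
  proof
    assume "(\<phi> v, t) \<in> map_prod \<phi> id ` run N V b t'"
    then obtain p where p: "p \<in> run N V b t'" "\<phi> v = \<phi> (fst p)" "t = snd p" by auto
    then have "fst p = v" using run_bounds[OF p(1)] inj v by (auto dest: inj_onD)
    then show "(v, t) \<in> run N V b t'" using p by auto
  next
    assume "(v, t) \<in> run N V b t'"
    then have "map_prod \<phi> id (v, t) \<in> map_prod \<phi> id ` run N V b t'" by (rule imageI)
    then show "(\<phi> v, t) \<in> map_prod \<phi> id ` run N V b t'" by simp
  qed
  then show ?thesis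
    unfolding run_relabel_responses[OF inj N]
    using measure_signals_reindex[OF inj run_event_measurable[where F=F and s=s and t=t and t'=t', OF fin v mF]] by simp
qed

text \<open>A vertex is labelled by its distance from \<open>u\<close> together with its number in
  the ball of that radius. The label thus reveals the distance, and the bound
  \<open>(d + 1)^j\<close> on balls makes the label sets finite and independent of the
  graph.\<close>

lemma exists_labels:
  assumes N: "\<And>v. v \<in> V \<Longrightarrow> N v \<subseteq> V \<and> finite (N v) \<and> card (N v) \<le> d" and u: "u \<in> V"
    and conn: "\<And>v. v \<in> V \<Longrightarrow> \<exists>k. v \<in> nball N k u"
  shows "\<exists>\<phi>. inj_on \<phi> V \<and> \<phi> u = prod_encode (0, 0) \<and>
    (\<forall>k. \<phi> ` nball N k u = \<phi> ` V \<inter> {prod_encode (j, i) | j i. j \<le> k \<and> i < (d + 1)^j})"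
proof -
  have sub: "nball N k u \<subseteq> V" for k using N by (intro nball_subset[OF _ u]) auto
  have "\<exists>e. inj_on e (nball N k u) \<and> e ` nball N k u \<subseteq> {..<(d + 1)^k}" for k
  proof -
    have "finite (nball N k u)" "card (nball N k u) \<le> card {..<(d + 1)^k}"
      using nball_finite_card[where V=V and N=N and d=d and u=u and k=k] N u by auto
    from card_le_inj[OF this(1) _ this(2)] show ?thesis by auto
  qed
  then have "\<forall>k. \<exists>e. inj_on e (nball N k u) \<and> e ` nball N k u \<subseteq> {..<(d + 1)^k}" by blast
  from choice[OF this] obtain e where e: "\<And>k. inj_on (e k) (nball N k u)" "\<And>k. e k ` nball N k u \<subseteq> {..<(d + 1)^k}" by blast
  define dist where "dist v = (LEAST k. v \<in> nball N k u)" for v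
  have dist: "v \<in> nball N (dist v) u" if "v \<in> V" for v
    unfolding dist_def using conn[OF that] by (rule LeastI_ex)
  have dist_le: "v \<in> nball N k u \<longleftrightarrow> dist v \<le> k" if "v \<in> V" for v k
  proof
    show "v \<in> nball N k u \<Longrightarrow> dist v \<le> k" unfolding dist_def by (rule Least_le)
    show "dist v \<le> k \<Longrightarrow> v \<in> nball N k u" using dist[OF that] nball_mono[of "dist v" k N u] by blast
  qed
  define \<phi> where "\<phi> v = prod_encode (dist v, e (dist v) v)" for v
  have "inj_on \<phi> V"
  proof (rule inj_onI)
    fix v w assume vw: "v \<in> V" "w \<in> V" "\<phi> v = \<phi> w"
    then have "dist v = dist w" "e (dist v) v = e (dist v) w" by (auto simp: \<phi>_def)
    then show "v = w" using e(1)[of "dist v"] dist[OF vw(1)] dist[OF vw(2)] by (auto dest: inj_onD)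
  qed
  moreover have "dist u = 0" unfolding dist_def by (rule Least_eq_0) simp
  then have "\<phi> u = prod_encode (0, 0)" using e(2)[of 0] by (simp add: \<phi>_def)
  moreover have "\<phi> ` nball N k u = \<phi> ` V \<inter> {prod_encode (j, i) | j i. j \<le> k \<and> i < (d + 1)^j}" for k
  proof (intro set_eqI iffI)
    fix x assume "x \<in> \<phi> ` nball N k u"
    then obtain v where v: "v \<in> nball N k u" "x = \<phi> v" by blast
    then have vV: "v \<in> V" using sub by blast
    then have "dist v \<le> k" using dist_le v by blast
    moreover have "e (dist v) v < (d + 1)^dist v" using e(2)[of "dist v"] dist[OF vV] by blast
    ultimately show "x \<in> \<phi> ` V \<inter> {prod_encode (j, i) | j i. j \<le> k \<and> i < (d + 1)^j}"
      using vV unfolding v(2) by (auto simp: \<phi>_def)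
  next
    fix x assume "x \<in> \<phi> ` V \<inter> {prod_encode (j, i) | j i. j \<le> k \<and> i < (d + 1)^j}"
    then obtain v where v: "v \<in> V" "x = \<phi> v" "\<exists>j i. j \<le> k \<and> \<phi> v = prod_encode (j, i)" by blast
    then have "dist v \<le> k" by (auto simp: \<phi>_def)
    then show "x \<in> \<phi> ` nball N k u" using dist_le[OF v(1)] v by blast
  qed
  ultimately show ?thesis by blast
qed

lemma relabel_MAP:
  assumes inj: "inj_on \<phi> V" and fin: "locally_finite V N"
    and mF: "\<And>v t h. Measurable.pred \<mu>0 (F v t h)" and MAP: "rule_MAP N V F"
  shows "rule_MAP (relabel_nbrs \<phi> V N) (\<phi> ` V) (relabel_table \<phi> V F)"
  unfolding rule_MAP_def
proof (intro ballI allI)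
  fix u t h D assume u: "u \<in> \<phi> ` V" and D: "D \<in> sets \<mu>0"
  then obtain v where v: "v \<in> V" "u = \<phi> v" by blast
  have "relabel_table \<phi> V F u t h = F v t (map_prod (inv_into V \<phi>) id ` h)"
    using inj v by (simp add: relabel_table_def fun_eq_iff)
  then show "((\<forall>x\<in>D. relabel_table \<phi> V F u t h x) \<longrightarrow>
      history_prob (relabel_nbrs \<phi> V N) (\<phi> ` V) (relabel_table \<phi> V F) False u t h D
      \<le> history_prob (relabel_nbrs \<phi> V N) (\<phi> ` V) (relabel_table \<phi> V F) True u t h D) \<and>
     ((\<forall>x\<in>D. \<not> relabel_table \<phi> V F u t h x) \<longrightarrow>
      history_prob (relabel_nbrs \<phi> V N) (\<phi> ` V) (relabel_table \<phi> V F) True u t h D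
      \<le> history_prob (relabel_nbrs \<phi> V N) (\<phi> ` V) (relabel_table \<phi> V F) False u t h D)"
    using history_prob_relabel[where F=F, OF inj fin v(1) mF D] MAP v(1) D
    unfolding rule_MAP_def v(2) by simp
qed

lemma relabel_threshold: "threshold_rule F q \<Longrightarrow> threshold_rule (relabel_table \<phi> V F) (relabel_table \<phi> V q)"
  by (simp add: threshold_rule_def relabel_table_def)

text \<open>\<open>\<psi>\<close> undoes the labelling. Each labelled history is matched with a
  history \<open>h'\<close> of the original network, so that inequalities on its information events
  can be transported to the labelled system.\<close>

lemma exists_labelled_system:
  assumes net: "network d G" and MAP: "MAP_actions \<mu>0 \<mu>1 G act" and u: "u \<in> pverts G"
  shows "\<exists>V N F q \<psi>. labelled_graph d (\<lambda>k. {prod_encode (j, i) | j i. j \<le> k \<and> i < (d + 1)^j}) (prod_encode (0, 0)) V N \<and>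
    (\<forall>v t h. Measurable.pred \<mu>0 (F v t h)) \<and> threshold_rule F q \<and> rule_MAP N V F \<and>
    (\<forall>k. V \<subseteq> {prod_encode (j, i) | j i. j \<le> k \<and> i < (d + 1)^j} \<longrightarrow> pverts G \<subseteq> nball (neighbors G) k u) \<and>
    (\<forall>k. \<forall>v\<in>V \<inter> {prod_encode (j, i) | j i. j \<le> k \<and> i < (d + 1)^j}. \<psi> v \<in> nball (neighbors G) k u) \<and>
    (\<forall>v\<in>V. \<forall>t h. \<exists>h'. \<forall>s. \<forall>D\<in>sets \<mu>0. history_prob N V F s v t h D =
       measure (given (pverts G) s) {\<omega>\<in>space (World (pverts G)). observed_history G act (\<psi> v) t \<omega> = h' \<and> snd \<omega> (\<psi> v) \<in> D}) \<and>
    (\<forall>s t. measure (signals V s) {w\<in>space (signals V s). (prod_encode (0, 0), t) \<in> run N V (responses F w) (Suc t)} =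
       measure (given (pverts G) s) {\<omega>\<in>space (World (pverts G)). act u (Suc t) \<omega>})"
proof -
  let ?V = "pverts G" and ?N = "neighbors G" and ?L = "\<lambda>k. {prod_encode (j, i) | j i. j \<le> k \<and> i < (d + 1)^j}"
  have G: "connected_undirected_graph G" using net by (simp add: network_def)
  have lf: "locally_finite ?V ?N" by (rule network_locally_finite[OF net])
  have Nsub: "\<forall>v\<in>?V. ?N v \<subseteq> ?V" using lf by (simp add: locally_finite_def)
  from exists_threshold_rule[OF net MAP] obtain F q where F: "(\<forall>u t h. Measurable.pred \<mu>0 (F u t h)) \<and> threshold_rule F q \<and> rule_MAP ?N ?V F \<and>
    (\<forall>s t h. \<forall>u\<in>?V. \<forall>D\<in>sets \<mu>0. history_prob ?N ?V F s u t h D =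
       measure (given ?V s) {\<omega>\<in>space (World ?V). observed_history G act u t \<omega> = h \<and> snd \<omega> u \<in> D}) \<and>
    (\<forall>s t. \<forall>u\<in>?V. measure (signals ?V s) {w\<in>space (signals ?V s). (u, t) \<in> run ?N ?V (responses F w) (Suc t)} =
       measure (given ?V s) {\<omega>\<in>space (World ?V). act u (Suc t) \<omega>})"
    by (elim exE)
  from F have mF: "Measurable.pred \<mu>0 (F v t h)" for v t h by blast
  from F have thr: "threshold_rule F q" and rMAP: "rule_MAP ?N ?V F" by blast+
  from F[THEN conjunct2, THEN conjunct2, THEN conjunct2, THEN conjunct1]
  have hp: "history_prob ?N ?V F s v t h D =
       measure (given ?V s) {\<omega>\<in>space (World ?V). observed_history G act v t \<omega> = h \<and> snd \<omega> v \<in> D}"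
    if "v \<in> ?V" "D \<in> sets \<mu>0" for s t h v D using that by simp
  from F[THEN conjunct2, THEN conjunct2, THEN conjunct2, THEN conjunct2]
  have rp: "measure (signals ?V s) {w\<in>space (signals ?V s). (v, t) \<in> run ?N ?V (responses F w) (Suc t)} =
       measure (given ?V s) {\<omega>\<in>space (World ?V). act v (Suc t) \<omega>}" if "v \<in> ?V" for s t v
    using that by (simp del: run.simps)
  have "\<exists>\<phi>. inj_on \<phi> ?V \<and> \<phi> u = prod_encode (0, 0) \<and> (\<forall>k. \<phi> ` nball ?N k u = \<phi> ` ?V \<inter> ?L k)"
    using net connected_undirected_graph_nbhd[OF G] connected_undirected_graphD(3)[OF G u]
    by (intro exists_labels u) (auto simp: network_def)
  then obtain \<phi> where inj: "inj_on \<phi> ?V" and \<phi>u: "\<phi> u = prod_encode (0, 0)"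
    and ball: "\<And>k. \<phi> ` nball ?N k u = \<phi> ` ?V \<inter> ?L k" by blast
  define \<psi> where "\<psi> = inv_into ?V \<phi>"
  have \<psi>: "\<psi> (\<phi> v) = v" if "v \<in> ?V" for v using inj that by (simp add: \<psi>_def)
  have bsub: "nball ?N k u \<subseteq> ?V" for k using Nsub by (intro nball_subset u) auto
  let ?V' = "\<phi> ` ?V" and ?N' = "relabel_nbrs \<phi> ?V ?N" and ?F = "relabel_table \<phi> ?V F" and ?q = "relabel_table \<phi> ?V q"
  have "labelled_graph d ?L (prod_encode (0, 0)) ?V' ?N'"
    unfolding labelled_graph_def
  proof (intro conjI allI impI ballI subsetI)
    show "prod_encode (0, 0) \<in> ?V'" using u \<phi>u by (metis imageI)
    fix k show "nball ?N' k (prod_encode (0, 0)) = ?V' \<inter> ?L k"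
      using nball_relabel[OF inj Nsub u, of k] ball[of k] by (simp add: \<phi>u)
  next
    fix v assume "v \<in> ?V'"
    then obtain x where x: "x \<in> ?V" "v = \<phi> x" by blast
    then show "finite (?N' v)" "card (?N' v) \<le> d"
      using net card_image_le[of "?N x" \<phi>] relabel_nbrs_image[OF inj x(1), of ?N] by (auto simp: network_def)
    obtain k where "x \<in> nball ?N k u" using connected_undirected_graphD(3)[OF G u x(1)] by blast
    then have "v \<in> \<phi> ` ?V \<inter> ?L k" using x ball[of k] by blast
    then show "v \<in> (\<Union>k. ?L k)" by blast
  next
    fix a b assume b: "b \<in> ?N' a"
    then have "a \<in> ?V'" by (auto simp: relabel_nbrs_def split: if_splits)
    then obtain x where x: "x \<in> ?V" "a = \<phi> x" by blast
    then obtain y where y: "y \<in> ?N x" "b = \<phi> y" using b relabel_nbrs_image[OF inj x(1), of ?N] by auto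
    have xy: "y \<in> ?V" "y \<noteq> x" "x \<in> ?N y" using connected_undirected_graphD(2)[OF G y(1)] by auto
    show "a \<in> ?V'" "b \<in> ?V'" "b \<noteq> a" using x y xy inj by (auto dest: inj_onD)
    show "a \<in> ?N' b" using relabel_nbrs_image[OF inj xy(1), of ?N] xy x y by simp
  qed
  moreover have "Measurable.pred \<mu>0 (?F v t h)" for v t h
  proof -
    have "?F v t h = F (inv_into ?V \<phi> v) t (map_prod (inv_into ?V \<phi>) id ` h)" by (rule ext) (simp add: relabel_table_def)
    then show ?thesis using mF by simp
  qed
  moreover have "threshold_rule ?F ?q" by (rule relabel_threshold[OF thr])
  moreover have "rule_MAP ?N' ?V' ?F" by (rule relabel_MAP[where F=F, OF inj lf mF rMAP])
  moreover have "?V \<subseteq> nball ?N k u" if "?V' \<subseteq> ?L k" for k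
  proof
    fix v assume v: "v \<in> ?V"
    then have "\<phi> v \<in> \<phi> ` nball ?N k u" using that ball[of k] by blast
    then obtain v' where "v' \<in> nball ?N k u" "\<phi> v = \<phi> v'" by blast
    moreover have "v' \<in> ?V" using calculation(1) bsub by blast
    ultimately show "v \<in> nball ?N k u" using inj v by (auto dest: inj_onD)
  qed
  moreover have "\<psi> v \<in> nball ?N k u" if v: "v \<in> ?V' \<inter> ?L k" for k v
  proof -
    have "v \<in> \<phi> ` nball ?N k u" using v ball[of k] by blast
    then obtain x where "x \<in> nball ?N k u" "v = \<phi> x" by blast
    then show ?thesis using \<psi>[of x] bsub[of k] by auto
  qed
  moreover have "\<exists>h'. \<forall>s. \<forall>D\<in>sets \<mu>0. history_prob ?N' ?V' ?F s v t h D =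
       measure (given ?V s) {\<omega>\<in>space (World ?V). observed_history G act (\<psi> v) t \<omega> = h' \<and> snd \<omega> (\<psi> v) \<in> D}"
    if v: "v \<in> ?V'" for v t h
  proof -
    obtain x where x: "x \<in> ?V" "v = \<phi> x" using v by blast
    have \<psi>v: "\<psi> v = x" using \<psi> x by simp
    show ?thesis
    proof (cases "fst ` h \<subseteq> ?V'")
      case True
      show ?thesis
        unfolding \<psi>v unfolding x(2)
      proof (intro exI[of _ "map_prod (inv_into ?V \<phi>) id ` h"] allI ballI)
        fix s D assume D: "D \<in> sets \<mu>0"
        show "history_prob ?N' ?V' ?F s (\<phi> x) t h D = measure (given ?V s) {\<omega>\<in>space (World ?V).
            observed_history G act x t \<omega> = map_prod (inv_into ?V \<phi>) id ` h \<and> snd \<omega> x \<in> D}"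
          unfolding history_prob_relabel[where F=F, OF inj lf x(1) mF D] hp[OF x(1) D, symmetric] using True by (rule if_P)
      qed
    next
      case False
      \<comment> \<open>The history \<open>{(0, t)}\<close> is impossible, since only entries with a
        time before \<open>t\<close> are recorded. It stands in for the labelled histories of
        probability 0.\<close>
      have empty: "{\<omega>\<in>space (World ?V). observed_history G act x t \<omega> = {(0, t)} \<and> snd \<omega> x \<in> D} = {}" for D
      proof -
        have "(0, t) \<notin> observed_history G act x t \<omega>" for \<omega> by (simp add: observed_history_def)
        then have "observed_history G act x t \<omega> \<noteq> {(0, t)}" for \<omega> by (metis singletonI)
        then show ?thesis by simp
      qed
      show ?thesis
        unfolding \<psi>v unfolding x(2)
      proof (intro exI[of _ "{(0, t)}"] allI ballI)
        fix s D assume D: "D \<in> sets \<mu>0"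
        show "history_prob ?N' ?V' ?F s (\<phi> x) t h D = measure (given ?V s) {\<omega>\<in>space (World ?V).
            observed_history G act x t \<omega> = {(0, t)} \<and> snd \<omega> x \<in> D}"
          unfolding history_prob_relabel[where F=F, OF inj lf x(1) mF D] empty measure_empty using False by (rule if_not_P)
      qed
    qed
  qed
  moreover have "measure (signals ?V' s) {w\<in>space (signals ?V' s). (prod_encode (0, 0), t) \<in> run ?N' ?V' (responses ?F w) (Suc t)} =
       measure (given ?V s) {\<omega>\<in>space (World ?V). act u (Suc t) \<omega>}" for s t
    using run_prob_relabel[where F=F, OF inj lf u mF, of s t "Suc t"] rp[OF u, of s t] unfolding \<phi>u by (simp del: run.simps)
  ultimately show ?thesis
    by (intro exI[of _ ?V'] exI[of _ ?N'] exI[of _ ?F] exI[of _ ?q] exI[of _ \<psi>] conjI allI ballI impI)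
qed

abbreviation action_prob :: "nat pair_pre_digraph \<Rightarrow> 'w action_process \<Rightarrow> nat \<Rightarrow> nat \<Rightarrow> bool \<Rightarrow> real" where
  "action_prob G act u t s \<equiv> measure (given (pverts G) s) {\<omega>\<in>space (World (pverts G)). act u t \<omega>}"

text \<open>This hides labels and rules from the later arguments. Growth beyond every ball makes the
  limit infinite. The last clause transports weighted inequalities that hold near the roots up to a
  vanishing error: a fixed vertex of the limit corresponds to vertices within one bounded distance
  of all roots.\<close>

theorem limit_network:
  fixes G :: "nat \<Rightarrow> nat pair_pre_digraph" and act :: "nat \<Rightarrow> 'w action_process" and u :: "nat \<Rightarrow> nat"
  assumes net: "\<And>n. network d (G n)" and MAP: "\<And>n. MAP_actions \<mu>0 \<mu>1 (G n) (act n)" and u: "\<And>n. u n \<in> pverts (G n)"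
    and far: "\<And>k. eventually (\<lambda>n. \<not> pverts (G n) \<subseteq> nball (neighbors (G n)) k (u n)) sequentially"
  shows "\<exists>\<sigma> H act' r. strict_mono \<sigma> \<and> network d H \<and> infinite (pverts H) \<and> MAP_actions \<mu>0 \<mu>1 H act' \<and> r \<in> pverts H \<and>
    (\<forall>s t. (\<lambda>n. action_prob (G (\<sigma> n)) (act (\<sigma> n)) (u (\<sigma> n)) (Suc t) s) \<longlonglongrightarrow> action_prob H act' r (Suc t) s) \<and>
    (\<forall>a c. (\<forall>k t. \<forall>e>0. eventually (\<lambda>n. \<forall>v\<in>nball (neighbors (G n)) k (u n). \<forall>E\<in>sets (Info (G n) (act n) v (Suc t)).
        a * measure (given (pverts (G n)) False) E \<le> c * measure (given (pverts (G n)) True) E + e) sequentially) \<longrightarrow>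
      (\<forall>v\<in>pverts H. \<forall>t. \<forall>E\<in>sets (Info H act' v (Suc t)).
        a * measure (given (pverts H) False) E \<le> c * measure (given (pverts H) True) E))"
proof -
  define L where "L k = {prod_encode (j, i) | j i. j \<le> k \<and> i < (d + 1)^j}" for k
  define r where "r = prod_encode (0, 0)"
  define P where "P n V N F q \<psi> \<longleftrightarrow> labelled_graph d L r V N \<and>
    (\<forall>v t h. Measurable.pred \<mu>0 (F v t h)) \<and> threshold_rule F q \<and> rule_MAP N V F \<and>
    (\<forall>k. V \<subseteq> L k \<longrightarrow> pverts (G n) \<subseteq> nball (neighbors (G n)) k (u n)) \<and>
    (\<forall>k. \<forall>v\<in>V \<inter> L k. \<psi> v \<in> nball (neighbors (G n)) k (u n)) \<and>
    (\<forall>v\<in>V. \<forall>t h. \<exists>h'. \<forall>s. \<forall>D\<in>sets \<mu>0. history_prob N V F s v t h D =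
       measure (given (pverts (G n)) s) {\<omega>\<in>space (World (pverts (G n))). observed_history (G n) (act n) (\<psi> v) t \<omega> = h' \<and> snd \<omega> (\<psi> v) \<in> D}) \<and>
    (\<forall>s t. measure (signals V s) {w\<in>space (signals V s). (r, t) \<in> run N V (responses F w) (Suc t)} =
       action_prob (G n) (act n) (u n) (Suc t) s)" for n V N F q \<psi>
  have "\<forall>n. \<exists>V. \<exists>N F q \<psi>. P n V N F q \<psi>"
    unfolding P_def L_def r_def using exists_labelled_system[OF net MAP u] by (intro allI)
  from choice[OF this] obtain V where "\<forall>n. \<exists>N. \<exists>F q \<psi>. P n (V n) N F q \<psi>" ..
  from choice[OF this] obtain N where "\<forall>n. \<exists>F. \<exists>q \<psi>. P n (V n) (N n) F q \<psi>" ..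
  from choice[OF this] obtain F where "\<forall>n. \<exists>q. \<exists>\<psi>. P n (V n) (N n) (F n) q \<psi>" ..
  from choice[OF this] obtain q where "\<forall>n. \<exists>\<psi>. P n (V n) (N n) (F n) (q n) \<psi>" ..
  from choice[OF this] obtain \<psi> where P: "\<forall>n. P n (V n) (N n) (F n) (q n) (\<psi> n)" ..
  have lab: "labelled_graph d L r (V n) (N n)" for n using P by (simp add: P_def)
  have mF: "Measurable.pred \<mu>0 (F n v t h)" for n v t h using P by (simp add: P_def)
  have thr: "threshold_rule (F n) (q n)" for n using P by (simp add: P_def)
  have rMAP: "rule_MAP (N n) (V n) (F n)" for n using P by (simp add: P_def)
  have PL: "V n \<subseteq> L k \<Longrightarrow> pverts (G n) \<subseteq> nball (neighbors (G n)) k (u n)" for n k using P by (simp add: P_def)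
  have P\<psi>: "v \<in> V n \<Longrightarrow> v \<in> L k \<Longrightarrow> \<psi> n v \<in> nball (neighbors (G n)) k (u n)" for n k v using P by (simp add: P_def)
  have Ph: "\<forall>v\<in>V n. \<forall>t h. \<exists>h'. \<forall>s. \<forall>D\<in>sets \<mu>0. history_prob (N n) (V n) (F n) s v t h D =
       measure (given (pverts (G n)) s) {\<omega>\<in>space (World (pverts (G n))). observed_history (G n) (act n) (\<psi> n v) t \<omega> = h' \<and> snd \<omega> (\<psi> n v) \<in> D}" for n
    using P[rule_format, of n] unfolding P_def by (elim conjE)
  have Pr: "measure (signals (V n) s) {w\<in>space (signals (V n) s). (r, t) \<in> run (N n) (V n) (responses (F n) w) (Suc t)} =
       action_prob (G n) (act n) (u n) (Suc t) s" for n s t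
    using P[rule_format, of n] unfolding P_def by (elim conjE allE)
  have Lfin: "finite (L k)" for k
  proof -
    have "L k = (\<Union>j\<in>{..k}. (\<lambda>i. prod_encode (j, i)) ` {..<(d + 1)^j})" by (auto simp: L_def)
    then show ?thesis by simp
  qed
  have Lmono: "mono L" by (rule monoI) (force simp: L_def)
  have farV: "eventually (\<lambda>n. \<not> V n \<subseteq> L k) sequentially" for k
    using far[of k] by eventually_elim (use PL in blast)
  from limit_system[of d L r V N F q, OF lab Lfin Lmono farV mF thr rMAP]
  obtain \<sigma> V' N' F' where lim: "strict_mono \<sigma> \<and> labelled_graph d L r V' N' \<and> infinite V' \<and>
    (\<forall>v t h. Measurable.pred \<mu>0 (F' v t h)) \<and> rule_MAP N' V' F' \<and>
    (\<forall>v\<in>V'. eventually (\<lambda>n. v \<in> V (\<sigma> n)) sequentially) \<and>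
    (\<forall>s t. \<forall>v\<in>V'. (\<lambda>n. measure (signals (V (\<sigma> n)) s)
        {w\<in>space (signals (V (\<sigma> n)) s). (v, t) \<in> run (N (\<sigma> n)) (V (\<sigma> n)) (responses (F (\<sigma> n)) w) (Suc t)})
      \<longlonglongrightarrow> measure (signals V' s) {w\<in>space (signals V' s). (v, t) \<in> run N' V' (responses F' w) (Suc t)}) \<and>
    (\<forall>a c t h. \<forall>v\<in>V'. (\<forall>e>0. eventually (\<lambda>n. \<forall>D\<in>sets \<mu>0.
        a * history_prob (N (\<sigma> n)) (V (\<sigma> n)) (F (\<sigma> n)) False v t h D \<le>
        c * history_prob (N (\<sigma> n)) (V (\<sigma> n)) (F (\<sigma> n)) True v t h D + e) sequentially) \<longrightarrow>
      (\<forall>D\<in>sets \<mu>0. a * history_prob N' V' F' False v t h D \<le> c * history_prob N' V' F' True v t h D))"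
    by (elim exE)
  note \<sigma> = lim[THEN conjunct1]
  note lab' = lim[THEN conjunct2, THEN conjunct1]
  note inf' = lim[THEN conjunct2, THEN conjunct2, THEN conjunct1]
  note lim3 = lim[THEN conjunct2, THEN conjunct2, THEN conjunct2]
  have mF': "Measurable.pred \<mu>0 (F' v t h)" for v t h using lim3 by blast
  note MAP' = lim3[THEN conjunct2, THEN conjunct1]
  note evV = lim3[THEN conjunct2, THEN conjunct2, THEN conjunct1]
  note conv = lim3[THEN conjunct2, THEN conjunct2, THEN conjunct2, THEN conjunct1]
  note ineq = lim3[THEN conjunct2, THEN conjunct2, THEN conjunct2, THEN conjunct2]
  define H where "H = \<lparr>pverts = V', parcs = {(u, v). v \<in> N' u}\<rparr>"
  have rV: "r \<in> V'" using lab' by (simp add: labelled_graph_def)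
  have N': "u \<in> V' \<and> v \<in> V' \<and> v \<noteq> u \<and> u \<in> N' v" if "v \<in> N' u" for u v
    using lab' that unfolding labelled_graph_def by blast
  have conn: "\<exists>k. v \<in> nball N' k r" if "v \<in> V'" for v
    using lab' that unfolding labelled_graph_def by blast
  have "connected_undirected_graph H"
    unfolding H_def by (rule connected_undirected_graphI(1)[of V' N' r]) (use rV N' conn in blast)+
  moreover have "neighbors H = N'" "pverts H = V'" by (auto simp: neighbors_def H_def fun_eq_iff)
  ultimately have H: "connected_undirected_graph H" "neighbors H = N'" "pverts H = V'" by blast+
  have netH: "network d H" using H lab' by (simp add: network_def labelled_graph_def)
  define act' where "act' = run_action H F'"
  have MAPH: "MAP_actions \<mu>0 \<mu>1 H act'"
    unfolding act'_def by (rule run_action_MAP[OF netH mF']) (simp add: H MAP')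
  have fol: "follows H act' F'" unfolding act'_def by (rule run_action_follows)
  have ad: "adapted H act'" by (rule MAP_actions_adapted[OF MAPH])
  have act_eq: "action_prob H act' r (Suc t) s = measure (signals V' s) {w\<in>space (signals V' s). (r, t) \<in> run N' V' (responses F' w) (Suc t)}" for s t
  proof -
    have "{\<omega>\<in>space (World (pverts H)). act' r (Suc t) \<omega>} \<in> sets (World (pverts H))"
      by (rule info_event_World[OF H(1) ad, of r _ "Suc t"]) (use ad rV H in \<open>simp_all add: adapted_def\<close>)
    from given_Collect[OF this, of s] show ?thesis by (simp add: act'_def run_action_def H(2,3) del: run.simps)
  qed
  have "(\<lambda>n. action_prob (G (\<sigma> n)) (act (\<sigma> n)) (u (\<sigma> n)) (Suc t) s) \<longlonglongrightarrow> action_prob H act' r (Suc t) s" for s t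
    using conv[rule_format, OF rV, of s t] unfolding act_eq Pr .
  moreover have "a * measure (given (pverts H) False) E \<le> c * measure (given (pverts H) True) E"
    if le: "\<forall>k t. \<forall>e>0. eventually (\<lambda>n. \<forall>v\<in>nball (neighbors (G n)) k (u n). \<forall>E\<in>sets (Info (G n) (act n) v (Suc t)).
        a * measure (given (pverts (G n)) False) E \<le> c * measure (given (pverts (G n)) True) E + e) sequentially"
      and v: "v \<in> pverts H" and E: "E \<in> sets (Info H act' v (Suc t))" for a c v t E
  proof (rule given_info_inequality[where Q="\<lambda>_ _. True", OF netH ad fol v E])
    fix h D assume D: "D \<in> sets \<mu>0"
    have vV: "v \<in> V'" using v H by simp
    \<comment> \<open>The label of \<open>v\<close> bounds its distance from the root by the same
      \<open>k\<close> in all approximating networks that contain it.\<close>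
    obtain k where k: "v \<in> L k" using lab' vV unfolding labelled_graph_def by blast
    have "eventually (\<lambda>n. \<forall>D\<in>sets \<mu>0.
        a * history_prob (N (\<sigma> n)) (V (\<sigma> n)) (F (\<sigma> n)) False v t h D \<le>
        c * history_prob (N (\<sigma> n)) (V (\<sigma> n)) (F (\<sigma> n)) True v t h D + e) sequentially" if e: "e > 0" for e
    proof -
      from le e have "eventually (\<lambda>n. \<forall>v\<in>nball (neighbors (G n)) k (u n). \<forall>E\<in>sets (Info (G n) (act n) v (Suc t)).
        a * measure (given (pverts (G n)) False) E \<le> c * measure (given (pverts (G n)) True) E + e) sequentially" by blast
      from eventually_subseq[OF \<sigma> this] evV[rule_format, OF vV]
      show ?thesis
      proof eventually_elim
        case (elim n)
        let ?n = "\<sigma> n"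
        obtain h' where h': "\<forall>s. \<forall>D\<in>sets \<mu>0. history_prob (N ?n) (V ?n) (F ?n) s v t h D =
          measure (given (pverts (G ?n)) s) {\<omega>\<in>space (World (pverts (G ?n))). observed_history (G ?n) (act ?n) (\<psi> ?n v) t \<omega> = h' \<and> snd \<omega> (\<psi> ?n v) \<in> D}"
          using Ph[of ?n, THEN bspec[OF _ elim(2)], THEN spec, THEN spec, of t h] by (elim exE)
        have x: "\<psi> ?n v \<in> nball (neighbors (G ?n)) k (u ?n)" by (rule P\<psi>[OF elim(2) k])
        have "nball (neighbors (G ?n)) k (u ?n) \<subseteq> pverts (G ?n)"
          using network_locally_finite[OF net] by (intro nball_subset u) (auto simp: locally_finite_def)
        with x have xV: "\<psi> ?n v \<in> pverts (G ?n)" by blast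
        show ?case
        proof
          fix D assume D: "D \<in> sets \<mu>0"
          show "a * history_prob (N ?n) (V ?n) (F ?n) False v t h D \<le> c * history_prob (N ?n) (V ?n) (F ?n) True v t h D + e"
            unfolding h'[rule_format, OF D]
            by (rule elim(1)[THEN bspec[OF _ x], THEN bspec]) (rule observed_event_info[OF net MAP_actions_adapted[OF MAP] xV D])
        qed
      qed
    qed
    then show "a * history_prob (neighbors H) (pverts H) F' False v t h D \<le> c * history_prob (neighbors H) (pverts H) F' True v t h D"
      using ineq vV D unfolding H(2,3) by blast
  qed simp_all
  ultimately show ?thesis
    using \<sigma> netH inf' MAPH rV H(3)
    by (intro exI[of _ \<sigma>] exI[of _ H] exI[of _ act'] exI[of _ r]) (simp add: H(3))
qed

end

section \<open>The advantage of an agent\<close>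

text \<open>The approximable sets form a sigma-algebra. A countable union is first cut to
  \<open>n + 1\<close> sets at a cost below \<open>e / 2\<close>, and their approximation errors
  share the other half.\<close>

lemma (in finite_measure) sigma_approximation:
  assumes sub: "C \<subseteq> sets M" and Om: "space M \<in> C"
    and compl: "\<And>A. A \<in> C \<Longrightarrow> space M - A \<in> C" and un: "\<And>A B. A \<in> C \<Longrightarrow> B \<in> C \<Longrightarrow> A \<union> B \<in> C"
    and E: "E \<in> sigma_sets (space M) C" and e: "e > 0"
  shows "\<exists>E'\<in>C. measure M (sym_diff E E') < e"
  using E e
proof (induction arbitrary: e)
  case (Basic a)
  then show ?case by (intro bexI[of _ a]) auto
next
  case Empty
  have "{} \<in> C" using compl[OF Om] by simp
  then show ?case using Empty by (intro bexI[of _ "{}"]) auto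
next
  case (Compl a)
  then obtain a' where a': "a' \<in> C" "measure M (sym_diff a a') < e" by blast
  have "a \<subseteq> space M" using Compl.hyps sub by (meson sets.sigma_sets_subset sets.sets_into_space subsetD)
  moreover have "a' \<subseteq> space M" using a' sub sets.sets_into_space by blast
  ultimately have "sym_diff (space M - a) (space M - a') = sym_diff a a'" by blast
  with a' compl[OF a'(1)] show ?case by (intro bexI[of _ "space M - a'"]) auto
next
  case (Union a)
  have a: "a i \<in> sets M" for i using Union.hyps sub by (meson sets.sigma_sets_subset subsetD)
  have "(\<lambda>n. measure M (\<Union>i\<le>n. a i)) \<longlonglongrightarrow> measure M (\<Union>n. \<Union>i\<le>n. a i)"
proof (rule finite_Lim_measure_incseq)
    show "range (\<lambda>n. \<Union>i\<le>n. a i) \<subseteq> sets M" using a by auto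
    show "incseq (\<lambda>n. \<Union>i\<le>n. a i)" unfolding incseq_def by (intro allI impI UN_mono) auto
  qed
  also have "(\<Union>n. \<Union>i\<le>n. a i) = (\<Union>i. a i)" by auto
  finally have "eventually (\<lambda>n. measure M (\<Union>i\<le>n. a i) > measure M (\<Union>i. a i) - e / 2) sequentially"
    using Union.prems by (intro order_tendstoD(1)) auto
  from eventually_happens'[OF sequentially_bot this] obtain n where n: "measure M (\<Union>i\<le>n. a i) > measure M (\<Union>i. a i) - e / 2" by blast
  have "\<forall>i. \<exists>a'\<in>C. measure M (sym_diff (a i) a') < e / (2 * (real n + 1))"
    using Union.IH Union.prems by simp
  then obtain a' where a': "\<And>i. a' i \<in> C" "\<And>i. measure M (sym_diff (a i) (a' i)) < e / (2 * (real n + 1))"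
    by metis
  have a'M: "a' i \<in> sets M" for i using a'(1) sub by blast
  define B where "B = (\<Union>i\<le>n. a' i)"
  have "(\<Union>i\<le>m. a' i) \<in> C" for m
  proof (induction m)
    case (Suc m)
    have "(\<Union>i\<le>Suc m. a' i) = (\<Union>i\<le>m. a' i) \<union> a' (Suc m)" by (auto simp: le_Suc_eq)
    then show ?case using un[OF Suc a'(1)] by simp
  qed (use a'(1) in simp)
  then have B: "B \<in> C" by (simp add: B_def)
  have "sym_diff (\<Union>i. a i) B \<subseteq> ((\<Union>i. a i) - (\<Union>i\<le>n. a i)) \<union> (\<Union>i\<le>n. sym_diff (a i) (a' i))"
    by (auto simp: B_def)
  then have "measure M (sym_diff (\<Union>i. a i) B) \<le> measure M (((\<Union>i. a i) - (\<Union>i\<le>n. a i)) \<union> (\<Union>i\<le>n. sym_diff (a i) (a' i)))"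
    using a a'M by (intro finite_measure_mono) auto
  also have "\<dots> \<le> measure M ((\<Union>i. a i) - (\<Union>i\<le>n. a i)) + measure M (\<Union>i\<le>n. sym_diff (a i) (a' i))"
    using a a'M by (intro measure_Un_le) auto
  also have "measure M ((\<Union>i. a i) - (\<Union>i\<le>n. a i)) = measure M (\<Union>i. a i) - measure M (\<Union>i\<le>n. a i)"
    using a by (intro finite_measure_Diff) auto
  also have "measure M (\<Union>i\<le>n. sym_diff (a i) (a' i)) \<le> (\<Sum>i\<le>n. measure M (sym_diff (a i) (a' i)))"
    using a a'M by (intro measure_UNION_le) auto
  also have "\<dots> \<le> (\<Sum>i\<le>n. e / (2 * (real n + 1)))" using a'(2) by (intro sum_mono less_imp_le) auto
  also have "\<dots> = e / 2" by (simp add: field_simps)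
  finally have "measure M (sym_diff (\<Union>i. a i) B) < e" using n by linarith
  with B show ?case by blast
qed

context signal_pair
begin

text \<open>The evidence of \<open>E\<close> for the state \<open>b\<close>, a signed measure.
  Deciding for \<open>b\<close> on \<open>E\<close> and for the other state elsewhere is correct
  with probability \<open>(1 + lik V b E) / 2\<close>.\<close>

definition lik :: "nat set \<Rightarrow> bool \<Rightarrow> 'w outcome set \<Rightarrow> real" where
  "lik V b E = measure (given V b) E - measure (given V (\<not> b)) E"

lemma lik_Not: "lik V (\<not> b) E = - lik V b E"
  by (simp add: lik_def)

lemma lik_Un:
  "A \<in> sets (World V) \<Longrightarrow> B \<in> sets (World V) \<Longrightarrow> A \<inter> B = {} \<Longrightarrow> lik V b (A \<union> B) = lik V b A + lik V b B"
  by (simp add: lik_def given.finite_measure_Union)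

lemma lik_split:
  assumes "A \<in> sets (World V)" "B \<in> sets (World V)"
  shows "lik V b A = lik V b (A \<inter> B) + lik V b (A - B)"
  using lik_Un[of "A \<inter> B" V "A - B" b] assms by (simp add: Int_Diff_Un Int_Diff_disjoint)

lemma lik_space: "lik V b (space (World V)) = 0"
  using given.prob_space[of V] by (simp add: lik_def)

text \<open>As in the lemma of Neyman and Pearson: what \<open>A\<close> has beyond \<open>E\<close>
  does not hurt, and what \<open>E\<close> has beyond \<open>A\<close> does not help.\<close>

lemma lik_maximal:
  assumes A: "A \<in> sets (World V)" and E: "E \<in> sets (World V)"
    and pos: "lik V b (A - E) \<ge> 0" and neg: "lik V b (E - A) \<le> 0"
  shows "lik V b E \<le> lik V b A"
  using lik_split[OF E A, of b] lik_split[OF A E, of b] pos neg by (simp add: Int_commute)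

definition action_event :: "nat pair_pre_digraph \<Rightarrow> 'w action_process \<Rightarrow> nat \<Rightarrow> nat \<Rightarrow> bool \<Rightarrow> 'w outcome set" where
  "action_event G act u t b = {\<omega>\<in>space (World (pverts G)). act u t \<omega> = b}"

lemma action_event_info:
  assumes "adapted G act" "u \<in> pverts G" "t \<ge> 1"
  shows "action_event G act u t b \<in> sets (Info G act u t)"
proof -
  have 1: "{\<omega>\<in>space (World (pverts G)). act u t \<omega>} \<in> sets (Info G act u t)" using assms by (simp add: adapted_def)
  have "space (Info G act u t) - {\<omega>\<in>space (World (pverts G)). act u t \<omega>} \<in> sets (Info G act u t)"
    by (rule sets.compl_sets[OF 1])
  also have "space (Info G act u t) - {\<omega>\<in>space (World (pverts G)). act u t \<omega>} = {\<omega>\<in>space (World (pverts G)). \<not> act u t \<omega>}" by auto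
  finally show ?thesis using 1 by (cases b) (simp_all add: action_event_def)
qed

definition advantage :: "nat pair_pre_digraph \<Rightarrow> 'w action_process \<Rightarrow> nat \<Rightarrow> nat \<Rightarrow> real" where
  "advantage G act u t = lik (pverts G) True (action_event G act u t True)"

lemma advantage_action_prob: "advantage G act u t = action_prob G act u t True - action_prob G act u t False"
  by (simp add: advantage_def lik_def action_event_def)

text \<open>The whole space carries no evidence, so the two action events carry opposite evidence
  for state 1; both states therefore give the same advantage.\<close>

lemma advantage_eq:
  assumes G: "connected_undirected_graph G" and ad: "adapted G act" and u: "u \<in> pverts G" and t: "t \<ge> 1"
  shows "advantage G act u t = lik (pverts G) b (action_event G act u t b)"
proof (cases b)
  case False
  have m: "action_event G act u t b \<in> sets (World (pverts G))" for b
    by (rule info_event_World[OF G ad u action_event_info[OF ad u t]])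
  have "action_event G act u t True \<union> action_event G act u t False = space (World (pverts G))"
    "action_event G act u t True \<inter> action_event G act u t False = {}" by (auto simp: action_event_def)
  then have "lik (pverts G) True (action_event G act u t True) + lik (pverts G) True (action_event G act u t False) = 0"
    using lik_Un[OF m m, of True False True] lik_space[of "pverts G" True] by simp
  then show ?thesis using False lik_Not[of "pverts G" True] by (simp add: advantage_def)
qed (simp add: advantage_def)

lemma advantage_bounds: "advantage G act u t \<le> 1" "advantage G act u t \<ge> -1"
proof -
  have "measure (given V s) A \<le> 1" "0 \<le> measure (given V s) A" for V s A by simp_all
  then show "advantage G act u t \<le> 1" "advantage G act u t \<ge> -1"
    unfolding advantage_def lik_def by (smt (verit))+
qed

lemma MAP_lik:
  assumes G: "connected_undirected_graph G" and MAP: "MAP_actions \<mu>0 \<mu>1 G act" and u: "u \<in> pverts G" and t: "t \<ge> 1"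
    and E: "E \<in> sets (Info G act u t)"
  shows "E \<subseteq> action_event G act u t b \<Longrightarrow> lik (pverts G) b E \<ge> 0"
  using MAP[unfolded MAP_actions_iff[OF G]] u t E unfolding lik_def action_event_def
  by (cases b) (auto simp: subset_eq)

lemma MAP_optimal:
  assumes G: "connected_undirected_graph G" and MAP: "MAP_actions \<mu>0 \<mu>1 G act" and u: "u \<in> pverts G" and t: "t \<ge> 1"
    and E: "E \<in> sets (Info G act u t)"
  shows "lik (pverts G) b E \<le> advantage G act u t"
proof -
  have ad: "adapted G act" by (rule MAP_actions_adapted[OF MAP])
  note A = action_event_info[OF ad u t]
  have EW: "E \<in> sets (World (pverts G))" by (rule info_event_World[OF G ad u E])
  have AW: "action_event G act u t b \<in> sets (World (pverts G))" by (rule info_event_World[OF G ad u A])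
  have "lik (pverts G) b E \<le> lik (pverts G) b (action_event G act u t b)"
  proof (rule lik_maximal[OF AW EW])
    show "lik (pverts G) b (action_event G act u t b - E) \<ge> 0"
      by (rule MAP_lik[OF G MAP u t]) (use A E in auto)
    have "E - action_event G act u t b \<subseteq> action_event G act u t (\<not> b)"
      using sets.sets_into_space[OF E] by (auto simp: action_event_def)
    then have "lik (pverts G) (\<not> b) (E - action_event G act u t b) \<ge> 0"
      by (intro MAP_lik[OF G MAP u t]) (use A E in auto)
    then show "lik (pverts G) b (E - action_event G act u t b) \<le> 0" by (simp add: lik_Not)
  qed
  then show ?thesis using advantage_eq[OF G ad u t, of b] by simp
qed

text \<open>Copying an action seen one step earlier is an admissible decision, and optimality makes
  the actual decision at least as good. Each edge costs one unit of time.\<close>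

lemma advantage_imitate:
  assumes G: "connected_undirected_graph G" and MAP: "MAP_actions \<mu>0 \<mu>1 G act" and u: "u \<in> pverts G"
  shows "v \<in> nball (neighbors G) k u \<Longrightarrow> advantage G act v (Suc t) \<le> advantage G act u (Suc (t + k))"
proof (induction k arbitrary: v t)
  case 0
  then show ?case by simp
next
  case (Suc k)
  have ad: "adapted G act" by (rule MAP_actions_adapted[OF MAP])
  from Suc.prems obtain x where x: "x \<in> nball (neighbors G) k u" "v \<in> insert x (neighbors G x)" by auto
  have "nball (neighbors G) k u \<subseteq> pverts G" using connected_undirected_graph_nbhd[OF G] by (intro nball_subset[OF _ u]) blast
  then have xV: "x \<in> pverts G" using x by blast
  have "action_event G act v (Suc t) True \<in> sets (Info G act x (Suc (Suc t)))"
    using x(2) own_action_info[OF ad xV, of "Suc t" "Suc (Suc t)"] info_neighbor_action[of v G x "Suc t" "Suc (Suc t)" act]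
    by (auto simp: action_event_def)
  then have "advantage G act v (Suc t) \<le> advantage G act x (Suc (Suc t))"
    unfolding advantage_def[of G act v] by (intro MAP_optimal[OF G MAP xV]) auto
  also have "\<dots> \<le> advantage G act u (Suc (Suc t + k))" by (rule Suc.IH[OF x(1)])
  finally show ?case by simp
qed

section \<open>Limiting information and the regions of the optimal action set\<close>

abbreviation "Info_limit \<equiv> info_limit \<mu>0 \<mu>1"

lemma info_limit_sets:
  assumes G: "connected_undirected_graph G" and ad: "adapted G act" and u: "u \<in> pverts G"
  shows "sets (Info_limit G act u) = sigma_sets (space (World (pverts G))) (\<Union>t\<in>{1..}. sets (Info G act u t))"
    and "space (Info_limit G act u) = space (World (pverts G))"
proof -
  have "(\<Union>t\<in>{1..}. sets (Info G act u t)) \<subseteq> Pow (space (World (pverts G)))"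
    using sets.sets_into_space by fastforce
  then show "sets (Info_limit G act u) = sigma_sets (space (World (pverts G))) (\<Union>t\<in>{1..}. sets (Info G act u t))"
    and "space (Info_limit G act u) = space (World (pverts G))"
    unfolding info_limit_def by simp_all
qed

lemma info_limit_subalgebra:
  assumes G: "connected_undirected_graph G" and ad: "adapted G act" and u: "u \<in> pverts G"
  shows "subalgebra (World (pverts G)) (Info_limit G act u)"
proof -
  have "(\<Union>t\<in>{1..}. sets (Info G act u t)) \<subseteq> sets (World (pverts G))"
    using info_event_World[OF G ad u] by blast
  then have "sigma_sets (space (World (pverts G))) (\<Union>t\<in>{1..}. sets (Info G act u t)) \<subseteq> sets (World (pverts G))"
    by (rule sets.sigma_sets_subset)
  then show ?thesis using info_limit_sets[OF assms] by (simp add: subalgebra_def)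
qed

lemma info_le_info_limit:
  assumes G: "connected_undirected_graph G" and ad: "adapted G act" and u: "u \<in> pverts G" and t: "t \<ge> 1"
    and E: "E \<in> sets (Info G act u t)"
  shows "E \<in> sets (Info_limit G act u)"
  unfolding info_limit_sets[OF G ad u] using t E by (intro sigma_sets.Basic) auto

lemma info_limit_World:
  assumes G: "connected_undirected_graph G" and ad: "adapted G act" and u: "u \<in> pverts G"
    and E: "E \<in> sets (Info_limit G act u)"
  shows "E \<in> sets (World (pverts G))"
  using info_limit_subalgebra[OF assms(1-3)] E by (auto simp: subalgebra_def)

text \<open>The intersection with an arbitrary \<open>B\<close> makes the estimate usable for
  overlaps with other agents' events. An error under one state is at most twice the error under the
  mixture, hence the approximation up to \<open>e / 2\<close>.\<close>

lemma info_limit_approximation: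
  assumes G: "connected_undirected_graph G" and ad: "adapted G act" and u: "u \<in> pverts G"
    and E: "E \<in> sets (Info_limit G act u)" and e: "e > 0"
  shows "\<exists>t. \<exists>E'\<in>sets (Info G act u (Suc t)). \<forall>s. \<forall>B\<in>sets (World (pverts G)).
    \<bar>measure (given (pverts G) s) (B \<inter> E) - measure (given (pverts G) s) (B \<inter> E')\<bar> \<le> e"
proof -
  let ?V = "pverts G"
  define C where "C = (\<Union>t\<in>{1..}. sets (Info G act u t))"
  have "\<exists>E'\<in>C. measure (World ?V) (sym_diff E E') < e / 2"
  proof (rule World.sigma_approximation)
    show "C \<subseteq> sets (World ?V)" unfolding C_def using info_event_World[OF G ad u] by blast
    show "space (World ?V) \<in> C" unfolding C_def using sets.top[of "Info G act u 1"] by auto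
    show "space (World ?V) - A \<in> C" if "A \<in> C" for A
      using that sets.compl_sets[of A "Info G act u _"] unfolding C_def by auto
    show "A \<union> B \<in> C" if A: "A \<in> C" and B: "B \<in> C" for A B
    proof -
      obtain t t' where t: "t \<ge> 1" "A \<in> sets (Info G act u t)" "t' \<ge> 1" "B \<in> sets (Info G act u t')"
        using A B unfolding C_def by auto
      then have "A \<in> sets (Info G act u (max t t'))" "B \<in> sets (Info G act u (max t t'))"
        using info_mono[of t "max t t'" G act u] info_mono[of t' "max t t'" G act u] by auto
      then have "A \<union> B \<in> sets (Info G act u (max t t'))" by auto
      then show ?thesis using t(1) unfolding C_def by (intro UN_I[of "max t t'"]) auto
    qed
    show "E \<in> sigma_sets (space (World ?V)) C" using E info_limit_sets(1)[OF G ad u] by (simp add: C_def)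
  qed (use e in simp)
  then obtain t E' where t: "t \<ge> 1" and E': "E' \<in> sets (Info G act u t)" and close: "measure (World ?V) (sym_diff E E') < e / 2"
    unfolding C_def by auto
  have EW: "E \<in> sets (World ?V)" by (rule info_limit_World[OF G ad u E])
  have E'W: "E' \<in> sets (World ?V)" by (rule info_event_World[OF G ad u E'])
  have small: "measure (given ?V s) (sym_diff E E') \<le> e" for s
  proof -
    have "measure (World ?V) (sym_diff E E') = (measure (given ?V False) (sym_diff E E') + measure (given ?V True) (sym_diff E E')) / 2"
      using EW E'W by (intro measure_World) auto
    moreover have "measure (given ?V False) (sym_diff E E') \<ge> 0" "measure (given ?V True) (sym_diff E E') \<ge> 0"
      by (rule measure_nonneg)+
    moreover have "x \<le> e \<and> y \<le> e" if "z = (x + y) / 2" "0 \<le> x" "0 \<le> y" "z < e / 2" for x y z :: real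
      using that by (simp add: field_simps)
    ultimately have "measure (given ?V False) (sym_diff E E') \<le> e \<and> measure (given ?V True) (sym_diff E E') \<le> e"
      using close by blast
    then show ?thesis by (cases s) simp_all
  qed
  have "\<bar>measure (given ?V s) (B \<inter> E) - measure (given ?V s) (B \<inter> E')\<bar> \<le> e" if B: "B \<in> sets (World ?V)" for s B
  proof -
    have "measure (given ?V s) X \<le> measure (given ?V s) Y + measure (given ?V s) (sym_diff E E')"
      if "X \<in> sets (World ?V)" "Y \<in> sets (World ?V)" "X \<subseteq> Y \<union> sym_diff E E'" for X Y
    proof -
      have "measure (given ?V s) X \<le> measure (given ?V s) (Y \<union> sym_diff E E')"
        using that EW E'W by (intro given.finite_measure_mono) auto
      also have "\<dots> \<le> measure (given ?V s) Y + measure (given ?V s) (sym_diff E E')"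
        using that EW E'W by (intro measure_Un_le) auto
      finally show ?thesis .
    qed
    note diff = this
    have "measure (given ?V s) (B \<inter> E) \<le> measure (given ?V s) (B \<inter> E') + measure (given ?V s) (sym_diff E E')"
      "measure (given ?V s) (B \<inter> E') \<le> measure (given ?V s) (B \<inter> E) + measure (given ?V s) (sym_diff E E')"
      using B EW E'W by (auto intro!: diff)
    with small[of s] show ?thesis by linarith
  qed
  moreover obtain t' where "t = Suc t'" using t by (cases t) auto
  ultimately show ?thesis using E' by blast
qed

text \<open>Limiting information is approximated by information at a finite time, where the MAP
  action is optimal.\<close>

lemma lik_info_limit_le:
  assumes G: "connected_undirected_graph G" and MAP: "MAP_actions \<mu>0 \<mu>1 G act" and u: "u \<in> pverts G"
    and g: "\<And>t. advantage G act u (Suc t) \<le> g" and E: "E \<in> sets (Info_limit G act u)"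
  shows "lik (pverts G) b E \<le> g"
proof (rule field_le_epsilon)
  fix e :: real assume e: "e > 0"
  let ?V = "pverts G"
  have ad: "adapted G act" by (rule MAP_actions_adapted[OF MAP])
  obtain t E' where E': "E' \<in> sets (Info G act u (Suc t))" and
    close: "\<forall>s. \<forall>B\<in>sets (World ?V). \<bar>measure (given ?V s) (B \<inter> E) - measure (given ?V s) (B \<inter> E')\<bar> \<le> e / 2"
    using info_limit_approximation[OF G ad u E, of "e / 2"] e by auto
  have sub: "E \<subseteq> space (World ?V)" "E' \<subseteq> space (World ?V)"
    using sets.sets_into_space info_limit_World[OF G ad u E] info_event_World[OF G ad u E'] by blast+
  have "\<bar>measure (given ?V s) E - measure (given ?V s) E'\<bar> \<le> e / 2" for s
    using close[rule_format, of "space (World ?V)" s] sub by (simp add: Int_absorb1)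
  from this[of b] this[of "\<not> b"] have "lik ?V b E \<le> lik ?V b E' + e"
    unfolding lik_def abs_le_iff by linarith
  also have "lik ?V b E' \<le> advantage G act u (Suc t)" by (rule MAP_optimal[OF G MAP u _ E']) simp
  also have "\<dots> \<le> g" by (rule g)
  finally show "lik ?V b E \<le> g + e" by simp
qed

text \<open>\<open>T\<close> is replaced by an event known at time \<open>t0 + 1\<close>, which
  depends on the ball of that radius about \<open>w\<close>; what a distant agent knows at time
  \<open>t + 1\<close> lives on a disjoint ball. So \<open>t0\<close> depends on \<open>T\<close>
  and \<open>e\<close>, but not on the distant agent.\<close>

lemma almost_independent:
  assumes G: "connected_undirected_graph G" and ad: "adapted G act" and w: "w \<in> pverts G"
    and T: "T \<in> sets (Info_limit G act w)" and e: "e > 0"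
  shows "\<exists>t0. \<forall>v\<in>pverts G. \<forall>t. v \<notin> nball (neighbors G) (Suc t0 + Suc t) w \<longrightarrow>
    (\<forall>E\<in>sets (Info G act v (Suc t)). \<forall>s.
      \<bar>measure (given (pverts G) s) (E \<inter> T) - measure (given (pverts G) s) E * measure (given (pverts G) s) T\<bar> \<le> e)"
proof -
  let ?V = "pverts G" and ?N = "neighbors G"
  obtain t0 T' where T': "T' \<in> sets (Info G act w (Suc t0))" and
    close: "\<forall>s. \<forall>B\<in>sets (World ?V). \<bar>measure (given ?V s) (B \<inter> T) - measure (given ?V s) (B \<inter> T')\<bar> \<le> e / 2"
    using info_limit_approximation[OF G ad w T, of "e / 2"] e by auto
  have sub: "T \<subseteq> space (World ?V)" "T' \<subseteq> space (World ?V)"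
    using sets.sets_into_space info_limit_World[OF G ad w T] info_event_World[OF G ad w T'] by blast+
  have close': "\<bar>measure (given ?V s) T - measure (given ?V s) T'\<bar> \<le> e / 2" for s
    using close[rule_format, of "space (World ?V)" s] sub by (simp add: Int_absorb1)
  have ball: "nball ?N k x \<subseteq> ?V" if "x \<in> ?V" for k x
    using connected_undirected_graph_nbhd[OF G] by (intro nball_subset[OF _ that]) blast
  have sym: "\<And>u v. v \<in> ?N u \<Longrightarrow> u \<in> ?N v" using connected_undirected_graphD(2)[OF G] by blast
  have "\<bar>measure (given ?V s) (E \<inter> T) - measure (given ?V s) E * measure (given ?V s) T\<bar> \<le> e"
    if v: "v \<in> ?V" and far: "v \<notin> nball ?N (Suc t0 + Suc t) w" and E: "E \<in> sets (Info G act v (Suc t))" for v t E s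
  proof -
    have "nball ?N (Suc t) v \<inter> nball ?N (Suc t0) w = {}"
    proof (rule ccontr)
      assume "nball ?N (Suc t) v \<inter> nball ?N (Suc t0) w \<noteq> {}"
      then obtain x where x: "x \<in> nball ?N (Suc t) v" "x \<in> nball ?N (Suc t0) w" by blast
      have "v \<in> nball ?N (Suc t) x" by (rule nball_sym[OF sym x(1)])
      from nball_trans[OF x(2) this] far show False by blast
    qed
    then have "measure (given ?V s) (E \<inter> T') = measure (given ?V s) E * measure (given ?V s) T'"
    proof (rule signal_events_indep[OF ball[OF v] ball[OF w]])
      show "?V \<noteq> {}" using v by blast
      show "E \<in> signal_events ?V (nball ?N (Suc t) v)" using info_signal_events[OF G ad v] E by blast
      show "T' \<in> signal_events ?V (nball ?N (Suc t0) w)" using info_signal_events[OF G ad w] T' by blast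
    qed
    moreover have "\<bar>measure (given ?V s) (E \<inter> T) - measure (given ?V s) (E \<inter> T')\<bar> \<le> e / 2"
      using close info_event_World[OF G ad v E] by blast
    moreover have "\<bar>measure (given ?V s) E * measure (given ?V s) T - measure (given ?V s) E * measure (given ?V s) T'\<bar> \<le> e / 2"
    proof -
      have "\<bar>measure (given ?V s) E * (measure (given ?V s) T - measure (given ?V s) T')\<bar> \<le> 1 * (e / 2)"
        unfolding abs_mult using close'[of s] by (intro mult_mono) auto
      then show ?thesis by (simp add: right_diff_distrib)
    qed
    ultimately show ?thesis by linarith
  qed
  then show ?thesis by blast
qed

definition region :: "nat pair_pre_digraph \<Rightarrow> 'w action_process \<Rightarrow> nat \<Rightarrow> bool set \<Rightarrow> 'w outcome set" where
  "region G act u S = {\<omega>\<in>space (World (pverts G)). optimal_action_set \<mu>0 \<mu>1 G act u \<omega> = S}"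

lemma region_alt:
  "region G act u {b} = {\<omega>\<in>space (World (pverts G)). if b then belief \<mu>0 \<mu>1 G (Info_limit G act u) \<omega> > 1/2
      else belief \<mu>0 \<mu>1 G (Info_limit G act u) \<omega> < 1/2}"
  "region G act u UNIV = {\<omega>\<in>space (World (pverts G)). belief \<mu>0 \<mu>1 G (Info_limit G act u) \<omega> = 1/2}"
  by (auto simp: region_def optimal_action_set_def Let_def UNIV_bool split: if_splits)

lemma region_cover:
  "space (World (pverts G)) = region G act u {b} \<union> region G act u {\<not> b} \<union> region G act u UNIV"
  "region G act u {b} \<inter> region G act u {\<not> b} = {}" "region G act u {b} \<inter> region G act u UNIV = {}"
  unfolding region_alt by (cases b, auto)+

lemma region_info_limit:
  assumes G: "connected_undirected_graph G" and ad: "adapted G act" and u: "u \<in> pverts G"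
  shows "region G act u {b} \<in> sets (Info_limit G act u)" "region G act u UNIV \<in> sets (Info_limit G act u)"
proof -
  have [measurable]: "belief \<mu>0 \<mu>1 G (Info_limit G act u) \<in> borel_measurable (Info_limit G act u)"
    by (rule belief_measurable[OF info_limit_subalgebra[OF assms]])
  show "region G act u {b} \<in> sets (Info_limit G act u)" "region G act u UNIV \<in> sets (Info_limit G act u)"
    unfolding region_alt info_limit_sets(2)[OF assms, symmetric] by (cases b; simp; measurable)+
qed

lemma region_lik:
  assumes G: "connected_undirected_graph G" and ad: "adapted G act" and u: "u \<in> pverts G" and E: "E \<in> sets (Info_limit G act u)"
  shows "E \<subseteq> region G act u {b} \<Longrightarrow> lik (pverts G) b E \<ge> 0"
    and "E \<subseteq> region G act u UNIV \<Longrightarrow> lik (pverts G) b E = 0"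
proof -
  note sub = info_limit_subalgebra[OF G ad u]
  show "lik (pverts G) b E \<ge> 0" if "E \<subseteq> region G act u {b}"
    using belief_ge_half[OF sub E] belief_le_half[OF sub E] that unfolding region_alt lik_def
    by (cases b) (fastforce intro!: AE_I2)+
  show "lik (pverts G) b E = 0" if "E \<subseteq> region G act u UNIV"
    using belief_ge_half[OF sub E] belief_le_half[OF sub E] that unfolding region_alt lik_def
    by (cases b) (fastforce intro!: AE_I2)+
qed

text \<open>Outside the region of \<open>b\<close> the event \<open>E\<close> meets the opposite
  region, where evidence for \<open>b\<close> is nonpositive, and the tie region, where it is
  0.\<close>

lemma region_optimal:
  assumes G: "connected_undirected_graph G" and ad: "adapted G act" and u: "u \<in> pverts G" and E: "E \<in> sets (Info_limit G act u)"
  shows "lik (pverts G) b E \<le> lik (pverts G) b (region G act u {b})"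
proof (rule lik_maximal)
  let ?R = "region G act u {b}" and ?R' = "region G act u {\<not> b}" and ?Z = "region G act u UNIV"
  have R: "?R \<in> sets (Info_limit G act u)" "?R' \<in> sets (Info_limit G act u)" "?Z \<in> sets (Info_limit G act u)"
    using region_info_limit[OF G ad u] by auto
  note W = info_limit_World[OF G ad u]
  show "?R \<in> sets (World (pverts G))" "E \<in> sets (World (pverts G))" using W R E by auto
  show "lik (pverts G) b (?R - E) \<ge> 0" by (rule region_lik(1)[OF G ad u]) (use R E in auto)
  have 1: "lik (pverts G) b (E \<inter> ?R') \<le> 0"
    using region_lik(1)[OF G ad u, of "E \<inter> ?R'" "\<not> b"] R E lik_Not[of "pverts G" b] by auto
  have 2: "lik (pverts G) b (E \<inter> ?Z) = 0" by (rule region_lik(2)[OF G ad u]) (use R E in auto)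
  have eq: "E - ?R = (E \<inter> ?R') \<union> (E \<inter> ?Z)"
    using region_cover[of G act u b] sets.sets_into_space[OF W[OF E]] by blast
  have "(E \<inter> ?R') \<inter> (E \<inter> ?Z) = {}" using region_cover(3)[of G act u "\<not> b"] by blast
  then show "lik (pverts G) b (E - ?R) \<le> 0"
    unfolding eq using 1 2 W R E by (subst lik_Un) auto
qed

text \<open>If no event favoured state 1, passing to complements would make the two laws
  equal.\<close>

lemma exists_informative_signal: "\<exists>D\<in>sets \<mu>0. measure \<mu>0 D < measure \<mu>1 D"
proof (rule ccontr)
  assume "\<not> ?thesis"
  then have le: "measure \<mu>1 D \<le> measure \<mu>0 D" if "D \<in> sets \<mu>0" for D using that by (auto simp: not_less)
  have "measure \<mu>0 D = measure \<mu>1 D" if D: "D \<in> sets \<mu>0" for D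
  proof -
    have "measure \<mu>1 (space \<mu>0 - D) = 1 - measure \<mu>1 D"
      using M1.prob_compl[of D] D by (simp add: sets_eq space_eq)
    moreover have "measure \<mu>0 (space \<mu>0 - D) = 1 - measure \<mu>0 D" using M0.prob_compl[OF D] .
    ultimately show ?thesis using le[OF D] le[of "space \<mu>0 - D"] D by auto
  qed
  then have "\<mu>0 = \<mu>1" using sets_eq by (intro measure_eqI) (auto simp: M0.emeasure_eq_measure M1.emeasure_eq_measure)
  then show False using neq by contradiction
qed

lemma given_signal:
  assumes D: "D \<in> sets \<mu>0" and u: "u \<in> V"
  shows "measure (given V s) {\<omega>\<in>space (World V). snd \<omega> u \<in> D} = measure (sig s) D"
proof -
  have "{\<omega>\<in>space (World V). snd \<omega> u \<in> D} \<in> sets (World V)"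
    using signal_event_singleton[OF D u] signal_events_World[of "{u}" V] u by blast
  then have "measure (given V s) {\<omega>\<in>space (World V). snd \<omega> u \<in> D} = measure (signals V s) {w\<in>space (signals V s). \<forall>v\<in>{u}. w v \<in> D}"
    by (simp add: given_Collect)
  also have "\<dots> = measure (sig s) D" using u D by (subst measure_signals_rectangle(1)) auto
  finally show ?thesis .
qed

end

section \<open>Infinite networks of bounded degree\<close>

context signal_pair
begin

text \<open>Both states have prior 1/2, so a null set of the mixture is null under both conditional
  laws.\<close>

lemma AE_World_given:
  assumes "AE \<omega> in World V. P \<omega>"
  shows "AE \<omega> in given V s. P \<omega>"
proof -
  from AE_E[OF assms] obtain N where N: "{x \<in> space (World V). \<not> P x} \<subseteq> N" "emeasure (World V) N = 0" "N \<in> sets (World V)" .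
  have "measure (World V) N = 0" using N(2) by (simp add: measure_def)
  then have "measure (given V s) N = 0" using measure_World_null[OF N(3)] by blast
  then have "emeasure (given V s) N = 0" by (simp add: given.emeasure_eq_measure)
  then show ?thesis using N by (intro AE_I[of _ _ N]) auto
qed

lemma agreement_region:
  assumes A: "common_optimal_action_set \<mu>0 \<mu>1 G act A" and u: "u \<in> pverts G" and v: "v \<in> pverts G"
    and E: "E \<in> sets (World (pverts G))"
    and R: "region G act u S \<in> sets (World (pverts G))" "region G act v S \<in> sets (World (pverts G))"
  shows "measure (given (pverts G) s) (E \<inter> region G act u S) = measure (given (pverts G) s) (E \<inter> region G act v S)"
proof (rule given.finite_measure_eq_AE)
  have "AE \<omega> in given (pverts G) s. \<forall>u\<in>pverts G. optimal_action_set \<mu>0 \<mu>1 G act u \<omega> = A \<omega>"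
    using A unfolding common_optimal_action_set_def by (intro AE_World_given) blast
  then show "AE \<omega> in given (pverts G) s. (\<omega> \<in> E \<inter> region G act u S) = (\<omega> \<in> E \<inter> region G act v S)"
    by eventually_elim (use u v in \<open>simp add: region_def\<close>)
qed (use E R in auto)

text \<open>For each state \<open>s\<close>, the action carries at most the evidence of the region
  \<open>{s}\<close>, which is at most its probability given \<open>s\<close>. By agreement this
  region is almost surely the event \<open>A = {s}\<close>. The two states are then
  averaged.\<close>

lemma advantage_le_correct:
  assumes G: "connected_undirected_graph G" and MAP: "MAP_actions \<mu>0 \<mu>1 G act" and u: "u \<in> pverts G" and t: "t \<ge> 1"
    and A: "common_optimal_action_set \<mu>0 \<mu>1 G act A"
  shows "advantage G act u t \<le> measure (World (pverts G)) {\<omega>\<in>space (World (pverts G)). A \<omega> = {fst \<omega>}}"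
proof -
  let ?V = "pverts G"
  have ad: "adapted G act" by (rule MAP_actions_adapted[OF MAP])
  let ?C = "\<lambda>s. {\<omega>\<in>space (World ?V). A \<omega> = {s}}"
  let ?E = "{\<omega>\<in>space (World ?V). A \<omega> = {fst \<omega>}}"
  have mA: "A \<in> World ?V \<rightarrow>\<^sub>M count_space UNIV" using A by (simp add: common_optimal_action_set_def)
  have C: "?C s \<in> sets (World ?V)" for s
    using measurable_sets[OF mA, of "{{s}}"] by (simp add: vimage_def Collect_conj_eq Int_commute)
  have "?E = (?C True \<inter> state_one ?V) \<union> (?C False - state_one ?V)"
  proof (rule set_eqI)
    fix \<omega> show "\<omega> \<in> ?E \<longleftrightarrow> \<omega> \<in> (?C True \<inter> state_one ?V) \<union> (?C False - state_one ?V)"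
      by (cases "fst \<omega>") (auto simp: state_one_def)
  qed
  moreover have "(?C True \<inter> state_one ?V) \<union> (?C False - state_one ?V) \<in> sets (World ?V)"
    by (intro sets.Un sets.Int sets.Diff C state_one_measurable)
  ultimately have E: "?E \<in> sets (World ?V)" by argo
  have "advantage G act u t \<le> measure (given ?V s) ?E" for s
  proof -
    have R: "region G act u {s} \<in> sets (World ?V)"
      by (rule info_limit_World[OF G ad u region_info_limit(1)[OF G ad u]])
    have "advantage G act u t = lik ?V s (action_event G act u t s)" by (rule advantage_eq[OF G ad u t])
    also have "\<dots> \<le> lik ?V s (region G act u {s})"
      by (intro region_optimal[OF G ad u] info_le_info_limit[OF G ad u t] action_event_info[OF ad u t])
    also have "\<dots> \<le> measure (given ?V s) (region G act u {s})" by (simp add: lik_def)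
    also have "\<dots> = measure (given ?V s) (?C s)"
    proof (rule given.finite_measure_eq_AE)
      have "AE \<omega> in given ?V s. \<forall>u\<in>pverts G. optimal_action_set \<mu>0 \<mu>1 G act u \<omega> = A \<omega>"
        using A unfolding common_optimal_action_set_def by (intro AE_World_given) blast
      then show "AE \<omega> in given ?V s. (\<omega> \<in> region G act u {s}) = (\<omega> \<in> ?C s)"
        by eventually_elim (use u in \<open>simp add: region_def\<close>)
    qed (use R C in auto)
    also have "\<dots> = measure (given ?V s) ?E"
      unfolding measure_given[OF C] measure_given[OF E] by (rule arg_cong[where f="measure (signals ?V s)"]) auto
    finally show ?thesis .
  qed
  from this[of False] this[of True] show ?thesis
    unfolding measure_World[OF E] by (simp add: field_simps)
qed

lemma network_connected: "network d G \<Longrightarrow> connected_undirected_graph G"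
  by (simp add: network_def)

lemma network_nball:
  assumes "network d G" "u \<in> pverts G"
  shows "finite (nball (neighbors G) k u)" "card (nball (neighbors G) k u) \<le> (d + 1)^k" "nball (neighbors G) k u \<subseteq> pverts G"
proof -
  have *: "neighbors G v \<subseteq> pverts G \<and> finite (neighbors G v) \<and> card (neighbors G v) \<le> d" if "v \<in> pverts G" for v
    using connected_undirected_graph_nbhd[OF network_connected[OF assms(1)] that] assms(1) that by (simp add: network_def)
  show "finite (nball (neighbors G) k u)" "card (nball (neighbors G) k u) \<le> (d + 1)^k"
    using nball_finite_card[of "pverts G" "neighbors G" d u k, OF * assms(2)] by auto
  show "nball (neighbors G) k u \<subseteq> pverts G" using * assms(2) by (intro nball_subset) auto
qed

text \<open>By connectedness \<open>u\<close> imitates any other agent after finitely many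
  steps.\<close>

lemma advantage_le_everywhere:
  assumes G: "connected_undirected_graph G" and MAP: "MAP_actions \<mu>0 \<mu>1 G act" and u: "u \<in> pverts G" and v: "v \<in> pverts G"
    and g: "\<And>t. advantage G act u (Suc t) \<le> g"
  shows "advantage G act v (Suc t) \<le> g"
proof -
  obtain k where "v \<in> nball (neighbors G) k u" using connected_undirected_graphD(3)[OF G u v] by blast
  from advantage_imitate[OF G MAP u this, of t] g[of "t + k"] show ?thesis by simp
qed

text \<open>The root moves along agents \<open>v n\<close> outside growing balls about
  \<open>w\<close>. By agreement the region of \<open>w\<close> is almost surely also the region of
  the agents near \<open>v n\<close>, hence part of what they learn; by
  \<open>almost_independent\<close>, intersecting their events with it multiplies probabilities
  given \<open>s\<close> almost by that of the region given \<open>s\<close>. Nonnegative evidence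
  inside the region gives the first inequality, and the bound \<open>g\<close> on limiting
  information gives the second.\<close>

lemma limit_weights:
  assumes net: "network d G" and inf: "infinite (pverts G)" and MAP: "MAP_actions \<mu>0 \<mu>1 G act" and w: "w \<in> pverts G"
    and A: "common_optimal_action_set \<mu>0 \<mu>1 G act A" and g: "\<And>t. advantage G act w (Suc t) \<le> g"
  defines "\<alpha> \<equiv> \<lambda>b. measure (given (pverts G) b) (region G act w {b})"
    and "\<beta> \<equiv> \<lambda>b. measure (given (pverts G) (\<not> b)) (region G act w {b})"
  shows "\<exists>H act' r. network d H \<and> infinite (pverts H) \<and> MAP_actions \<mu>0 \<mu>1 H act' \<and> r \<in> pverts H \<and>
    (\<forall>t. advantage H act' r (Suc t) \<le> g) \<and>
    (\<forall>v\<in>pverts H. \<forall>t. \<forall>E\<in>sets (Info H act' v (Suc t)). \<forall>b.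
      \<beta> b * measure (given (pverts H) (\<not> b)) E \<le> \<alpha> b * measure (given (pverts H) b) E) \<and>
    (\<forall>t b. \<alpha> b * measure (given (pverts H) b) (action_event H act' r (Suc t) (\<not> b)) -
      \<beta> b * measure (given (pverts H) (\<not> b)) (action_event H act' r (Suc t) (\<not> b)) \<le> g - advantage H act' r (Suc t))"
proof -
  let ?V = "pverts G" and ?N = "neighbors G"
  let ?P = "\<lambda>s. measure (given ?V s)"
  have G: "connected_undirected_graph G" by (rule network_connected[OF net])
  have ad: "adapted G act" by (rule MAP_actions_adapted[OF MAP])
  have "\<forall>n. \<exists>v. v \<in> ?V \<and> v \<notin> nball ?N n w"
    using network_nball(1)[OF net w] inf by (metis finite_subset subsetI)
  from choice[OF this] obtain v where v: "\<And>n. v n \<in> ?V" "\<And>n. v n \<notin> nball ?N n w" by blast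
  have sym: "\<And>u v. v \<in> ?N u \<Longrightarrow> u \<in> ?N v" using connected_undirected_graphD(2)[OF G] by blast
  have R: "region G act x {b} \<in> sets (Info_limit G act x)" "region G act x {b} \<in> sets (World ?V)" if "x \<in> ?V" for x b
    using region_info_limit(1)[OF G ad that] info_limit_World[OF G ad that] by blast+
  have nb: "nball ?N k x \<subseteq> ?V" if "x \<in> ?V" for k x by (rule network_nball(3)[OF net that])
  have indep: "eventually (\<lambda>n. \<forall>x\<in>nball ?N k (v n). \<forall>E\<in>sets (Info G act x (Suc t)). \<forall>s.
      \<bar>?P s (E \<inter> region G act x {b}) - ?P s E * ?P s (region G act w {b})\<bar> \<le> e) sequentially"
    if e: "e > 0" for k t b e
  proof -
    from almost_independent[OF G ad w R(1)[OF w] e, of b] obtain t0 where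
      t0: "\<forall>x\<in>?V. \<forall>t. x \<notin> nball ?N (Suc t0 + Suc t) w \<longrightarrow> (\<forall>E\<in>sets (Info G act x (Suc t)). \<forall>s.
        \<bar>?P s (E \<inter> region G act w {b}) - ?P s E * ?P s (region G act w {b})\<bar> \<le> e)" by blast
    show ?thesis
    proof (rule eventually_sequentiallyI[of "Suc t0 + Suc t + k"], intro ballI allI)
      fix n x E s assume n: "Suc t0 + Suc t + k \<le> n" and x: "x \<in> nball ?N k (v n)" and E: "E \<in> sets (Info G act x (Suc t))"
      have xV: "x \<in> ?V" using nb[OF v(1)] x by blast
      have "x \<notin> nball ?N (Suc t0 + Suc t) w"
      proof
        assume "x \<in> nball ?N (Suc t0 + Suc t) w"
        then have "v n \<in> nball ?N (Suc t0 + Suc t + k) w" using nball_sym[OF sym x] by (rule nball_trans)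
        then show False using nball_mono[OF n, of ?N w] v(2)[of n] by blast
      qed
      then have "\<bar>?P s (E \<inter> region G act w {b}) - ?P s E * ?P s (region G act w {b})\<bar> \<le> e"
        using t0 xV E by blast
      moreover have "?P s (E \<inter> region G act w {b}) = ?P s (E \<inter> region G act x {b})"
        by (rule agreement_region[OF A w xV info_event_World[OF G ad xV E] R(2)[OF w] R(2)[OF xV]])
      ultimately show "\<bar>?P s (E \<inter> region G act x {b}) - ?P s E * ?P s (region G act w {b})\<bar> \<le> e" by simp
    qed
  qed
  have nonneg: "eventually (\<lambda>n. \<forall>x\<in>nball ?N k (v n). \<forall>E\<in>sets (Info G act x (Suc t)).
      \<beta> b * ?P (\<not> b) E \<le> \<alpha> b * ?P b E + e) sequentially" if e: "e > 0" for k t b e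
  proof (rule eventually_mono[OF indep[of "e / 2" k t b]], use e in simp, intro ballI)
    fix n x E assume *: "\<forall>x\<in>nball ?N k (v n). \<forall>E\<in>sets (Info G act x (Suc t)). \<forall>s.
      \<bar>?P s (E \<inter> region G act x {b}) - ?P s E * ?P s (region G act w {b})\<bar> \<le> e / 2"
      and x: "x \<in> nball ?N k (v n)" and E: "E \<in> sets (Info G act x (Suc t))"
    have xV: "x \<in> ?V" using nb[OF v(1)] x by blast
    have "E \<inter> region G act x {b} \<in> sets (Info_limit G act x)"
      using info_le_info_limit[OF G ad xV _ E] R(1)[OF xV] by auto
    from region_lik(1)[OF G ad xV this, of b] have "?P (\<not> b) (E \<inter> region G act x {b}) \<le> ?P b (E \<inter> region G act x {b})"
      by (simp add: lik_def)
    moreover have "\<bar>?P b (E \<inter> region G act x {b}) - ?P b E * \<alpha> b\<bar> \<le> e / 2"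
      "\<bar>?P (\<not> b) (E \<inter> region G act x {b}) - ?P (\<not> b) E * \<beta> b\<bar> \<le> e / 2"
      using *[rule_format, OF x E] unfolding \<alpha>_def \<beta>_def by blast+
    ultimately have "?P (\<not> b) E * \<beta> b \<le> ?P b E * \<alpha> b + e" by linarith
    then show "\<beta> b * ?P (\<not> b) E \<le> \<alpha> b * ?P b E + e" by (simp add: mult.commute)
  qed
  \<comment> \<open>The decision tested here is for \<open>b\<close> if the action is
    \<open>b\<close> or the region is that of \<open>b\<close>. Its gain over the action alone is
    the evidence of \<open>?F \<inter> ?R\<close>, and in total it cannot exceed
    \<open>g\<close>.\<close>
  have wrong: "eventually (\<lambda>n. \<alpha> b * ?P b (action_event G act (v n) (Suc t) (\<not> b)) -
      \<beta> b * ?P (\<not> b) (action_event G act (v n) (Suc t) (\<not> b)) + advantage G act (v n) (Suc t) \<le> g + e) sequentially"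
    if e: "e > 0" for t b e
  proof (rule eventually_mono[OF indep[of "e / 2" 0 t b]], use e in simp)
    fix n assume *: "\<forall>x\<in>nball ?N 0 (v n). \<forall>E\<in>sets (Info G act x (Suc t)). \<forall>s.
      \<bar>?P s (E \<inter> region G act x {b}) - ?P s E * ?P s (region G act w {b})\<bar> \<le> e / 2"
    let ?Y = "action_event G act (v n) (Suc t) b" and ?F = "action_event G act (v n) (Suc t) (\<not> b)"
      and ?R = "region G act (v n) {b}"
    note vV = v(1)[of n]
    have Y: "?Y \<in> sets (Info G act (v n) (Suc t))" and F: "?F \<in> sets (Info G act (v n) (Suc t))"
      by (rule action_event_info[OF ad vV], simp)+
    note lim = info_le_info_limit[OF G ad vV, of "Suc t"]
    have 1: "?Y \<in> sets (Info_limit G act (v n))" "?F \<inter> ?R \<in> sets (Info_limit G act (v n))"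
      using lim[OF _ Y] lim[OF _ F] R(1)[OF vV] by auto
    have "lik ?V b (?Y \<union> (?F \<inter> ?R)) \<le> g"
      by (rule lik_info_limit_le[OF G MAP vV advantage_le_everywhere[OF G MAP w vV g]]) (use 1 in auto)
    moreover have "lik ?V b (?Y \<union> (?F \<inter> ?R)) = lik ?V b ?Y + lik ?V b (?F \<inter> ?R)"
      by (rule lik_Un) (use info_limit_World[OF G ad vV 1(1)] info_limit_World[OF G ad vV 1(2)] in \<open>auto simp: action_event_def\<close>)
    moreover have "advantage G act (v n) (Suc t) = lik ?V b ?Y"
      by (rule advantage_eq[OF G ad vV]) simp
    moreover have "\<bar>?P b (?F \<inter> ?R) - ?P b ?F * \<alpha> b\<bar> \<le> e / 2" "\<bar>?P (\<not> b) (?F \<inter> ?R) - ?P (\<not> b) ?F * \<beta> b\<bar> \<le> e / 2"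
      using *[rule_format, OF nball_self F] unfolding \<alpha>_def \<beta>_def by blast+
    moreover have "lik ?V b (?F \<inter> ?R) = ?P b (?F \<inter> ?R) - ?P (\<not> b) (?F \<inter> ?R)" by (simp add: lik_def)
    ultimately have "?P b ?F * \<alpha> b - ?P (\<not> b) ?F * \<beta> b + advantage G act (v n) (Suc t) \<le> g + e" by linarith
    then show "\<alpha> b * ?P b ?F - \<beta> b * ?P (\<not> b) ?F + advantage G act (v n) (Suc t) \<le> g + e" by (simp add: mult.commute)
  qed
  have far: "eventually (\<lambda>n. \<not> ?V \<subseteq> nball ?N k (v n)) sequentially" for k
    using network_nball(1)[OF net v(1)] inf by (intro always_eventually) (metis finite_subset)
  from limit_network[of d "\<lambda>_. G" "\<lambda>_. act" v, OF net MAP v(1) far]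
  obtain \<sigma> H act' r where \<sigma>: "strict_mono \<sigma>" and H: "network d H" "infinite (pverts H)" "MAP_actions \<mu>0 \<mu>1 H act'" "r \<in> pverts H"
    and conv: "\<forall>s t. (\<lambda>n. action_prob G act (v (\<sigma> n)) (Suc t) s) \<longlonglongrightarrow> action_prob H act' r (Suc t) s"
    and ineq: "\<forall>a c. (\<forall>k t. \<forall>e>0. eventually (\<lambda>n. \<forall>x\<in>nball ?N k (v n). \<forall>E\<in>sets (Info G act x (Suc t)).
        a * ?P False E \<le> c * ?P True E + e) sequentially) \<longrightarrow>
      (\<forall>v\<in>pverts H. \<forall>t. \<forall>E\<in>sets (Info H act' v (Suc t)).
        a * measure (given (pverts H) False) E \<le> c * measure (given (pverts H) True) E)"
    by (elim exE conjE)
  have adH: "adapted H act'" by (rule MAP_actions_adapted[OF H(3)])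
  have prob_event: "measure (given (pverts K) s) (action_event K a x (Suc t) c) =
      (if c then action_prob K a x (Suc t) s else 1 - action_prob K a x (Suc t) s)"
    if K: "connected_undirected_graph K" "adapted K a" "x \<in> pverts K" for K a x t c s
  proof (cases c)
    case False
    have "action_event K a x (Suc t) True \<in> sets (World (pverts K))"
      by (rule info_event_World[OF K action_event_info[OF K(2,3)]]) simp
    then have "measure (given (pverts K) s) (space (given (pverts K) s) - action_event K a x (Suc t) True) =
        1 - measure (given (pverts K) s) (action_event K a x (Suc t) True)"
      by (intro given.prob_compl) simp
    moreover have "space (given (pverts K) s) - action_event K a x (Suc t) True = action_event K a x (Suc t) False"
      by (auto simp: action_event_def)
    ultimately show ?thesis using False by (simp add: action_event_def)
  qed (simp add: action_event_def)
  have conv_event: "(\<lambda>n. ?P s (action_event G act (v (\<sigma> n)) (Suc t) c)) \<longlonglongrightarrow> measure (given (pverts H) s) (action_event H act' r (Suc t) c)"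
    for s t c
    unfolding prob_event[OF G ad v(1)] prob_event[OF network_connected[OF H(1)] adH H(4)]
    using conv by (cases c) (auto intro!: tendsto_intros)
  have conv_adv: "(\<lambda>n. advantage G act (v (\<sigma> n)) (Suc t)) \<longlonglongrightarrow> advantage H act' r (Suc t)" for t
    unfolding advantage_def lik_def by (intro tendsto_diff conv_event)
  have "advantage H act' r (Suc t) \<le> g" for t
    using advantage_le_everywhere[OF G MAP w v(1) g]
    by (intro tendsto_upperbound[OF conv_adv]) auto
  moreover have "\<beta> b * measure (given (pverts H) (\<not> b)) E \<le> \<alpha> b * measure (given (pverts H) b) E"
    if x: "x \<in> pverts H" and E: "E \<in> sets (Info H act' x (Suc t))" for x t E b
  proof (cases b)
    case True
    have "\<forall>k t. \<forall>e>0. eventually (\<lambda>n. \<forall>x\<in>nball ?N k (v n). \<forall>E\<in>sets (Info G act x (Suc t)).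
        \<beta> True * ?P False E \<le> \<alpha> True * ?P True E + e) sequentially"
      using nonneg[of _ _ _ True] by simp
    from ineq[rule_format, OF this[rule_format] x E] True show ?thesis by simp
  next
    \<comment> \<open>Here the states change sides in the transported inequality, so the weights
      enter with negative signs.\<close>
    case False
    have "\<forall>k t. \<forall>e>0. eventually (\<lambda>n. \<forall>x\<in>nball ?N k (v n). \<forall>E\<in>sets (Info G act x (Suc t)).
        - \<alpha> False * ?P False E \<le> - \<beta> False * ?P True E + e) sequentially"
      using nonneg[of _ _ _ False] by (simp add: algebra_simps)
    from ineq[rule_format, OF this[rule_format] x E] False show ?thesis by simp
  qed
  moreover have "\<alpha> b * measure (given (pverts H) b) (action_event H act' r (Suc t) (\<not> b)) -
      \<beta> b * measure (given (pverts H) (\<not> b)) (action_event H act' r (Suc t) (\<not> b)) \<le> g - advantage H act' r (Suc t)" for t b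
  proof -
    have "\<alpha> b * measure (given (pverts H) b) (action_event H act' r (Suc t) (\<not> b)) -
      \<beta> b * measure (given (pverts H) (\<not> b)) (action_event H act' r (Suc t) (\<not> b)) + advantage H act' r (Suc t) \<le> g + e" if e: "e > 0" for e
    proof (rule tendsto_upperbound)
      show "(\<lambda>n. \<alpha> b * ?P b (action_event G act (v (\<sigma> n)) (Suc t) (\<not> b)) -
          \<beta> b * ?P (\<not> b) (action_event G act (v (\<sigma> n)) (Suc t) (\<not> b)) + advantage G act (v (\<sigma> n)) (Suc t)) \<longlonglongrightarrow>
        \<alpha> b * measure (given (pverts H) b) (action_event H act' r (Suc t) (\<not> b)) -
          \<beta> b * measure (given (pverts H) (\<not> b)) (action_event H act' r (Suc t) (\<not> b)) + advantage H act' r (Suc t)"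
        by (intro tendsto_intros conv_event conv_adv)
      show "eventually (\<lambda>n. \<alpha> b * ?P b (action_event G act (v (\<sigma> n)) (Suc t) (\<not> b)) -
          \<beta> b * ?P (\<not> b) (action_event G act (v (\<sigma> n)) (Suc t) (\<not> b)) + advantage G act (v (\<sigma> n)) (Suc t) \<le> g + e) sequentially"
        by (rule eventually_subseq[OF \<sigma> wrong[OF e]])
    qed simp
    from field_le_epsilon[OF this] show ?thesis by linarith
  qed
  ultimately show ?thesis using H by blast
qed

text \<open>The weights say that conditioning on the region of an agent of an earlier network does not make any
  event of the present network evidence against the true state.  The errors of the agent \<open>r\<close> vanish in the
  weighted sense; agreement and independence upgrade this to certainty.\<close>

lemma weights_imply_certainty:
  assumes net: "network d G" and inf: "infinite (pverts G)" and MAP: "MAP_actions \<mu>0 \<mu>1 G act" and r: "r \<in> pverts G"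
    and A: "common_optimal_action_set \<mu>0 \<mu>1 G act A"
    and g: "\<And>t. advantage G act r (Suc t) \<le> g" and sup: "\<And>e. e > 0 \<Longrightarrow> \<exists>t. advantage G act r (Suc t) > g - e"
    and \<alpha>: "\<And>b. \<alpha> b \<le> 1" and \<beta>: "\<And>b. 0 \<le> \<beta> b" and \<delta>: "\<delta> > 0" "\<And>b. \<alpha> b - \<beta> b \<ge> \<delta>"
    and nonneg: "\<And>v t E b. v \<in> pverts G \<Longrightarrow> E \<in> sets (Info G act v (Suc t)) \<Longrightarrow>
      \<beta> b * measure (given (pverts G) (\<not> b)) E \<le> \<alpha> b * measure (given (pverts G) b) E"
    and wrong: "\<And>t b. \<alpha> b * measure (given (pverts G) b) (action_event G act r (Suc t) (\<not> b)) -
      \<beta> b * measure (given (pverts G) (\<not> b)) (action_event G act r (Suc t) (\<not> b)) \<le> g - advantage G act r (Suc t)"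
  shows "1 \<le> g"
proof -
  let ?V = "pverts G" and ?N = "neighbors G" and ?R = "\<lambda>b. region G act r {b}" and ?Z = "region G act r UNIV"
  let ?P = "\<lambda>s. measure (given ?V s)"
  have G: "connected_undirected_graph G" by (rule network_connected[OF net])
  have ad: "adapted G act" by (rule MAP_actions_adapted[OF MAP])
  \<comment> \<open>The evidence of \<open>E\<close> for \<open>b\<close> when an independent
    observation of an earlier region \<open>{b}\<close> is taken into account. By approximation it
    is nonnegative on all limiting information.\<close>
  define f where "f b E = \<alpha> b * ?P b E - \<beta> b * ?P (\<not> b) E" for b E
  have \<alpha>pos: "\<alpha> b > 0" for b using \<delta>(1) \<delta>(2)[of b] \<beta>[of b] by linarith
  have \<beta>1: "\<beta> b \<le> 1" for b using \<delta>(1) \<delta>(2)[of b] \<alpha>[of b] by linarith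
  have P01: "0 \<le> ?P s E" "?P s E \<le> 1" for s E by simp_all
  have R: "?R b \<in> sets (Info_limit G act r)" "?R b \<in> sets (World ?V)" for b
    using region_info_limit(1)[OF G ad r] info_limit_World[OF G ad r] by blast+
  have Z: "?Z \<in> sets (Info_limit G act r)" "?Z \<in> sets (World ?V)"
    using region_info_limit(2)[OF G ad r] info_limit_World[OF G ad r] by blast+
  have f_nonneg: "0 \<le> f b E" if v: "v \<in> ?V" and E: "E \<in> sets (Info_limit G act v)" for v E b
  proof (rule field_le_epsilon)
    fix e :: real assume e: "e > 0"
    obtain t E' where E': "E' \<in> sets (Info G act v (Suc t))" and
      close: "\<forall>s. \<forall>B\<in>sets (World ?V). \<bar>?P s (B \<inter> E) - ?P s (B \<inter> E')\<bar> \<le> e / 2"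
      using info_limit_approximation[OF G ad v E, of "e / 2"] e by auto
    have "E \<subseteq> space (World ?V)" "E' \<subseteq> space (World ?V)"
      using sets.sets_into_space info_limit_World[OF G ad v E] info_event_World[OF G ad v E'] by blast+
    then have c: "\<bar>?P s E - ?P s E'\<bar> \<le> e / 2" for s
      using close[rule_format, of "space (World ?V)" s] by (simp add: Int_absorb1)
    have scaled: "z * x \<le> e / 2" if "0 \<le> z" "z \<le> 1" "x \<le> e / 2" for x z :: real
    proof -
      have "z * x \<le> z * (e / 2)" using that by (intro mult_left_mono) auto
      also have "\<dots> \<le> 1 * (e / 2)" using that e by (intro mult_right_mono) auto
      finally show ?thesis by simp
    qed
    have "\<alpha> b * (?P b E' - ?P b E) \<le> e / 2"
      by (rule scaled[OF less_imp_le[OF \<alpha>pos] \<alpha>]) (use c[of b] in linarith)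
    moreover have "\<beta> b * (?P (\<not> b) E - ?P (\<not> b) E') \<le> e / 2"
      by (rule scaled[OF \<beta> \<beta>1]) (use c[of "\<not> b"] in linarith)
    moreover have "0 \<le> f b E'" using nonneg[OF v E', of b] by (simp add: f_def)
    ultimately show "0 \<le> f b E + e" unfolding f_def by (simp add: right_diff_distrib)
  qed
  have f_split: "f b E = f b (E \<inter> B) + f b (E - B)" if "E \<in> sets (World ?V)" "B \<in> sets (World ?V)" for b E B
  proof -
    have "?P s E = ?P s (E \<inter> B) + ?P s (E - B)" for s
      using that given.finite_measure_Union[of "E \<inter> B" ?V s "E - B"] by (simp add: Int_Diff_Un Int_Diff_disjoint)
    then show ?thesis by (simp add: f_def algebra_simps)
  qed
  have f_mono: "f b E \<le> f b E'" if "E \<subseteq> E'" "E \<in> sets (Info_limit G act r)" "E' \<in> sets (Info_limit G act r)" for b E E'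
  proof -
    have "E' \<inter> E = E" using that by blast
    moreover have "E' - E \<in> sets (Info_limit G act r)" using that by simp
    ultimately show ?thesis
      using f_split[of E' E b] f_nonneg[OF r, of "E' - E" b] info_limit_World[OF G ad r] that by simp
  qed
  define Y where "Y t b = action_event G act r (Suc t) b" for t b
  have Y: "Y t b \<in> sets (Info_limit G act r)" for t b
    unfolding Y_def by (rule info_le_info_limit[OF G ad r _ action_event_info[OF ad r]]) auto
  \<comment> \<open>The advantage comes arbitrarily close to \<open>g\<close>, so at suitable times
    the weighted errors for both states are small together.\<close>
  have error: "\<exists>t. \<forall>b. f b (Y t (\<not> b)) \<le> e" if e: "e > 0" for e
  proof -
    obtain t where "advantage G act r (Suc t) > g - e" using sup[OF e] by blast
    then have "f b (Y t (\<not> b)) \<le> e" for b using wrong[of b t] unfolding f_def Y_def by linarith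
    then show ?thesis by blast
  qed
  have Y_split: "f b E = f b (E \<inter> Y t (\<not> b)) + f b (E \<inter> Y t b)" if "E \<in> sets (World ?V)" for b E t
  proof -
    have "E - Y t (\<not> b) = E \<inter> Y t b" using sets.sets_into_space[OF that] by (auto simp: Y_def action_event_def)
    then show ?thesis using f_split[OF that info_limit_World[OF G ad r Y]] by metis
  qed
  \<comment> \<open>On subsets of the tie region that \<open>r\<close> can observe, the two
    conditional laws agree, so \<open>f b\<close> is \<open>\<alpha> b - \<beta> b\<close> times the
    probability; the gap \<open>\<delta>\<close> turns small \<open>f b\<close> into small
    probability.\<close>
  have small: "?P b (?Z \<inter> Y t (\<not> b)) \<le> e / \<delta>" if "\<forall>b. f b (Y t (\<not> b)) \<le> e" for t b e
  proof -
    have "f b (?Z \<inter> Y t (\<not> b)) \<le> f b (Y t (\<not> b))" using Y Z by (intro f_mono) auto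
    moreover have "?P (\<not> b) (?Z \<inter> Y t (\<not> b)) = ?P b (?Z \<inter> Y t (\<not> b))"
      using region_lik(2)[OF G ad r, of "?Z \<inter> Y t (\<not> b)" b] Y Z by (simp add: lik_def)
    ultimately have "(\<alpha> b - \<beta> b) * ?P b (?Z \<inter> Y t (\<not> b)) \<le> e"
      using that[rule_format, of b] by (simp add: f_def left_diff_distrib)
    moreover have "\<delta> * ?P b (?Z \<inter> Y t (\<not> b)) \<le> (\<alpha> b - \<beta> b) * ?P b (?Z \<inter> Y t (\<not> b))"
      using \<delta> P01 by (intro mult_right_mono) auto
    ultimately show ?thesis using \<delta>(1) by (simp add: pos_le_divide_eq mult.commute)
  qed
  have Z0: "?P b ?Z = 0" for b
  proof -
    have "?P b ?Z \<le> 0 + e" if e: "e > 0" for e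
    proof -
      have "\<delta> * (e / 2) > 0" using \<delta>(1) e by simp
      then obtain t where t: "\<forall>b. f b (Y t (\<not> b)) \<le> \<delta> * (e / 2)" using error by blast
      have 1: "?P b (?Z \<inter> Y t (\<not> b)) \<le> e / 2" using small[OF t, of b] \<delta>(1) by simp
      have "?P (\<not> b) (?Z \<inter> Y t b) = ?P b (?Z \<inter> Y t b)"
        using region_lik(2)[OF G ad r, of "?Z \<inter> Y t b" b] Y Z by (simp add: lik_def)
      then have 2: "?P b (?Z \<inter> Y t b) \<le> e / 2" using small[OF t, of "\<not> b"] \<delta>(1) by simp
      have "?Z = (?Z \<inter> Y t (\<not> b)) \<union> (?Z \<inter> Y t b)"
        using sets.sets_into_space[OF Z(2)] by (auto simp: Y_def action_event_def)
      then have "?P b ?Z = ?P b ((?Z \<inter> Y t (\<not> b)) \<union> (?Z \<inter> Y t b))" by (rule arg_cong)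
      moreover have "?P b ((?Z \<inter> Y t (\<not> b)) \<union> (?Z \<inter> Y t b)) \<le> ?P b (?Z \<inter> Y t (\<not> b)) + ?P b (?Z \<inter> Y t b)"
        using Z(2) info_limit_World[OF G ad r Y] by (intro measure_Un_le) auto
      ultimately show ?thesis using 1 2 by linarith
    qed
    then have "?P b ?Z \<le> 0" by (rule field_le_epsilon)
    with P01(1)[of b ?Z] show ?thesis by linarith
  qed
  \<comment> \<open>Where the action is \<open>\<not> b\<close>, the error bound for
    \<open>b\<close> applies directly. Where the action is \<open>b\<close> inside the region of
    \<open>\<not> b\<close>, the error bound for \<open>\<not> b\<close> applies, and there the law
    given \<open>b\<close> is dominated by the one given \<open>\<not> b\<close>.\<close>
  have f0: "f b (?R (\<not> b)) = 0" for b
  proof -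
    let ?Q = "?R (\<not> b)"
    have "f b ?Q \<le> 0 + e" if e: "e > 0" for e
    proof -
      define e' where "e' = min (e / 2) (\<delta> * (e / 2))"
      have "e' > 0" using \<delta>(1) e by (simp add: e'_def)
      then obtain t where t: "\<forall>b. f b (Y t (\<not> b)) \<le> e'" using error by blast
      have "f b (?Q \<inter> Y t (\<not> b)) \<le> f b (Y t (\<not> b))" using Y R by (intro f_mono) auto
      then have 1: "f b (?Q \<inter> Y t (\<not> b)) \<le> e / 2" using t[rule_format, of b] by (simp add: e'_def)
      let ?E = "?Q \<inter> Y t b"
      have E: "?E \<in> sets (Info_limit G act r)" using Y R by auto
      have "f (\<not> b) ?E \<le> f (\<not> b) (Y t b)" using Y E by (intro f_mono) auto
      also have "\<dots> \<le> e'" using t[rule_format, of "\<not> b"] by simp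
      finally have 2: "\<alpha> (\<not> b) * ?P (\<not> b) ?E - \<beta> (\<not> b) * ?P b ?E \<le> \<delta> * (e / 2)" by (simp add: f_def e'_def)
      have "?P b ?E \<le> ?P (\<not> b) ?E" using region_lik(1)[OF G ad r E, of "\<not> b"] by (simp add: lik_def)
      then have "\<alpha> (\<not> b) * ?P b ?E \<le> \<alpha> (\<not> b) * ?P (\<not> b) ?E" using \<alpha>pos[of "\<not> b"] by (intro mult_left_mono) auto
      moreover have "\<delta> * ?P b ?E \<le> (\<alpha> (\<not> b) - \<beta> (\<not> b)) * ?P b ?E" using \<delta>(2) P01 by (intro mult_right_mono) auto
      ultimately have "\<delta> * ?P b ?E \<le> \<delta> * (e / 2)" using 2 by (simp add: left_diff_distrib)
      then have 3: "?P b ?E \<le> e / 2" using \<delta>(1) by simp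
      have "\<alpha> b * ?P b ?E \<le> 1 * ?P b ?E" using \<alpha> P01 by (intro mult_right_mono) auto
      moreover have "0 \<le> \<beta> b * ?P (\<not> b) ?E" using \<beta> P01 by simp
      ultimately have "f b ?E \<le> e / 2" using 3 by (simp add: f_def)
      then show ?thesis using 1 Y_split[OF R(2), of b "\<not> b" t] by simp
    qed
    then have "f b ?Q \<le> 0" by (rule field_le_epsilon)
    with f_nonneg[OF r R(1), of b "\<not> b"] show ?thesis by linarith
  qed
  \<comment> \<open>As \<open>f b\<close> vanishes on \<open>?Q\<close> and is nonnegative on what
    agents learn, it vanishes on every piece cut out by the signal of an agent \<open>x\<close>, who
    agrees on \<open>?Q\<close>. For distant \<open>x\<close> the signal is almost independent of
    \<open>?Q\<close>, which yields the equation \<open>balance\<close>.\<close>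
  have Q0: "?P b (?R (\<not> b)) = 0" for b
  proof -
    let ?Q = "?R (\<not> b)"
    have balance: "\<alpha> b * ?P b ?Q * measure (sig b) D = \<beta> b * ?P (\<not> b) ?Q * measure (sig (\<not> b)) D" if D: "D \<in> sets \<mu>0" for D
    proof -
      let ?W = "\<lambda>x. {\<omega>\<in>space (World ?V). snd \<omega> x \<in> D}"
      have f_signal: "f b (?W x \<inter> ?Q) = 0" if x: "x \<in> ?V" for x
      proof -
        have W: "?W x \<in> sets (Info G act x (Suc 0))" by (rule info_signal[OF D])
        note WW = info_event_World[OF G ad x W] and WL = info_le_info_limit[OF G ad x _ W]
        let ?S = "region G act x {\<not> b}"
        have S: "?S \<in> sets (Info_limit G act x)" "?S \<in> sets (World ?V)"
          using region_info_limit(1)[OF G ad x] info_limit_World[OF G ad x] by blast+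
        have eq: "f b (E \<inter> ?Q) = f b (E \<inter> ?S)" if "E \<in> sets (World ?V)" for E
          using agreement_region[OF A r x that R(2) S(2)] by (simp add: f_def)
        have "0 \<le> f b (?W x \<inter> ?S)" "0 \<le> f b ((space (World ?V) - ?W x) \<inter> ?S)"
          using WL S(1) sets.compl_sets[OF WL] info_limit_sets(2)[OF G ad x] by (auto intro!: f_nonneg[OF x] sets.Int)
        then have "0 \<le> f b (?W x \<inter> ?Q)" "0 \<le> f b ((space (World ?V) - ?W x) \<inter> ?Q)"
          using eq WW by auto
        moreover have "(space (World ?V) - ?W x) \<inter> ?Q = ?Q - ?W x" using sets.sets_into_space[OF R(2)] by blast
        ultimately show ?thesis using f_split[OF R(2) WW, of b "\<not> b"] f0[of b] by (simp add: Int_commute)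
      qed
      let ?L = "\<alpha> b * ?P b ?Q * measure (sig b) D - \<beta> b * ?P (\<not> b) ?Q * measure (sig (\<not> b)) D"
      have "\<bar>?L\<bar> \<le> 0 + e" if e: "e > 0" for e
      proof -
        obtain t0 where t0: "\<forall>v\<in>?V. \<forall>t. v \<notin> nball ?N (Suc t0 + Suc t) r \<longrightarrow> (\<forall>E\<in>sets (Info G act v (Suc t)). \<forall>s.
            \<bar>?P s (E \<inter> ?Q) - ?P s E * ?P s ?Q\<bar> \<le> e / 2)"
          using almost_independent[OF G ad r R(1), of "e / 2" "\<not> b"] e by auto
        obtain x where x: "x \<in> ?V" "x \<notin> nball ?N (Suc t0 + Suc 0) r"
          using network_nball(1)[OF net r, of "Suc t0 + Suc 0"] inf by (meson finite_subset subsetI)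
        have "\<bar>?P s (?W x \<inter> ?Q) - ?P s (?W x) * ?P s ?Q\<bar> \<le> e / 2" for s
          using t0 x info_signal[OF D] by blast
        then have c: "\<bar>?P s (?W x \<inter> ?Q) - measure (sig s) D * ?P s ?Q\<bar> \<le> e / 2" for s
          using given_signal[OF D x(1)] by simp
        have "\<bar>\<alpha> b * (?P b (?W x \<inter> ?Q) - measure (sig b) D * ?P b ?Q)\<bar> \<le> 1 * (e / 2)"
          unfolding abs_mult using c \<alpha> \<alpha>pos[of b] by (intro mult_mono) auto
        moreover have "\<bar>\<beta> b * (?P (\<not> b) (?W x \<inter> ?Q) - measure (sig (\<not> b)) D * ?P (\<not> b) ?Q)\<bar> \<le> 1 * (e / 2)"
          unfolding abs_mult using c \<beta> \<beta>1[of b] by (intro mult_mono) auto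
        moreover have "\<alpha> b * ?P b (?W x \<inter> ?Q) = \<beta> b * ?P (\<not> b) (?W x \<inter> ?Q)" using f_signal[OF x(1)] by (simp add: f_def)
        then have "?L = \<beta> b * (?P (\<not> b) (?W x \<inter> ?Q) - measure (sig (\<not> b)) D * ?P (\<not> b) ?Q) - \<alpha> b * (?P b (?W x \<inter> ?Q) - measure (sig b) D * ?P b ?Q)"
          by (simp add: right_diff_distrib mult_ac)
        ultimately show ?thesis by linarith
      qed
      then have "\<bar>?L\<bar> \<le> 0" by (rule field_le_epsilon)
      then show ?thesis by simp
    qed
    define \<kappa> where "\<kappa> = \<alpha> b * ?P b ?Q"
    \<comment> \<open>The sure event equates the two coefficients; an informative event then forces
      their common value to be 0.\<close>
    have "\<kappa> = \<beta> b * ?P (\<not> b) ?Q"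
      using balance[OF sets.top] sig.prob_space[of b] sig.prob_space[of "\<not> b"] by (simp add: \<kappa>_def)
    then have eq: "\<kappa> * measure (sig b) D = \<kappa> * measure (sig (\<not> b)) D" if "D \<in> sets \<mu>0" for D
      using balance[OF that] by (simp add: \<kappa>_def)
    obtain D where D: "D \<in> sets \<mu>0" "measure \<mu>0 D < measure \<mu>1 D" using exists_informative_signal by blast
    have "measure (sig b) D \<noteq> measure (sig (\<not> b)) D" using D(2) by (cases b) (auto simp: sig_def)
    then have "\<kappa> = 0" using eq[OF D(1)] by simp
    then show ?thesis using \<alpha>pos[of b] by (simp add: \<kappa>_def)
  qed
  have "?P True (?R True) = 1"
  proof -
    have cov: "space (World ?V) = ?R True \<union> ?R False \<union> ?Z" using region_cover(1)[of G act r True] by simp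
    have "1 = ?P True (?R True \<union> ?R False \<union> ?Z)" using given.prob_space[of ?V True] cov by simp
    also have "\<dots> \<le> ?P True (?R True \<union> ?R False) + ?P True ?Z" using R Z by (intro measure_Un_le) auto
    also have "?P True (?R True \<union> ?R False) \<le> ?P True (?R True) + ?P True (?R False)" using R by (intro measure_Un_le) auto
    finally have "1 \<le> ?P True (?R True)" using Q0[of True] Z0[of True] by simp
    with P01(2)[of True "?R True"] show ?thesis by (rule antisym)
  qed
  moreover have "?P False (?R True) = 0" using Q0[of False] by simp
  ultimately have "lik ?V True (?R True) = 1" by (simp add: lik_def)
  then show ?thesis using lik_info_limit_le[OF G MAP r g R(1), of True True] by simp
qed

text \<open>In the proof by contradiction, \<open>K\<close> attains the infimum \<open>g\<close> and
  \<open>L\<close> arises from \<open>K\<close> by moving the root to infinity. The advantages in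
  \<open>L\<close> stay below \<open>g\<close>, while \<open>L\<close> itself competes in the
  infimum; both bounds enter \<open>weights_imply_certainty\<close>, which then gives
  \<open>1 \<le> g\<close>.\<close>

theorem infinite_network_learns:
  assumes agree: "\<And>G act. connected_undirected_graph G \<Longrightarrow> MAP_actions \<mu>0 \<mu>1 G act \<Longrightarrow> \<exists>A. common_optimal_action_set \<mu>0 \<mu>1 G act A"
    and net: "network d G" and inf: "infinite (pverts G)" and MAP: "MAP_actions \<mu>0 \<mu>1 G act" and u: "u \<in> pverts G"
    and e: "e > 0"
  shows "\<exists>t. advantage G act u (Suc t) > 1 - e"
proof (rule ccontr)
  assume no: "\<not> ?thesis"
  define ok where "ok H a x \<longleftrightarrow> network d H \<and> infinite (pverts H) \<and> MAP_actions \<mu>0 \<mu>1 H a \<and> x \<in> pverts H" for H a x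
  define val where "val H a x = (SUP t. advantage H a x (Suc t))" for H :: "nat pair_pre_digraph" and a :: "'w action_process" and x
  define S where "S = {val H a x | H a x. ok H a x}"
  have bdd: "bdd_above (range (\<lambda>t. advantage H a x (Suc t)))" for H a x
    by (rule bdd_aboveI[of _ 1]) (auto simp: advantage_bounds)
  have le_val: "advantage H a x (Suc t) \<le> val H a x" for H a x t
    unfolding val_def by (rule cSUP_upper[OF _ bdd]) simp
  have S: "val G act u \<in> S" unfolding S_def ok_def using net inf MAP u by blast
  have bddS: "bdd_below S"
  proof (rule bdd_belowI[of _ "-1"])
    fix y assume "y \<in> S"
    then obtain H a x where "y = val H a x" by (auto simp: S_def)
    then show "-1 \<le> y" using le_val[of H a x 0] advantage_bounds(2)[of H a x "Suc 0"] by simp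
  qed
  define g where "g = Inf S"
  have "val G act u \<le> 1 - e" unfolding val_def using no by (intro cSUP_least) (auto simp: not_less)
  then have g1: "g < 1" using cInf_lower[OF S bddS] e by (simp add: g_def)
  have "\<exists>H a x. ok H a x \<and> val H a x < g + 1 / (real n + 1)" for n
  proof -
    have "\<exists>y\<in>S. y < g + 1 / (real n + 1)"
      unfolding g_def using S by (subst cInf_less_iff[symmetric]) (auto simp: bddS)
    then show ?thesis by (auto simp: S_def)
  qed
  then have "\<forall>n. \<exists>H. \<exists>a x. ok H a x \<and> val H a x < g + 1 / (real n + 1)" by blast
  from choice[OF this] obtain H where "\<forall>n. \<exists>a. \<exists>x. ok (H n) a x \<and> val (H n) a x < g + 1 / (real n + 1)" ..
  from choice[OF this] obtain a where "\<forall>n. \<exists>x. ok (H n) (a n) x \<and> val (H n) (a n) x < g + 1 / (real n + 1)" ..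
  from choice[OF this] obtain x where x: "\<forall>n. ok (H n) (a n) (x n) \<and> val (H n) (a n) (x n) < g + 1 / (real n + 1)" ..
  have ok: "network d (H n)" "infinite (pverts (H n))" "MAP_actions \<mu>0 \<mu>1 (H n) (a n)" "x n \<in> pverts (H n)" for n
    using x by (auto simp: ok_def)
  have far: "eventually (\<lambda>n. \<not> pverts (H n) \<subseteq> nball (neighbors (H n)) k (x n)) sequentially" for k
    using network_nball(1)[OF ok(1) ok(4)] ok(2) by (intro always_eventually) (metis finite_subset)
  from limit_network[of d H a x, OF ok(1) ok(3) ok(4) far]
  obtain \<sigma> K act' w where \<sigma>: "strict_mono \<sigma>" and K: "network d K" "infinite (pverts K)" "MAP_actions \<mu>0 \<mu>1 K act'" "w \<in> pverts K"
    and conv: "\<forall>s t. (\<lambda>n. action_prob (H (\<sigma> n)) (a (\<sigma> n)) (x (\<sigma> n)) (Suc t) s) \<longlonglongrightarrow> action_prob K act' w (Suc t) s"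
    by (elim exE conjE)
  \<comment> \<open>The time is fixed, so no interchange of the limit with the supremum over time is
    required.\<close>
  have le_g: "advantage K act' w (Suc t) \<le> g" for t
  proof (rule LIMSEQ_le)
    show "(\<lambda>n. advantage (H (\<sigma> n)) (a (\<sigma> n)) (x (\<sigma> n)) (Suc t)) \<longlonglongrightarrow> advantage K act' w (Suc t)"
      unfolding advantage_action_prob using conv by (intro tendsto_diff) auto
    have "(\<lambda>n. g + 1 / (real n + 1)) \<longlonglongrightarrow> g + 0"
      using LIMSEQ_inverse_real_of_nat by (intro tendsto_add tendsto_const) (simp add: inverse_eq_divide add.commute)
    from LIMSEQ_subseq_LIMSEQ[OF this \<sigma>] show "(\<lambda>n. g + 1 / (real (\<sigma> n) + 1)) \<longlonglongrightarrow> g" by (simp add: o_def)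
    show "\<exists>N. \<forall>n\<ge>N. advantage (H (\<sigma> n)) (a (\<sigma> n)) (x (\<sigma> n)) (Suc t) \<le> g + 1 / (real (\<sigma> n) + 1)"
      using x le_val by (meson less_imp_le order_trans)
  qed
  have KG: "connected_undirected_graph K" by (rule network_connected[OF K(1)])
  have adK: "adapted K act'" by (rule MAP_actions_adapted[OF K(3)])
  obtain B where B: "common_optimal_action_set \<mu>0 \<mu>1 K act' B" using agree[OF KG K(3)] by blast
  define \<alpha> where "\<alpha> b = measure (given (pverts K) b) (region K act' w {b})" for b
  define \<beta> where "\<beta> b = measure (given (pverts K) (\<not> b)) (region K act' w {b})" for b
  from limit_weights[OF K B le_g, folded \<alpha>_def \<beta>_def]
  obtain L l r where L: "network d L" "infinite (pverts L)" "MAP_actions \<mu>0 \<mu>1 L l" "r \<in> pverts L"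
    and Lg: "\<forall>t. advantage L l r (Suc t) \<le> g"
    and nonneg: "\<forall>v\<in>pverts L. \<forall>t. \<forall>E\<in>sets (Info L l v (Suc t)). \<forall>b.
      \<beta> b * measure (given (pverts L) (\<not> b)) E \<le> \<alpha> b * measure (given (pverts L) b) E"
    and wrong: "\<forall>t b. \<alpha> b * measure (given (pverts L) b) (action_event L l r (Suc t) (\<not> b)) -
      \<beta> b * measure (given (pverts L) (\<not> b)) (action_event L l r (Suc t) (\<not> b)) \<le> g - advantage L l r (Suc t)"
    by (elim exE conjE)
  obtain C where C: "common_optimal_action_set \<mu>0 \<mu>1 L l C" using agree[OF network_connected[OF L(1)] L(3)] by blast
  obtain D where D: "D \<in> sets \<mu>0" "measure \<mu>0 D < measure \<mu>1 D" using exists_informative_signal by blast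
  define \<delta> where "\<delta> = measure \<mu>1 D - measure \<mu>0 D"
  \<comment> \<open>The own signal belongs to the limiting information, so the region carries at
    least the evidence of \<open>D\<close>, or of its complement for state 0; the amount is the same
    in both cases.\<close>
  have "\<alpha> b - \<beta> b \<ge> \<delta>" for b
  proof -
    define D' where "D' = (if b then D else space \<mu>0 - D)"
    have D': "D' \<in> sets \<mu>0" using D(1) by (simp add: D'_def)
    have "{\<omega>\<in>space (World (pverts K)). snd \<omega> w \<in> D'} \<in> sets (Info_limit K act' w)"
      by (rule info_le_info_limit[OF KG adK K(4) order_refl info_signal[OF D']])
    from region_optimal[OF KG adK K(4) this, of b]
    have "measure (sig b) D' - measure (sig (\<not> b)) D' \<le> \<alpha> b - \<beta> b"
      unfolding lik_def \<alpha>_def \<beta>_def given_signal[OF D' K(4)] .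
    moreover have "measure (sig b) D' - measure (sig (\<not> b)) D' = \<delta>"
      using M0.prob_compl[OF D(1)] M1.prob_compl[of D] D(1) by (auto simp: D'_def \<delta>_def sig_def sets_eq space_eq)
    ultimately show ?thesis by simp
  qed
  moreover have "\<exists>t. advantage L l r (Suc t) > g - e" if "e > 0" for e
  proof -
    \<comment> \<open>Since \<open>L\<close> is one of the networks over which the infimum is taken,
      its supremum is at least \<open>g\<close>.\<close>
    have "val L l r \<in> S" unfolding S_def ok_def using L by blast
    then have "g - e < val L l r" using cInf_lower[OF _ bddS] that by (fastforce simp: g_def)
    then show ?thesis unfolding val_def by (subst (asm) less_cSUP_iff) (auto simp: bdd)
  qed
  moreover have "\<delta> > 0" using D(2) by (simp add: \<delta>_def)
  moreover have "\<alpha> b \<le> 1" "0 \<le> \<beta> b" for b by (simp_all add: \<alpha>_def \<beta>_def)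
  ultimately have "1 \<le> g"
    using nonneg wrong Lg by (intro weights_imply_certainty[OF L C, where \<alpha>=\<alpha> and \<beta>=\<beta> and \<delta>=\<delta>]) auto
  with g1 show False by simp
qed

text \<open>Balls of radius \<open>k\<close> have at most \<open>(d + 1)^k\<close> vertices, so
  counterexamples of growing size leave every ball around their agents. Their limit would be
  infinite with an advantage bounded away from 1 at all times.\<close>

theorem large_network_learns:
  assumes agree: "\<And>G act. connected_undirected_graph G \<Longrightarrow> MAP_actions \<mu>0 \<mu>1 G act \<Longrightarrow> \<exists>A. common_optimal_action_set \<mu>0 \<mu>1 G act A"
    and e: "e > 0"
  shows "\<exists>n0. \<forall>G act u. network d G \<and> finite (pverts G) \<and> card (pverts G) \<ge> n0 \<and> MAP_actions \<mu>0 \<mu>1 G act \<and> u \<in> pverts G \<longrightarrow>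
    (\<exists>t. advantage G act u (Suc t) > 1 - e)"
proof (rule ccontr)
  define bad where "bad n G act u \<longleftrightarrow> network d G \<and> finite (pverts G) \<and> card (pverts G) \<ge> n \<and> MAP_actions \<mu>0 \<mu>1 G act \<and> u \<in> pverts G \<and>
    (\<forall>t. advantage G act u (Suc t) \<le> 1 - e)" for n G act u
  assume "\<not> ?thesis"
  then have "\<forall>n. \<exists>G. \<exists>act u. bad n G act u" unfolding bad_def by (force simp: not_less)
  from choice[OF this] obtain G where "\<forall>n. \<exists>act. \<exists>u. bad n (G n) act u" ..
  from choice[OF this] obtain act where "\<forall>n. \<exists>u. bad n (G n) (act n) u" ..
  from choice[OF this] obtain u where u: "\<forall>n. bad n (G n) (act n) (u n)" ..
  have ok: "network d (G n)" "finite (pverts (G n))" "card (pverts (G n)) \<ge> n" "MAP_actions \<mu>0 \<mu>1 (G n) (act n)" "u n \<in> pverts (G n)"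
    "advantage (G n) (act n) (u n) (Suc t) \<le> 1 - e" for n t
    using u by (auto simp: bad_def)
  have far: "eventually (\<lambda>n. \<not> pverts (G n) \<subseteq> nball (neighbors (G n)) k (u n)) sequentially" for k
  proof (rule eventually_sequentiallyI[of "Suc ((d + 1)^k)"])
    fix n assume n: "Suc ((d + 1)^k) \<le> n"
    show "\<not> pverts (G n) \<subseteq> nball (neighbors (G n)) k (u n)"
    proof
      assume "pverts (G n) \<subseteq> nball (neighbors (G n)) k (u n)"
      from card_mono[OF network_nball(1)[OF ok(1,5)] this] network_nball(2)[OF ok(1,5), of n k] ok(3)[of n] n show False by linarith
    qed
  qed
  from limit_network[of d G act u, OF ok(1) ok(4) ok(5) far]
  obtain \<sigma> K act' w where \<sigma>: "strict_mono \<sigma>" and K: "network d K" "infinite (pverts K)" "MAP_actions \<mu>0 \<mu>1 K act'" "w \<in> pverts K"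
    and conv: "\<forall>s t. (\<lambda>n. action_prob (G (\<sigma> n)) (act (\<sigma> n)) (u (\<sigma> n)) (Suc t) s) \<longlonglongrightarrow> action_prob K act' w (Suc t) s"
    by (elim exE conjE)
  have "advantage K act' w (Suc t) \<le> 1 - e" for t
  proof (rule tendsto_upperbound)
    show "(\<lambda>n. advantage (G (\<sigma> n)) (act (\<sigma> n)) (u (\<sigma> n)) (Suc t)) \<longlonglongrightarrow> advantage K act' w (Suc t)"
      unfolding advantage_action_prob using conv by (intro tendsto_diff) auto
  qed (use ok(6) in auto)
  moreover obtain t where "advantage K act' w (Suc t) > 1 - e" using infinite_network_learns[OF agree K e] by blast
  ultimately show False by (simp add: not_le[symmetric])
qed

end

section \<open>Agents with many neighbors\<close>

text \<open>Pairwise independence removes the off-diagonal terms of the variance, and each diagonal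
  term is bounded crudely by 1.\<close>

lemma (in prob_space) Chebyshev_pairwise_indep:
  assumes J: "finite J" and A: "\<And>v. v \<in> J \<Longrightarrow> A v \<in> events"
    and indep: "\<And>v w. v \<in> J \<Longrightarrow> w \<in> J \<Longrightarrow> v \<noteq> w \<Longrightarrow> prob (A v \<inter> A w) = prob (A v) * prob (A w)" and a: "a > 0"
  shows "prob {x\<in>space M. a \<le> \<bar>(\<Sum>v\<in>J. indicator (A v) x) - (\<Sum>v\<in>J. prob (A v))\<bar>} \<le> card J / a\<^sup>2"
proof -
  let ?X = "\<lambda>x. \<Sum>v\<in>J. indicator (A v) x :: real"
  have int: "integrable M (indicator (B :: 'a set) :: 'a \<Rightarrow> real)" if "B \<in> events" for B
    using that by (simp add: emeasure_eq_measure)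
  have intX: "integrable M ?X" using int[OF A] by (intro Bochner_Integration.integrable_sum) auto
  have sq: "(?X x)\<^sup>2 = (\<Sum>v\<in>J. \<Sum>w\<in>J. indicator (A v \<inter> A w) x)" for x
    by (simp add: power2_eq_square sum_product indicator_inter_arith)
  have AA: "A v \<inter> A w \<in> events" if "v \<in> J" "w \<in> J" for v w using A that by blast
  have intX2: "integrable M (\<lambda>x. (?X x)\<^sup>2)"
    unfolding sq using int[OF AA] by (intro Bochner_Integration.integrable_sum) auto
  have EB: "expectation (indicator B) = prob B" if "B \<in> events" for B
    using that sets.sets_into_space[OF that] by (simp add: Int_absorb2)
  have EX: "expectation ?X = (\<Sum>v\<in>J. prob (A v))"
    using int[OF A] EB[OF A] by (subst Bochner_Integration.integral_sum) auto
  have "expectation (\<lambda>x. (?X x)\<^sup>2) = (\<Sum>v\<in>J. \<Sum>w\<in>J. prob (A v \<inter> A w))"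
    unfolding sq using int[OF AA] EB[OF AA] by (subst Bochner_Integration.integral_sum, simp_all)+
  then have "variance ?X = (\<Sum>v\<in>J. \<Sum>w\<in>J. prob (A v \<inter> A w)) - (\<Sum>v\<in>J. \<Sum>w\<in>J. prob (A v) * prob (A w))"
    using variance_eq[OF intX intX2] by (simp add: EX power2_eq_square sum_product)
  also have "\<dots> = (\<Sum>v\<in>J. \<Sum>w\<in>J. prob (A v \<inter> A w) - prob (A v) * prob (A w))" by (simp add: sum_subtractf)
  also have "\<dots> = (\<Sum>v\<in>J. \<Sum>w\<in>J. if v = w then prob (A v) - prob (A v) * prob (A v) else 0)"
    using indep by (intro sum.cong refl) auto
  also have "\<dots> = (\<Sum>v\<in>J. prob (A v) - prob (A v) * prob (A v))" using J by simp
  also have "\<dots> \<le> (\<Sum>v\<in>J. 1)"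
  proof (rule sum_mono)
    fix v
    have "0 \<le> prob (A v) * prob (A v)" "prob (A v) \<le> 1" by simp_all
    then show "prob (A v) - prob (A v) * prob (A v) \<le> 1" by linarith
  qed
  finally have "variance ?X \<le> card J" by simp
  then have "variance ?X / a\<^sup>2 \<le> card J / a\<^sup>2" by (rule divide_right_mono) simp
  moreover have "prob {x\<in>space M. a \<le> \<bar>?X x - expectation ?X\<bar>} \<le> variance ?X / a\<^sup>2"
    using intX by (intro Chebyshev_inequality intX2 a) simp
  ultimately show ?thesis unfolding EX by linarith
qed

context signal_pair
begin

text \<open>At time 1 there is nothing to observe, so first actions depend on own signals only and
  those of distinct agents are independent given the state.\<close>

lemma first_action_signal_event:
  assumes ad: "adapted G act" and v: "v \<in> pverts G"
  shows "action_event G act v 1 b \<in> signal_events (pverts G) {v}"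
proof (rule signal_events_sigma)
  show "{v} \<subseteq> pverts G" using v by simp
  show "info_generator G act v 1 \<subseteq> signal_events (pverts G) {v}"
    using signal_event_singleton[OF _ v] by (auto simp: info_generator_def)
  show "action_event G act v 1 b \<in> sigma_sets (space (World (pverts G))) (info_generator G act v 1)"
    using action_event_info[OF ad v, of 1 b] by (simp add: sets_info)
qed

text \<open>The number of neighbours whose first action is 1 has means under the two states that
  differ by at least \<open>card J * \<delta>\<close>. A test at half this distance above the lower
  mean errs with probability at most \<open>4 / (card J * \<delta>\<^sup>2)\<close> under each
  state, by Chebyshev; the two errors add up to the constant 8.\<close>

lemma hub_learns:
  fixes \<delta> :: real
  assumes G: "connected_undirected_graph G" and MAP: "MAP_actions \<mu>0 \<mu>1 G act" and u: "u \<in> pverts G"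
    and J: "J \<subseteq> neighbors G u" "finite J" "J \<noteq> {}" and D: "D \<in> sets \<mu>0" and \<delta>: "measure \<mu>1 D - measure \<mu>0 D = \<delta>" "\<delta> > 0"
  shows "advantage G act u 2 \<ge> 1 - 8 / (card J * \<delta>\<^sup>2)"
proof -
  let ?V = "pverts G" and ?P = "\<lambda>s. measure (given (pverts G) s)"
  have ad: "adapted G act" by (rule MAP_actions_adapted[OF MAP])
  have JV: "v \<in> ?V" if "v \<in> J" for v using that J(1) connected_undirected_graphD(2)[OF G] by blast
  define A where "A v = action_event G act v 1 True" for v
  have Asig: "A v \<in> signal_events ?V {v}" if "v \<in> J" for v
    unfolding A_def by (rule first_action_signal_event[OF ad JV[OF that]])
  have AW: "A v \<in> sets (World ?V)" if "v \<in> J" for v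
    using signal_events_World[OF _ Asig[OF that]] JV[OF that] by blast
  have indep: "?P s (A v \<inter> A w) = ?P s (A v) * ?P s (A w)" if "v \<in> J" "w \<in> J" "v \<noteq> w" for s v w
    by (rule signal_events_indep[OF _ _ _ _ Asig[OF that(1)] Asig[OF that(2)]]) (use JV that in auto)
  have gain: "\<delta> \<le> ?P True (A v) - ?P False (A v)" if v: "v \<in> J" for v
  proof -
    have "lik ?V True {\<omega>\<in>space (World ?V). snd \<omega> v \<in> D} \<le> advantage G act v 1"
      by (rule MAP_optimal[OF G MAP JV[OF v] _ info_signal[OF D]]) simp
    moreover have "lik ?V True {\<omega>\<in>space (World ?V). snd \<omega> v \<in> D} = \<delta>"
      using given_signal[OF D JV[OF v]] \<delta>(1) by (simp add: lik_def sig_def)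
    ultimately show ?thesis by (simp add: advantage_def lik_def A_def)
  qed
  define d where "d = real (card J)"
  have d: "d > 0" using J(2,3) by (simp add: d_def card_gt_0_iff)
  define m where "m s = (\<Sum>v\<in>J. ?P s (A v))" for s
  have "(\<Sum>v\<in>J. \<delta>) \<le> (\<Sum>v\<in>J. ?P True (A v) - ?P False (A v))" by (rule sum_mono) (rule gain)
  then have gap: "d * \<delta> \<le> m True - m False" by (simp add: d_def m_def sum_subtractf)
  define X where "X \<omega> = (\<Sum>v\<in>J. indicator (A v) \<omega> :: real)" for \<omega>
  define a where "a = d * \<delta> / 2"
  have a: "a > 0" using d \<delta>(2) by (simp add: a_def)
  let ?F = "\<lambda>s. {\<omega>\<in>space (World ?V). a \<le> \<bar>X \<omega> - m s\<bar>}"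
  have XW [measurable]: "X \<in> borel_measurable (World ?V)"
    unfolding X_def using AW by (intro borel_measurable_sum borel_measurable_indicator) auto
  have F: "?P s (?F s) \<le> 4 / (d * \<delta>\<^sup>2)" for s
  proof -
    have "?P s (?F s) \<le> d / a\<^sup>2"
    proof -
      have "?P s {\<omega>\<in>space (given ?V s). a \<le> \<bar>(\<Sum>v\<in>J. indicator (A v) \<omega>) - (\<Sum>v\<in>J. ?P s (A v))\<bar>} \<le> card J / a\<^sup>2"
        by (rule given.Chebyshev_pairwise_indep[OF J(2) _ _ a]) (use AW indep in auto)
      then show ?thesis by (simp add: X_def m_def d_def)
    qed
    also have "d / a\<^sup>2 = 4 / (d * \<delta>\<^sup>2)" using d \<delta>(2) by (simp add: a_def power2_eq_square field_simps)
    finally show ?thesis .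
  qed
  define B where "B = {\<omega>\<in>space (World ?V). X \<omega> > m False + a}"
  have BI: "B \<in> sets (Info G act u 2)"
  proof -
    have "A v \<in> sets (Info G act u 2)" if "v \<in> J" for v
      using info_neighbor_action[of v G u 1 2 act] that J(1) by (auto simp: A_def action_event_def)
    then have [measurable]: "X \<in> borel_measurable (Info G act u 2)"
      unfolding X_def by (intro borel_measurable_sum borel_measurable_indicator) auto
    have "{\<omega>\<in>space (Info G act u 2). X \<omega> > m False + a} \<in> sets (Info G act u 2)" by measurable
    then show ?thesis by (simp add: B_def)
  qed
  have BW: "B \<in> sets (World ?V)" by (rule info_event_World[OF G ad u BI])
  have FW: "?F s \<in> sets (World ?V)" for s by measurable
  have "?P False B \<le> ?P False (?F False)"
    using FW[of False] by (intro given.finite_measure_mono) (auto simp: B_def)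
  moreover have "space (World ?V) - B \<subseteq> ?F True"
  proof
    fix \<omega> assume "\<omega> \<in> space (World ?V) - B"
    then have \<omega>: "\<omega> \<in> space (World ?V)" "X \<omega> \<le> m False + a" by (auto simp: B_def)
    have "2 * a \<le> m True - m False" using gap by (simp add: a_def)
    then have "a \<le> \<bar>X \<omega> - m True\<bar>" using \<omega>(2) by linarith
    with \<omega>(1) show "\<omega> \<in> ?F True" by simp
  qed
  then have "?P True (space (World ?V) - B) \<le> ?P True (?F True)"
    using FW[of True] by (intro given.finite_measure_mono) auto
  moreover have "?P True (space (World ?V) - B) = 1 - ?P True B"
    using given.prob_compl[of B ?V True] BW by simp
  ultimately have "1 - (4 / (d * \<delta>\<^sup>2) + 4 / (d * \<delta>\<^sup>2)) \<le> ?P True B - ?P False B"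
    using F[of True] F[of False] by linarith
  also have "\<dots> = lik ?V True B" by (simp add: lik_def)
  also have "\<dots> \<le> advantage G act u 2" by (rule MAP_optimal[OF G MAP u _ BI]) simp
  finally show ?thesis by (simp add: d_def)
qed

text \<open>\<open>d\<close> is chosen so that a vertex of degree above \<open>d\<close> reaches
  \<open>1 - e\<close> at time 2. If there is none, the graph is a network for \<open>d\<close> and
  its size decides. By agreement one agent with a large advantage suffices.\<close>

theorem large_graph_learns:
  assumes agree: "\<And>G act. connected_undirected_graph G \<Longrightarrow> MAP_actions \<mu>0 \<mu>1 G act \<Longrightarrow> \<exists>A. common_optimal_action_set \<mu>0 \<mu>1 G act A"
    and e: "e > 0"
  shows "\<exists>n0. \<forall>G act A. connected_undirected_graph G \<and> finite (pverts G) \<and> card (pverts G) \<ge> n0 \<and>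
      MAP_actions \<mu>0 \<mu>1 G act \<and> common_optimal_action_set \<mu>0 \<mu>1 G act A \<longrightarrow>
    measure (World (pverts G)) {\<omega>\<in>space (World (pverts G)). A \<omega> = {fst \<omega>}} \<ge> 1 - e"
proof -
  obtain D where D: "D \<in> sets \<mu>0" "measure \<mu>0 D < measure \<mu>1 D" using exists_informative_signal by blast
  define \<delta> where "\<delta> = measure \<mu>1 D - measure \<mu>0 D"
  have \<delta>: "\<delta> > 0" using D(2) by (simp add: \<delta>_def)
  obtain d :: nat where d: "8 / (e * \<delta>\<^sup>2) < d" using reals_Archimedean2 by blast
  have d0: "d > 0" using d e \<delta> by (metis divide_pos_pos mult_pos_pos of_nat_0_less_iff order_less_trans zero_less_numeral zero_less_power)
  obtain n0 where n0: "\<forall>G act u. network d G \<and> finite (pverts G) \<and> card (pverts G) \<ge> n0 \<and> MAP_actions \<mu>0 \<mu>1 G act \<and> u \<in> pverts G \<longrightarrow>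
    (\<exists>t. advantage G act u (Suc t) > 1 - e)" using large_network_learns[OF agree e, of d] by blast
  have "measure (World (pverts G)) {\<omega>\<in>space (World (pverts G)). A \<omega> = {fst \<omega>}} \<ge> 1 - e"
    if G: "connected_undirected_graph G" and fin: "finite (pverts G)" and n: "card (pverts G) \<ge> n0"
      and MAP: "MAP_actions \<mu>0 \<mu>1 G act" and A: "common_optimal_action_set \<mu>0 \<mu>1 G act A" for G act A
  proof -
    have "\<exists>u\<in>pverts G. \<exists>t\<ge>1. 1 - e \<le> advantage G act u t"
    proof (cases "network d G")
      case True
      obtain u where u: "u \<in> pverts G" using connected_undirected_graphD(1)[OF G] by blast
      obtain t where "advantage G act u (Suc t) > 1 - e" using n0 True fin n MAP u by blast
      then have "1 - e \<le> advantage G act u (Suc t)" by simp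
      moreover have "Suc t \<ge> 1" by simp
      ultimately show ?thesis using u by blast
    next
      case False
      have finN: "finite (neighbors G u)" for u
        using connected_undirected_graphD(2)[OF G] fin by (metis finite_subset subsetI)
      obtain u where u: "u \<in> pverts G" "card (neighbors G u) > d"
        using False G finN by (auto simp: network_def not_le)
      have "8 / (card (neighbors G u) * \<delta>\<^sup>2) \<le> 8 / (d * \<delta>\<^sup>2)"
        using u(2) d0 \<delta> by (intro divide_left_mono mult_right_mono mult_pos_pos) auto
      also have "8 / (d * \<delta>\<^sup>2) \<le> e" using d d0 e \<delta> by (simp add: field_simps)
      finally have "1 - e \<le> 1 - 8 / (card (neighbors G u) * \<delta>\<^sup>2)" by simp
      also have "\<dots> \<le> advantage G act u 2"
        using u(2) by (intro hub_learns[OF G MAP u(1) subset_refl finN _ D(1) \<delta>_def[symmetric] \<delta>]) auto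
      finally have "1 - e \<le> advantage G act u 2" .
      moreover have "(2::nat) \<ge> 1" by simp
      ultimately show ?thesis using u(1) by blast
    qed
    then obtain u t where "u \<in> pverts G" "t \<ge> 1" "1 - e \<le> advantage G act u t" by blast
    then show ?thesis using advantage_le_correct[OF G MAP _ _ A] by (meson order_trans)
  qed
  then show ?thesis by blast
qed

end

theorem theorem2:
  fixes \<mu>0 \<mu>1 :: "'w measure"
  assumes "prob_space \<mu>0" and "prob_space \<mu>1" and "sets \<mu>0 = sets \<mu>1"
    and "absolutely_continuous \<mu>0 \<mu>1" and "absolutely_continuous \<mu>1 \<mu>0"
    and "\<mu>0 \<noteq> \<mu>1"
    and "\<And>G act. connected_undirected_graph G \<Longrightarrow> MAP_actions \<mu>0 \<mu>1 G act \<Longrightarrow>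
           \<exists>A. common_optimal_action_set \<mu>0 \<mu>1 G act A"
  shows "\<exists>q :: nat \<Rightarrow> real. q \<longlonglongrightarrow> 1 \<and>
           (\<forall>n G act A. connected_undirected_graph G \<and> finite (pverts G) \<and> card (pverts G) = n \<and>
              MAP_actions \<mu>0 \<mu>1 G act \<and> common_optimal_action_set \<mu>0 \<mu>1 G act A \<longrightarrow>
              measure (world \<mu>0 \<mu>1 (pverts G))
                {\<omega> \<in> space (world \<mu>0 \<mu>1 (pverts G)). A \<omega> = {fst \<omega>}} \<ge> q n)"
proof -
  interpret signal_pair \<mu>0 \<mu>1 using assms(1-6) by (simp add: signal_pair_def)
  define T where "T n = {measure (World (pverts G)) {\<omega>\<in>space (World (pverts G)). A \<omega> = {fst \<omega>}} | G act A.
    connected_undirected_graph G \<and> finite (pverts G) \<and> card (pverts G) = n \<and>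
    MAP_actions \<mu>0 \<mu>1 G act \<and> common_optimal_action_set \<mu>0 \<mu>1 G act A}" for n
  \<comment> \<open>The element 1 keeps the set nonempty for sizes without any network, such as 0,
    and gives \<open>q n \<le> 1\<close>.\<close>
  define q where "q n = Inf (insert 1 (T n))" for n
  have bdd: "bdd_below (insert 1 (T n))" for n
    by (rule bdd_belowI[of _ 0]) (auto simp: T_def)
  have "q \<longlonglongrightarrow> 1"
  proof (rule LIMSEQ_I)
    fix e :: real assume e: "e > 0"
    then have "e / 2 > 0" by simp
    from large_graph_learns[OF assms(7) this] obtain n0 where n0: "\<forall>G act A. connected_undirected_graph G \<and> finite (pverts G) \<and>
      card (pverts G) \<ge> n0 \<and> MAP_actions \<mu>0 \<mu>1 G act \<and> common_optimal_action_set \<mu>0 \<mu>1 G act A \<longrightarrow>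
      measure (World (pverts G)) {\<omega>\<in>space (World (pverts G)). A \<omega> = {fst \<omega>}} \<ge> 1 - e / 2" by blast
    have "norm (q n - 1) < e" if n: "n \<ge> n0" for n
    proof -
      have "1 - e / 2 \<le> q n"
        unfolding q_def using n0 n e by (intro cInf_greatest) (auto simp: T_def)
      moreover have "q n \<le> 1" unfolding q_def by (rule cInf_lower[OF _ bdd]) simp
      ultimately show ?thesis using e by simp
    qed
    then show "\<exists>n0. \<forall>n\<ge>n0. norm (q n - 1) < e" by blast
  qed
  moreover have "q n \<le> measure (World (pverts G)) {\<omega>\<in>space (World (pverts G)). A \<omega> = {fst \<omega>}}"
    if "connected_undirected_graph G \<and> finite (pverts G) \<and> card (pverts G) = n \<and>
      MAP_actions \<mu>0 \<mu>1 G act \<and> common_optimal_action_set \<mu>0 \<mu>1 G act A" for n G act A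
    unfolding q_def by (rule cInf_lower[OF _ bdd], unfold T_def, rule insertI2, rule CollectI) (use that in blast)
  ultimately show ?thesis by (intro exI[of _ q] conjI allI impI)
qed

end
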